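(* Let $B$ be a commutative algebra such that the chain $\{\mu_k\}$ stabilises and $\mathcal{J}(B)$ is a finitely generated projective $B$-module. Let $F\in\mathcal{D}(B)\diamond_B\mathcal{D}(B)$ be an invertible left 2-cocycle in $\mathcal{D}(B)$, $F=F^i\diamond F_i$, and let $a\ast b=\varepsilon(F^ia)\varepsilon(F_ib)$ denote the corresponding twisted product on the vector space $B$. Then there is an invertible left 2-cocycle $\Gamma$ on $\mathcal{J}(B)$ given by $$\Gamma([a\otimes b],[c\otimes d])=(a\ast c)\,db,$$ with inverse $$\Gamma^{-1}([a\otimes b],[c\otimes d])=(ac)\ast(d\ast b).$$ Denoting $B$ with product $\ast$ by $B^\Gamma$, the left $B^\Gamma$-Hopf algebroid structure on the cotwist $\mathcal{J}(B)^\Gamma$ is $$s(b)=[b\otimes1],\quad t(b)=[1\otimes b],\quad [a\otimes b]\cdot_\Gamma[c\otimes d]=[a\ast c\otimes d\ast b],$$ $$\Delta^\Gamma([a\otimes b])=[a\otimes1]\diamond_{B^\Gamma}[1\otimes b],\qquad\varepsilon^\Gamma([a\otimes b])=a\ast b,$$ $$[a\otimes b]_{\hat+}\otimes[a\otimes b]_{\hat-}=[a\otimes1]\otimes[b\otimes1].$$ Its dual pairing with the twisted differential operators $\mathcal{D}(B)^F$ is $$\langle D|[a\otimes b]\rangle^\Gamma=D(a)\ast b.$$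
   Context: All algebras are unital over a field $\mathbb{K}$ and $\otimes$ is over $\mathbb K$. $\overline{B}$ is the opposite algebra, $b\mapsto\overline b$. Standing assumption: all $B$-module and $\overline B$-module structures are faithfully flat. Left bialgebroid over a unital algebra $B$: a unital algebra $\mathcal{L}$ with algebra maps $s:B\to\mathcal{L}$, $t:B^{op}\to\mathcal{L}$ with commuting images; write $b$ for $s(b)$, $\overline b$ for $t(b)$. Put $P\diamond_B Q=P\otimes Q/\langle \overline b p\otimes q-p\otimes bq\rangle$. With $a.X.b=a\overline bX$, $\mathcal{L}$ is a $B$-coring with coproduct $\Delta(X)=X_{(1)}\diamond X_{(2)}\in\mathcal{L}\diamond_B\mathcal{L}$ and counit $\varepsilon:\mathcal{L}\to B$, such that $X_{(1)}\overline b\diamond X_{(2)}=X_{(1)}\diamond X_{(2)}b$, $\Delta$ is multiplicative and unital, $\varepsilon(1)=1$ and $\varepsilon(X\varepsilon(Y))=\varepsilon(XY)=\varepsilon(X\overline{\varepsilon(Y)})$. It is a left Hopf algebroid if $\lambda:\mathcal{L}\otimes_{\overline B}\mathcal{L}\to\mathcal{L}\diamond_B\mathcal{L}$, $X\otimes Y\mapsto X_{(1)}\diamond X_{(2)}Y$ is invertible ($\otimes_{\overline B}$: $X\overline b\otimes Y=X\otimes\overline bY$); $X_+\otimes X_-=\lambda^{-1}(X\diamond1)$. Jets: for commutative $B$, the pair Hopf algebroid $B^e=B\otimes\overline B$ has $s(a)=a\otimes1$, $t(a)=1\otimes a$, product $(a\otimes b)(c\otimes d)=ac\otimes db$, $\Delta(a\otimes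 b)=(a\otimes1)\diamond_B(1\otimes b)$, $\varepsilon(a\otimes b)=ab$. $\mu=\ker(B\otimes B\to B)$, $\mu_k=\mu^{k+1}$, $\mathcal{J}^k(B)=B^e/\mu_k$. If $\{\mu_k\}$ stabilises, $\mathcal{J}(B)=\mathcal{J}^k(B)$ for $k$ large enough, a Hopf algebroid over $B$ with the structure inherited from $B^e$; $[a\otimes b]$ is the class of $a\otimes b$. Differential operators: for $b\in B$, $D\in\mathrm{Hom}_{\mathbb K}(B,B)$ let $\delta_b(D)(a)=D(a)b-D(ab)$. $\mathcal{D}(B)$ is the algebra (under composition) of all $D$ with $\delta_{b_0}\circ\cdots\circ\delta_{b_k}(D)=0$ for all $b_0,\dots,b_k\in B$, for some $k$. In the present situation it is a Hopf algebroid over $B$ with $s(a)(b)=ab$, $t(a)(b)=ba$, coproduct determined by $D_{(1)}(a)D_{(2)}(b)=D(ab)$, counit $\varepsilon(D)=D(1)$, and it is dually paired with $\mathcal{J}(B)$ by $\langle D|[a\otimes b]\rangle=D(a)b$. Dual pairing between left bialgebroids $\Lambda$, $\mathcal{H}$ over $B$: a linear map $\langle\ |\ \rangle:\Lambda\otimes\mathcal{H}\to B$ such that (1) $\langle a\overline bxc\overline d|g\rangle f=a\langle x|c\overline fgd\overline b\rangle$; (2) $\langle x|gh\rangle=\langle x_{(1)}|g\overline{\langle x_{(2)}|h\rangle}\rangle=\langle\overline{\langle x_{(2)}|h\rangle}x_{(1)}|g\rangle$; (3) $\langle xy|g\rangle=\langle x\langle y|g_{(1)}\rangle|g_{(2)}\rangle=\langle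 x|\langle y|g_{(1)}\rangle g_{(2)}\rangle$; (4) $\langle x|1\rangle=\varepsilon(x)$; (5) $\langle1|g\rangle=\varepsilon(g)$. Left 2-cocycle in a left bialgebroid $\Lambda$: $F=F^i\diamond F_i\in\Lambda\diamond_B\Lambda$ with $(\varepsilon\diamond\mathrm{id})F=1=(\mathrm{id}\diamond\varepsilon)F$ and $(\Delta\diamond\mathrm{id})(F)(F\otimes1)=(\mathrm{id}\diamond\Delta)(F)(1\otimes F)$. Then $B^F$ is $B$ with product $\varepsilon(F^ia)\varepsilon(F_ib)$, $s^F(b)=\varepsilon(F^ib)F_i$, $t^F(b)=\overline{\varepsilon(F_ib)}F^i$. $F$ is invertible if $F^\#:M\diamond_{B^F}N\to M\diamond_BN$, $m\otimes n\mapsto F^i\triangleright m\diamond F_i\triangleright n$ is invertible for all left $\Lambda$-modules $M,N$ ($M\diamond_{B^F}N=M\otimes N/\langle t^F(b)\triangleright m\otimes n-m\otimes s^F(b)\triangleright n\rangle$). $\Lambda^F$ is the left bialgebroid over $B^F$ with the product, unit, counit of $\Lambda$, source and target $s^F,t^F$ and coproduct $\Delta^F(\alpha)=(F^\#)^{-1}(\alpha_{(1)}F^i\diamond\alpha_{(2)}F_i)$. For $\Lambda=\mathcal{D}(B)$ the twisted product is $a\ast b=F^i(a)F_i(b)$. Left 2-cocycle on $\mathcal{L}$: a map $\Gamma:\mathcal{L}\otimes_{\overline B}\mathcal{L}\to B$ with $\Gamma(\overline bX,Y)=\Gamma(X,Y)b$, $\Gamma(X,\Gamma(Y_{(1)},Z_{(1)})Y_{(2)}Z_{(2)})=\Gamma(\Gamma(X_{(1)},Y_{(1)})X_{(2)}Y_{(2)},Z)$,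 $\Gamma(1,X)=\varepsilon(X)=\Gamma(X,1)$; $B^\Gamma$ is $B$ with product $\Gamma(s(a),s(b))$. Left comodules $M$ ($B$-bimodules with coassociative counital $\delta(m)=m_{(-1)}\otimes m_{(0)}\in\mathcal{L}\diamond_BM$, $m_{(-1)}\overline b\diamond m_{(0)}=m_{(-1)}\diamond m_{(0)}b$, $\delta(bmb')=bm_{(-1)}b'\otimes m_{(0)}$) are $B^\Gamma$-bimodules by $a\cdot_\Gamma m=\Gamma(a,m_{(-1)})m_{(0)}$, $m\cdot_\Gamma a=\Gamma(m_{(-1)},a)m_{(0)}$; $\Gamma$ is invertible if all maps $M\otimes_{B^\Gamma}N\to M\otimes_BN$, $m\otimes n\mapsto\Gamma(m_{(-1)},n_{(-1)})m_{(0)}\otimes n_{(0)}$ are invertible. For a left Hopf algebroid $\mathcal{L}$ and invertible $\Gamma$, the left Hopf algebroid $\mathcal{L}^\Gamma$ over $B^\Gamma$ is the vector space $\mathcal{L}$ with the same $s,t$, product $X\cdot_\Gamma Y=\Gamma(X_{(1)},Y_{(1)})X_{(2)+}Y_{(2)+}\overline{\Gamma(Y_{(2)-},X_{(2)-})}$, coproduct $\Delta^\Gamma=(\Gamma^\#)^{-1}\circ\Delta$ with $\Gamma^\#:\mathcal{L}^\Gamma\diamond_{B^\Gamma}\mathcal{L}^\Gamma\to\mathcal{L}\diamond_B\mathcal{L}$, $X\diamond Y\mapsto X_+\overline{\Gamma(X_-,Y_{(1)})}\diamond Y_{(2)}$, and counit $\varepsilon^\Gamma(X)=\Gamma(X_+,X_-)$;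 $X_{\hat+}\otimes X_{\hat-}=(\lambda^\Gamma)^{-1}(X\diamond_{B^\Gamma}1)$ for the corresponding map $\lambda^\Gamma$ of $\mathcal{L}^\Gamma$. The inverse of $\Gamma$ is the left 2-cocycle on $\mathcal{L}^\Gamma$ given by $\Gamma^{-1}(X,Y)=\Gamma(X_+Y_+,\Gamma(Y_{-(1)},X_{-(1)})Y_{-(2)}X_{-(2)})$. The dual pairing $\langle\ |\ \rangle^\Gamma$ between $\Lambda^F$ and $\mathcal{L}^\Gamma$ is $\langle\alpha|X\rangle^\Gamma=\langle F^i\alpha|X_+\overline{\langle F_i|X_-\rangle}\rangle$. *)

theory Defs
  imports "HOL-Algebra.Free_Abelian_Groups" "HOL-Algebra.Ideal_Product" "HOL-Algebra.QuotRing"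
    "HOL-Algebra.Module"
begin

section \<open>Algebras and linear maps\<close>

text \<open>
  Structures are carrier-based. An algebra over a field \<open>K\<close> is a record of type
  \<open>('k, 'a) module\<close>; when such a record is only used as a vector space, its
  \<open>mult\<close> and \<open>one\<close> fields are irrelevant. The locale \<^locale>\<open>algebra\<close> of
  HOL-Algebra covers commutative algebras only.
\<close>

locale unital_algebra = module K A + ring A for K (structure) and A (structure) +
  assumes smult_mult_left:
      "\<lbrakk>k \<in> carrier K; x \<in> carrier A; y \<in> carrier A\<rbrakk> \<Longrightarrow>
         (k \<odot>\<^bsub>A\<^esub> x) \<otimes>\<^bsub>A\<^esub> y = k \<odot>\<^bsub>A\<^esub> (x \<otimes>\<^bsub>A\<^esub> y)"
    and smult_mult_right:
      "\<lbrakk>k \<in> carrier K; x \<in> carrier A; y \<in> carrier A\<rbrakk> \<Longrightarrow>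
         x \<otimes>\<^bsub>A\<^esub> (k \<odot>\<^bsub>A\<^esub> y) = k \<odot>\<^bsub>A\<^esub> (x \<otimes>\<^bsub>A\<^esub> y)"

definition opposite :: "('a, 'z) ring_scheme \<Rightarrow> ('a, 'z) ring_scheme" where
  "opposite A = A\<lparr>mult := (\<lambda>a b. b \<otimes>\<^bsub>A\<^esub> a)\<rparr>"

definition linear_map ::
  "('k, 'u) ring_scheme \<Rightarrow> ('k, 'm, 'v) module_scheme \<Rightarrow> ('k, 'n, 'w) module_scheme
    \<Rightarrow> ('m \<Rightarrow> 'n) \<Rightarrow> bool" where
  "linear_map K M N f \<longleftrightarrow>
     f \<in> carrier M \<rightarrow> carrier N \<and>
     (\<forall>x\<in>carrier M. \<forall>y\<in>carrier M. f (x \<oplus>\<^bsub>M\<^esub> y) = f x \<oplus>\<^bsub>N\<^esub> f y) \<and>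
     (\<forall>k\<in>carrier K. \<forall>x\<in>carrier M. f (k \<odot>\<^bsub>M\<^esub> x) = k \<odot>\<^bsub>N\<^esub> f x)"

definition bilinear_map ::
  "('k, 'u) ring_scheme \<Rightarrow> ('k, 'm, 'v) module_scheme \<Rightarrow> ('k, 'n, 'w) module_scheme
    \<Rightarrow> ('k, 'p, 'x) module_scheme \<Rightarrow> ('m \<Rightarrow> 'n \<Rightarrow> 'p) \<Rightarrow> bool" where
  "bilinear_map K M N P f \<longleftrightarrow>
     (\<forall>x\<in>carrier M. linear_map K N P (f x)) \<and>
     (\<forall>y\<in>carrier N. linear_map K M P (\<lambda>x. f x y))"

text \<open>Finitely generated projective: a direct summand of some \<open>R\<^sup>n\<close>, i.e. the identity of
  \<open>M\<close> factors linearly through \<open>R\<^sup>n\<close>.\<close>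

definition power_module :: "('r, 'z) ring_scheme \<Rightarrow> nat \<Rightarrow> ('r, nat \<Rightarrow> 'r) module" where
  "power_module R n =
     \<lparr>carrier = {..<n} \<rightarrow>\<^sub>E carrier R,
      mult = (\<lambda>v w. \<lambda>i\<in>{..<n}. v i \<otimes>\<^bsub>R\<^esub> w i),
      one = (\<lambda>i\<in>{..<n}. \<one>\<^bsub>R\<^esub>),
      zero = (\<lambda>i\<in>{..<n}. \<zero>\<^bsub>R\<^esub>),
      add = (\<lambda>v w. \<lambda>i\<in>{..<n}. v i \<oplus>\<^bsub>R\<^esub> w i),
      smult = (\<lambda>r v. \<lambda>i\<in>{..<n}. r \<otimes>\<^bsub>R\<^esub> v i)\<rparr>"

definition fg_projective ::
  "('r, 'z) ring_scheme \<Rightarrow> ('r, 'm, 'w) module_scheme \<Rightarrow> bool" where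
  "fg_projective R M \<longleftrightarrow> module R M \<and>
     (\<exists>n \<iota> \<pi>. linear_map R M (power_module R n) \<iota> \<and> linear_map R (power_module R n) M \<pi> \<and>
              (\<forall>x\<in>carrier M. \<pi> (\<iota> x) = x))"


section \<open>Tensor products\<close>

text \<open>
  A tensor product is the free abelian group on a set \<open>S\<close> of tuples modulo a set \<open>R\<close> of
  relations; its elements are cosets of formal integer combinations of tuples.
\<close>

type_synonym 'x tens = "('x \<Rightarrow>\<^sub>0 int) set"

definition presented_group :: "'x set \<Rightarrow> ('x \<Rightarrow>\<^sub>0 int) set \<Rightarrow> 'x tens monoid" where
  "presented_group S R = free_Abelian_group S Mod generate (free_Abelian_group S) R"

text \<open>\<open>pure G z\<close> is the class of the tuple \<open>z\<close> in the presented group \<open>G\<close>: the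
  unique coset in the carrier which contains the generator of \<open>z\<close>.\<close>

definition pure :: "'x tens monoid \<Rightarrow> 'x \<Rightarrow> 'x tens" where
  "pure G z = (THE T. T \<in> carrier G \<and> frag_of z \<in> T)"

text \<open>
  \<open>tensor_lift H f T\<close> is the value at \<open>T\<close> of the map into the commutative group \<open>H\<close>
  induced by the map \<open>f\<close> on tuples. It is computed from a chosen representative, hence is
  independent of the choice exactly when \<open>f\<close> respects the relations. This renders Sweedler
  notation: if \<open>T\<close> is a coproduct, then \<open>tensor_lift H (\<lambda>(x, y). f x y) T\<close> is
  the expression in which \<open>x\<close>, \<open>y\<close> are the two Sweedler factors. In nested
  expressions every factor of every tensor runs through one and the same representative, so that
  only the whole sum has to respect the relations, as usual for Sweedler notation.
\<close>

definition tensor_lift :: "('h, 'z) monoid_scheme \<Rightarrow> ('x \<Rightarrow> 'h) \<Rightarrow> 'x tens \<Rightarrow> 'h" where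
  "tensor_lift H f T =
     (let u = (SOME u. u \<in> T)
      in finprod H (\<lambda>z. f z [^]\<^bsub>H\<^esub> Poly_Mapping.lookup u z) (Poly_Mapping.keys u))"

text \<open>
  \<open>tensor K M N A r l\<close> is the quotient of \<open>M \<otimes>\<^sub>K N\<close> by
  \<open>r b x \<otimes> y = x \<otimes> l b y\<close> for \<open>b \<in> A\<close>.
\<close>

definition tensor ::
  "('k, 'u) ring_scheme \<Rightarrow> ('k, 'm, 'v) module_scheme \<Rightarrow> ('k, 'n, 'w) module_scheme
    \<Rightarrow> 'b set \<Rightarrow> ('b \<Rightarrow> 'm \<Rightarrow> 'm) \<Rightarrow> ('b \<Rightarrow> 'n \<Rightarrow> 'n) \<Rightarrow> ('m \<times> 'n) tens monoid" where
  "tensor K M N A r l = presented_group (carrier M \<times> carrier N)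
     ({frag_of (x \<oplus>\<^bsub>M\<^esub> x', y) - frag_of (x, y) - frag_of (x', y) | x x' y.
         x \<in> carrier M \<and> x' \<in> carrier M \<and> y \<in> carrier N} \<union>
      {frag_of (x, y \<oplus>\<^bsub>N\<^esub> y') - frag_of (x, y) - frag_of (x, y') | x y y'.
         x \<in> carrier M \<and> y \<in> carrier N \<and> y' \<in> carrier N} \<union>
      {frag_of (k \<odot>\<^bsub>M\<^esub> x, y) - frag_of (x, k \<odot>\<^bsub>N\<^esub> y) | k x y.
         k \<in> carrier K \<and> x \<in> carrier M \<and> y \<in> carrier N} \<union>
      {frag_of (r b x, y) - frag_of (x, l b y) | b x y.
         b \<in> A \<and> x \<in> carrier M \<and> y \<in> carrier N})"

definition tensor3 ::
  "('k, 'u) ring_scheme \<Rightarrow> ('k, 'm, 'v) module_scheme \<Rightarrow> ('k, 'n, 'w) module_scheme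
    \<Rightarrow> ('k, 'p, 'x) module_scheme \<Rightarrow> 'b set \<Rightarrow> ('b \<Rightarrow> 'm \<Rightarrow> 'm) \<Rightarrow> ('b \<Rightarrow> 'n \<Rightarrow> 'n)
    \<Rightarrow> ('b \<Rightarrow> 'n \<Rightarrow> 'n) \<Rightarrow> ('b \<Rightarrow> 'p \<Rightarrow> 'p) \<Rightarrow> ('m \<times> 'n \<times> 'p) tens monoid" where
  "tensor3 K M N P A r l r' l' = presented_group (carrier M \<times> carrier N \<times> carrier P)
     ({frag_of (x \<oplus>\<^bsub>M\<^esub> x', y, z) - frag_of (x, y, z) - frag_of (x', y, z) | x x' y z.
         x \<in> carrier M \<and> x' \<in> carrier M \<and> y \<in> carrier N \<and> z \<in> carrier P} \<union>
      {frag_of (x, y \<oplus>\<^bsub>N\<^esub> y', z) - frag_of (x, y, z) - frag_of (x, y', z) | x y y' z.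
         x \<in> carrier M \<and> y \<in> carrier N \<and> y' \<in> carrier N \<and> z \<in> carrier P} \<union>
      {frag_of (x, y, z \<oplus>\<^bsub>P\<^esub> z') - frag_of (x, y, z) - frag_of (x, y, z') | x y z z'.
         x \<in> carrier M \<and> y \<in> carrier N \<and> z \<in> carrier P \<and> z' \<in> carrier P} \<union>
      {frag_of (k \<odot>\<^bsub>M\<^esub> x, y, z) - frag_of (x, k \<odot>\<^bsub>N\<^esub> y, z) | k x y z.
         k \<in> carrier K \<and> x \<in> carrier M \<and> y \<in> carrier N \<and> z \<in> carrier P} \<union>
      {frag_of (x, k \<odot>\<^bsub>N\<^esub> y, z) - frag_of (x, y, k \<odot>\<^bsub>P\<^esub> z) | k x y z.
         k \<in> carrier K \<and> x \<in> carrier M \<and> y \<in> carrier N \<and> z \<in> carrier P} \<union>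
      {frag_of (r b x, y, z) - frag_of (x, l b y, z) | b x y z.
         b \<in> A \<and> x \<in> carrier M \<and> y \<in> carrier N \<and> z \<in> carrier P} \<union>
      {frag_of (x, r' b y, z) - frag_of (x, y, l' b z) | b x y z.
         b \<in> A \<and> x \<in> carrier M \<and> y \<in> carrier N \<and> z \<in> carrier P})"


section \<open>Left bialgebroids and left Hopf algebroids\<close>

record ('k, 'b, 'l) st_algebra = "('k, 'l) module" +
  src :: "'b \<Rightarrow> 'l"
  tgt :: "'b \<Rightarrow> 'l"

record ('k, 'b, 'l) bialgebroid = "('k, 'b, 'l) st_algebra" +
  cop :: "'l \<Rightarrow> ('l \<times> 'l) tens"
  cou :: "'l \<Rightarrow> 'b"

text \<open>\<open>M \<diamond>\<^sub>B N\<close> for two left \<open>L\<close>-modules with actions \<open>\<alpha>\<close>, \<open>\<beta>\<close>.\<close>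

definition diamond_mod ::
  "('k, 'u) ring_scheme \<Rightarrow> ('b, 'v) ring_scheme \<Rightarrow> ('k, 'b, 'l, 'w) st_algebra_scheme
    \<Rightarrow> ('k, 'm, 'x) module_scheme \<Rightarrow> ('l \<Rightarrow> 'm \<Rightarrow> 'm)
    \<Rightarrow> ('k, 'n, 'y) module_scheme \<Rightarrow> ('l \<Rightarrow> 'n \<Rightarrow> 'n) \<Rightarrow> ('m \<times> 'n) tens monoid" where
  "diamond_mod K B L M \<alpha> N \<beta> =
     tensor K M N (carrier B) (\<lambda>b. \<alpha> (tgt L b)) (\<lambda>b. \<beta> (src L b))"

definition diamond ::
  "('k, 'u) ring_scheme \<Rightarrow> ('b, 'v) ring_scheme \<Rightarrow> ('k, 'b, 'l, 'w) st_algebra_scheme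
    \<Rightarrow> ('l \<times> 'l) tens monoid" where
  "diamond K B L = diamond_mod K B L L (mult L) L (mult L)"

text \<open>\<open>L \<diamond>\<^sub>B L \<diamond>\<^sub>B M\<close>, where \<open>l\<close> is the left action of \<open>B\<close> on \<open>M\<close>.\<close>

definition diamond3 ::
  "('k, 'u) ring_scheme \<Rightarrow> ('b, 'v) ring_scheme \<Rightarrow> ('k, 'b, 'l, 'w) st_algebra_scheme
    \<Rightarrow> ('k, 'm, 'x) module_scheme \<Rightarrow> ('b \<Rightarrow> 'm \<Rightarrow> 'm) \<Rightarrow> ('l \<times> 'l \<times> 'm) tens monoid" where
  "diamond3 K B L M l =
     tensor3 K L L M (carrier B)
       (\<lambda>b x. tgt L b \<otimes>\<^bsub>L\<^esub> x) (\<lambda>b y. src L b \<otimes>\<^bsub>L\<^esub> y) (\<lambda>b y. tgt L b \<otimes>\<^bsub>L\<^esub> y) l"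

locale left_bialgebroid =
  fixes K :: "('k, 'u) ring_scheme" and B :: "('k, 'b, 'v) module_scheme"
    and L :: "('k, 'b, 'l, 'w) bialgebroid_scheme"
  assumes base: "unital_algebra K B"
    and total: "unital_algebra K L"
    and src_hom: "src L \<in> ring_hom B L" "linear_map K B L (src L)"
    and tgt_hom: "tgt L \<in> ring_hom (opposite B) L" "linear_map K B L (tgt L)"
    and src_tgt_commute:
      "\<lbrakk>a \<in> carrier B; b \<in> carrier B\<rbrakk> \<Longrightarrow>
         src L a \<otimes>\<^bsub>L\<^esub> tgt L b = tgt L b \<otimes>\<^bsub>L\<^esub> src L a"
    and cop_closed: "X \<in> carrier L \<Longrightarrow> cop L X \<in> carrier (diamond K B L)"
    and cop_add:
      "\<lbrakk>X \<in> carrier L; Y \<in> carrier L\<rbrakk> \<Longrightarrow>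
         cop L (X \<oplus>\<^bsub>L\<^esub> Y) = cop L X \<otimes>\<^bsub>diamond K B L\<^esub> cop L Y"
    and cop_bimodule:
      "\<lbrakk>a \<in> carrier B; b \<in> carrier B; X \<in> carrier L\<rbrakk> \<Longrightarrow>
         cop L (src L a \<otimes>\<^bsub>L\<^esub> tgt L b \<otimes>\<^bsub>L\<^esub> X) =
         tensor_lift (diamond K B L)
           (\<lambda>(x, y). pure (diamond K B L) (src L a \<otimes>\<^bsub>L\<^esub> x, tgt L b \<otimes>\<^bsub>L\<^esub> y)) (cop L X)"
    and coassoc:
      "X \<in> carrier L \<Longrightarrow>
         (let T = diamond3 K B L L (\<lambda>b y. src L b \<otimes>\<^bsub>L\<^esub> y) in
          tensor_lift T (\<lambda>(x, y). tensor_lift T (\<lambda>(x1, x2). pure T (x1, x2, y)) (cop L x)) (cop L X) =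
          tensor_lift T (\<lambda>(x, y). tensor_lift T (\<lambda>(y1, y2). pure T (x, y1, y2)) (cop L y)) (cop L X))"
    and cou_closed: "X \<in> carrier L \<Longrightarrow> cou L X \<in> carrier B"
    and cou_add:
      "\<lbrakk>X \<in> carrier L; Y \<in> carrier L\<rbrakk> \<Longrightarrow> cou L (X \<oplus>\<^bsub>L\<^esub> Y) = cou L X \<oplus>\<^bsub>B\<^esub> cou L Y"
    and cou_bimodule:
      "\<lbrakk>a \<in> carrier B; b \<in> carrier B; X \<in> carrier L\<rbrakk> \<Longrightarrow>
         cou L (src L a \<otimes>\<^bsub>L\<^esub> tgt L b \<otimes>\<^bsub>L\<^esub> X) = a \<otimes>\<^bsub>B\<^esub> cou L X \<otimes>\<^bsub>B\<^esub> b"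
    and counit_left:
      "X \<in> carrier L \<Longrightarrow>
         tensor_lift (add_monoid L) (\<lambda>(x, y). src L (cou L x) \<otimes>\<^bsub>L\<^esub> y) (cop L X) = X"
    and counit_right:
      "X \<in> carrier L \<Longrightarrow>
         tensor_lift (add_monoid L) (\<lambda>(x, y). tgt L (cou L y) \<otimes>\<^bsub>L\<^esub> x) (cop L X) = X"
    and takeuchi:
      "\<lbrakk>X \<in> carrier L; b \<in> carrier B\<rbrakk> \<Longrightarrow>
         tensor_lift (diamond K B L) (\<lambda>(x, y). pure (diamond K B L) (x \<otimes>\<^bsub>L\<^esub> tgt L b, y)) (cop L X) =
         tensor_lift (diamond K B L) (\<lambda>(x, y). pure (diamond K B L) (x, y \<otimes>\<^bsub>L\<^esub> src L b)) (cop L X)"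
    and cop_mult:
      "\<lbrakk>X \<in> carrier L; Y \<in> carrier L\<rbrakk> \<Longrightarrow>
         cop L (X \<otimes>\<^bsub>L\<^esub> Y) =
         tensor_lift (diamond K B L)
           (\<lambda>(x1, x2). tensor_lift (diamond K B L)
              (\<lambda>(y1, y2). pure (diamond K B L) (x1 \<otimes>\<^bsub>L\<^esub> y1, x2 \<otimes>\<^bsub>L\<^esub> y2)) (cop L Y)) (cop L X)"
    and cop_one: "cop L \<one>\<^bsub>L\<^esub> = pure (diamond K B L) (\<one>\<^bsub>L\<^esub>, \<one>\<^bsub>L\<^esub>)"
    and cou_one: "cou L \<one>\<^bsub>L\<^esub> = \<one>\<^bsub>B\<^esub>"
    and cou_mult_src:
      "\<lbrakk>X \<in> carrier L; Y \<in> carrier L\<rbrakk> \<Longrightarrow>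
         cou L (X \<otimes>\<^bsub>L\<^esub> src L (cou L Y)) = cou L (X \<otimes>\<^bsub>L\<^esub> Y)"
    and cou_mult_tgt:
      "\<lbrakk>X \<in> carrier L; Y \<in> carrier L\<rbrakk> \<Longrightarrow>
         cou L (X \<otimes>\<^bsub>L\<^esub> tgt L (cou L Y)) = cou L (X \<otimes>\<^bsub>L\<^esub> Y)"

text \<open>The tensor product of \<open>L\<close> with itself over the opposite algebra of \<open>B\<close>, balanced
  through the target map.\<close>

definition bar_tensor ::
  "('k, 'u) ring_scheme \<Rightarrow> ('b, 'v) ring_scheme \<Rightarrow> ('k, 'b, 'l, 'w) st_algebra_scheme
    \<Rightarrow> ('l \<times> 'l) tens monoid" where
  "bar_tensor K B L =
     tensor K L L (carrier B) (\<lambda>b x. x \<otimes>\<^bsub>L\<^esub> tgt L b) (\<lambda>b y. tgt L b \<otimes>\<^bsub>L\<^esub> y)"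

definition hopf_map ::
  "('k, 'u) ring_scheme \<Rightarrow> ('b, 'v) ring_scheme \<Rightarrow> ('k, 'b, 'l, 'w) bialgebroid_scheme
    \<Rightarrow> ('l \<times> 'l) tens \<Rightarrow> ('l \<times> 'l) tens" where
  "hopf_map K B L =
     tensor_lift (diamond K B L)
       (\<lambda>(x, y). tensor_lift (diamond K B L)
          (\<lambda>(x1, x2). pure (diamond K B L) (x1, x2 \<otimes>\<^bsub>L\<^esub> y)) (cop L x))"

locale left_hopf_algebroid = left_bialgebroid +
  assumes hopf_map_bij:
    "bij_betw (hopf_map K B L) (carrier (bar_tensor K B L)) (carrier (diamond K B L))"

text \<open>\<open>translation K B L X\<close> is \<open>X\<^sub>+ \<otimes> X\<^sub>-\<close>.\<close>

definition translation ::
  "('k, 'u) ring_scheme \<Rightarrow> ('b, 'v) ring_scheme \<Rightarrow> ('k, 'b, 'l, 'w) bialgebroid_scheme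
    \<Rightarrow> 'l \<Rightarrow> ('l \<times> 'l) tens" where
  "translation K B L X =
     inv_into (carrier (bar_tensor K B L)) (hopf_map K B L) (pure (diamond K B L) (X, \<one>\<^bsub>L\<^esub>))"

text \<open>\<open>L\<close> as a left \<open>B\<close>-module through the source map.\<close>

definition src_module :: "('k, 'b, 'l, 'w) st_algebra_scheme \<Rightarrow> ('b, 'l) module" where
  "src_module L =
     \<lparr>carrier = carrier L, mult = mult L, one = one L, zero = zero L, add = add L,
      smult = (\<lambda>b x. src L b \<otimes>\<^bsub>L\<^esub> x)\<rparr>"

text \<open>The axioms (1)--(5) of a dual pairing between left bialgebroids \<open>\<Lambda>\<close> and \<open>H\<close>
  over \<open>B\<close>; that \<open>\<Lambda>\<close> and \<open>H\<close> are bialgebroids is not part of the predicate.\<close>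

definition dual_pairing ::
  "('k, 'u) ring_scheme \<Rightarrow> ('k, 'b, 'v) module_scheme \<Rightarrow> ('k, 'b, 'l, 'w) bialgebroid_scheme
    \<Rightarrow> ('k, 'b, 'h, 'x) bialgebroid_scheme \<Rightarrow> ('l \<Rightarrow> 'h \<Rightarrow> 'b) \<Rightarrow> bool" where
  "dual_pairing K B \<Lambda> H p \<longleftrightarrow>
     bilinear_map K \<Lambda> H B p \<and>
     (\<forall>a\<in>carrier B. \<forall>b\<in>carrier B. \<forall>c\<in>carrier B. \<forall>d\<in>carrier B. \<forall>f\<in>carrier B.
        \<forall>x\<in>carrier \<Lambda>. \<forall>g\<in>carrier H.
        p (src \<Lambda> a \<otimes>\<^bsub>\<Lambda>\<^esub> tgt \<Lambda> b \<otimes>\<^bsub>\<Lambda>\<^esub> x \<otimes>\<^bsub>\<Lambda>\<^esub> src \<Lambda> c \<otimes>\<^bsub>\<Lambda>\<^esub> tgt \<Lambda> d) g \<otimes>\<^bsub>B\<^esub> f =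
        a \<otimes>\<^bsub>B\<^esub> p x (src H c \<otimes>\<^bsub>H\<^esub> tgt H f \<otimes>\<^bsub>H\<^esub> g \<otimes>\<^bsub>H\<^esub> src H d \<otimes>\<^bsub>H\<^esub> tgt H b)) \<and>
     (\<forall>x\<in>carrier \<Lambda>. \<forall>g\<in>carrier H. \<forall>h\<in>carrier H.
        p x (g \<otimes>\<^bsub>H\<^esub> h) =
          tensor_lift (add_monoid B) (\<lambda>(x1, x2). p x1 (g \<otimes>\<^bsub>H\<^esub> tgt H (p x2 h))) (cop \<Lambda> x) \<and>
        p x (g \<otimes>\<^bsub>H\<^esub> h) =
          tensor_lift (add_monoid B) (\<lambda>(x1, x2). p (tgt \<Lambda> (p x2 h) \<otimes>\<^bsub>\<Lambda>\<^esub> x1) g) (cop \<Lambda> x)) \<and>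
     (\<forall>x\<in>carrier \<Lambda>. \<forall>y\<in>carrier \<Lambda>. \<forall>g\<in>carrier H.
        p (x \<otimes>\<^bsub>\<Lambda>\<^esub> y) g =
          tensor_lift (add_monoid B) (\<lambda>(g1, g2). p (x \<otimes>\<^bsub>\<Lambda>\<^esub> src \<Lambda> (p y g1)) g2) (cop H g) \<and>
        p (x \<otimes>\<^bsub>\<Lambda>\<^esub> y) g =
          tensor_lift (add_monoid B) (\<lambda>(g1, g2). p x (src H (p y g1) \<otimes>\<^bsub>H\<^esub> g2)) (cop H g)) \<and>
     (\<forall>x\<in>carrier \<Lambda>. p x \<one>\<^bsub>H\<^esub> = cou \<Lambda> x) \<and>
     (\<forall>g\<in>carrier H. p \<one>\<^bsub>\<Lambda>\<^esub> g = cou H g)"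


section \<open>Left 2-cocycles in a left bialgebroid and twisting\<close>

definition left_2cocycle_in ::
  "('k, 'u) ring_scheme \<Rightarrow> ('b, 'v) ring_scheme \<Rightarrow> ('k, 'b, 'l, 'w) bialgebroid_scheme
    \<Rightarrow> ('l \<times> 'l) tens \<Rightarrow> bool" where
  "left_2cocycle_in K B \<Lambda> F \<longleftrightarrow>
     F \<in> carrier (diamond K B \<Lambda>) \<and>
     tensor_lift (add_monoid \<Lambda>) (\<lambda>(x, y). src \<Lambda> (cou \<Lambda> x) \<otimes>\<^bsub>\<Lambda>\<^esub> y) F = \<one>\<^bsub>\<Lambda>\<^esub> \<and>
     tensor_lift (add_monoid \<Lambda>) (\<lambda>(x, y). tgt \<Lambda> (cou \<Lambda> y) \<otimes>\<^bsub>\<Lambda>\<^esub> x) F = \<one>\<^bsub>\<Lambda>\<^esub> \<and>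
     (let T = diamond3 K B \<Lambda> \<Lambda> (\<lambda>b y. src \<Lambda> b \<otimes>\<^bsub>\<Lambda>\<^esub> y) in
      tensor_lift T (\<lambda>(x, y). tensor_lift T (\<lambda>(x1, x2). tensor_lift T (\<lambda>(u, v).
        pure T (x1 \<otimes>\<^bsub>\<Lambda>\<^esub> u, x2 \<otimes>\<^bsub>\<Lambda>\<^esub> v, y)) F) (cop \<Lambda> x)) F =
      tensor_lift T (\<lambda>(x, y). tensor_lift T (\<lambda>(y1, y2). tensor_lift T (\<lambda>(u, v).
        pure T (x, y1 \<otimes>\<^bsub>\<Lambda>\<^esub> u, y2 \<otimes>\<^bsub>\<Lambda>\<^esub> v)) F) (cop \<Lambda> y)) F)"

definition twist_base ::
  "('b, 'v) ring_scheme \<Rightarrow> ('k, 'b, 'l, 'w) bialgebroid_scheme \<Rightarrow> ('l \<times> 'l) tens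
    \<Rightarrow> ('b, 'v) ring_scheme" where
  "twist_base B \<Lambda> F = B\<lparr>mult := (\<lambda>a b.
     tensor_lift (add_monoid B)
       (\<lambda>(x, y). cou \<Lambda> (x \<otimes>\<^bsub>\<Lambda>\<^esub> src \<Lambda> a) \<otimes>\<^bsub>B\<^esub> cou \<Lambda> (y \<otimes>\<^bsub>\<Lambda>\<^esub> src \<Lambda> b)) F)\<rparr>"

definition twist_src ::
  "('k, 'b, 'l, 'w) bialgebroid_scheme \<Rightarrow> ('l \<times> 'l) tens \<Rightarrow> 'b \<Rightarrow> 'l" where
  "twist_src \<Lambda> F b =
     tensor_lift (add_monoid \<Lambda>) (\<lambda>(x, y). src \<Lambda> (cou \<Lambda> (x \<otimes>\<^bsub>\<Lambda>\<^esub> src \<Lambda> b)) \<otimes>\<^bsub>\<Lambda>\<^esub> y) F"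

definition twist_tgt ::
  "('k, 'b, 'l, 'w) bialgebroid_scheme \<Rightarrow> ('l \<times> 'l) tens \<Rightarrow> 'b \<Rightarrow> 'l" where
  "twist_tgt \<Lambda> F b =
     tensor_lift (add_monoid \<Lambda>) (\<lambda>(x, y). tgt \<Lambda> (cou \<Lambda> (y \<otimes>\<^bsub>\<Lambda>\<^esub> src \<Lambda> b)) \<otimes>\<^bsub>\<Lambda>\<^esub> x) F"

definition twist_st ::
  "('k, 'b, 'l, 'w) bialgebroid_scheme \<Rightarrow> ('l \<times> 'l) tens
    \<Rightarrow> ('k, 'b, 'l, 'w) bialgebroid_scheme" where
  "twist_st \<Lambda> F = \<Lambda>\<lparr>src := twist_src \<Lambda> F, tgt := twist_tgt \<Lambda> F\<rparr>"

text \<open>The map \<open>F\<^sup>#\<close> on \<open>M \<diamond> N\<close>, for modules with actions \<open>\<alpha>\<close>, \<open>\<beta>\<close>.\<close>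

definition twist_map ::
  "('k, 'u) ring_scheme \<Rightarrow> ('b, 'v) ring_scheme \<Rightarrow> ('k, 'b, 'l, 'w) bialgebroid_scheme
    \<Rightarrow> ('l \<times> 'l) tens \<Rightarrow> ('k, 'm, 'x) module_scheme \<Rightarrow> ('l \<Rightarrow> 'm \<Rightarrow> 'm)
    \<Rightarrow> ('k, 'n, 'y) module_scheme \<Rightarrow> ('l \<Rightarrow> 'n \<Rightarrow> 'n) \<Rightarrow> ('m \<times> 'n) tens \<Rightarrow> ('m \<times> 'n) tens" where
  "twist_map K B \<Lambda> F M \<alpha> N \<beta> =
     (let T = diamond_mod K B \<Lambda> M \<alpha> N \<beta> in
      tensor_lift T (\<lambda>(m, n). tensor_lift T (\<lambda>(x, y). pure T (\<alpha> x m, \<beta> y n)) F))"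

locale left_module =
  fixes K :: "('k, 'u) ring_scheme" and \<Lambda> :: "('k, 'l, 'v) module_scheme"
    and M :: "('k, 'm, 'w) module_scheme" and \<alpha> :: "'l \<Rightarrow> 'm \<Rightarrow> 'm"
  assumes vector_space: "module K M"
    and act_bilinear: "bilinear_map K \<Lambda> M M \<alpha>"
    and act_mult:
      "\<lbrakk>x \<in> carrier \<Lambda>; y \<in> carrier \<Lambda>; m \<in> carrier M\<rbrakk> \<Longrightarrow>
         \<alpha> (x \<otimes>\<^bsub>\<Lambda>\<^esub> y) m = \<alpha> x (\<alpha> y m)"
    and act_one: "m \<in> carrier M \<Longrightarrow> \<alpha> \<one>\<^bsub>\<Lambda>\<^esub> m = m"

text \<open>
  Invertibility of \<open>F\<close>, where the modules \<open>M\<close>, \<open>N\<close> range over all left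
  \<open>\<Lambda>\<close>-modules whose carriers are subsets of the types \<open>'m\<close>, \<open>'n\<close>. Quantification
  over all types at once is impossible in HOL, so the types are parameters. The instance
  \<open>'m = 'n = 'l\<close> contains the regular module; since
  \<open>M \<diamond> N = (\<Lambda> \<diamond> \<Lambda>) \<otimes> (M \<otimes> N)\<close>, the middle tensor product being over \<open>\<Lambda> \<otimes> \<Lambda>\<close>,
  it implies the instances for all other types.
\<close>

definition invertible_in ::
  "'m itself \<Rightarrow> 'n itself \<Rightarrow> ('k, 'u) ring_scheme \<Rightarrow> ('b, 'v) ring_scheme
    \<Rightarrow> ('k, 'b, 'l, 'w) bialgebroid_scheme \<Rightarrow> ('l \<times> 'l) tens \<Rightarrow> bool" where
  "invertible_in _ _ K B \<Lambda> F \<longleftrightarrow>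
     (\<forall>(M :: ('k, 'm) module) \<alpha> (N :: ('k, 'n) module) \<beta>.
        left_module K \<Lambda> M \<alpha> \<and> left_module K \<Lambda> N \<beta> \<longrightarrow>
        bij_betw (twist_map K B \<Lambda> F M \<alpha> N \<beta>)
          (carrier (diamond_mod K (twist_base B \<Lambda> F) (twist_st \<Lambda> F) M \<alpha> N \<beta>))
          (carrier (diamond_mod K B \<Lambda> M \<alpha> N \<beta>)))"

text \<open>The twist \<open>\<Lambda>\<^sup>F\<close>; in its coproduct \<open>F\<^sup>#\<close> is taken for the regular modules.\<close>

definition twist ::
  "('k, 'u) ring_scheme \<Rightarrow> ('b, 'v) ring_scheme \<Rightarrow> ('k, 'b, 'l, 'w) bialgebroid_scheme
    \<Rightarrow> ('l \<times> 'l) tens \<Rightarrow> ('k, 'b, 'l, 'w) bialgebroid_scheme" where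
  "twist K B \<Lambda> F = (twist_st \<Lambda> F)\<lparr>cop := (\<lambda>\<alpha>.
     inv_into (carrier (diamond K (twist_base B \<Lambda> F) (twist_st \<Lambda> F)))
       (twist_map K B \<Lambda> F \<Lambda> (mult \<Lambda>) \<Lambda> (mult \<Lambda>))
       (tensor_lift (diamond K B \<Lambda>)
          (\<lambda>(\<alpha>1, \<alpha>2). tensor_lift (diamond K B \<Lambda>)
             (\<lambda>(x, y). pure (diamond K B \<Lambda>) (\<alpha>1 \<otimes>\<^bsub>\<Lambda>\<^esub> x, \<alpha>2 \<otimes>\<^bsub>\<Lambda>\<^esub> y)) F) (cop \<Lambda> \<alpha>)))\<rparr>"


section \<open>Left 2-cocycles on a left bialgebroid and cotwisting\<close>

text \<open>Linear maps on tensor products are represented by (balanced) bilinear maps.\<close>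

definition left_2cocycle_on ::
  "('k, 'u) ring_scheme \<Rightarrow> ('k, 'b, 'v) module_scheme \<Rightarrow> ('k, 'b, 'l, 'w) bialgebroid_scheme
    \<Rightarrow> ('l \<Rightarrow> 'l \<Rightarrow> 'b) \<Rightarrow> bool" where
  "left_2cocycle_on K B L \<Gamma> \<longleftrightarrow>
     bilinear_map K L L B \<Gamma> \<and>
     (\<forall>X\<in>carrier L. \<forall>Y\<in>carrier L. \<forall>b\<in>carrier B.
        \<Gamma> (X \<otimes>\<^bsub>L\<^esub> tgt L b) Y = \<Gamma> X (tgt L b \<otimes>\<^bsub>L\<^esub> Y) \<and>
        \<Gamma> (tgt L b \<otimes>\<^bsub>L\<^esub> X) Y = \<Gamma> X Y \<otimes>\<^bsub>B\<^esub> b) \<and>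
     (\<forall>X\<in>carrier L. \<forall>Y\<in>carrier L. \<forall>Z\<in>carrier L.
        \<Gamma> X (tensor_lift (add_monoid L) (\<lambda>(y1, y2). tensor_lift (add_monoid L)
               (\<lambda>(z1, z2). src L (\<Gamma> y1 z1) \<otimes>\<^bsub>L\<^esub> y2 \<otimes>\<^bsub>L\<^esub> z2) (cop L Z)) (cop L Y)) =
        \<Gamma> (tensor_lift (add_monoid L) (\<lambda>(x1, x2). tensor_lift (add_monoid L)
             (\<lambda>(y1, y2). src L (\<Gamma> x1 y1) \<otimes>\<^bsub>L\<^esub> x2 \<otimes>\<^bsub>L\<^esub> y2) (cop L Y)) (cop L X)) Z) \<and>
     (\<forall>X\<in>carrier L. \<Gamma> \<one>\<^bsub>L\<^esub> X = cou L X \<and> \<Gamma> X \<one>\<^bsub>L\<^esub> = cou L X)"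

definition cotwist_base ::
  "('b, 'v) ring_scheme \<Rightarrow> ('k, 'b, 'l, 'w) st_algebra_scheme \<Rightarrow> ('l \<Rightarrow> 'l \<Rightarrow> 'b)
    \<Rightarrow> ('b, 'v) ring_scheme" where
  "cotwist_base B L \<Gamma> = B\<lparr>mult := (\<lambda>a b. \<Gamma> (src L a) (src L b))\<rparr>"

text \<open>\<open>L \<diamond>\<^sub>B M\<close> for \<open>M\<close> with left \<open>B\<close>-action \<open>l\<close>.\<close>

definition diamond_comod ::
  "('k, 'u) ring_scheme \<Rightarrow> ('b, 'v) ring_scheme \<Rightarrow> ('k, 'b, 'l, 'w) st_algebra_scheme
    \<Rightarrow> ('k, 'm, 'x) module_scheme \<Rightarrow> ('b \<Rightarrow> 'm \<Rightarrow> 'm) \<Rightarrow> ('l \<times> 'm) tens monoid" where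
  "diamond_comod K B L M l = tensor K L M (carrier B) (\<lambda>b x. tgt L b \<otimes>\<^bsub>L\<^esub> x) l"

text \<open>Left comodules; \<open>l b m\<close> is \<open>b m\<close> and \<open>r b m\<close> is \<open>m b\<close>.\<close>

locale left_comodule =
  fixes K :: "('k, 'u) ring_scheme" and B :: "('k, 'b, 'v) module_scheme"
    and L :: "('k, 'b, 'l, 'w) bialgebroid_scheme"
    and M :: "('k, 'm, 'x) module_scheme" and l :: "'b \<Rightarrow> 'm \<Rightarrow> 'm" and r :: "'b \<Rightarrow> 'm \<Rightarrow> 'm"
    and \<delta> :: "'m \<Rightarrow> ('l \<times> 'm) tens"
  assumes left_act: "left_module K B M l"
    and right_act: "left_module K (opposite B) M r"
    and left_right:
      "\<lbrakk>a \<in> carrier B; b \<in> carrier B; m \<in> carrier M\<rbrakk> \<Longrightarrow> l a (r b m) = r b (l a m)"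
    and coact_closed: "m \<in> carrier M \<Longrightarrow> \<delta> m \<in> carrier (diamond_comod K B L M l)"
    and coact_add:
      "\<lbrakk>m \<in> carrier M; m' \<in> carrier M\<rbrakk> \<Longrightarrow>
         \<delta> (m \<oplus>\<^bsub>M\<^esub> m') = \<delta> m \<otimes>\<^bsub>diamond_comod K B L M l\<^esub> \<delta> m'"
    and coact_coassoc:
      "m \<in> carrier M \<Longrightarrow>
         (let T = diamond3 K B L M l in
          tensor_lift T (\<lambda>(x, y). tensor_lift T (\<lambda>(x1, x2). pure T (x1, x2, y)) (cop L x)) (\<delta> m) =
          tensor_lift T (\<lambda>(x, y). tensor_lift T (\<lambda>(z, w). pure T (x, z, w)) (\<delta> y)) (\<delta> m))"
    and coact_counit:
      "m \<in> carrier M \<Longrightarrow> tensor_lift (add_monoid M) (\<lambda>(x, y). l (cou L x) y) (\<delta> m) = m"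
    and coact_takeuchi:
      "\<lbrakk>m \<in> carrier M; b \<in> carrier B\<rbrakk> \<Longrightarrow>
         (let T = diamond_comod K B L M l in
          tensor_lift T (\<lambda>(x, y). pure T (x \<otimes>\<^bsub>L\<^esub> tgt L b, y)) (\<delta> m) =
          tensor_lift T (\<lambda>(x, y). pure T (x, r b y)) (\<delta> m))"
    and coact_bimodule:
      "\<lbrakk>m \<in> carrier M; b \<in> carrier B; b' \<in> carrier B\<rbrakk> \<Longrightarrow>
         (let T = diamond_comod K B L M l in
          \<delta> (l b (r b' m)) =
          tensor_lift T (\<lambda>(x, y). pure T (src L b \<otimes>\<^bsub>L\<^esub> x \<otimes>\<^bsub>L\<^esub> src L b', y)) (\<delta> m))"

text \<open>The actions of \<open>B\<^sup>\<Gamma>\<close> on a comodule \<open>M\<close> with left \<open>B\<close>-action \<open>l\<close> and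
  coaction \<open>\<delta>\<close>.\<close>

definition cotwist_lact ::
  "('k, 'b, 'l, 'w) st_algebra_scheme \<Rightarrow> ('l \<Rightarrow> 'l \<Rightarrow> 'b) \<Rightarrow> ('k, 'm, 'x) module_scheme
    \<Rightarrow> ('b \<Rightarrow> 'm \<Rightarrow> 'm) \<Rightarrow> ('m \<Rightarrow> ('l \<times> 'm) tens) \<Rightarrow> 'b \<Rightarrow> 'm \<Rightarrow> 'm" where
  "cotwist_lact L \<Gamma> M l \<delta> a m =
     tensor_lift (add_monoid M) (\<lambda>(x, y). l (\<Gamma> (src L a) x) y) (\<delta> m)"

definition cotwist_ract ::
  "('k, 'b, 'l, 'w) st_algebra_scheme \<Rightarrow> ('l \<Rightarrow> 'l \<Rightarrow> 'b) \<Rightarrow> ('k, 'm, 'x) module_scheme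
    \<Rightarrow> ('b \<Rightarrow> 'm \<Rightarrow> 'm) \<Rightarrow> ('m \<Rightarrow> ('l \<times> 'm) tens) \<Rightarrow> 'b \<Rightarrow> 'm \<Rightarrow> 'm" where
  "cotwist_ract L \<Gamma> M l \<delta> a m =
     tensor_lift (add_monoid M) (\<lambda>(x, y). l (\<Gamma> x (src L a)) y) (\<delta> m)"

text \<open>Invertibility of \<open>\<Gamma>\<close>, for all left \<open>L\<close>-comodules with carriers in the types
  \<open>'m\<close> and \<open>'n\<close>.\<close>

definition invertible_on ::
  "'m itself \<Rightarrow> 'n itself \<Rightarrow> ('k, 'u) ring_scheme \<Rightarrow> ('k, 'b, 'v) module_scheme
    \<Rightarrow> ('k, 'b, 'l, 'w) bialgebroid_scheme \<Rightarrow> ('l \<Rightarrow> 'l \<Rightarrow> 'b) \<Rightarrow> bool" where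
  "invertible_on _ _ K B L \<Gamma> \<longleftrightarrow>
     (\<forall>(M :: ('k, 'm) module) l r \<delta> (N :: ('k, 'n) module) l' r' \<delta>'.
        left_comodule K B L M l r \<delta> \<and> left_comodule K B L N l' r' \<delta>' \<longrightarrow>
        (let T = tensor K M N (carrier B) r l' in
         bij_betw
           (tensor_lift T (\<lambda>(m, n). tensor_lift T (\<lambda>(x, m0). tensor_lift T
              (\<lambda>(y, n0). pure T (l (\<Gamma> x y) m0, n0)) (\<delta>' n)) (\<delta> m)))
           (carrier (tensor K M N (carrier (cotwist_base B L \<Gamma>))
              (cotwist_ract L \<Gamma> M l \<delta>) (cotwist_lact L \<Gamma> N l' \<delta>')))
           (carrier T)))"

definition cotwist_algebra ::
  "('k, 'u) ring_scheme \<Rightarrow> ('b, 'v) ring_scheme \<Rightarrow> ('k, 'b, 'l, 'w) bialgebroid_scheme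
    \<Rightarrow> ('l \<Rightarrow> 'l \<Rightarrow> 'b) \<Rightarrow> ('k, 'b, 'l, 'w) bialgebroid_scheme" where
  "cotwist_algebra K B L \<Gamma> = L\<lparr>mult := (\<lambda>X Y.
     tensor_lift (add_monoid L) (\<lambda>(x1, x2). tensor_lift (add_monoid L) (\<lambda>(y1, y2).
       tensor_lift (add_monoid L) (\<lambda>(xp, xm). tensor_lift (add_monoid L) (\<lambda>(yp, ym).
         src L (\<Gamma> x1 y1) \<otimes>\<^bsub>L\<^esub> xp \<otimes>\<^bsub>L\<^esub> yp \<otimes>\<^bsub>L\<^esub> tgt L (\<Gamma> ym xm))
       (translation K B L y2)) (translation K B L x2)) (cop L Y)) (cop L X))\<rparr>"

definition cotwist_map ::
  "('k, 'u) ring_scheme \<Rightarrow> ('b, 'v) ring_scheme \<Rightarrow> ('k, 'b, 'l, 'w) bialgebroid_scheme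
    \<Rightarrow> ('l \<Rightarrow> 'l \<Rightarrow> 'b) \<Rightarrow> ('l \<times> 'l) tens \<Rightarrow> ('l \<times> 'l) tens" where
  "cotwist_map K B L \<Gamma> =
     (let T = diamond K B L in
      tensor_lift T (\<lambda>(X, Y). tensor_lift T (\<lambda>(xp, xm). tensor_lift T
        (\<lambda>(y1, y2). pure T (xp \<otimes>\<^bsub>L\<^esub> tgt L (\<Gamma> xm y1), y2)) (cop L Y)) (translation K B L X)))"

definition cotwist ::
  "('k, 'u) ring_scheme \<Rightarrow> ('b, 'v) ring_scheme \<Rightarrow> ('k, 'b, 'l, 'w) bialgebroid_scheme
    \<Rightarrow> ('l \<Rightarrow> 'l \<Rightarrow> 'b) \<Rightarrow> ('k, 'b, 'l, 'w) bialgebroid_scheme" where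
  "cotwist K B L \<Gamma> = (cotwist_algebra K B L \<Gamma>)
     \<lparr>cop := (\<lambda>X. inv_into
        (carrier (diamond K (cotwist_base B L \<Gamma>) (cotwist_algebra K B L \<Gamma>)))
        (cotwist_map K B L \<Gamma>) (cop L X)),
      cou := (\<lambda>X. tensor_lift (add_monoid B) (\<lambda>(xp, xm). \<Gamma> xp xm) (translation K B L X))\<rparr>"

definition cocycle_inverse ::
  "('k, 'u) ring_scheme \<Rightarrow> ('b, 'v) ring_scheme \<Rightarrow> ('k, 'b, 'l, 'w) bialgebroid_scheme
    \<Rightarrow> ('l \<Rightarrow> 'l \<Rightarrow> 'b) \<Rightarrow> 'l \<Rightarrow> 'l \<Rightarrow> 'b" where
  "cocycle_inverse K B L \<Gamma> X Y =
     tensor_lift (add_monoid B) (\<lambda>(xp, xm). tensor_lift (add_monoid B) (\<lambda>(yp, ym).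
       \<Gamma> (xp \<otimes>\<^bsub>L\<^esub> yp)
         (tensor_lift (add_monoid L) (\<lambda>(ym1, ym2). tensor_lift (add_monoid L) (\<lambda>(xm1, xm2).
            src L (\<Gamma> ym1 xm1) \<otimes>\<^bsub>L\<^esub> ym2 \<otimes>\<^bsub>L\<^esub> xm2) (cop L xm)) (cop L ym)))
       (translation K B L Y)) (translation K B L X)"

text \<open>The pairing between \<open>\<Lambda>\<^sup>F\<close> and \<open>L\<^sup>\<Gamma>\<close> obtained from a pairing \<open>p\<close> between
  \<open>\<Lambda>\<close> and \<open>L\<close>.\<close>

definition twisted_pairing ::
  "('k, 'u) ring_scheme \<Rightarrow> ('b, 'v) ring_scheme \<Rightarrow> ('k, 'b, 'a, 'w) bialgebroid_scheme
    \<Rightarrow> ('k, 'b, 'l, 'x) bialgebroid_scheme \<Rightarrow> ('a \<Rightarrow> 'l \<Rightarrow> 'b) \<Rightarrow> ('a \<times> 'a) tens \<Rightarrow> 'a \<Rightarrow> 'l \<Rightarrow> 'b" where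
  "twisted_pairing K B \<Lambda> L p F \<alpha> X =
     tensor_lift (add_monoid B) (\<lambda>(x, y). tensor_lift (add_monoid B)
       (\<lambda>(xp, xm). p (x \<otimes>\<^bsub>\<Lambda>\<^esub> \<alpha>) (xp \<otimes>\<^bsub>L\<^esub> tgt L (p y xm))) (translation K B L X)) F"


section \<open>Jets\<close>

definition env_group ::
  "('k, 'u) ring_scheme \<Rightarrow> ('k, 'b, 'v) module_scheme \<Rightarrow> ('b \<times> 'b) tens monoid" where
  "env_group K B = tensor K B B ({} :: 'b set) (\<lambda>_ x. x) (\<lambda>_ x. x)"

definition env ::
  "('k, 'u) ring_scheme \<Rightarrow> ('k, 'b, 'v) module_scheme \<Rightarrow> ('k, ('b \<times> 'b) tens) module" where
  "env K B =
     \<lparr>carrier = carrier (env_group K B),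
      mult = (\<lambda>S T. tensor_lift (env_group K B) (\<lambda>(a, b). tensor_lift (env_group K B)
        (\<lambda>(c, d). pure (env_group K B) (a \<otimes>\<^bsub>B\<^esub> c, d \<otimes>\<^bsub>B\<^esub> b)) T) S),
      one = pure (env_group K B) (\<one>\<^bsub>B\<^esub>, \<one>\<^bsub>B\<^esub>),
      zero = one (env_group K B),
      add = mult (env_group K B),
      smult = (\<lambda>k. tensor_lift (env_group K B) (\<lambda>(a, b). pure (env_group K B) (k \<odot>\<^bsub>B\<^esub> a, b)))\<rparr>"

definition diagonal_ideal ::
  "('k, 'u) ring_scheme \<Rightarrow> ('k, 'b, 'v) module_scheme \<Rightarrow> ('b \<times> 'b) tens set" where
  "diagonal_ideal K B =
     a_kernel (env K B) B (tensor_lift (add_monoid B) (\<lambda>(a, b). a \<otimes>\<^bsub>B\<^esub> b))"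

text \<open>\<open>jet_ideal K B k\<close> is the power with exponent \<open>k + 1\<close> of the kernel of the product.\<close>

primrec jet_ideal ::
  "('k, 'u) ring_scheme \<Rightarrow> ('k, 'b, 'v) module_scheme \<Rightarrow> nat \<Rightarrow> ('b \<times> 'b) tens set" where
  "jet_ideal K B 0 = diagonal_ideal K B"
| "jet_ideal K B (Suc k) = ideal_prod (env K B) (jet_ideal K B k) (diagonal_ideal K B)"

definition jets_stabilise :: "('k, 'u) ring_scheme \<Rightarrow> ('k, 'b, 'v) module_scheme \<Rightarrow> bool" where
  "jets_stabilise K B \<longleftrightarrow> (\<exists>k. \<forall>j\<ge>k. jet_ideal K B j = jet_ideal K B k)"

definition stable_ideal ::
  "('k, 'u) ring_scheme \<Rightarrow> ('k, 'b, 'v) module_scheme \<Rightarrow> ('b \<times> 'b) tens set" where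
  "stable_ideal K B = jet_ideal K B (LEAST k. \<forall>j\<ge>k. jet_ideal K B j = jet_ideal K B k)"

text \<open>\<open>jet K B a b\<close> is the class \<open>[a \<otimes> b]\<close>.\<close>

definition jet ::
  "('k, 'u) ring_scheme \<Rightarrow> ('k, 'b, 'v) module_scheme \<Rightarrow> 'b \<Rightarrow> 'b \<Rightarrow> ('b \<times> 'b) tens set" where
  "jet K B a b = stable_ideal K B +>\<^bsub>env K B\<^esub> pure (env_group K B) (a, b)"

text \<open>The value of the map on jets induced by a map on pairs, as in the definition of
  \<^const>\<open>tensor_lift\<close>.\<close>

definition jet_lift :: "('h, 'z) monoid_scheme \<Rightarrow> ('b \<times> 'b \<Rightarrow> 'h) \<Rightarrow> ('b \<times> 'b) tens set \<Rightarrow> 'h" where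
  "jet_lift H f X = tensor_lift H f (SOME T. T \<in> X)"

definition jets_st ::
  "('k, 'u) ring_scheme \<Rightarrow> ('k, 'b, 'v) module_scheme
    \<Rightarrow> ('k, 'b, ('b \<times> 'b) tens set) st_algebra" where
  "jets_st K B =
     (let Q = env K B Quot stable_ideal K B in
     \<lparr>carrier = carrier Q, mult = mult Q, one = one Q, zero = zero Q, add = add Q,
      smult = (\<lambda>k. jet_lift (add_monoid Q) (\<lambda>(a, b). jet K B (k \<odot>\<^bsub>B\<^esub> a) b)),
      src = (\<lambda>a. jet K B a \<one>\<^bsub>B\<^esub>),
      tgt = (\<lambda>b. jet K B \<one>\<^bsub>B\<^esub> b)\<rparr>)"

definition jets ::
  "('k, 'u) ring_scheme \<Rightarrow> ('k, 'b, 'v) module_scheme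
    \<Rightarrow> ('k, 'b, ('b \<times> 'b) tens set) bialgebroid" where
  "jets K B = st_algebra.extend (jets_st K B) (bialgebroid.fields
     (jet_lift (diamond K B (jets_st K B))
        (\<lambda>(a, b). pure (diamond K B (jets_st K B)) (jet K B a \<one>\<^bsub>B\<^esub>, jet K B \<one>\<^bsub>B\<^esub> b)))
     (jet_lift (add_monoid B) (\<lambda>(a, b). a \<otimes>\<^bsub>B\<^esub> b)))"


section \<open>Differential operators\<close>

text \<open>Endomaps of \<open>B\<close> are represented by functions which are \<open>undefined\<close> outside the carrier.\<close>

definition diff_delta :: "('b, 'v) ring_scheme \<Rightarrow> 'b \<Rightarrow> ('b \<Rightarrow> 'b) \<Rightarrow> ('b \<Rightarrow> 'b)" where
  "diff_delta B b D = (\<lambda>a\<in>carrier B. D a \<otimes>\<^bsub>B\<^esub> b \<ominus>\<^bsub>B\<^esub> D (a \<otimes>\<^bsub>B\<^esub> b))"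

definition diffops_st ::
  "('k, 'u) ring_scheme \<Rightarrow> ('k, 'b, 'v) module_scheme \<Rightarrow> ('k, 'b, 'b \<Rightarrow> 'b) st_algebra" where
  "diffops_st K B =
     \<lparr>carrier = {D \<in> extensional (carrier B). linear_map K B B D \<and>
        (\<exists>k. \<forall>bs. set bs \<subseteq> carrier B \<and> length bs = Suc k \<longrightarrow>
           foldr (diff_delta B) bs D = (\<lambda>a\<in>carrier B. \<zero>\<^bsub>B\<^esub>))},
      mult = compose (carrier B),
      one = (\<lambda>a\<in>carrier B. a),
      zero = (\<lambda>a\<in>carrier B. \<zero>\<^bsub>B\<^esub>),
      add = (\<lambda>D E. \<lambda>a\<in>carrier B. D a \<oplus>\<^bsub>B\<^esub> E a),
      smult = (\<lambda>k D. \<lambda>a\<in>carrier B. k \<odot>\<^bsub>B\<^esub> D a),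
      src = (\<lambda>a. \<lambda>b\<in>carrier B. a \<otimes>\<^bsub>B\<^esub> b),
      tgt = (\<lambda>a. \<lambda>b\<in>carrier B. b \<otimes>\<^bsub>B\<^esub> a)\<rparr>"

definition diffops ::
  "('k, 'u) ring_scheme \<Rightarrow> ('k, 'b, 'v) module_scheme \<Rightarrow> ('k, 'b, 'b \<Rightarrow> 'b) bialgebroid" where
  "diffops K B = st_algebra.extend (diffops_st K B) (bialgebroid.fields
     (\<lambda>D. THE T. T \<in> carrier (diamond K B (diffops_st K B)) \<and>
        (\<forall>a\<in>carrier B. \<forall>b\<in>carrier B.
           tensor_lift (add_monoid B) (\<lambda>(D1, D2). D1 a \<otimes>\<^bsub>B\<^esub> D2 b) T = D (a \<otimes>\<^bsub>B\<^esub> b)))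
     (\<lambda>D. D \<one>\<^bsub>B\<^esub>))"

definition jet_pairing ::
  "('b, 'v) ring_scheme \<Rightarrow> ('b \<Rightarrow> 'b) \<Rightarrow> ('b \<times> 'b) tens set \<Rightarrow> 'b" where
  "jet_pairing B D = jet_lift (add_monoid B) (\<lambda>(a, b). D a \<otimes>\<^bsub>B\<^esub> b)"

end

theory Submission
  imports Defs
begin

text \<open>
  The finiteness of jets gives a \<^emph>\<open>coevaluation\<close>: finitely many \<open>u\<^sub>i \<in> B\<close> and differential
  operators \<open>E\<^sub>i\<close> with \<open>[a \<otimes> 1] = \<Sum> [u\<^sub>i \<otimes> E\<^sub>i(a)]\<close> (lemma \<open>coevaluation\<close>). It comes from a dual
  basis: the coordinates of \<open>[1 \<otimes> a]\<close> are functionals on jets which are linear over one factor, and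
  such a functional is a differential operator in the other factor, because it kills a power of the
  diagonal ideal (\<open>functional_order\<close>). In the other direction an operator of order less than \<open>n\<close>
  maps \<open>\<mu>\<^sup>n\<^sup>+\<^sup>i\<close> into \<open>\<mu>\<^sup>i\<close> (\<open>order_lowers\<close>), so that it acts on both factors of a jet once the chain
  of powers is constant.

  All maps in the theorem are then explicit on the symbols \<open>[a \<otimes> b]\<close>, which generate the jets
  additively. The coevaluation turns these formulas into well-defined maps. It also supplies all
  the inverses that are needed. The inverse of the Hopf map takes \<open>X \<diamond> Y\<close> to
  \<open>\<Sum> (1 \<otimes> E\<^sub>i)X \<otimes> [u\<^sub>i \<otimes> 1]Y\<close>, and the inverse of \<open>\<Gamma>\<^sup>#\<close> takes \<open>X \<diamond> Y\<close> to
  \<open>\<Sum> [u\<^sub>i \<otimes> 1] \<diamond> \<langle>E\<^sub>i|X\<rangle>Y\<close>. Moreover \<open>D = \<Sum> D(u\<^sub>i)E\<^sub>i\<close>, so an element of \<open>\<D> \<diamond> \<D>\<close> is the same as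
  the bidifferential operator that it defines (\<open>ev_inject\<close>).

  The cocycle is \<open>\<Gamma>(X, Y) = \<Sum> \<langle>F\<^sup>i|X\<rangle> \<langle>F\<^sub>i|Y\<rangle>\<close>. Evaluating the cocycle identity of \<open>F\<close> at three
  elements of \<open>B\<close> shows that the twisted product is associative (\<open>star_assoc\<close>), and every identity
  for \<open>\<Gamma>\<close>, for its inverse and for the cotwist reduces on symbols to this associativity and to the unit law. The locale
  \<open>jet_bialgebroid\<close> isolates what makes an algebroid spanned by symbols a left Hopf algebroid; it
  applies to the jets over \<open>B\<close> and again to the cotwist over the twisted base.

  For the invertibility of \<open>\<Gamma>\<close>, a comodule over the jets is a module over \<open>\<D>\<close> through
  \<open>D \<triangleright> m = \<langle>D|m\<^sub>-\<^sub>1\<rangle> m\<^sub>0\<close>, and the map attached to \<open>\<Gamma>\<close> is \<open>F\<^sup>#\<close> for these modules. With the element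
  \<open>G\<close> that \<open>F\<^sup>#\<close> takes to \<open>1 \<diamond> 1\<close> in the case of the regular modules, the inverse of \<open>F\<^sup>#\<close> in general is
  \<open>m \<otimes> n \<mapsto> \<Sum> G\<^sup>i \<triangleright> m \<otimes> G\<^sub>i \<triangleright> n\<close> (\<open>twist_map_bij\<close>). The coproduct of the twist is governed by
  \<open>\<Sum> D\<^sub>(\<^sub>1\<^sub>)(a) \<star> D\<^sub>(\<^sub>2\<^sub>)(b) = D(a \<star> b)\<close>, from which the axioms of the pairing \<open>D(a) \<star> b\<close> follow.
\<close>

section \<open>Elements of presented groups as formal sums\<close>

definition frag_lift :: "('h, 'z) monoid_scheme \<Rightarrow> ('x \<Rightarrow> 'h) \<Rightarrow> ('x \<Rightarrow>\<^sub>0 int) \<Rightarrow> 'h" where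
  "frag_lift H f c = finprod H (\<lambda>z. f z [^]\<^bsub>H\<^esub> Poly_Mapping.lookup c z) (Poly_Mapping.keys c)"

lemma tensor_lift_representative: "tensor_lift H f T = frag_lift H f (SOME u. u \<in> T)"
  by (simp add: tensor_lift_def frag_lift_def Let_def)

lemmas frag_induct [consumes 1, case_names zero diff of] = free_Abelian_group_induct

context comm_group
begin

lemma frag_lift_superset:
  assumes "finite A" "Poly_Mapping.keys c \<subseteq> A" "f \<in> A \<rightarrow> carrier G"
  shows "frag_lift G f c = (\<Otimes>z\<in>A. f z [^] Poly_Mapping.lookup c z)"
  unfolding frag_lift_def
proof (rule finprod_mono_neutral_cong_left)
  fix z assume "z \<in> A - Poly_Mapping.keys c"
  then show "f z [^] Poly_Mapping.lookup c z = \<one>" by (simp add: in_keys_iff)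
qed (use assms in \<open>auto simp: Pi_def\<close>)

lemma frag_lift_closed:
  assumes "Poly_Mapping.keys c \<subseteq> S" "f \<in> S \<rightarrow> carrier G"
  shows "frag_lift G f c \<in> carrier G"
  unfolding frag_lift_def using assms by (intro finprod_closed) auto

lemma frag_lift_add:
  assumes "Poly_Mapping.keys c \<subseteq> S" "Poly_Mapping.keys d \<subseteq> S" and f: "f \<in> S \<rightarrow> carrier G"
  shows "frag_lift G f (c + d) = frag_lift G f c \<otimes> frag_lift G f d"
proof -
  let ?A = "Poly_Mapping.keys c \<union> Poly_Mapping.keys d"
  have A: "finite ?A" "f \<in> ?A \<rightarrow> carrier G" "Poly_Mapping.keys (c + d) \<subseteq> ?A"
    using assms by (auto simp: keys_add)
  have "frag_lift G f (c + d) = (\<Otimes>z\<in>?A. f z [^] Poly_Mapping.lookup (c + d) z)"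
    using A by (rule_tac frag_lift_superset) auto
  also have "\<dots> = (\<Otimes>z\<in>?A. f z [^] Poly_Mapping.lookup c z \<otimes> f z [^] Poly_Mapping.lookup d z)"
    using A by (intro finprod_cong') (auto simp: lookup_add int_pow_mult Pi_def)
  also have "\<dots> = (\<Otimes>z\<in>?A. f z [^] Poly_Mapping.lookup c z) \<otimes> (\<Otimes>z\<in>?A. f z [^] Poly_Mapping.lookup d z)"
    using A by (intro finprod_multf) (auto simp: Pi_def)
  also have "\<dots> = frag_lift G f c \<otimes> frag_lift G f d"
    using A by (simp add: frag_lift_superset[of ?A])
  finally show ?thesis .
qed

lemma frag_lift_hom: "f \<in> S \<rightarrow> carrier G \<Longrightarrow> frag_lift G f \<in> hom (free_Abelian_group S) G"
  by (rule homI) (simp_all add: frag_lift_add frag_lift_closed)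

lemma frag_lift_group_hom:
  "f \<in> S \<rightarrow> carrier G \<Longrightarrow> group_hom (free_Abelian_group S) G (frag_lift G f)"
  by (simp add: group_hom_def group_hom_axioms_def is_group frag_lift_hom)

lemma frag_lift_frag_of: "f z \<in> carrier G \<Longrightarrow> frag_lift G f (frag_of z) = f z"
  by (simp add: frag_lift_def)

lemma frag_lift_diff:
  assumes "Poly_Mapping.keys c \<subseteq> S" "Poly_Mapping.keys d \<subseteq> S" and f: "f \<in> S \<rightarrow> carrier G"
  shows "frag_lift G f (c - d) = frag_lift G f c \<otimes> inv (frag_lift G f d)"
proof -
  interpret group_hom "free_Abelian_group S" G "frag_lift G f"
    by (rule frag_lift_group_hom[OF f])
  have "frag_lift G f (c \<otimes>\<^bsub>free_Abelian_group S\<^esub> inv\<^bsub>free_Abelian_group S\<^esub> d)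
      = frag_lift G f c \<otimes> inv (frag_lift G f d)"
    using assms hom_mult[of c "inv\<^bsub>free_Abelian_group S\<^esub> d"] hom_inv[of d]
    by (simp add: keys_minus)
  then show ?thesis using assms by simp
qed

lemma frag_lift_zero: "frag_lift G f 0 = \<one>"
  by (simp add: frag_lift_def)

lemma frag_lift_cong:
  assumes "Poly_Mapping.keys c \<subseteq> S" "\<And>z. z \<in> S \<Longrightarrow> f z = g z" "g \<in> S \<rightarrow> carrier G"
  shows "frag_lift G f c = frag_lift G g c"
  unfolding frag_lift_def using assms by (intro finprod_cong') (auto simp: Pi_def)

lemma frag_lift_comp_hom:
  assumes H: "comm_group H" and h: "h \<in> hom G H" and f: "f \<in> S \<rightarrow> carrier G"
    and c: "Poly_Mapping.keys c \<subseteq> S"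
  shows "h (frag_lift G f c) = frag_lift H (\<lambda>z. h (f z)) c"
  using c
proof (induction c rule: frag_induct)
  interpret H: comm_group H by (rule H)
  interpret h: group_hom G H h
    by (simp add: group_hom_def group_hom_axioms_def is_group H.is_group h)
  have hf: "(\<lambda>z. h (f z)) \<in> S \<rightarrow> carrier H" using f by (auto intro: h.hom_closed)
  { case zero then show ?case by (simp add: frag_lift_zero H.frag_lift_zero) }
  { case (diff x y) then show ?case
      using f hf by (simp add: frag_lift_diff[of _ S] H.frag_lift_diff[of _ S] frag_lift_closed[of _ S]) }
  { case (of a) then show ?case
      using f hf by (simp add: frag_lift_frag_of H.frag_lift_frag_of Pi_iff) }
qed

lemma frag_lift_mult:
  assumes "Poly_Mapping.keys c \<subseteq> S" "f \<in> S \<rightarrow> carrier G" "g \<in> S \<rightarrow> carrier G"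
  shows "frag_lift G (\<lambda>z. f z \<otimes> g z) c = frag_lift G f c \<otimes> frag_lift G g c"
proof -
  have "(\<Otimes>z\<in>Poly_Mapping.keys c. (f z \<otimes> g z) [^] Poly_Mapping.lookup c z)
      = (\<Otimes>z\<in>Poly_Mapping.keys c. f z [^] Poly_Mapping.lookup c z \<otimes> g z [^] Poly_Mapping.lookup c z)"
    using assms by (intro finprod_cong') (auto simp: int_pow_distrib Pi_def)
  also have "\<dots> = frag_lift G f c \<otimes> frag_lift G g c"
    unfolding frag_lift_def using assms by (intro finprod_multf) (auto simp: Pi_def)
  finally show ?thesis by (simp add: frag_lift_def)
qed

lemma frag_lift_inv:
  assumes "Poly_Mapping.keys c \<subseteq> S" "f \<in> S \<rightarrow> carrier G"
  shows "frag_lift G (\<lambda>z. inv (f z)) c = inv (frag_lift G f c)"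
proof -
  have inv: "(\<lambda>x. inv x) \<in> hom G G"
    by (rule homI) (auto simp: inv_mult)
  show ?thesis
    using frag_lift_comp_hom[OF comm_group_axioms inv assms(2,1)] by simp
qed

lemma frag_lift_one: "frag_lift G (\<lambda>z. \<one>) c = \<one>"
  by (simp add: frag_lift_def)

text \<open>By induction on \<open>c\<close>; for a generator both sides are the same sum over \<open>d\<close>.\<close>

lemma frag_lift_swap:
  assumes c: "Poly_Mapping.keys c \<subseteq> S" and d: "Poly_Mapping.keys d \<subseteq> S'"
    and f: "\<And>z w. z \<in> S \<Longrightarrow> w \<in> S' \<Longrightarrow> f z w \<in> carrier G"
  shows "frag_lift G (\<lambda>z. frag_lift G (f z) d) c = frag_lift G (\<lambda>w. frag_lift G (\<lambda>z. f z w) c) d"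
  using c
proof (induction c rule: frag_induct)
  have cl: "(\<lambda>w. frag_lift G (\<lambda>z. f z w) x) \<in> S' \<rightarrow> carrier G" if "Poly_Mapping.keys x \<subseteq> S" for x
    using that f by (auto intro!: frag_lift_closed[of _ S])
  have cl': "(\<lambda>z. frag_lift G (f z) d) \<in> S \<rightarrow> carrier G"
    using d f by (auto intro!: frag_lift_closed[of _ S'])
  { case zero then show ?case by (simp add: frag_lift_zero frag_lift_one) }
  { case (diff x y)
    have "frag_lift G (\<lambda>w. frag_lift G (\<lambda>z. f z w) (x - y)) d =
      frag_lift G (\<lambda>w. frag_lift G (\<lambda>z. f z w) x \<otimes> inv (frag_lift G (\<lambda>z. f z w) y)) d"
      using diff cl[of x] cl[of y] f
      by (intro frag_lift_cong[OF d] frag_lift_diff) (auto intro!: m_closed inv_closed dest: funcset_mem)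
    also have "\<dots> = frag_lift G (\<lambda>w. frag_lift G (\<lambda>z. f z w) x) d \<otimes>
        inv (frag_lift G (\<lambda>w. frag_lift G (\<lambda>z. f z w) y) d)"
      using diff cl[of x] cl[of y] by (subst frag_lift_mult[OF d]) (auto simp: frag_lift_inv[OF d])
    finally show ?case using diff cl' by (simp add: frag_lift_diff[of _ S]) }
  { case (of a) 
    have "frag_lift G (\<lambda>w. frag_lift G (\<lambda>z. f z w) (frag_of a)) d = frag_lift G (f a) d"
      using f of by (intro frag_lift_cong[OF d]) (auto simp: frag_lift_frag_of)
    then show ?case
      using f cl' of by (simp add: frag_lift_frag_of Pi_iff) }
qed

end

subsection \<open>Presented groups\<close>

locale group_presentation =
  fixes S :: "'x set" and R :: "('x \<Rightarrow>\<^sub>0 int) set"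
  assumes relators: "r \<in> R \<Longrightarrow> Poly_Mapping.keys r \<subseteq> S"
begin

abbreviation "FG \<equiv> free_Abelian_group S"
abbreviation "Q \<equiv> presented_group S R"
abbreviation "N \<equiv> generate FG R"

interpretation FG: comm_group FG by (rule abelian_free_Abelian_group)

lemma relation_subgroup: "subgroup N FG"
  using relators by (intro FG.generate_is_subgroup) auto

interpretation N: normal N FG
  by (rule FG.subgroup_imp_normal[OF relation_subgroup])

lemma comm_group_presented: "comm_group Q"
  unfolding presented_group_def by (rule FG.abelian_FactGroup[OF relation_subgroup])

lemma coset_hom: "(\<lambda>u. N #>\<^bsub>FG\<^esub> u) \<in> hom FG Q"
  unfolding presented_group_def by (rule N.r_coset_hom_Mod)

lemma carrier_presented: "carrier Q = (\<lambda>u. N #>\<^bsub>FG\<^esub> u) ` carrier FG"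
  unfolding presented_group_def by (rule carrier_FactGroup)

lemma pure_eq_coset:
  assumes "z \<in> S"
  shows "pure Q z = N #>\<^bsub>FG\<^esub> frag_of z"
  unfolding pure_def
proof (rule the_equality)
  have z: "frag_of z \<in> carrier FG" using assms by simp
  show "N #>\<^bsub>FG\<^esub> frag_of z \<in> carrier Q \<and> frag_of z \<in> N #>\<^bsub>FG\<^esub> frag_of z"
    using z FG.rcos_self[OF z relation_subgroup] by (auto simp: carrier_presented)
  fix T assume T: "T \<in> carrier Q \<and> frag_of z \<in> T"
  then obtain u where u: "u \<in> carrier FG" "T = N #>\<^bsub>FG\<^esub> u" by (auto simp: carrier_presented)
  then show "T = N #>\<^bsub>FG\<^esub> frag_of z"
    using T FG.repr_independence[OF _ u(1) relation_subgroup] by blast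
qed

lemma pure_closed: "z \<in> S \<Longrightarrow> pure Q z \<in> carrier Q"
  by (simp add: pure_eq_coset carrier_presented)

lemma representative:
  assumes "T \<in> carrier Q"
  shows "Poly_Mapping.keys (SOME u. u \<in> T) \<subseteq> S" "N #>\<^bsub>FG\<^esub> (SOME u. u \<in> T) = T"
proof -
  obtain u where u: "u \<in> carrier FG" "T = N #>\<^bsub>FG\<^esub> u" using assms by (auto simp: carrier_presented)
  have "u \<in> T" using FG.rcos_self[OF u(1) relation_subgroup] u by simp
  then have s: "(SOME u. u \<in> T) \<in> T" by (rule someI)
  show "N #>\<^bsub>FG\<^esub> (SOME u. u \<in> T) = T"
    using FG.repr_independence[OF _ u(1) relation_subgroup] s u(2) by blast
  have "(SOME u. u \<in> T) \<in> carrier FG"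
    using s u FG.r_coset_subset_G[OF subgroup.subset[OF relation_subgroup] u(1)] by blast
  then show "Poly_Mapping.keys (SOME u. u \<in> T) \<subseteq> S" by simp
qed

text \<open>Both sides are homomorphisms from the free group which agree on generators.\<close>

lemma coset_eq_frag_lift:
  assumes "Poly_Mapping.keys c \<subseteq> S"
  shows "N #>\<^bsub>FG\<^esub> c = frag_lift Q (pure Q) c"
proof -
  interpret Q: comm_group Q by (rule comm_group_presented)
  interpret q: group_hom FG Q "\<lambda>u. N #>\<^bsub>FG\<^esub> u"
    by (simp add: group_hom_def group_hom_axioms_def coset_hom)
  have p: "pure Q \<in> S \<rightarrow> carrier Q" by (simp add: pure_closed)
  interpret l: group_hom FG Q "frag_lift Q (pure Q)"
    by (rule Q.frag_lift_group_hom[OF p])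
  show ?thesis using assms
  proof (induction c rule: frag_induct)
    case zero show ?case using q.hom_one l.hom_one by simp
  next
    case (diff x y)
    then have "x - y = x \<otimes>\<^bsub>FG\<^esub> inv\<^bsub>FG\<^esub> y" "x \<in> carrier FG" "y \<in> carrier FG" by simp_all
    then show ?case using diff by (metis FG.inv_closed q.hom_inv q.hom_mult l.hom_inv l.hom_mult)
  next
    case (of a) then show ?case by (simp add: pure_eq_coset[symmetric] Q.frag_lift_frag_of pure_closed)
  qed
qed

lemma pure_relation: "r \<in> R \<Longrightarrow> frag_lift Q (pure Q) r = \<one>\<^bsub>Q\<^esub>"
  using coset_eq_frag_lift[OF relators]
  by (simp add: presented_group_def generate.incl FG.coset_join2 relation_subgroup relators)

text \<open>A representative may have negative coefficients, whence the case of inverses.\<close>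

lemma presented_induct [consumes 1, case_names pure mult inv one]:
  assumes T: "T \<in> carrier Q"
    and pure: "\<And>z. z \<in> S \<Longrightarrow> P (pure Q z)"
    and mult: "\<And>U V. \<lbrakk>U \<in> carrier Q; V \<in> carrier Q; P U; P V\<rbrakk> \<Longrightarrow> P (U \<otimes>\<^bsub>Q\<^esub> V)"
    and inv: "\<And>z. z \<in> S \<Longrightarrow> P (inv\<^bsub>Q\<^esub> (pure Q z))"
    and one: "P \<one>\<^bsub>Q\<^esub>"
  shows "P T"
proof -
  interpret Q: comm_group Q by (rule comm_group_presented)
  have p: "pure Q \<in> S \<rightarrow> carrier Q" by (simp add: pure_closed)
  obtain c where c: "Poly_Mapping.keys c \<subseteq> S" "T = frag_lift Q (pure Q) c"
    using representative[OF T] coset_eq_frag_lift by metis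
  have i: "P (frag_lift Q (pure Q) c) \<and> P (inv\<^bsub>Q\<^esub> frag_lift Q (pure Q) c)"
    using c(1)
  proof (induction c rule: frag_induct)
    case zero then show ?case using one by (simp add: Q.frag_lift_zero)
  next
    case (diff x y)
    have [simp]: "frag_lift Q (pure Q) x \<in> carrier Q" "frag_lift Q (pure Q) y \<in> carrier Q"
      using diff p by (auto intro: Q.frag_lift_closed)
    show ?case using diff by (simp add: Q.frag_lift_diff[OF _ _ p] Q.inv_mult mult)
  next
    case (of a) then show ?case using pure inv by (simp add: Q.frag_lift_frag_of pure_closed)
  qed
  then show ?thesis using c by simp
qed

text \<open>The following rules compare sums over one and the same representative. They therefore hold for
  arbitrary maps on tuples, which allows nested Sweedler sums to be rearranged before any of them is
  known to respect the relations.\<close>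

lemma tensor_lift_closed:
  assumes "comm_group H" "T \<in> carrier Q" "f \<in> S \<rightarrow> carrier H"
  shows "tensor_lift H f T \<in> carrier H"
  unfolding tensor_lift_representative
  using assms representative by (blast intro: comm_group.frag_lift_closed)

lemma tensor_lift_cong:
  assumes "comm_group H" "T \<in> carrier Q" "\<And>z. z \<in> S \<Longrightarrow> f z = g z" "g \<in> S \<rightarrow> carrier H"
  shows "tensor_lift H f T = tensor_lift H g T"
  unfolding tensor_lift_representative
  using assms representative by (intro comm_group.frag_lift_cong[of H _ S]) auto

lemma tensor_lift_mult:
  assumes "comm_group H" "T \<in> carrier Q" "f \<in> S \<rightarrow> carrier H" "g \<in> S \<rightarrow> carrier H"
  shows "tensor_lift H (\<lambda>z. f z \<otimes>\<^bsub>H\<^esub> g z) T = tensor_lift H f T \<otimes>\<^bsub>H\<^esub> tensor_lift H g T"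
  unfolding tensor_lift_representative
  using assms representative by (intro comm_group.frag_lift_mult[of H _ S]) auto

lemma tensor_lift_comp_hom:
  assumes "comm_group G" "comm_group H" "T \<in> carrier Q" "h \<in> hom G H" "f \<in> S \<rightarrow> carrier G"
  shows "h (tensor_lift G f T) = tensor_lift H (\<lambda>z. h (f z)) T"
  unfolding tensor_lift_representative
  using assms representative by (intro comm_group.frag_lift_comp_hom[of G H h _ S]) auto

lemma tensor_lift_pure_id: "T \<in> carrier Q \<Longrightarrow> tensor_lift Q (pure Q) T = T"
  unfolding tensor_lift_representative by (metis coset_eq_frag_lift representative)

lemma tensor_lift_respects:
  assumes H: "comm_group H" and f: "f \<in> S \<rightarrow> carrier H"
    and kills: "\<And>r. r \<in> R \<Longrightarrow> frag_lift H f r = \<one>\<^bsub>H\<^esub>"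
  shows "tensor_lift H f \<in> hom Q H" "\<And>z. z \<in> S \<Longrightarrow> tensor_lift H f (pure Q z) = f z"
proof -
  interpret H: comm_group H by (rule H)
  interpret l: group_hom FG H "frag_lift H f" by (rule H.frag_lift_group_hom[OF f])
  have "R \<subseteq> kernel FG H (frag_lift H f)" using kills relators by (auto simp: kernel_def)
  then have N: "N \<subseteq> kernel FG H (frag_lift H f)"
    by (intro FG.generate_subgroup_incl l.subgroup_kernel)
  have coset: "tensor_lift H f (N #>\<^bsub>FG\<^esub> c) = frag_lift H f c" if c: "c \<in> carrier FG" for c
  proof -
    let ?u = "SOME u. u \<in> N #>\<^bsub>FG\<^esub> c"
    have T: "N #>\<^bsub>FG\<^esub> c \<in> carrier Q" using c by (simp add: carrier_presented)
    have "?u \<in> carrier FG" using representative[OF T] by simp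
    then have "?u \<in> N #>\<^bsub>FG\<^esub> c"
      using FG.rcos_self[OF _ relation_subgroup] representative(2)[OF T] by blast
    then obtain n where n: "n \<in> N" "?u = n \<otimes>\<^bsub>FG\<^esub> c" by (auto simp: r_coset_def)
    then have "frag_lift H f n = \<one>\<^bsub>H\<^esub>" "n \<in> carrier FG" using N by (auto simp: kernel_def)
    then have "frag_lift H f (n \<otimes>\<^bsub>FG\<^esub> c) = frag_lift H f c"
      using c by (simp add: l.hom_mult del: mult_free_Abelian_group)
    then show ?thesis using n by (simp add: tensor_lift_representative)
  qed
  interpret q: group_hom FG Q "\<lambda>u. N #>\<^bsub>FG\<^esub> u"
    by (simp add: group_hom_def group_hom_axioms_def coset_hom comm_group_presented comm_group.axioms)
  show "tensor_lift H f \<in> hom Q H"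
  proof (rule homI)
    fix T assume "T \<in> carrier Q" then show "tensor_lift H f T \<in> carrier H"
      by (simp add: tensor_lift_closed H f)
  next
    fix T U assume "T \<in> carrier Q" "U \<in> carrier Q"
    then obtain c d where cd: "c \<in> carrier FG" "T = N #>\<^bsub>FG\<^esub> c" "d \<in> carrier FG" "U = N #>\<^bsub>FG\<^esub> d"
      by (auto simp: carrier_presented)
    then have "T \<otimes>\<^bsub>Q\<^esub> U = N #>\<^bsub>FG\<^esub> (c \<otimes>\<^bsub>FG\<^esub> d)" using q.hom_mult by metis
    then show "tensor_lift H f (T \<otimes>\<^bsub>Q\<^esub> U) = tensor_lift H f T \<otimes>\<^bsub>H\<^esub> tensor_lift H f U"
      using cd by (metis FG.m_closed coset l.hom_mult)
  qed
  fix z assume "z \<in> S"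
  then show "tensor_lift H f (pure Q z) = f z"
    using f by (simp add: pure_eq_coset coset H.frag_lift_frag_of Pi_iff)
qed

end

lemma tensor_lift_swap:
  assumes "group_presentation S R" "group_presentation S' R'" "comm_group H"
    and "T \<in> carrier (presented_group S R)" "U \<in> carrier (presented_group S' R')"
    and "\<And>z w. z \<in> S \<Longrightarrow> w \<in> S' \<Longrightarrow> f z w \<in> carrier H"
  shows "tensor_lift H (\<lambda>z. tensor_lift H (f z) U) T = tensor_lift H (\<lambda>w. tensor_lift H (\<lambda>z. f z w) T) U"
  unfolding tensor_lift_representative
  using assms by (intro comm_group.frag_lift_swap[of H _ S _ S'] group_presentation.representative) auto

section \<open>Tensor products and balanced maps\<close>

text \<open>The values lie in a multiplicatively written group, so that both a tensor product and the additive
  group of a module can serve as the target.\<close>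

definition balanced ::
  "('k, 'u) ring_scheme \<Rightarrow> ('k, 'm, 'v) module_scheme \<Rightarrow> ('k, 'n, 'w) module_scheme
    \<Rightarrow> 'b set \<Rightarrow> ('b \<Rightarrow> 'm \<Rightarrow> 'm) \<Rightarrow> ('b \<Rightarrow> 'n \<Rightarrow> 'n) \<Rightarrow> ('h, 'z) monoid_scheme
    \<Rightarrow> ('m \<Rightarrow> 'n \<Rightarrow> 'h) \<Rightarrow> bool" where
  "balanced K M N A r l H f \<longleftrightarrow>
     (\<forall>x\<in>carrier M. \<forall>y\<in>carrier N. f x y \<in> carrier H) \<and>
     (\<forall>x\<in>carrier M. \<forall>x'\<in>carrier M. \<forall>y\<in>carrier N. f (x \<oplus>\<^bsub>M\<^esub> x') y = f x y \<otimes>\<^bsub>H\<^esub> f x' y) \<and>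
     (\<forall>x\<in>carrier M. \<forall>y\<in>carrier N. \<forall>y'\<in>carrier N. f x (y \<oplus>\<^bsub>N\<^esub> y') = f x y \<otimes>\<^bsub>H\<^esub> f x y') \<and>
     (\<forall>k\<in>carrier K. \<forall>x\<in>carrier M. \<forall>y\<in>carrier N. f (k \<odot>\<^bsub>M\<^esub> x) y = f x (k \<odot>\<^bsub>N\<^esub> y)) \<and>
     (\<forall>b\<in>A. \<forall>x\<in>carrier M. \<forall>y\<in>carrier N. f (r b x) y = f x (l b y))"

lemma balancedI:
  assumes "\<And>x y. \<lbrakk>x \<in> carrier M; y \<in> carrier N\<rbrakk> \<Longrightarrow> f x y \<in> carrier H"
    and "\<And>x x' y. \<lbrakk>x \<in> carrier M; x' \<in> carrier M; y \<in> carrier N\<rbrakk> \<Longrightarrow> f (x \<oplus>\<^bsub>M\<^esub> x') y = f x y \<otimes>\<^bsub>H\<^esub> f x' y"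
    and "\<And>x y y'. \<lbrakk>x \<in> carrier M; y \<in> carrier N; y' \<in> carrier N\<rbrakk> \<Longrightarrow> f x (y \<oplus>\<^bsub>N\<^esub> y') = f x y \<otimes>\<^bsub>H\<^esub> f x y'"
    and "\<And>k x y. \<lbrakk>k \<in> carrier K; x \<in> carrier M; y \<in> carrier N\<rbrakk> \<Longrightarrow> f (k \<odot>\<^bsub>M\<^esub> x) y = f x (k \<odot>\<^bsub>N\<^esub> y)"
    and "\<And>b x y. \<lbrakk>b \<in> A; x \<in> carrier M; y \<in> carrier N\<rbrakk> \<Longrightarrow> f (r b x) y = f x (l b y)"
  shows "balanced K M N A r l H f"
  using assms by (auto simp: balanced_def)

lemma balancedD:
  assumes "balanced K M N A r l H f"
  shows "\<And>x y. \<lbrakk>x \<in> carrier M; y \<in> carrier N\<rbrakk> \<Longrightarrow> f x y \<in> carrier H"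
    and "\<And>x x' y. \<lbrakk>x \<in> carrier M; x' \<in> carrier M; y \<in> carrier N\<rbrakk> \<Longrightarrow> f (x \<oplus>\<^bsub>M\<^esub> x') y = f x y \<otimes>\<^bsub>H\<^esub> f x' y"
    and "\<And>x y y'. \<lbrakk>x \<in> carrier M; y \<in> carrier N; y' \<in> carrier N\<rbrakk> \<Longrightarrow> f x (y \<oplus>\<^bsub>N\<^esub> y') = f x y \<otimes>\<^bsub>H\<^esub> f x y'"
    and "\<And>k x y. \<lbrakk>k \<in> carrier K; x \<in> carrier M; y \<in> carrier N\<rbrakk> \<Longrightarrow> f (k \<odot>\<^bsub>M\<^esub> x) y = f x (k \<odot>\<^bsub>N\<^esub> y)"
    and "\<And>b x y. \<lbrakk>b \<in> A; x \<in> carrier M; y \<in> carrier N\<rbrakk> \<Longrightarrow> f (r b x) y = f x (l b y)"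
  using assms by (auto simp: balanced_def)

lemma (in comm_group) diff_eq_oneD:
  assumes "u \<otimes> inv v = \<one>" "u \<in> carrier G" "v \<in> carrier G"
  shows "u = v"
  using inv_equality[OF assms(1)] assms by simp

lemma (in comm_group) diff_diff_eq_oneD:
  assumes "u \<otimes> inv v \<otimes> inv w = \<one>" "u \<in> carrier G" "v \<in> carrier G" "w \<in> carrier G"
  shows "u = v \<otimes> w"
proof (rule diff_eq_oneD)
  show "u \<otimes> inv (v \<otimes> w) = \<one>" using assms by (simp add: inv_mult m_assoc)
qed (use assms in auto)

lemma (in comm_group) mult_inv_inv:
  assumes "u \<in> carrier G" "v \<in> carrier G"
  shows "u \<otimes> v \<otimes> inv u \<otimes> inv v = \<one>"
  using assms by (metis inv_closed inv_mult m_assoc m_closed r_inv)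

lemma lift_frag_relator:
  assumes "comm_group H" "f \<in> S \<rightarrow> carrier H"
  shows "\<lbrakk>a \<in> S; b \<in> S\<rbrakk> \<Longrightarrow> frag_lift H f (frag_of a - frag_of b) = f a \<otimes>\<^bsub>H\<^esub> inv\<^bsub>H\<^esub> f b"
    and "\<lbrakk>a \<in> S; b \<in> S; c \<in> S\<rbrakk> \<Longrightarrow> frag_lift H f (frag_of a - frag_of b - frag_of c) =
      f a \<otimes>\<^bsub>H\<^esub> inv\<^bsub>H\<^esub> f b \<otimes>\<^bsub>H\<^esub> inv\<^bsub>H\<^esub> f c"
proof -
  interpret H: comm_group H by (rule assms(1))
  have k: "Poly_Mapping.keys (frag_of a - frag_of b) \<subseteq> S" if "a \<in> S" "b \<in> S" for a b
    using that keys_diff by fastforce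
  show *: "frag_lift H f (frag_of a - frag_of b) = f a \<otimes>\<^bsub>H\<^esub> inv\<^bsub>H\<^esub> f b" if "a \<in> S" "b \<in> S" for a b
    using assms that by (auto simp: H.frag_lift_diff[of _ S] H.frag_lift_frag_of Pi_iff)
  show "frag_lift H f (frag_of a - frag_of b - frag_of c) =
      f a \<otimes>\<^bsub>H\<^esub> inv\<^bsub>H\<^esub> f b \<otimes>\<^bsub>H\<^esub> inv\<^bsub>H\<^esub> f c" if "a \<in> S" "b \<in> S" "c \<in> S"
    using assms that k by (auto simp: H.frag_lift_diff[of _ S] * H.frag_lift_frag_of Pi_iff)
qed

locale tensor_data =
  fixes K :: "('k, 'u) ring_scheme" and M :: "('k, 'm, 'v) module_scheme"
    and N :: "('k, 'n, 'w) module_scheme"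
    and A :: "'b set" and r :: "'b \<Rightarrow> 'm \<Rightarrow> 'm" and l :: "'b \<Rightarrow> 'n \<Rightarrow> 'n"
  assumes modM: "module K M" and modN: "module K N"
    and r_closed: "\<lbrakk>b \<in> A; x \<in> carrier M\<rbrakk> \<Longrightarrow> r b x \<in> carrier M"
    and l_closed: "\<lbrakk>b \<in> A; y \<in> carrier N\<rbrakk> \<Longrightarrow> l b y \<in> carrier N"
begin

interpretation M: module K M by (rule modM)
interpretation N: module K N by (rule modN)

abbreviation "bal \<equiv> balanced K M N A r l"
abbreviation "MN \<equiv> tensor K M N A r l"

definition relators where
  "relators = {frag_of (x \<oplus>\<^bsub>M\<^esub> x', y) - frag_of (x, y) - frag_of (x', y) | x x' y.
         x \<in> carrier M \<and> x' \<in> carrier M \<and> y \<in> carrier N} \<union>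
      {frag_of (x, y \<oplus>\<^bsub>N\<^esub> y') - frag_of (x, y) - frag_of (x, y') | x y y'.
         x \<in> carrier M \<and> y \<in> carrier N \<and> y' \<in> carrier N} \<union>
      {frag_of (k \<odot>\<^bsub>M\<^esub> x, y) - frag_of (x, k \<odot>\<^bsub>N\<^esub> y) | k x y.
         k \<in> carrier K \<and> x \<in> carrier M \<and> y \<in> carrier N} \<union>
      {frag_of (r b x, y) - frag_of (x, l b y) | b x y.
         b \<in> A \<and> x \<in> carrier M \<and> y \<in> carrier N}"

lemma tensor_presented: "MN = presented_group (carrier M \<times> carrier N) relators"
  by (simp add: tensor_def relators_def)

sublocale P: group_presentation "carrier M \<times> carrier N" relators
  by unfold_locales
    (auto simp: relators_def r_closed l_closed dest!: subsetD[OF keys_diff] split: if_splits)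

lemma comm_group_tensor: "comm_group MN"
  unfolding tensor_presented by (rule P.comm_group_presented)

interpretation MN: comm_group MN by (rule comm_group_tensor)

lemma pure_tensor_closed [simp, intro]: "\<lbrakk>x \<in> carrier M; y \<in> carrier N\<rbrakk> \<Longrightarrow> pure MN (x, y) \<in> carrier MN"
  unfolding tensor_presented by (rule P.pure_closed) simp

lemma balanced_pure: "bal MN (\<lambda>x y. pure MN (x, y))"
proof -
  let ?S = "carrier M \<times> carrier N"
  have p: "pure MN \<in> ?S \<rightarrow> carrier MN" by auto
  note rel = lift_frag_relator[OF comm_group_tensor p]
  have R: "frag_lift MN (pure MN) c = \<one>\<^bsub>MN\<^esub>" if "c \<in> relators" for c
    using P.pure_relation[OF that] by (simp add: tensor_presented)
  note eq2 = MN.diff_eq_oneD and eq3 = MN.diff_diff_eq_oneD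
  show ?thesis
  proof (rule balancedI)
    fix x x' y assume h: "x \<in> carrier M" "x' \<in> carrier M" "y \<in> carrier N"
    have "frag_of (x \<oplus>\<^bsub>M\<^esub> x', y) - frag_of (x, y) - frag_of (x', y) \<in> relators"
      unfolding relators_def using h by blast
    note rr = R[OF this]
    show "pure MN (x \<oplus>\<^bsub>M\<^esub> x', y) = pure MN (x, y) \<otimes>\<^bsub>MN\<^esub> pure MN (x', y)"
      using rr h by (rule_tac eq3) (auto simp: rel)
  next
    fix x y y' assume h: "x \<in> carrier M" "y \<in> carrier N" "y' \<in> carrier N"
    have "frag_of (x, y \<oplus>\<^bsub>N\<^esub> y') - frag_of (x, y) - frag_of (x, y') \<in> relators"
      unfolding relators_def using h by blast
    note rr = R[OF this]
    show "pure MN (x, y \<oplus>\<^bsub>N\<^esub> y') = pure MN (x, y) \<otimes>\<^bsub>MN\<^esub> pure MN (x, y')"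
      using rr h by (rule_tac eq3) (auto simp: rel)
  next
    fix k x y assume h: "k \<in> carrier K" "x \<in> carrier M" "y \<in> carrier N"
    have "frag_of (k \<odot>\<^bsub>M\<^esub> x, y) - frag_of (x, k \<odot>\<^bsub>N\<^esub> y) \<in> relators"
      unfolding relators_def using h by blast
    note rr = R[OF this]
    show "pure MN (k \<odot>\<^bsub>M\<^esub> x, y) = pure MN (x, k \<odot>\<^bsub>N\<^esub> y)"
      using rr h by (rule_tac eq2) (auto simp: rel)
  next
    fix b x y assume h: "b \<in> A" "x \<in> carrier M" "y \<in> carrier N"
    have "frag_of (r b x, y) - frag_of (x, l b y) \<in> relators"
      unfolding relators_def using h by blast
    note rr = R[OF this]
    show "pure MN (r b x, y) = pure MN (x, l b y)"
      using rr h r_closed l_closed by (rule_tac eq2) (auto simp: rel)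
  qed auto
qed

lemma tensor_lift_hom:
  assumes H: "comm_group H" and f: "bal H f"
  shows "tensor_lift H (\<lambda>(x, y). f x y) \<in> hom MN H"
    and "\<lbrakk>x \<in> carrier M; y \<in> carrier N\<rbrakk> \<Longrightarrow> tensor_lift H (\<lambda>(x, y). f x y) (pure MN (x, y)) = f x y"
proof -
  interpret H: comm_group H by (rule H)
  let ?S = "carrier M \<times> carrier N"
  note D = balancedD[OF f]
  have fS: "(\<lambda>(x, y). f x y) \<in> ?S \<rightarrow> carrier H" using D(1) by auto
  have kills: "frag_lift H (\<lambda>(x, y). f x y) c = \<one>\<^bsub>H\<^esub>" if c: "c \<in> relators" for c
  proof -
    note inv3 = H.mult_inv_inv
    consider (1) x x' y where "c = frag_of (x \<oplus>\<^bsub>M\<^esub> x', y) - frag_of (x, y) - frag_of (x', y)"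
        "x \<in> carrier M" "x' \<in> carrier M" "y \<in> carrier N"
      | (2) x y y' where "c = frag_of (x, y \<oplus>\<^bsub>N\<^esub> y') - frag_of (x, y) - frag_of (x, y')"
        "x \<in> carrier M" "y \<in> carrier N" "y' \<in> carrier N"
      | (3) k x y where "c = frag_of (k \<odot>\<^bsub>M\<^esub> x, y) - frag_of (x, k \<odot>\<^bsub>N\<^esub> y)"
        "k \<in> carrier K" "x \<in> carrier M" "y \<in> carrier N"
      | (4) b x y where "c = frag_of (r b x, y) - frag_of (x, l b y)"
        "b \<in> A" "x \<in> carrier M" "y \<in> carrier N"
      using c unfolding relators_def by blast
    then show ?thesis
    proof cases
      case 1 then show ?thesis by (simp add: lift_frag_relator[OF H fS] D inv3)
    next
      case 2 then show ?thesis by (simp add: lift_frag_relator[OF H fS] D inv3)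
    next
      case 3
      have "(k \<odot>\<^bsub>M\<^esub> x, y) \<in> ?S" "(x, k \<odot>\<^bsub>N\<^esub> y) \<in> ?S" using 3 by auto
      from lift_frag_relator(1)[OF H fS this] show ?thesis using 3 D(1,4) by (simp add: D(4))
    next
      case 4 then show ?thesis by (simp add: lift_frag_relator[OF H fS] D r_closed l_closed)
    qed
  qed
  show "tensor_lift H (\<lambda>(x, y). f x y) \<in> hom MN H"
    unfolding tensor_presented by (rule P.tensor_lift_respects(1)[OF H fS kills])
  show "\<lbrakk>x \<in> carrier M; y \<in> carrier N\<rbrakk> \<Longrightarrow> tensor_lift H (\<lambda>(x, y). f x y) (pure MN (x, y)) = f x y"
    unfolding tensor_presented by (subst P.tensor_lift_respects(2)[OF H fS kills]) auto
qed

lemma pure_zero: "y \<in> carrier N \<Longrightarrow> pure MN (\<zero>\<^bsub>M\<^esub>, y) = \<one>\<^bsub>MN\<^esub>"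
  using balancedD(2)[OF balanced_pure, of "\<zero>\<^bsub>M\<^esub>" "\<zero>\<^bsub>M\<^esub>" y] MN.l_cancel_one' by fastforce

lemma pure_minus:
  assumes "x \<in> carrier M" "y \<in> carrier N"
  shows "inv\<^bsub>MN\<^esub> (pure MN (x, y)) = pure MN (\<ominus>\<^bsub>M\<^esub> x, y)"
  using balancedD(2)[OF balanced_pure, of "\<ominus>\<^bsub>M\<^esub> x" x y] assms
  by (intro MN.inv_equality) (auto simp: pure_zero M.l_neg)

text \<open>The inverse of a pure tensor is pure, as a sign can be moved into the first factor.\<close>

lemma tensor_induct [consumes 1, case_names pure mult]:
  assumes T: "T \<in> carrier MN"
    and pure: "\<And>x y. \<lbrakk>x \<in> carrier M; y \<in> carrier N\<rbrakk> \<Longrightarrow> P (pure MN (x, y))"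
    and mult: "\<And>U V. \<lbrakk>U \<in> carrier MN; V \<in> carrier MN; P U; P V\<rbrakk> \<Longrightarrow> P (U \<otimes>\<^bsub>MN\<^esub> V)"
  shows "P T"
  using T[unfolded tensor_presented]
proof (induction T rule: P.presented_induct)
  case (pure z) then show ?case using assms(2) by (auto simp: tensor_presented)
next
  case (mult U V) then show ?case using assms(3) by (auto simp: tensor_presented)
next
  case (inv z)
  then obtain x y where z: "z = (x, y)" "x \<in> carrier M" "y \<in> carrier N" by auto
  show ?case unfolding z tensor_presented[symmetric] using z pure by (auto simp: pure_minus)
next
  case one
  show ?case using pure[of "\<zero>\<^bsub>M\<^esub>" "\<zero>\<^bsub>N\<^esub>"] by (simp add: pure_zero tensor_presented[symmetric])
qed

lemma tensor_lift_closed2: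
  assumes "comm_group H" "T \<in> carrier MN" "\<And>x y. \<lbrakk>x \<in> carrier M; y \<in> carrier N\<rbrakk> \<Longrightarrow> f x y \<in> carrier H"
  shows "tensor_lift H (\<lambda>(x, y). f x y) T \<in> carrier H"
  using assms by (intro P.tensor_lift_closed) (auto simp: tensor_presented)

lemma tensor_lift_cong2:
  assumes "comm_group H" "T \<in> carrier MN"
    and "\<And>x y. \<lbrakk>x \<in> carrier M; y \<in> carrier N\<rbrakk> \<Longrightarrow> f x y = g x y"
    and "\<And>x y. \<lbrakk>x \<in> carrier M; y \<in> carrier N\<rbrakk> \<Longrightarrow> g x y \<in> carrier H"
  shows "tensor_lift H (\<lambda>(x, y). f x y) T = tensor_lift H (\<lambda>(x, y). g x y) T"
  using assms by (intro P.tensor_lift_cong) (auto simp: tensor_presented)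

lemma tensor_lift_comp_hom2:
  assumes "comm_group G" "comm_group H" "T \<in> carrier MN" "h \<in> hom G H"
    and "\<And>x y. \<lbrakk>x \<in> carrier M; y \<in> carrier N\<rbrakk> \<Longrightarrow> f x y \<in> carrier G"
  shows "h (tensor_lift G (\<lambda>(x, y). f x y) T) = tensor_lift H (\<lambda>(x, y). h (f x y)) T"
  using P.tensor_lift_comp_hom[of G H T h "\<lambda>(x, y). f x y"] assms
  by (auto simp: tensor_presented case_prod_unfold Pi_iff)

lemma tensor_lift_id: "T \<in> carrier MN \<Longrightarrow> tensor_lift MN (\<lambda>(x, y). pure MN (x, y)) T = T"
  using P.tensor_lift_pure_id[of T] by (simp add: tensor_presented case_prod_unfold)

lemma tensor_lift_add2:
  assumes "comm_group H" "T \<in> carrier MN"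
    and "\<And>x y. \<lbrakk>x \<in> carrier M; y \<in> carrier N\<rbrakk> \<Longrightarrow> f x y \<in> carrier H"
    and "\<And>x y. \<lbrakk>x \<in> carrier M; y \<in> carrier N\<rbrakk> \<Longrightarrow> g x y \<in> carrier H"
  shows "tensor_lift H (\<lambda>(x, y). f x y \<otimes>\<^bsub>H\<^esub> g x y) T =
    tensor_lift H (\<lambda>(x, y). f x y) T \<otimes>\<^bsub>H\<^esub> tensor_lift H (\<lambda>(x, y). g x y) T"
  using P.tensor_lift_mult[of H T "\<lambda>(x, y). f x y" "\<lambda>(x, y). g x y"] assms
  by (auto simp: tensor_presented case_prod_unfold Pi_iff)

lemma tensor_lift_add_cong:
  assumes "comm_group H" "T \<in> carrier MN"
    and "\<And>x y. \<lbrakk>x \<in> carrier M; y \<in> carrier N\<rbrakk> \<Longrightarrow> f x y \<in> carrier H"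
    and "\<And>x y. \<lbrakk>x \<in> carrier M; y \<in> carrier N\<rbrakk> \<Longrightarrow> g x y \<in> carrier H"
    and "\<And>x y. \<lbrakk>x \<in> carrier M; y \<in> carrier N\<rbrakk> \<Longrightarrow> h x y = f x y \<otimes>\<^bsub>H\<^esub> g x y"
  shows "tensor_lift H (\<lambda>(x, y). h x y) T =
    tensor_lift H (\<lambda>(x, y). f x y) T \<otimes>\<^bsub>H\<^esub> tensor_lift H (\<lambda>(x, y). g x y) T"
proof -
  interpret H: comm_group H by (rule assms(1))
  have "tensor_lift H (\<lambda>(x, y). h x y) T = tensor_lift H (\<lambda>(x, y). f x y \<otimes>\<^bsub>H\<^esub> g x y) T"
    using assms by (intro tensor_lift_cong2) auto
  then show ?thesis using tensor_lift_add2[OF assms(1-4)] by simp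
qed

lemma balanced_frag_lift:
  assumes "comm_group H" "Poly_Mapping.keys c \<subseteq> S" "\<And>w. w \<in> S \<Longrightarrow> bal H (\<lambda>x y. g x y w)"
  shows "bal H (\<lambda>x y. frag_lift H (g x y) c)"
proof -
  interpret H: comm_group H by (rule assms(1))
  note D = balancedD[OF assms(3)]
  show ?thesis
  proof (rule balancedI)
    fix x y assume "x \<in> carrier M" "y \<in> carrier N"
    then show "frag_lift H (g x y) c \<in> carrier H" using D(1) assms by (intro H.frag_lift_closed) auto
  next
    fix x x' y assume h: "x \<in> carrier M" "x' \<in> carrier M" "y \<in> carrier N"
    then show "frag_lift H (g (x \<oplus>\<^bsub>M\<^esub> x') y) c = frag_lift H (g x y) c \<otimes>\<^bsub>H\<^esub> frag_lift H (g x' y) c"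
      using D(1,2) assms by (subst H.frag_lift_mult[symmetric, of _ S]) (auto intro!: H.frag_lift_cong[of _ S])
  next
    fix x y y' assume "x \<in> carrier M" "y \<in> carrier N" "y' \<in> carrier N"
    then show "frag_lift H (g x (y \<oplus>\<^bsub>N\<^esub> y')) c = frag_lift H (g x y) c \<otimes>\<^bsub>H\<^esub> frag_lift H (g x y') c"
      using D(1,3) assms by (subst H.frag_lift_mult[symmetric, of _ S]) (auto intro!: H.frag_lift_cong[of _ S])
  next
    fix k x y assume kxy: "k \<in> carrier K" "x \<in> carrier M" "y \<in> carrier N"
    then show "frag_lift H (g (k \<odot>\<^bsub>M\<^esub> x) y) c = frag_lift H (g x (k \<odot>\<^bsub>N\<^esub> y)) c"
      using D(1,4) assms by (intro H.frag_lift_cong[of _ S]) auto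
  next
    fix b x y assume "b \<in> A" "x \<in> carrier M" "y \<in> carrier N"
    then show "frag_lift H (g (r b x) y) c = frag_lift H (g x (l b y)) c"
      using D(1,5) assms l_closed by (intro H.frag_lift_cong[of _ S]) auto
  qed
qed

end

text \<open>In a double sum each of the two tensors runs through a fixed representative, so that two finite sums
  are interchanged.\<close>

lemma tensor_lift_swap2:
  assumes "tensor_data K M N A r l" "tensor_data K' M' N' A' r' l'" "comm_group H"
    and "T \<in> carrier (tensor K M N A r l)" "U \<in> carrier (tensor K' M' N' A' r' l')"
    and "\<And>x y z w. \<lbrakk>x \<in> carrier M; y \<in> carrier N; z \<in> carrier M'; w \<in> carrier N'\<rbrakk> \<Longrightarrow> f x y z w \<in> carrier H"
  shows "tensor_lift H (\<lambda>(x, y). tensor_lift H (\<lambda>(z, w). f x y z w) U) T =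
    tensor_lift H (\<lambda>(z, w). tensor_lift H (\<lambda>(x, y). f x y z w) T) U"
proof -
  interpret T: tensor_data K M N A r l by fact
  interpret U: tensor_data K' M' N' A' r' l' by fact
  show ?thesis
    using tensor_lift_swap[OF T.P.group_presentation_axioms U.P.group_presentation_axioms assms(3),
      of T U "\<lambda>(x, y) (z, w). f x y z w"] assms(4-)
    by (auto simp: T.tensor_presented U.tensor_presented case_prod_unfold)
qed

text \<open>A sum of balanced maps is balanced, and the sum here is over a fixed representative of \<open>U\<close>.\<close>

lemma balanced_tensor_lift:
  assumes "tensor_data K M N A r l" "tensor_data K' M' N' A' r' l'" "comm_group H"
    and "U \<in> carrier (tensor K' M' N' A' r' l')"
    and "\<And>z w. \<lbrakk>z \<in> carrier M'; w \<in> carrier N'\<rbrakk> \<Longrightarrow> balanced K M N A r l H (\<lambda>x y. f x y z w)"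
  shows "balanced K M N A r l H (\<lambda>x y. tensor_lift H (\<lambda>(z, w). f x y z w) U)"
proof -
  interpret T: tensor_data K M N A r l by fact
  interpret U: tensor_data K' M' N' A' r' l' by fact
  show ?thesis
    unfolding tensor_lift_representative
    using assms(4,5) by (intro T.balanced_frag_lift[OF assms(3), where S = "carrier M' \<times> carrier N'"])
      (auto simp: U.tensor_presented U.P.representative)
qed

subsection \<open>Threefold tensor products\<close>

definition balanced3 ::
  "('k, 'u) ring_scheme \<Rightarrow> ('k, 'm, 'v) module_scheme \<Rightarrow> ('k, 'n, 'w) module_scheme
    \<Rightarrow> ('k, 'p, 'x) module_scheme \<Rightarrow> 'b set \<Rightarrow> ('b \<Rightarrow> 'm \<Rightarrow> 'm) \<Rightarrow> ('b \<Rightarrow> 'n \<Rightarrow> 'n)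
    \<Rightarrow> ('b \<Rightarrow> 'n \<Rightarrow> 'n) \<Rightarrow> ('b \<Rightarrow> 'p \<Rightarrow> 'p) \<Rightarrow> ('h, 'z) monoid_scheme
    \<Rightarrow> ('m \<Rightarrow> 'n \<Rightarrow> 'p \<Rightarrow> 'h) \<Rightarrow> bool" where
  "balanced3 K M N P A r l r' l' H f \<longleftrightarrow>
     (\<forall>x y z. x \<in> carrier M \<and> y \<in> carrier N \<and> z \<in> carrier P \<longrightarrow> f x y z \<in> carrier H) \<and>
     (\<forall>x x' y z. x \<in> carrier M \<and> x' \<in> carrier M \<and> y \<in> carrier N \<and> z \<in> carrier P \<longrightarrow>
        f (x \<oplus>\<^bsub>M\<^esub> x') y z = f x y z \<otimes>\<^bsub>H\<^esub> f x' y z) \<and>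
     (\<forall>x y y' z. x \<in> carrier M \<and> y \<in> carrier N \<and> y' \<in> carrier N \<and> z \<in> carrier P \<longrightarrow>
        f x (y \<oplus>\<^bsub>N\<^esub> y') z = f x y z \<otimes>\<^bsub>H\<^esub> f x y' z) \<and>
     (\<forall>x y z z'. x \<in> carrier M \<and> y \<in> carrier N \<and> z \<in> carrier P \<and> z' \<in> carrier P \<longrightarrow>
        f x y (z \<oplus>\<^bsub>P\<^esub> z') = f x y z \<otimes>\<^bsub>H\<^esub> f x y z') \<and>
     (\<forall>k x y z. k \<in> carrier K \<and> x \<in> carrier M \<and> y \<in> carrier N \<and> z \<in> carrier P \<longrightarrow>
        f (k \<odot>\<^bsub>M\<^esub> x) y z = f x (k \<odot>\<^bsub>N\<^esub> y) z) \<and>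
     (\<forall>k x y z. k \<in> carrier K \<and> x \<in> carrier M \<and> y \<in> carrier N \<and> z \<in> carrier P \<longrightarrow>
        f x (k \<odot>\<^bsub>N\<^esub> y) z = f x y (k \<odot>\<^bsub>P\<^esub> z)) \<and>
     (\<forall>b x y z. b \<in> A \<and> x \<in> carrier M \<and> y \<in> carrier N \<and> z \<in> carrier P \<longrightarrow>
        f (r b x) y z = f x (l b y) z) \<and>
     (\<forall>b x y z. b \<in> A \<and> x \<in> carrier M \<and> y \<in> carrier N \<and> z \<in> carrier P \<longrightarrow>
        f x (r' b y) z = f x y (l' b z))"

lemma balanced3I:
  assumes "\<And>x y z. \<lbrakk>x \<in> carrier M; y \<in> carrier N; z \<in> carrier P\<rbrakk> \<Longrightarrow> f x y z \<in> carrier H"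
    and "\<And>x x' y z. \<lbrakk>x \<in> carrier M; x' \<in> carrier M; y \<in> carrier N; z \<in> carrier P\<rbrakk> \<Longrightarrow>
        f (x \<oplus>\<^bsub>M\<^esub> x') y z = f x y z \<otimes>\<^bsub>H\<^esub> f x' y z"
    and "\<And>x y y' z. \<lbrakk>x \<in> carrier M; y \<in> carrier N; y' \<in> carrier N; z \<in> carrier P\<rbrakk> \<Longrightarrow>
        f x (y \<oplus>\<^bsub>N\<^esub> y') z = f x y z \<otimes>\<^bsub>H\<^esub> f x y' z"
    and "\<And>x y z z'. \<lbrakk>x \<in> carrier M; y \<in> carrier N; z \<in> carrier P; z' \<in> carrier P\<rbrakk> \<Longrightarrow>
        f x y (z \<oplus>\<^bsub>P\<^esub> z') = f x y z \<otimes>\<^bsub>H\<^esub> f x y z'"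
    and "\<And>k x y z. \<lbrakk>k \<in> carrier K; x \<in> carrier M; y \<in> carrier N; z \<in> carrier P\<rbrakk> \<Longrightarrow>
        f (k \<odot>\<^bsub>M\<^esub> x) y z = f x (k \<odot>\<^bsub>N\<^esub> y) z"
    and "\<And>k x y z. \<lbrakk>k \<in> carrier K; x \<in> carrier M; y \<in> carrier N; z \<in> carrier P\<rbrakk> \<Longrightarrow>
        f x (k \<odot>\<^bsub>N\<^esub> y) z = f x y (k \<odot>\<^bsub>P\<^esub> z)"
    and "\<And>b x y z. \<lbrakk>b \<in> A; x \<in> carrier M; y \<in> carrier N; z \<in> carrier P\<rbrakk> \<Longrightarrow>
        f (r b x) y z = f x (l b y) z"
    and "\<And>b x y z. \<lbrakk>b \<in> A; x \<in> carrier M; y \<in> carrier N; z \<in> carrier P\<rbrakk> \<Longrightarrow>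
        f x (r' b y) z = f x y (l' b z)"
  shows "balanced3 K M N P A r l r' l' H f"
  using assms by (auto simp: balanced3_def)

lemma balanced3D:
  assumes "balanced3 K M N P A r l r' l' H f"
  shows "\<And>x y z. \<lbrakk>x \<in> carrier M; y \<in> carrier N; z \<in> carrier P\<rbrakk> \<Longrightarrow> f x y z \<in> carrier H"
    and "\<And>x x' y z. \<lbrakk>x \<in> carrier M; x' \<in> carrier M; y \<in> carrier N; z \<in> carrier P\<rbrakk> \<Longrightarrow>
        f (x \<oplus>\<^bsub>M\<^esub> x') y z = f x y z \<otimes>\<^bsub>H\<^esub> f x' y z"
    and "\<And>x y y' z. \<lbrakk>x \<in> carrier M; y \<in> carrier N; y' \<in> carrier N; z \<in> carrier P\<rbrakk> \<Longrightarrow>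
        f x (y \<oplus>\<^bsub>N\<^esub> y') z = f x y z \<otimes>\<^bsub>H\<^esub> f x y' z"
    and "\<And>x y z z'. \<lbrakk>x \<in> carrier M; y \<in> carrier N; z \<in> carrier P; z' \<in> carrier P\<rbrakk> \<Longrightarrow>
        f x y (z \<oplus>\<^bsub>P\<^esub> z') = f x y z \<otimes>\<^bsub>H\<^esub> f x y z'"
    and "\<And>k x y z. \<lbrakk>k \<in> carrier K; x \<in> carrier M; y \<in> carrier N; z \<in> carrier P\<rbrakk> \<Longrightarrow>
        f (k \<odot>\<^bsub>M\<^esub> x) y z = f x (k \<odot>\<^bsub>N\<^esub> y) z"
    and "\<And>k x y z. \<lbrakk>k \<in> carrier K; x \<in> carrier M; y \<in> carrier N; z \<in> carrier P\<rbrakk> \<Longrightarrow>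
        f x (k \<odot>\<^bsub>N\<^esub> y) z = f x y (k \<odot>\<^bsub>P\<^esub> z)"
    and "\<And>b x y z. \<lbrakk>b \<in> A; x \<in> carrier M; y \<in> carrier N; z \<in> carrier P\<rbrakk> \<Longrightarrow>
        f (r b x) y z = f x (l b y) z"
    and "\<And>b x y z. \<lbrakk>b \<in> A; x \<in> carrier M; y \<in> carrier N; z \<in> carrier P\<rbrakk> \<Longrightarrow>
        f x (r' b y) z = f x y (l' b z)"
  using assms by (auto simp: balanced3_def)

locale tensor3_data =
  fixes K :: "('k, 'u) ring_scheme" and M :: "('k, 'm, 'v) module_scheme"
    and N :: "('k, 'n, 'w) module_scheme" and P :: "('k, 'p, 'x) module_scheme"
    and A :: "'b set" and r :: "'b \<Rightarrow> 'm \<Rightarrow> 'm" and l :: "'b \<Rightarrow> 'n \<Rightarrow> 'n"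
    and r' :: "'b \<Rightarrow> 'n \<Rightarrow> 'n" and l' :: "'b \<Rightarrow> 'p \<Rightarrow> 'p"
  assumes modM: "module K M" and modN: "module K N" and modP: "module K P"
    and act_closed: "\<lbrakk>b \<in> A; x \<in> carrier M\<rbrakk> \<Longrightarrow> r b x \<in> carrier M"
      "\<lbrakk>b \<in> A; y \<in> carrier N\<rbrakk> \<Longrightarrow> l b y \<in> carrier N"
      "\<lbrakk>b \<in> A; y \<in> carrier N\<rbrakk> \<Longrightarrow> r' b y \<in> carrier N"
      "\<lbrakk>b \<in> A; z \<in> carrier P\<rbrakk> \<Longrightarrow> l' b z \<in> carrier P"
begin

interpretation M: module K M by (rule modM)
interpretation N: module K N by (rule modN)
interpretation P: module K P by (rule modP)

abbreviation "bal \<equiv> balanced3 K M N P A r l r' l'"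
abbreviation "MNP \<equiv> tensor3 K M N P A r l r' l'"

definition relators where
  "relators =
      {frag_of (x \<oplus>\<^bsub>M\<^esub> x', y, z) - frag_of (x, y, z) - frag_of (x', y, z) | x x' y z.
         x \<in> carrier M \<and> x' \<in> carrier M \<and> y \<in> carrier N \<and> z \<in> carrier P} \<union>
      {frag_of (x, y \<oplus>\<^bsub>N\<^esub> y', z) - frag_of (x, y, z) - frag_of (x, y', z) | x y y' z.
         x \<in> carrier M \<and> y \<in> carrier N \<and> y' \<in> carrier N \<and> z \<in> carrier P} \<union>
      {frag_of (x, y, z \<oplus>\<^bsub>P\<^esub> z') - frag_of (x, y, z) - frag_of (x, y, z') | x y z z'.
         x \<in> carrier M \<and> y \<in> carrier N \<and> z \<in> carrier P \<and> z' \<in> carrier P} \<union>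
      {frag_of (k \<odot>\<^bsub>M\<^esub> x, y, z) - frag_of (x, k \<odot>\<^bsub>N\<^esub> y, z) | k x y z.
         k \<in> carrier K \<and> x \<in> carrier M \<and> y \<in> carrier N \<and> z \<in> carrier P} \<union>
      {frag_of (x, k \<odot>\<^bsub>N\<^esub> y, z) - frag_of (x, y, k \<odot>\<^bsub>P\<^esub> z) | k x y z.
         k \<in> carrier K \<and> x \<in> carrier M \<and> y \<in> carrier N \<and> z \<in> carrier P} \<union>
      {frag_of (r b x, y, z) - frag_of (x, l b y, z) | b x y z.
         b \<in> A \<and> x \<in> carrier M \<and> y \<in> carrier N \<and> z \<in> carrier P} \<union>
      {frag_of (x, r' b y, z) - frag_of (x, y, l' b z) | b x y z.
         b \<in> A \<and> x \<in> carrier M \<and> y \<in> carrier N \<and> z \<in> carrier P}"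

lemma tensor3_presented: "MNP = presented_group (carrier M \<times> carrier N \<times> carrier P) relators"
  by (simp add: tensor3_def relators_def)

sublocale P3: group_presentation "carrier M \<times> carrier N \<times> carrier P" relators
  by unfold_locales
    (auto simp: relators_def act_closed dest!: subsetD[OF keys_diff] split: if_splits)

lemma comm_group_tensor3: "comm_group MNP"
  unfolding tensor3_presented by (rule P3.comm_group_presented)

interpretation MNP: comm_group MNP by (rule comm_group_tensor3)

lemma pure_tensor3_closed [simp, intro]:
  "\<lbrakk>x \<in> carrier M; y \<in> carrier N; z \<in> carrier P\<rbrakk> \<Longrightarrow> pure MNP (x, y, z) \<in> carrier MNP"
  unfolding tensor3_presented by (rule P3.pure_closed) simp

lemma balanced3_pure: "bal MNP (\<lambda>x y z. pure MNP (x, y, z))"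
proof -
  let ?S = "carrier M \<times> carrier N \<times> carrier P"
  have p: "pure MNP \<in> ?S \<rightarrow> carrier MNP" by auto
  note rel = lift_frag_relator[OF comm_group_tensor3 p]
  have R: "frag_lift MNP (pure MNP) c = \<one>\<^bsub>MNP\<^esub>" if "c \<in> relators" for c
    using P3.pure_relation[OF that] by (simp add: tensor3_presented)
  note eq2 = MNP.diff_eq_oneD and eq3 = MNP.diff_diff_eq_oneD
  show ?thesis
  proof (rule balanced3I)
    fix x x' y z assume h: "x \<in> carrier M" "x' \<in> carrier M" "y \<in> carrier N" "z \<in> carrier P"
    have "frag_of (x \<oplus>\<^bsub>M\<^esub> x', y, z) - frag_of (x, y, z) - frag_of (x', y, z) \<in> relators"
      unfolding relators_def Un_iff mem_Collect_eq by (rule disjI1, rule disjI1, rule disjI1, rule disjI1, rule disjI1, rule disjI1) (use h in blast)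
    note rr = R[OF this]
    show "pure MNP (x \<oplus>\<^bsub>M\<^esub> x', y, z) = pure MNP (x, y, z) \<otimes>\<^bsub>MNP\<^esub> pure MNP (x', y, z)"
      using rr h act_closed by (rule_tac eq3) (auto simp: rel)
  next
    fix x y y' z assume h: "x \<in> carrier M" "y \<in> carrier N" "y' \<in> carrier N" "z \<in> carrier P"
    have "frag_of (x, y \<oplus>\<^bsub>N\<^esub> y', z) - frag_of (x, y, z) - frag_of (x, y', z) \<in> relators"
      unfolding relators_def Un_iff mem_Collect_eq by (rule disjI1, rule disjI1, rule disjI1, rule disjI1, rule disjI1, rule disjI2) (use h in blast)
    note rr = R[OF this]
    show "pure MNP (x, y \<oplus>\<^bsub>N\<^esub> y', z) = pure MNP (x, y, z) \<otimes>\<^bsub>MNP\<^esub> pure MNP (x, y', z)"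
      using rr h act_closed by (rule_tac eq3) (auto simp: rel)
  next
    fix x y z z' assume h: "x \<in> carrier M" "y \<in> carrier N" "z \<in> carrier P" "z' \<in> carrier P"
    have "frag_of (x, y, z \<oplus>\<^bsub>P\<^esub> z') - frag_of (x, y, z) - frag_of (x, y, z') \<in> relators"
      unfolding relators_def Un_iff mem_Collect_eq by (rule disjI1, rule disjI1, rule disjI1, rule disjI1, rule disjI2) (use h in blast)
    note rr = R[OF this]
    show "pure MNP (x, y, z \<oplus>\<^bsub>P\<^esub> z') = pure MNP (x, y, z) \<otimes>\<^bsub>MNP\<^esub> pure MNP (x, y, z')"
      using rr h act_closed by (rule_tac eq3) (auto simp: rel)
  next
    fix k x y z assume h: "k \<in> carrier K" "x \<in> carrier M" "y \<in> carrier N" "z \<in> carrier P"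
    have "frag_of (k \<odot>\<^bsub>M\<^esub> x, y, z) - frag_of (x, k \<odot>\<^bsub>N\<^esub> y, z) \<in> relators"
      unfolding relators_def Un_iff mem_Collect_eq by (rule disjI1, rule disjI1, rule disjI1, rule disjI2) (use h in blast)
    note rr = R[OF this]
    show "pure MNP (k \<odot>\<^bsub>M\<^esub> x, y, z) = pure MNP (x, k \<odot>\<^bsub>N\<^esub> y, z)"
      using rr h act_closed by (rule_tac eq2) (auto simp: rel)
  next
    fix k x y z assume h: "k \<in> carrier K" "x \<in> carrier M" "y \<in> carrier N" "z \<in> carrier P"
    have "frag_of (x, k \<odot>\<^bsub>N\<^esub> y, z) - frag_of (x, y, k \<odot>\<^bsub>P\<^esub> z) \<in> relators"
      unfolding relators_def Un_iff mem_Collect_eq by (rule disjI1, rule disjI1, rule disjI2) (use h in blast)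
    note rr = R[OF this]
    show "pure MNP (x, k \<odot>\<^bsub>N\<^esub> y, z) = pure MNP (x, y, k \<odot>\<^bsub>P\<^esub> z)"
      using rr h act_closed by (rule_tac eq2) (auto simp: rel)
  next
    fix b x y z assume h: "b \<in> A" "x \<in> carrier M" "y \<in> carrier N" "z \<in> carrier P"
    have "frag_of (r b x, y, z) - frag_of (x, l b y, z) \<in> relators"
      unfolding relators_def Un_iff mem_Collect_eq by (rule disjI1, rule disjI2) (use h in blast)
    note rr = R[OF this]
    show "pure MNP (r b x, y, z) = pure MNP (x, l b y, z)"
      using rr h act_closed by (rule_tac eq2) (auto simp: rel)
  next
    fix b x y z assume h: "b \<in> A" "x \<in> carrier M" "y \<in> carrier N" "z \<in> carrier P"
    have "frag_of (x, r' b y, z) - frag_of (x, y, l' b z) \<in> relators"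
      unfolding relators_def Un_iff mem_Collect_eq by (rule disjI2) (use h in blast)
    note rr = R[OF this]
    show "pure MNP (x, r' b y, z) = pure MNP (x, y, l' b z)"
      using rr h act_closed by (rule_tac eq2) (auto simp: rel)
  qed auto
qed

lemma tensor3_lift_hom:
  assumes H: "comm_group H" and f: "bal H f"
  shows "tensor_lift H (\<lambda>(x, y, z). f x y z) \<in> hom MNP H"
    and "\<lbrakk>x \<in> carrier M; y \<in> carrier N; z \<in> carrier P\<rbrakk> \<Longrightarrow>
      tensor_lift H (\<lambda>(x, y, z). f x y z) (pure MNP (x, y, z)) = f x y z"
proof -
  interpret H: comm_group H by (rule H)
  let ?S = "carrier M \<times> carrier N \<times> carrier P"
  note D = balanced3D[OF f]
  have fS: "(\<lambda>(x, y, z). f x y z) \<in> ?S \<rightarrow> carrier H" using D(1) by auto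
  have kills: "frag_lift H (\<lambda>(x, y, z). f x y z) c = \<one>\<^bsub>H\<^esub>" if c: "c \<in> relators" for c
  proof -
    note inv3 = H.mult_inv_inv
    consider (1) x x' y z where "c = frag_of (x \<oplus>\<^bsub>M\<^esub> x', y, z) - frag_of (x, y, z) - frag_of (x', y, z)"
        "x \<in> carrier M" "x' \<in> carrier M" "y \<in> carrier N" "z \<in> carrier P"
      | (2) x y y' z where "c = frag_of (x, y \<oplus>\<^bsub>N\<^esub> y', z) - frag_of (x, y, z) - frag_of (x, y', z)"
        "x \<in> carrier M" "y \<in> carrier N" "y' \<in> carrier N" "z \<in> carrier P"
      | (3) x y z z' where "c = frag_of (x, y, z \<oplus>\<^bsub>P\<^esub> z') - frag_of (x, y, z) - frag_of (x, y, z')"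
        "x \<in> carrier M" "y \<in> carrier N" "z \<in> carrier P" "z' \<in> carrier P"
      | (4) k x y z where "c = frag_of (k \<odot>\<^bsub>M\<^esub> x, y, z) - frag_of (x, k \<odot>\<^bsub>N\<^esub> y, z)"
        "k \<in> carrier K" "x \<in> carrier M" "y \<in> carrier N" "z \<in> carrier P"
      | (5) k x y z where "c = frag_of (x, k \<odot>\<^bsub>N\<^esub> y, z) - frag_of (x, y, k \<odot>\<^bsub>P\<^esub> z)"
        "k \<in> carrier K" "x \<in> carrier M" "y \<in> carrier N" "z \<in> carrier P"
      | (6) b x y z where "c = frag_of (r b x, y, z) - frag_of (x, l b y, z)"
        "b \<in> A" "x \<in> carrier M" "y \<in> carrier N" "z \<in> carrier P"
      | (7) b x y z where "c = frag_of (x, r' b y, z) - frag_of (x, y, l' b z)"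
        "b \<in> A" "x \<in> carrier M" "y \<in> carrier N" "z \<in> carrier P"
      using c unfolding relators_def Un_iff mem_Collect_eq
      by (elim disjE exE conjE) (rule that; assumption)+
    then show ?thesis
      by cases (simp_all add: lift_frag_relator[OF H fS] D inv3 act_closed M.smult_closed N.smult_closed P.smult_closed)
  qed
  show "tensor_lift H (\<lambda>(x, y, z). f x y z) \<in> hom MNP H"
    unfolding tensor3_presented by (rule P3.tensor_lift_respects(1)[OF H fS kills])
  show "\<lbrakk>x \<in> carrier M; y \<in> carrier N; z \<in> carrier P\<rbrakk> \<Longrightarrow>
      tensor_lift H (\<lambda>(x, y, z). f x y z) (pure MNP (x, y, z)) = f x y z"
    unfolding tensor3_presented by (subst P3.tensor_lift_respects(2)[OF H fS kills]) auto
qed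

end

section \<open>Left Hopf algebroids spanned by jets\<close>

lemma hom_finprod_finsum:
  assumes "abelian_group M" "comm_group H" "h \<in> hom (add_monoid M) H" "finite I"
    and "f \<in> I \<rightarrow> carrier M"
  shows "h (finsum M f I) = finprod H (\<lambda>i. h (f i)) I"
proof -
  interpret M: abelian_group M by fact
  interpret H: comm_group H by fact
  interpret h: group_hom "add_monoid M" H h
    by (simp add: group_hom_def group_hom_axioms_def M.a_group H.is_group assms)
  show ?thesis
    using assms(4,5)
  proof (induction I)
    case empty then show ?case using h.hom_one by simp
  next
    case (insert i I)
    then have "f i \<in> carrier M" "f \<in> I \<rightarrow> carrier M" "(\<lambda>i. h (f i)) \<in> I \<rightarrow> carrier H" "h (f i) \<in> carrier H"
      using h.hom_closed by (auto simp: Pi_iff)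
    then show ?case using insert h.hom_mult[of "f i" "finsum M f I"] by simp
  qed
qed

lemma (in comm_group) finprod_mult_cong:
  assumes "f \<in> A \<rightarrow> carrier G" "g \<in> A \<rightarrow> carrier G" "\<And>i. i \<in> A \<Longrightarrow> h i = f i \<otimes> g i"
  shows "finprod G h A = finprod G f A \<otimes> finprod G g A"
proof -
  have "finprod G h A = finprod G (\<lambda>i. f i \<otimes> g i) A"
    using assms by (intro finprod_cong') (auto simp: Pi_iff)
  then show ?thesis using finprod_multf[OF assms(1,2)] by simp
qed

text \<open>An algebroid spanned by symbols \<open>j a b\<close>, to be thought of as \<open>[a \<otimes> b]\<close>, over a base which may be
  noncommutative. The locale is instantiated by the jets over a commutative algebra and by their
  cotwist over the twisted base. The last five assumptions are the coevaluation
  \<open>[a \<otimes> 1] = \<Sum> [u\<^sub>i \<otimes> E\<^sub>i(a)]\<close>, where \<open>P i\<close> is \<open>E i\<close> acting on the right factor of a symbol. They are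
  used to invert the Hopf map.\<close>

locale jet_bialgebroid =
  fixes K :: "('k, 'u) ring_scheme" and B :: "('k, 'b, 'v) module_scheme"
    and L :: "('k, 'b, 'l, 'w) bialgebroid_scheme" (structure) and j :: "'b \<Rightarrow> 'b \<Rightarrow> 'l"
    and I :: "'i set" and u :: "'i \<Rightarrow> 'b" and E :: "'i \<Rightarrow> 'b \<Rightarrow> 'b" and P :: "'i \<Rightarrow> 'l \<Rightarrow> 'l"
  assumes base: "unital_algebra K B"
    and space: "module K L"
    and jet_closed: "\<lbrakk>a \<in> carrier B; b \<in> carrier B\<rbrakk> \<Longrightarrow> j a b \<in> carrier L"
    and jet_smult: "\<lbrakk>k \<in> carrier K; a \<in> carrier B; b \<in> carrier B\<rbrakk> \<Longrightarrow> k \<odot> j a b = j (k \<odot>\<^bsub>B\<^esub> a) b"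
      "\<lbrakk>k \<in> carrier K; a \<in> carrier B; b \<in> carrier B\<rbrakk> \<Longrightarrow> k \<odot> j a b = j a (k \<odot>\<^bsub>B\<^esub> b)"
    and jet_add: "\<lbrakk>a \<in> carrier B; a' \<in> carrier B; b \<in> carrier B\<rbrakk> \<Longrightarrow> j (a \<oplus>\<^bsub>B\<^esub> a') b = j a b \<oplus> j a' b"
      "\<lbrakk>a \<in> carrier B; b \<in> carrier B; b' \<in> carrier B\<rbrakk> \<Longrightarrow> j a (b \<oplus>\<^bsub>B\<^esub> b') = j a b \<oplus> j a b'"
    and jet_induct [consumes 1, case_names jet add]: "\<lbrakk>X \<in> carrier L;
        \<And>a b. \<lbrakk>a \<in> carrier B; b \<in> carrier B\<rbrakk> \<Longrightarrow> Q (j a b);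
        \<And>X Y. \<lbrakk>X \<in> carrier L; Y \<in> carrier L; Q X; Q Y\<rbrakk> \<Longrightarrow> Q (X \<oplus> Y)\<rbrakk> \<Longrightarrow> Q X"
    and one_jet: "\<one> = j \<one>\<^bsub>B\<^esub> \<one>\<^bsub>B\<^esub>"
    and mult_closed: "\<lbrakk>X \<in> carrier L; Y \<in> carrier L\<rbrakk> \<Longrightarrow> X \<otimes> Y \<in> carrier L"
    and mult_add: "\<lbrakk>X \<in> carrier L; X' \<in> carrier L; Y \<in> carrier L\<rbrakk> \<Longrightarrow>
        (X \<oplus> X') \<otimes> Y = X \<otimes> Y \<oplus> X' \<otimes> Y"
      "\<lbrakk>X \<in> carrier L; Y \<in> carrier L; Y' \<in> carrier L\<rbrakk> \<Longrightarrow>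
        X \<otimes> (Y \<oplus> Y') = X \<otimes> Y \<oplus> X \<otimes> Y'"
    and mult_jet: "\<lbrakk>a \<in> carrier B; b \<in> carrier B; c \<in> carrier B; d \<in> carrier B\<rbrakk> \<Longrightarrow>
        j a b \<otimes> j c d = j (a \<otimes>\<^bsub>B\<^esub> c) (d \<otimes>\<^bsub>B\<^esub> b)"
    and src_jet: "b \<in> carrier B \<Longrightarrow> src L b = j b \<one>\<^bsub>B\<^esub>"
    and tgt_jet: "b \<in> carrier B \<Longrightarrow> tgt L b = j \<one>\<^bsub>B\<^esub> b"
    and cop_hom: "cop L \<in> hom (add_monoid L) (diamond K B L)"
    and cop_jet: "\<lbrakk>a \<in> carrier B; b \<in> carrier B\<rbrakk> \<Longrightarrow>
        cop L (j a b) = pure (diamond K B L) (j a \<one>\<^bsub>B\<^esub>, j \<one>\<^bsub>B\<^esub> b)"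
    and cou_hom: "cou L \<in> hom (add_monoid L) (add_monoid B)"
    and cou_jet: "\<lbrakk>a \<in> carrier B; b \<in> carrier B\<rbrakk> \<Longrightarrow> cou L (j a b) = a \<otimes>\<^bsub>B\<^esub> b"
    and coev_finite: "finite I"
    and coev_closed: "i \<in> I \<Longrightarrow> u i \<in> carrier B" "\<lbrakk>i \<in> I; b \<in> carrier B\<rbrakk> \<Longrightarrow> E i b \<in> carrier B"
    and coev_hom: "i \<in> I \<Longrightarrow> P i \<in> hom (add_monoid L) (add_monoid L)"
    and coev_jet: "\<lbrakk>i \<in> I; a \<in> carrier B; b \<in> carrier B\<rbrakk> \<Longrightarrow> P i (j a b) = j a (E i b)"
    and coev: "a \<in> carrier B \<Longrightarrow> j a \<one>\<^bsub>B\<^esub> = (\<Oplus>i\<in>I. j (u i) (E i a))"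
begin

interpretation B: unital_algebra K B by (rule base)
interpretation Lm: module K L by (rule space)

lemma total: "unital_algebra K L"
proof -
  have assoc: "(X \<otimes> Y) \<otimes> Z = X \<otimes> (Y \<otimes> Z)"
    if "X \<in> carrier L" "Y \<in> carrier L" "Z \<in> carrier L" for X Y Z
  proof -
    have 1: "(j a b \<otimes> j c d) \<otimes> Z = j a b \<otimes> (j c d \<otimes> Z)"
      if "a \<in> carrier B" "b \<in> carrier B" "c \<in> carrier B" "d \<in> carrier B" for a b c d
      using \<open>Z \<in> carrier L\<close>
      by (induction Z rule: jet_induct) (simp_all add: that mult_jet jet_closed mult_closed mult_add B.m_assoc)
    have 2: "(j a b \<otimes> Y) \<otimes> Z = j a b \<otimes> (Y \<otimes> Z)"
      if "a \<in> carrier B" "b \<in> carrier B" for a b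
      using \<open>Y \<in> carrier L\<close>
      by (induction Y rule: jet_induct) (simp_all add: that 1 \<open>Z \<in> carrier L\<close> jet_closed mult_closed mult_add)
    show ?thesis using \<open>X \<in> carrier L\<close>
      by (induction X rule: jet_induct) (simp_all add: that(2,3) 2 jet_closed mult_closed mult_add)
  qed
  have l_one: "\<one> \<otimes> X = X" "X \<otimes> \<one> = X" if "X \<in> carrier L" for X
    using that by (induction X rule: jet_induct) (simp_all add: one_jet mult_jet jet_closed mult_add)
  have sm: "(k \<odot> X) \<otimes> Y = k \<odot> (X \<otimes> Y)" "X \<otimes> (k \<odot> Y) = k \<odot> (X \<otimes> Y)"
    if k: "k \<in> carrier K" and X: "X \<in> carrier L" and Y: "Y \<in> carrier L" for k X Y
  proof -
    have "(k \<odot> j a b) \<otimes> Y = k \<odot> (j a b \<otimes> Y)" "j a b \<otimes> (k \<odot> Y) = k \<odot> (j a b \<otimes> Y)"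
      if "a \<in> carrier B" "b \<in> carrier B" for a b
      using Y by (induction Y rule: jet_induct)
       (simp_all add: that k jet_smult(1) mult_jet jet_closed mult_closed mult_add Lm.smult_r_distr
         B.smult_mult_left B.smult_mult_right)
    with X show "(k \<odot> X) \<otimes> Y = k \<odot> (X \<otimes> Y)" "X \<otimes> (k \<odot> Y) = k \<odot> (X \<otimes> Y)"
      by (induction X rule: jet_induct)
       (simp_all add: k Y jet_closed mult_closed mult_add Lm.smult_r_distr)
  qed
  have ring: "ring L"
    by (rule ringI)
      (use assoc l_one in \<open>auto simp: Lm.abelian_group_axioms monoid_def mult_closed mult_add one_jet jet_closed\<close>)
  show ?thesis
    by (intro unital_algebra.intro unital_algebra_axioms.intro space ring sm)
qed

interpretation L: unital_algebra K L by (rule total)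

lemma src_closed [simp]: "b \<in> carrier B \<Longrightarrow> src L b \<in> carrier L"
  by (simp add: src_jet jet_closed)

lemma tgt_closed [simp]: "b \<in> carrier B \<Longrightarrow> tgt L b \<in> carrier L"
  by (simp add: tgt_jet jet_closed)

lemma src_mult_jet [simp]:
  "\<lbrakk>c \<in> carrier B; a \<in> carrier B; b \<in> carrier B\<rbrakk> \<Longrightarrow> src L c \<otimes> j a b = j (c \<otimes>\<^bsub>B\<^esub> a) b"
  "\<lbrakk>c \<in> carrier B; a \<in> carrier B; b \<in> carrier B\<rbrakk> \<Longrightarrow> j a b \<otimes> src L c = j (a \<otimes>\<^bsub>B\<^esub> c) b"
  by (simp_all add: src_jet mult_jet)

lemma tgt_mult_jet [simp]:
  "\<lbrakk>c \<in> carrier B; a \<in> carrier B; b \<in> carrier B\<rbrakk> \<Longrightarrow> tgt L c \<otimes> j a b = j a (b \<otimes>\<^bsub>B\<^esub> c)"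
  "\<lbrakk>c \<in> carrier B; a \<in> carrier B; b \<in> carrier B\<rbrakk> \<Longrightarrow> j a b \<otimes> tgt L c = j a (c \<otimes>\<^bsub>B\<^esub> b)"
  by (simp_all add: tgt_jet mult_jet)

sublocale D: tensor_data K L L "carrier B" "\<lambda>b. mult L (tgt L b)" "\<lambda>b. mult L (src L b)"
  rewrites "tensor K L L (carrier B) (\<lambda>b. mult L (tgt L b)) (\<lambda>b. mult L (src L b)) = diamond K B L"
  by unfold_locales (simp_all add: space diamond_def diamond_mod_def)

sublocale T: tensor_data K L L "carrier B" "\<lambda>b x. x \<otimes> tgt L b" "\<lambda>b y. tgt L b \<otimes> y"
  rewrites "tensor K L L (carrier B) (\<lambda>b x. x \<otimes> tgt L b) (\<lambda>b y. tgt L b \<otimes> y) = bar_tensor K B L"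
  by unfold_locales (simp_all add: space bar_tensor_def)

sublocale D3: tensor3_data K L L L "carrier B" "\<lambda>b x. tgt L b \<otimes> x" "\<lambda>b y. src L b \<otimes> y"
    "\<lambda>b y. tgt L b \<otimes> y" "\<lambda>b y. src L b \<otimes> y"
  rewrites "tensor3 K L L L (carrier B) (\<lambda>b x. tgt L b \<otimes> x) (\<lambda>b y. src L b \<otimes> y)
    (\<lambda>b y. tgt L b \<otimes> y) (\<lambda>b y. src L b \<otimes> y) = diamond3 K B L L (\<lambda>b y. src L b \<otimes> y)"
  by unfold_locales (simp_all add: space diamond3_def)

abbreviation "LL \<equiv> diamond K B L"
abbreviation "LbL \<equiv> bar_tensor K B L"
abbreviation "LLL \<equiv> diamond3 K B L L (\<lambda>b y. src L b \<otimes> y)"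

lemma diamond_tensor: "tensor K L L (carrier B) (\<lambda>b. mult L (tgt L b)) (\<lambda>b. mult L (src L b)) = LL"
  by (simp add: diamond_def diamond_mod_def)

lemma smult_src_tgt:
  assumes "k \<in> carrier K" "X \<in> carrier L"
  shows "k \<odot> X = src L (k \<odot>\<^bsub>B\<^esub> \<one>\<^bsub>B\<^esub>) \<otimes> X" "k \<odot> X = tgt L (k \<odot>\<^bsub>B\<^esub> \<one>\<^bsub>B\<^esub>) \<otimes> X"
    "k \<odot> X = X \<otimes> tgt L (k \<odot>\<^bsub>B\<^esub> \<one>\<^bsub>B\<^esub>)"
proof -
  have "src L (k \<odot>\<^bsub>B\<^esub> \<one>\<^bsub>B\<^esub>) = k \<odot> \<one>" "tgt L (k \<odot>\<^bsub>B\<^esub> \<one>\<^bsub>B\<^esub>) = k \<odot> \<one>"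
    using assms by (simp_all add: src_jet tgt_jet one_jet jet_smult(1)) (simp add: jet_smult(1)[symmetric] jet_smult(2))
  then show "k \<odot> X = src L (k \<odot>\<^bsub>B\<^esub> \<one>\<^bsub>B\<^esub>) \<otimes> X" "k \<odot> X = tgt L (k \<odot>\<^bsub>B\<^esub> \<one>\<^bsub>B\<^esub>) \<otimes> X"
    "k \<odot> X = X \<otimes> tgt L (k \<odot>\<^bsub>B\<^esub> \<one>\<^bsub>B\<^esub>)"
    using assms by (simp_all add: L.smult_mult_left L.smult_mult_right)
qed

text \<open>The field acts through the source and the target, so balancedness over the field follows from
  balancedness over the base.\<close>

lemma diamond_balancedI:
  assumes "\<And>x y. \<lbrakk>x \<in> carrier L; y \<in> carrier L\<rbrakk> \<Longrightarrow> f x y \<in> carrier H"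
    and "\<And>x x' y. \<lbrakk>x \<in> carrier L; x' \<in> carrier L; y \<in> carrier L\<rbrakk> \<Longrightarrow> f (x \<oplus> x') y = f x y \<otimes>\<^bsub>H\<^esub> f x' y"
    and "\<And>x y y'. \<lbrakk>x \<in> carrier L; y \<in> carrier L; y' \<in> carrier L\<rbrakk> \<Longrightarrow> f x (y \<oplus> y') = f x y \<otimes>\<^bsub>H\<^esub> f x y'"
    and "\<And>b x y. \<lbrakk>b \<in> carrier B; x \<in> carrier L; y \<in> carrier L\<rbrakk> \<Longrightarrow>
      f (tgt L b \<otimes> x) y = f x (src L b \<otimes> y)"
  shows "D.bal H f"
proof (rule balancedI)
  fix k x y assume "k \<in> carrier K" "x \<in> carrier L" "y \<in> carrier L"
  then show "f (k \<odot> x) y = f x (k \<odot> y)"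
    by (simp add: smult_src_tgt(2)[of k x] smult_src_tgt(1)[of k y] assms(4))
qed (use assms in auto)

lemma bar_balancedI:
  assumes "\<And>x y. \<lbrakk>x \<in> carrier L; y \<in> carrier L\<rbrakk> \<Longrightarrow> f x y \<in> carrier H"
    and "\<And>x x' y. \<lbrakk>x \<in> carrier L; x' \<in> carrier L; y \<in> carrier L\<rbrakk> \<Longrightarrow> f (x \<oplus> x') y = f x y \<otimes>\<^bsub>H\<^esub> f x' y"
    and "\<And>x y y'. \<lbrakk>x \<in> carrier L; y \<in> carrier L; y' \<in> carrier L\<rbrakk> \<Longrightarrow> f x (y \<oplus> y') = f x y \<otimes>\<^bsub>H\<^esub> f x y'"
    and "\<And>b x y. \<lbrakk>b \<in> carrier B; x \<in> carrier L; y \<in> carrier L\<rbrakk> \<Longrightarrow>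
      f (x \<otimes> tgt L b) y = f x (tgt L b \<otimes> y)"
  shows "T.bal H f"
proof (rule balancedI)
  fix k x y assume "k \<in> carrier K" "x \<in> carrier L" "y \<in> carrier L"
  then show "f (k \<odot> x) y = f x (k \<odot> y)"
    by (simp add: smult_src_tgt(3)[of k x] smult_src_tgt(2)[of k y] assms(4))
qed (use assms in auto)

text \<open>Since symbols generate additively, biadditive identities, and in particular balancing relations, can
  be checked on symbols.\<close>

lemma biadditive_eqI:
  assumes "\<And>x x' y. \<lbrakk>x \<in> carrier L; x' \<in> carrier L; y \<in> carrier L\<rbrakk> \<Longrightarrow> f (x \<oplus> x') y = f x y \<otimes>\<^bsub>H\<^esub> f x' y"
    and "\<And>x x' y. \<lbrakk>x \<in> carrier L; x' \<in> carrier L; y \<in> carrier L\<rbrakk> \<Longrightarrow> g (x \<oplus> x') y = g x y \<otimes>\<^bsub>H\<^esub> g x' y"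
    and "\<And>x y y'. \<lbrakk>x \<in> carrier L; y \<in> carrier L; y' \<in> carrier L\<rbrakk> \<Longrightarrow> f x (y \<oplus> y') = f x y \<otimes>\<^bsub>H\<^esub> f x y'"
    and "\<And>x y y'. \<lbrakk>x \<in> carrier L; y \<in> carrier L; y' \<in> carrier L\<rbrakk> \<Longrightarrow> g x (y \<oplus> y') = g x y \<otimes>\<^bsub>H\<^esub> g x y'"
    and "\<And>a b c d. \<lbrakk>a \<in> carrier B; b \<in> carrier B; c \<in> carrier B; d \<in> carrier B\<rbrakk> \<Longrightarrow>
      f (j a b) (j c d) = g (j a b) (j c d)"
    and "x \<in> carrier L" "y \<in> carrier L"
  shows "f x y = g x y"
proof -
  have "f (j a b) y = g (j a b) y" if "a \<in> carrier B" "b \<in> carrier B" for a b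
    using \<open>y \<in> carrier L\<close> by (induction y rule: jet_induct) (simp_all add: that assms(3-5) jet_closed)
  with \<open>x \<in> carrier L\<close> show ?thesis
    by (induction x rule: jet_induct) (simp_all add: assms(1,2,7))
qed

lemma diamond_balanced_jetI:
  assumes "\<And>x y. \<lbrakk>x \<in> carrier L; y \<in> carrier L\<rbrakk> \<Longrightarrow> f x y \<in> carrier H"
    and "\<And>x x' y. \<lbrakk>x \<in> carrier L; x' \<in> carrier L; y \<in> carrier L\<rbrakk> \<Longrightarrow> f (x \<oplus> x') y = f x y \<otimes>\<^bsub>H\<^esub> f x' y"
    and "\<And>x y y'. \<lbrakk>x \<in> carrier L; y \<in> carrier L; y' \<in> carrier L\<rbrakk> \<Longrightarrow> f x (y \<oplus> y') = f x y \<otimes>\<^bsub>H\<^esub> f x y'"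
    and "\<And>e a b c d. \<lbrakk>e \<in> carrier B; a \<in> carrier B; b \<in> carrier B; c \<in> carrier B; d \<in> carrier B\<rbrakk> \<Longrightarrow>
      f (j a (b \<otimes>\<^bsub>B\<^esub> e)) (j c d) = f (j a b) (j (e \<otimes>\<^bsub>B\<^esub> c) d)"
  shows "D.bal H f"
proof (rule diamond_balancedI)
  fix e x y assume e: "e \<in> carrier B" and xy: "x \<in> carrier L" "y \<in> carrier L"
  show "f (tgt L e \<otimes> x) y = f x (src L e \<otimes> y)"
    using xy by (rule_tac biadditive_eqI[where f = "\<lambda>x y. f (tgt L e \<otimes> x) y" and g = "\<lambda>x y. f x (src L e \<otimes> y)" and H=H])
      (simp_all add: assms e L.r_distr)
qed (use assms in auto)

lemma bar_balanced_jetI: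
  assumes "\<And>x y. \<lbrakk>x \<in> carrier L; y \<in> carrier L\<rbrakk> \<Longrightarrow> f x y \<in> carrier H"
    and "\<And>x x' y. \<lbrakk>x \<in> carrier L; x' \<in> carrier L; y \<in> carrier L\<rbrakk> \<Longrightarrow> f (x \<oplus> x') y = f x y \<otimes>\<^bsub>H\<^esub> f x' y"
    and "\<And>x y y'. \<lbrakk>x \<in> carrier L; y \<in> carrier L; y' \<in> carrier L\<rbrakk> \<Longrightarrow> f x (y \<oplus> y') = f x y \<otimes>\<^bsub>H\<^esub> f x y'"
    and "\<And>e a b c d. \<lbrakk>e \<in> carrier B; a \<in> carrier B; b \<in> carrier B; c \<in> carrier B; d \<in> carrier B\<rbrakk> \<Longrightarrow>
      f (j a (e \<otimes>\<^bsub>B\<^esub> b)) (j c d) = f (j a b) (j c (d \<otimes>\<^bsub>B\<^esub> e))"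
  shows "T.bal H f"
proof (rule bar_balancedI)
  fix e x y assume e: "e \<in> carrier B" and xy: "x \<in> carrier L" "y \<in> carrier L"
  show "f (x \<otimes> tgt L e) y = f x (tgt L e \<otimes> y)"
    using xy by (rule_tac biadditive_eqI[where f = "\<lambda>x y. f (x \<otimes> tgt L e) y" and g = "\<lambda>x y. f x (tgt L e \<otimes> y)" and H=H])
      (simp_all add: assms e L.r_distr L.l_distr)
qed (use assms in auto)

lemmas diamond_pure = balancedD[OF D.balanced_pure]
lemmas bar_pure = balancedD[OF T.balanced_pure]
lemmas triple_pure = balanced3D[OF D3.balanced3_pure]

lemma diamond_pure_jet:
  "\<lbrakk>e \<in> carrier B; a \<in> carrier B; b \<in> carrier B; c \<in> carrier B; d \<in> carrier B\<rbrakk> \<Longrightarrow>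
    pure LL (j a (b \<otimes>\<^bsub>B\<^esub> e), j c d) = pure LL (j a b, j (e \<otimes>\<^bsub>B\<^esub> c) d)"
  using diamond_pure(5)[of e "j a b" "j c d"] by (simp add: jet_closed)

lemma cop_closed: "X \<in> carrier L \<Longrightarrow> cop L X \<in> carrier LL"
  using hom_in_carrier[OF cop_hom] by simp

lemma cop_add: "\<lbrakk>X \<in> carrier L; Y \<in> carrier L\<rbrakk> \<Longrightarrow> cop L (X \<oplus> Y) = cop L X \<otimes>\<^bsub>LL\<^esub> cop L Y"
  using hom_mult[OF cop_hom] by simp

lemma cou_closed: "X \<in> carrier L \<Longrightarrow> cou L X \<in> carrier B"
  using hom_in_carrier[OF cou_hom] by simp

lemma cou_add: "\<lbrakk>X \<in> carrier L; Y \<in> carrier L\<rbrakk> \<Longrightarrow> cou L (X \<oplus> Y) = cou L X \<oplus>\<^bsub>B\<^esub> cou L Y"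
  using hom_mult[OF cou_hom] by simp

lemma cop_lift:
  assumes H: "comm_group H" and f: "D.bal H f"
  shows "X \<in> carrier L \<Longrightarrow> tensor_lift H (\<lambda>(x, y). f x y) (cop L X) \<in> carrier H"
    and "\<lbrakk>X \<in> carrier L; Y \<in> carrier L\<rbrakk> \<Longrightarrow> tensor_lift H (\<lambda>(x, y). f x y) (cop L (X \<oplus> Y)) =
      tensor_lift H (\<lambda>(x, y). f x y) (cop L X) \<otimes>\<^bsub>H\<^esub> tensor_lift H (\<lambda>(x, y). f x y) (cop L Y)"
    and "\<lbrakk>a \<in> carrier B; b \<in> carrier B\<rbrakk> \<Longrightarrow>
      tensor_lift H (\<lambda>(x, y). f x y) (cop L (j a b)) = f (j a \<one>\<^bsub>B\<^esub>) (j \<one>\<^bsub>B\<^esub> b)"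
  using D.tensor_lift_hom[OF H f]
  by (auto simp: cop_closed cop_add cop_jet jet_closed hom_mult hom_in_carrier)

text \<open>Each axiom is an equation between additive maps, so it is checked on symbols. There the coproduct is
  \<open>[a \<otimes> 1] \<diamond> [1 \<otimes> b]\<close>, and what remains is associativity of the base together with the relation
  \<open>[a \<otimes> be] \<diamond> [c \<otimes> d] = [a \<otimes> b] \<diamond> [ec \<otimes> d]\<close>.\<close>

theorem left_bialgebroid: "left_bialgebroid K B L"
proof (rule left_bialgebroid.intro)
  show "unital_algebra K B" by (rule base)
  show "unital_algebra K L" by (rule total)
  show "src L \<in> ring_hom B L"
    by (rule ring_hom_memI) (simp_all add: src_jet jet_closed mult_jet jet_add one_jet)
  show "linear_map K B L (src L)"
    by (auto simp: linear_map_def src_jet jet_closed jet_add jet_smult(1) B.smult_closed)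
  show "tgt L \<in> ring_hom (opposite B) L"
    by (rule ring_hom_memI) (simp_all add: opposite_def tgt_jet jet_closed mult_jet jet_add one_jet)
  show "linear_map K B L (tgt L)"
    by (auto simp: linear_map_def tgt_jet jet_closed jet_add jet_smult(2) B.smult_closed)
  fix a b assume "a \<in> carrier B" "b \<in> carrier B"
  then show "src L a \<otimes> tgt L b = tgt L b \<otimes> src L a"
    by (simp add: src_jet tgt_jet mult_jet)
next
  fix X Y assume "X \<in> carrier L" "Y \<in> carrier L"
  then show "cop L (X \<oplus> Y) = cop L X \<otimes>\<^bsub>LL\<^esub> cop L Y" "cou L (X \<oplus> Y) = cou L X \<oplus>\<^bsub>B\<^esub> cou L Y"
    by (rule cop_add cou_add; assumption)+
next
  fix a b X assume ab: "a \<in> carrier B" "b \<in> carrier B" and X: "X \<in> carrier L"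
  have bal: "D.bal LL (\<lambda>x y. pure LL (src L a \<otimes> x, tgt L b \<otimes> y))"
    using ab by (intro diamond_balanced_jetI)
      (simp_all add: diamond_pure(2,3) L.r_distr diamond_pure_jet B.m_assoc)
  note lift = cop_lift[OF D.comm_group_tensor bal]
  show "cop L (src L a \<otimes> tgt L b \<otimes> X) =
      tensor_lift LL (\<lambda>(x, y). pure LL (src L a \<otimes> x, tgt L b \<otimes> y)) (cop L X)"
    using X
  proof (induction X rule: jet_induct)
    case (jet c d)
    then show ?case using ab by (subst lift(3)) (simp_all add: cop_jet jet_closed L.m_assoc)
  next
    case (add X Y)
    have "cop L (src L a \<otimes> tgt L b \<otimes> (X \<oplus> Y)) =
        cop L (src L a \<otimes> tgt L b \<otimes> X) \<otimes>\<^bsub>LL\<^esub> cop L (src L a \<otimes> tgt L b \<otimes> Y)"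
      using add ab by (simp add: L.r_distr cop_add)
    then show ?case using add by (simp only: lift(2))
  qed
  show "cou L (src L a \<otimes> tgt L b \<otimes> X) = a \<otimes>\<^bsub>B\<^esub> cou L X \<otimes>\<^bsub>B\<^esub> b"
    using X
  proof (induction X rule: jet_induct)
    case (jet c d)
    then show ?case using ab by (simp add: cou_jet jet_closed L.m_assoc B.m_assoc)
  next
    case (add X Y)
    then show ?case using ab by (simp add: L.r_distr cou_add B.r_distr B.l_distr cou_closed)
  qed
next
  fix X assume X: "X \<in> carrier L"
  show "cop L X \<in> carrier LL" using X by (rule cop_closed)
  show "cou L X \<in> carrier B" using X by (rule cou_closed)
  interpret LLL: comm_group LLL by (rule D3.comm_group_tensor3)
  define G where "G = (\<lambda>x y. tensor_lift LLL (\<lambda>(x1, x2). pure LLL (x1, x2, y)) (cop L x))"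
  define G' where "G' = (\<lambda>x y. tensor_lift LLL (\<lambda>(y1, y2). pure LLL (x, y1, y2)) (cop L y))"
  have balG: "D.bal LLL (\<lambda>x1 x2. pure LLL (x1, x2, y))" "D.bal LLL (\<lambda>y1 y2. pure LLL (y, y1, y2))"
    if "y \<in> carrier L" for y
    using that by (intro diamond_balancedI; simp add: triple_pure)+
  note lG = cop_lift[OF D3.comm_group_tensor3 balG(1)] cop_lift[OF D3.comm_group_tensor3 balG(2)]
  have bal: "D.bal LLL G" "D.bal LLL G'"
  proof (rule diamond_balanced_jetI)
    fix e a b c d assume "e \<in> carrier B" "a \<in> carrier B" "b \<in> carrier B" "c \<in> carrier B" "d \<in> carrier B"
    then show "G (j a (b \<otimes>\<^bsub>B\<^esub> e)) (j c d) = G (j a b) (j (e \<otimes>\<^bsub>B\<^esub> c) d)"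
      using triple_pure(8)[of e "j a \<one>\<^bsub>B\<^esub>" "j \<one>\<^bsub>B\<^esub> b" "j c d"]
      by (simp add: G_def lG jet_closed)
  next
    show "D.bal LLL G'"
    proof (rule diamond_balanced_jetI)
      fix e a b c d assume "e \<in> carrier B" "a \<in> carrier B" "b \<in> carrier B" "c \<in> carrier B" "d \<in> carrier B"
      then show "G' (j a (b \<otimes>\<^bsub>B\<^esub> e)) (j c d) = G' (j a b) (j (e \<otimes>\<^bsub>B\<^esub> c) d)"
        using triple_pure(7)[of e "j a b" "j c \<one>\<^bsub>B\<^esub>" "j \<one>\<^bsub>B\<^esub> d"]
        by (simp add: G'_def lG jet_closed)
    next
      fix x x' y assume "x \<in> carrier L" "x' \<in> carrier L" "y \<in> carrier L"
      then show "G' (x \<oplus> x') y = G' x y \<otimes>\<^bsub>LLL\<^esub> G' x' y"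
        unfolding G'_def
        by (intro D.tensor_lift_add_cong)
          (simp_all add: cop_closed D3.comm_group_tensor3 triple_pure)
    qed (simp_all add: G'_def lG)
  next
    fix x y y' assume "x \<in> carrier L" "y \<in> carrier L" "y' \<in> carrier L"
    then show "G x (y \<oplus> y') = G x y \<otimes>\<^bsub>LLL\<^esub> G x y'"
      unfolding G_def
      by (intro D.tensor_lift_add_cong)
        (simp_all add: cop_closed D3.comm_group_tensor3 triple_pure)
  qed (simp_all add: G_def lG)
  note l1 = cop_lift[OF D3.comm_group_tensor3 bal(1)] and l2 = cop_lift[OF D3.comm_group_tensor3 bal(2)]
  have "tensor_lift LLL (\<lambda>(x, y). G x y) (cop L X) = tensor_lift LLL (\<lambda>(x, y). G' x y) (cop L X)"
    using X
  proof (induction X rule: jet_induct)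
    case (jet a b)
    then show ?case by (simp only: l1(3) l2(3)) (simp add: G_def G'_def lG jet_closed)
  next
    case (add X Y)
    then show ?case by (simp add: l1(2) l2(2))
  qed
  then show "let T = LLL in
      tensor_lift T (\<lambda>(x, y). tensor_lift T (\<lambda>(x1, x2). pure T (x1, x2, y)) (cop L x)) (cop L X) =
      tensor_lift T (\<lambda>(x, y). tensor_lift T (\<lambda>(y1, y2). pure T (x, y1, y2)) (cop L y)) (cop L X)"
    by (simp add: G_def G'_def)
  have bal_l: "D.bal (add_monoid L) (\<lambda>x y. src L (cou L x) \<otimes> y)"
    by (rule diamond_balanced_jetI)
      (simp_all add: cou_closed cou_add cou_jet L.l_distr L.r_distr jet_add src_jet jet_closed mult_jet B.m_assoc)
  have bal_r: "D.bal (add_monoid L) (\<lambda>x y. tgt L (cou L y) \<otimes> x)"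
    by (rule diamond_balanced_jetI)
      (simp_all add: cou_closed cou_add cou_jet L.l_distr L.r_distr jet_add tgt_jet jet_closed mult_jet B.m_assoc)
  show "tensor_lift (add_monoid L) (\<lambda>(x, y). src L (cou L x) \<otimes> y) (cop L X) = X"
    using X
  proof (induction X rule: jet_induct)
    case (jet a b)
    then show ?case by (simp add: cop_lift(3)[OF Lm.a_comm_group bal_l] cou_jet)
  next
    case (add X Y)
    then show ?case by (simp add: cop_lift(2)[OF Lm.a_comm_group bal_l])
  qed
  show "tensor_lift (add_monoid L) (\<lambda>(x, y). tgt L (cou L y) \<otimes> x) (cop L X) = X"
    using X
  proof (induction X rule: jet_induct)
    case (jet a b)
    then show ?case by (simp add: cop_lift(3)[OF Lm.a_comm_group bal_r] cou_jet)
  next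
    case (add X Y)
    then show ?case by (simp add: cop_lift(2)[OF Lm.a_comm_group bal_r])
  qed
next
  fix X b assume X: "X \<in> carrier L" and b: "b \<in> carrier B"
  have bal: "D.bal LL (\<lambda>x y. pure LL (x \<otimes> tgt L b, y))" "D.bal LL (\<lambda>x y. pure LL (x, y \<otimes> src L b))"
    using b by (rule_tac diamond_balanced_jetI;
      simp add: diamond_pure(2,3) L.r_distr L.l_distr diamond_pure_jet B.m_assoc[symmetric])+
  note l1 = cop_lift[OF D.comm_group_tensor bal(1)] and l2 = cop_lift[OF D.comm_group_tensor bal(2)]
  show "tensor_lift LL (\<lambda>(x, y). pure LL (x \<otimes> tgt L b, y)) (cop L X) =
      tensor_lift LL (\<lambda>(x, y). pure LL (x, y \<otimes> src L b)) (cop L X)"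
    using X
  proof (induction X rule: jet_induct)
    case (jet c d)
    then show ?case using b diamond_pure_jet[of b c "\<one>\<^bsub>B\<^esub>" "\<one>\<^bsub>B\<^esub>" d] by (simp add: l1(3) l2(3))
  next
    case (add X Y)
    then show ?case by (simp add: l1(2) l2(2))
  qed
next
  fix X Y assume X: "X \<in> carrier L" and Y: "Y \<in> carrier L"
  have bal1: "D.bal LL (\<lambda>x1 x2. pure LL (x1 \<otimes> y1, x2 \<otimes> y2))"
    if "y1 \<in> carrier L" "y2 \<in> carrier L" for y1 y2
    using that by (rule_tac diamond_balancedI)
      (simp_all add: diamond_pure(2,3) L.l_distr L.m_assoc diamond_pure(5))
  have bal2: "D.bal LL (\<lambda>y1 y2. pure LL (j a \<one>\<^bsub>B\<^esub> \<otimes> y1, j \<one>\<^bsub>B\<^esub> b \<otimes> y2))"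
    if "a \<in> carrier B" "b \<in> carrier B" for a b
    using that by (rule_tac diamond_balanced_jetI)
      (simp_all add: diamond_pure(2,3) L.r_distr diamond_pure_jet jet_closed mult_jet)
  define G where "G = (\<lambda>Y x1 x2. tensor_lift LL (\<lambda>(y1, y2). pure LL (x1 \<otimes> y1, x2 \<otimes> y2)) (cop L Y))"
  have balG: "D.bal LL (G Y)" if "Y \<in> carrier L" for Y
    unfolding G_def
    using balanced_tensor_lift[OF D.tensor_data_axioms D.tensor_data_axioms D.comm_group_tensor,
        unfolded diamond_tensor, of "cop L Y" "\<lambda>x1 x2 y1 y2. pure LL (x1 \<otimes> y1, x2 \<otimes> y2)"] that
    by (simp add: cop_closed bal1)
  note l1 = cop_lift[OF D.comm_group_tensor balG]
  note l2 = cop_lift[OF D.comm_group_tensor bal2]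
  have *: "cop L (j a b \<otimes> Y) = tensor_lift LL (\<lambda>(x1, x2). G Y x1 x2) (cop L (j a b))"
    if ab: "a \<in> carrier B" "b \<in> carrier B" for a b
    unfolding l1(3)[OF Y ab] unfolding G_def using Y
  proof (induction Y rule: jet_induct)
    case (jet c d)
    then show ?case using ab by (subst l2(3)) (simp_all add: cop_jet mult_jet)
  next
    case (add Y Y')
    have "cop L (j a b \<otimes> (Y \<oplus> Y')) = cop L (j a b \<otimes> Y) \<otimes>\<^bsub>LL\<^esub> cop L (j a b \<otimes> Y')"
      using add ab by (simp add: cop_add L.r_distr jet_closed)
    then show ?case using add ab by (simp only: l2(2))
  qed
  have "cop L (X \<otimes> Y) = tensor_lift LL (\<lambda>(x1, x2). G Y x1 x2) (cop L X)"
    using X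
  proof (induction X rule: jet_induct)
    case (jet a b) then show ?case by (rule *)
  next
    case (add X X')
    have "cop L ((X \<oplus> X') \<otimes> Y) = cop L (X \<otimes> Y) \<otimes>\<^bsub>LL\<^esub> cop L (X' \<otimes> Y)"
      using add Y by (simp add: cop_add L.l_distr)
    then show ?case using add Y by (simp only: l1(2))
  qed
  then show "cop L (X \<otimes> Y) = tensor_lift LL (\<lambda>(x1, x2). tensor_lift LL
      (\<lambda>(y1, y2). pure LL (x1 \<otimes> y1, x2 \<otimes> y2)) (cop L Y)) (cop L X)"
    by (simp add: G_def)
  show "cou L (X \<otimes> src L (cou L Y)) = cou L (X \<otimes> Y)"
    using X Y
    by (rule_tac biadditive_eqI[where f = "\<lambda>X Y. cou L (X \<otimes> src L (cou L Y))" and g = "\<lambda>X Y. cou L (X \<otimes> Y)"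
        and H = "add_monoid B"])
      (simp_all add: cou_add cou_closed L.l_distr L.r_distr src_jet jet_add jet_closed cou_jet mult_jet B.m_assoc)
  show "cou L (X \<otimes> tgt L (cou L Y)) = cou L (X \<otimes> Y)"
    using X Y
    by (rule_tac biadditive_eqI[where f = "\<lambda>X Y. cou L (X \<otimes> tgt L (cou L Y))" and g = "\<lambda>X Y. cou L (X \<otimes> Y)"
        and H = "add_monoid B"])
      (simp_all add: cou_add cou_closed L.l_distr L.r_distr tgt_jet jet_add jet_closed cou_jet mult_jet B.m_assoc)
next
  show "cop L \<one> = pure LL (\<one>, \<one>)" by (simp add: one_jet cop_jet)
  show "cou L \<one> = \<one>\<^bsub>B\<^esub>" by (simp add: one_jet cou_jet)
qed

text \<open>On symbols the inverse has to send \<open>[a \<otimes> b] \<diamond> Y\<close> to \<open>[a \<otimes> 1] \<otimes> [b \<otimes> 1]Y\<close>. The coevaluation of \<open>b\<close>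
  turns this into a formula that makes sense for every \<open>X\<close>: the coefficient \<open>E\<^sub>i(b)\<close> is carried by
  \<open>P i X = [a \<otimes> E\<^sub>i(b)]\<close> and can be moved across the tensor sign.\<close>

definition hopf_inverse where
  "hopf_inverse = tensor_lift LbL (\<lambda>(X, Y). \<Otimes>\<^bsub>LbL\<^esub>i\<in>I. pure LbL (P i X, j (u i) \<one>\<^bsub>B\<^esub> \<otimes> Y))"

interpretation LbL: comm_group LbL by (rule T.comm_group_tensor)

lemma P_simps:
  "\<lbrakk>i \<in> I; X \<in> carrier L\<rbrakk> \<Longrightarrow> P i X \<in> carrier L"
  "\<lbrakk>i \<in> I; X \<in> carrier L; Y \<in> carrier L\<rbrakk> \<Longrightarrow> P i (X \<oplus> Y) = P i X \<oplus> P i Y"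
  using hom_in_carrier[OF coev_hom] hom_mult[OF coev_hom] by simp_all

lemma hopf_inverse_term:
  assumes "a \<in> carrier B" "b \<in> carrier B" "Y \<in> carrier L"
  shows "(\<Otimes>\<^bsub>LbL\<^esub>i\<in>I. pure LbL (P i (j a b), j (u i) \<one>\<^bsub>B\<^esub> \<otimes> Y)) = pure LbL (j a \<one>\<^bsub>B\<^esub>, j b \<one>\<^bsub>B\<^esub> \<otimes> Y)"
proof -
  have factor: "pure LbL (P i (j a b), j (u i) \<one>\<^bsub>B\<^esub> \<otimes> Y) = pure LbL (j a \<one>\<^bsub>B\<^esub>, j (u i) (E i b) \<otimes> Y)"
    if i: "i \<in> I" for i
    using bar_pure(5)[of "E i b" "j a \<one>\<^bsub>B\<^esub>" "j (u i) \<one>\<^bsub>B\<^esub> \<otimes> Y"] assms i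
    by (simp add: coev_jet coev_closed jet_closed mult_closed L.m_assoc[symmetric])
  have hom: "(\<lambda>Z. pure LbL (j a \<one>\<^bsub>B\<^esub>, Z \<otimes> Y)) \<in> hom (add_monoid L) LbL"
    using assms by (intro homI) (auto simp: jet_closed L.l_distr bar_pure)
  have "(\<Otimes>\<^bsub>LbL\<^esub>i\<in>I. pure LbL (P i (j a b), j (u i) \<one>\<^bsub>B\<^esub> \<otimes> Y)) =
      (\<Otimes>\<^bsub>LbL\<^esub>i\<in>I. pure LbL (j a \<one>\<^bsub>B\<^esub>, j (u i) (E i b) \<otimes> Y))"
    using assms by (intro LbL.finprod_cong') (auto simp: factor jet_closed coev_closed mult_closed)
  also have "\<dots> = pure LbL (j a \<one>\<^bsub>B\<^esub>, (\<Oplus>i\<in>I. j (u i) (E i b)) \<otimes> Y)"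
    using assms
    by (intro hom_finprod_finsum[OF Lm.abelian_group_axioms LbL.comm_group_axioms hom coev_finite, symmetric])
      (auto simp: jet_closed coev_closed)
  finally show ?thesis using coev[OF assms(2)] by simp
qed

lemma hopf_inverse_balanced:
  "D.bal LbL (\<lambda>X Y. \<Otimes>\<^bsub>LbL\<^esub>i\<in>I. pure LbL (P i X, j (u i) \<one>\<^bsub>B\<^esub> \<otimes> Y))"
proof (rule diamond_balanced_jetI)
  fix e a b c d assume h: "e \<in> carrier B" "a \<in> carrier B" "b \<in> carrier B" "c \<in> carrier B" "d \<in> carrier B"
  then show "(\<Otimes>\<^bsub>LbL\<^esub>i\<in>I. pure LbL (P i (j a (b \<otimes>\<^bsub>B\<^esub> e)), j (u i) \<one>\<^bsub>B\<^esub> \<otimes> j c d)) =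
      (\<Otimes>\<^bsub>LbL\<^esub>i\<in>I. pure LbL (P i (j a b), j (u i) \<one>\<^bsub>B\<^esub> \<otimes> j (e \<otimes>\<^bsub>B\<^esub> c) d))"
    by (simp add: hopf_inverse_term jet_closed mult_jet B.m_assoc)
next
  fix x x' y assume "x \<in> carrier L" "x' \<in> carrier L" "y \<in> carrier L"
  then show "(\<Otimes>\<^bsub>LbL\<^esub>i\<in>I. pure LbL (P i (x \<oplus> x'), j (u i) \<one>\<^bsub>B\<^esub> \<otimes> y)) =
      (\<Otimes>\<^bsub>LbL\<^esub>i\<in>I. pure LbL (P i x, j (u i) \<one>\<^bsub>B\<^esub> \<otimes> y)) \<otimes>\<^bsub>LbL\<^esub>
      (\<Otimes>\<^bsub>LbL\<^esub>i\<in>I. pure LbL (P i x', j (u i) \<one>\<^bsub>B\<^esub> \<otimes> y))"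
    by (intro LbL.finprod_mult_cong) (auto simp: P_simps bar_pure jet_closed coev_closed mult_closed)
next
  fix x y y' assume "x \<in> carrier L" "y \<in> carrier L" "y' \<in> carrier L"
  then show "(\<Otimes>\<^bsub>LbL\<^esub>i\<in>I. pure LbL (P i x, j (u i) \<one>\<^bsub>B\<^esub> \<otimes> (y \<oplus> y'))) =
      (\<Otimes>\<^bsub>LbL\<^esub>i\<in>I. pure LbL (P i x, j (u i) \<one>\<^bsub>B\<^esub> \<otimes> y)) \<otimes>\<^bsub>LbL\<^esub>
      (\<Otimes>\<^bsub>LbL\<^esub>i\<in>I. pure LbL (P i x, j (u i) \<one>\<^bsub>B\<^esub> \<otimes> y'))"
    by (intro LbL.finprod_mult_cong) (auto simp: P_simps bar_pure jet_closed coev_closed mult_closed L.r_distr)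
next
  fix x y assume "x \<in> carrier L" "y \<in> carrier L"
  then show "(\<Otimes>\<^bsub>LbL\<^esub>i\<in>I. pure LbL (P i x, j (u i) \<one>\<^bsub>B\<^esub> \<otimes> y)) \<in> carrier LbL"
    by (intro LbL.finprod_closed) (auto simp: P_simps jet_closed coev_closed mult_closed)
qed

lemma hopf_inverse_hom: "hopf_inverse \<in> hom LL LbL"
  unfolding hopf_inverse_def by (rule D.tensor_lift_hom(1)[OF LbL.comm_group_axioms hopf_inverse_balanced])

lemma hopf_inverse_pure:
  assumes "a \<in> carrier B" "b \<in> carrier B" "Y \<in> carrier L"
  shows "hopf_inverse (pure LL (j a b, Y)) = pure LbL (j a \<one>\<^bsub>B\<^esub>, j b \<one>\<^bsub>B\<^esub> \<otimes> Y)"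
  unfolding hopf_inverse_def
  using D.tensor_lift_hom(2)[OF LbL.comm_group_axioms hopf_inverse_balanced, of "j a b" Y] assms
  by (simp add: hopf_inverse_term jet_closed)

lemma hopf_map_hom: "hopf_map K B L \<in> hom LbL LL"
  and hopf_map_pure: "\<lbrakk>a \<in> carrier B; b \<in> carrier B; Y \<in> carrier L\<rbrakk> \<Longrightarrow>
    hopf_map K B L (pure LbL (j a b, Y)) = pure LL (j a \<one>\<^bsub>B\<^esub>, j \<one>\<^bsub>B\<^esub> b \<otimes> Y)"
proof -
  have bal1: "D.bal LL (\<lambda>x1 x2. pure LL (x1, x2 \<otimes> y))" if "y \<in> carrier L" for y
    using that by (rule_tac diamond_balancedI)
      (simp_all add: diamond_pure(2,3) L.l_distr L.m_assoc diamond_pure(5))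
  note l1 = cop_lift[OF D.comm_group_tensor bal1]
  define G where "G = (\<lambda>x y. tensor_lift LL (\<lambda>(x1, x2). pure LL (x1, x2 \<otimes> y)) (cop L x))"
  have bal: "T.bal LL G"
  proof (rule bar_balanced_jetI)
    fix e a b c d assume "e \<in> carrier B" "a \<in> carrier B" "b \<in> carrier B" "c \<in> carrier B" "d \<in> carrier B"
    then show "G (j a (e \<otimes>\<^bsub>B\<^esub> b)) (j c d) = G (j a b) (j c (d \<otimes>\<^bsub>B\<^esub> e))"
      by (simp add: G_def l1(3) jet_closed mult_jet B.m_assoc)
  next
    fix x y y' assume "x \<in> carrier L" "y \<in> carrier L" "y' \<in> carrier L"
    then show "G x (y \<oplus> y') = G x y \<otimes>\<^bsub>LL\<^esub> G x y'"
      unfolding G_def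
      by (intro D.tensor_lift_add_cong)
        (simp_all add: cop_closed D.comm_group_tensor diamond_pure L.r_distr)
  qed (simp_all add: G_def l1)
  have eq: "hopf_map K B L = tensor_lift LL (\<lambda>(x, y). G x y)"
    by (simp add: hopf_map_def G_def)
  show "hopf_map K B L \<in> hom LbL LL"
    unfolding eq by (rule T.tensor_lift_hom(1)[OF D.comm_group_tensor bal])
  show "\<lbrakk>a \<in> carrier B; b \<in> carrier B; Y \<in> carrier L\<rbrakk> \<Longrightarrow>
    hopf_map K B L (pure LbL (j a b, Y)) = pure LL (j a \<one>\<^bsub>B\<^esub>, j \<one>\<^bsub>B\<^esub> b \<otimes> Y)"
    unfolding eq by (subst T.tensor_lift_hom(2)[OF D.comm_group_tensor bal]) (simp_all add: jet_closed G_def l1(3))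
qed

interpretation LL: comm_group LL by (rule D.comm_group_tensor)

lemma hopf_inverse_hopf_map:
  assumes "T \<in> carrier LbL"
  shows "hopf_inverse (hopf_map K B L T) = T"
  using assms
proof (induction T rule: T.tensor_induct)
  case (pure x y)
  then show ?case
  proof (induction x rule: jet_induct)
    case (jet a b)
    then have "hopf_inverse (hopf_map K B L (pure LbL (j a b, y))) =
        pure LbL (j a \<one>\<^bsub>B\<^esub>, tgt L b \<otimes> y)"
      by (simp add: hopf_map_pure hopf_inverse_pure jet_closed mult_closed one_jet[symmetric] tgt_jet)
    also have "\<dots> = pure LbL (j a b, y)"
      using bar_pure(5)[of b "j a \<one>\<^bsub>B\<^esub>" y] jet by (simp add: jet_closed)
    finally show ?case .
  next
    case (add x x')
    then show ?case
      by (simp add: bar_pure hom_mult[OF hopf_map_hom] hom_mult[OF hopf_inverse_hom] hom_in_carrier[OF hopf_map_hom])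
  qed
next
  case (mult U V)
  then show ?case
    by (simp add: hom_mult[OF hopf_map_hom] hom_mult[OF hopf_inverse_hom] hom_in_carrier[OF hopf_map_hom])
qed

lemma hopf_map_hopf_inverse:
  assumes "T \<in> carrier LL"
  shows "hopf_map K B L (hopf_inverse T) = T"
  using assms
proof (induction T rule: D.tensor_induct)
  case (pure x y)
  then show ?case
  proof (induction x rule: jet_induct)
    case (jet a b)
    then have "hopf_map K B L (hopf_inverse (pure LL (j a b, y))) =
        pure LL (j a \<one>\<^bsub>B\<^esub>, src L b \<otimes> y)"
      by (simp add: hopf_map_pure hopf_inverse_pure jet_closed mult_closed one_jet[symmetric] src_jet)
    also have "\<dots> = pure LL (j a b, y)"
      using diamond_pure(5)[of b "j a \<one>\<^bsub>B\<^esub>" y] jet by (simp add: jet_closed)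
    finally show ?case .
  next
    case (add x x')
    then show ?case
      by (simp add: diamond_pure hom_mult[OF hopf_map_hom] hom_mult[OF hopf_inverse_hom] hom_in_carrier[OF hopf_inverse_hom])
  qed
next
  case (mult U V)
  then show ?case
    by (simp add: hom_mult[OF hopf_map_hom] hom_mult[OF hopf_inverse_hom] hom_in_carrier[OF hopf_inverse_hom])
qed

lemma hopf_map_bij: "bij_betw (hopf_map K B L) (carrier LbL) (carrier LL)"
  by (rule bij_betw_byWitness[where f' = hopf_inverse])
    (auto simp: hopf_inverse_hopf_map hopf_map_hopf_inverse
      hom_in_carrier[OF hopf_map_hom] hom_in_carrier[OF hopf_inverse_hom])

theorem left_hopf_algebroid: "left_hopf_algebroid K B L"
  by (intro left_hopf_algebroid.intro left_bialgebroid left_hopf_algebroid_axioms.intro hopf_map_bij)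

lemma translation_eq:
  assumes "X \<in> carrier L"
  shows "translation K B L X = hopf_inverse (pure LL (X, \<one>))"
  unfolding translation_def using assms hopf_map_bij
  by (intro inv_into_f_eq)
    (auto simp: bij_betw_def hopf_map_hopf_inverse hom_in_carrier[OF hopf_inverse_hom])

lemma translation_closed: "X \<in> carrier L \<Longrightarrow> translation K B L X \<in> carrier LbL"
  by (simp add: translation_eq hom_in_carrier[OF hopf_inverse_hom])

lemma translation_add: "\<lbrakk>X \<in> carrier L; Y \<in> carrier L\<rbrakk> \<Longrightarrow>
    translation K B L (X \<oplus> Y) = translation K B L X \<otimes>\<^bsub>LbL\<^esub> translation K B L Y"
  by (simp add: translation_eq diamond_pure hom_mult[OF hopf_inverse_hom])

lemma translation_jet: "\<lbrakk>a \<in> carrier B; b \<in> carrier B\<rbrakk> \<Longrightarrow>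
    translation K B L (j a b) = pure LbL (j a \<one>\<^bsub>B\<^esub>, j b \<one>\<^bsub>B\<^esub>)"
  by (simp add: translation_eq jet_closed hopf_inverse_pure)

lemma translation_lift:
  assumes H: "comm_group H" and f: "T.bal H f"
  shows "X \<in> carrier L \<Longrightarrow> tensor_lift H (\<lambda>(x, y). f x y) (translation K B L X) \<in> carrier H"
    and "\<lbrakk>X \<in> carrier L; Y \<in> carrier L\<rbrakk> \<Longrightarrow> tensor_lift H (\<lambda>(x, y). f x y) (translation K B L (X \<oplus> Y)) =
      tensor_lift H (\<lambda>(x, y). f x y) (translation K B L X) \<otimes>\<^bsub>H\<^esub> tensor_lift H (\<lambda>(x, y). f x y) (translation K B L Y)"
    and "\<lbrakk>a \<in> carrier B; b \<in> carrier B\<rbrakk> \<Longrightarrow>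
      tensor_lift H (\<lambda>(x, y). f x y) (translation K B L (j a b)) = f (j a \<one>\<^bsub>B\<^esub>) (j b \<one>\<^bsub>B\<^esub>)"
  using T.tensor_lift_hom[OF H f]
  by (auto simp: translation_closed translation_add translation_jet jet_closed hom_mult hom_in_carrier)

end

section \<open>The enveloping algebra and its diagonal ideal\<close>

locale commutative_algebra =
  fixes K :: "'k ring" and B :: "('k, 'b) module" (structure)
  assumes alg: "algebra K B"
begin

sublocale B: algebra K B by (rule alg)

abbreviation "EG \<equiv> env_group K B"
abbreviation "BB \<equiv> env K B"
abbreviation pe where "pe a b \<equiv> pure (env_group K B) (a, b)"

sublocale EG: tensor_data K B B "{} :: 'b set" "\<lambda>_ x. x" "\<lambda>_ x. x"
  rewrites "tensor K B B ({} :: 'b set) (\<lambda>_ x. x) (\<lambda>_ x. x) = env_group K B"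
  by unfold_locales (simp_all add: B.module env_group_def)

lemmas env_pure = balancedD(1-4)[OF EG.balanced_pure]

lemma env_simps:
  "carrier BB = carrier EG" "one BB = pe \<one> \<one>" "zero BB = one EG" "add BB = mult EG"
  by (simp_all add: env_def)

interpretation EG: comm_group EG by (rule EG.comm_group_tensor)

lemma smult_left: "\<lbrakk>k \<in> carrier K; a \<in> carrier B; b \<in> carrier B\<rbrakk> \<Longrightarrow> (k \<odot> a) \<otimes> b = k \<odot> (a \<otimes> b)"
  by (rule B.smult_assoc2)

lemma smult_right: "\<lbrakk>k \<in> carrier K; a \<in> carrier B; b \<in> carrier B\<rbrakk> \<Longrightarrow> a \<otimes> (k \<odot> b) = k \<odot> (a \<otimes> b)"
  using B.smult_assoc2[of k b a] by (simp add: B.m_comm)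

lemma balanced_product:
  "\<lbrakk>a \<in> carrier B; b \<in> carrier B\<rbrakk> \<Longrightarrow> EG.bal EG (\<lambda>c d. pe (a \<otimes> c) (d \<otimes> b))"
  "\<lbrakk>c \<in> carrier B; d \<in> carrier B\<rbrakk> \<Longrightarrow> EG.bal EG (\<lambda>a b. pe (a \<otimes> c) (d \<otimes> b))"
  by (rule balancedI; simp add: env_pure B.l_distr B.r_distr smult_left smult_right)+

lemma env_mult_lifts:
  "S \<otimes>\<^bsub>BB\<^esub> T = tensor_lift EG (\<lambda>(a, b). tensor_lift EG (\<lambda>(c, d). pe (a \<otimes> c) (d \<otimes> b)) T) S"
  by (simp add: env_def)

lemma balanced_product_lift:
  "T \<in> carrier EG \<Longrightarrow> EG.bal EG (\<lambda>a b. tensor_lift EG (\<lambda>(c, d). pe (a \<otimes> c) (d \<otimes> b)) T)"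
  using balanced_tensor_lift[OF EG.tensor_data_axioms EG.tensor_data_axioms EG.comm_group_axioms,
      folded env_group_def, of T "\<lambda>a b c d. pe (a \<otimes> c) (d \<otimes> b)"] balanced_product
  by simp

lemma env_mult_pure:
  "\<lbrakk>a \<in> carrier B; b \<in> carrier B; c \<in> carrier B; d \<in> carrier B\<rbrakk> \<Longrightarrow>
    pe a b \<otimes>\<^bsub>BB\<^esub> pe c d = pe (a \<otimes> c) (d \<otimes> b)"
  unfolding env_mult_lifts
  by (simp add: EG.tensor_lift_hom(2)[OF EG.comm_group_axioms balanced_product_lift]
      EG.tensor_lift_hom(2)[OF EG.comm_group_axioms balanced_product(1)])

lemma env_mult_closed: "\<lbrakk>S \<in> carrier EG; T \<in> carrier EG\<rbrakk> \<Longrightarrow> S \<otimes>\<^bsub>BB\<^esub> T \<in> carrier EG"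
  unfolding env_mult_lifts
  using hom_in_carrier[OF EG.tensor_lift_hom(1)[OF EG.comm_group_axioms balanced_product_lift]] by simp

lemma env_mult_add:
  assumes "S \<in> carrier EG" "S' \<in> carrier EG" "T \<in> carrier EG" "T' \<in> carrier EG"
  shows "(S \<otimes>\<^bsub>EG\<^esub> S') \<otimes>\<^bsub>BB\<^esub> T = (S \<otimes>\<^bsub>BB\<^esub> T) \<otimes>\<^bsub>EG\<^esub> (S' \<otimes>\<^bsub>BB\<^esub> T)"
    and "S \<otimes>\<^bsub>BB\<^esub> (T \<otimes>\<^bsub>EG\<^esub> T') = (S \<otimes>\<^bsub>BB\<^esub> T) \<otimes>\<^bsub>EG\<^esub> (S \<otimes>\<^bsub>BB\<^esub> T')"
proof -
  show "(S \<otimes>\<^bsub>EG\<^esub> S') \<otimes>\<^bsub>BB\<^esub> T = (S \<otimes>\<^bsub>BB\<^esub> T) \<otimes>\<^bsub>EG\<^esub> (S' \<otimes>\<^bsub>BB\<^esub> T)"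
    unfolding env_mult_lifts
    using hom_mult[OF EG.tensor_lift_hom(1)[OF EG.comm_group_axioms balanced_product_lift]] assms by simp
  note h = EG.tensor_lift_hom(1)[OF EG.comm_group_axioms balanced_product(1)]
  show "S \<otimes>\<^bsub>BB\<^esub> (T \<otimes>\<^bsub>EG\<^esub> T') = (S \<otimes>\<^bsub>BB\<^esub> T) \<otimes>\<^bsub>EG\<^esub> (S \<otimes>\<^bsub>BB\<^esub> T')"
    unfolding env_mult_lifts
    by (intro EG.tensor_lift_add_cong)
      (simp_all add: EG.comm_group_axioms assms hom_mult[OF h] hom_in_carrier[OF h])
qed

lemma env_cring: "cring BB"
proof -
  have comm: "S \<otimes>\<^bsub>BB\<^esub> T = T \<otimes>\<^bsub>BB\<^esub> S" if S: "S \<in> carrier EG" and T: "T \<in> carrier EG" for S T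
  proof -
    have "pe a b \<otimes>\<^bsub>BB\<^esub> T = T \<otimes>\<^bsub>BB\<^esub> pe a b" if "a \<in> carrier B" "b \<in> carrier B" for a b
      using T by (induction T rule: EG.tensor_induct) (simp_all add: that env_mult_pure B.m_comm env_mult_add)
    with S show ?thesis
      by (induction S rule: EG.tensor_induct) (simp_all add: T env_mult_add)
  qed
  have assoc: "(S \<otimes>\<^bsub>BB\<^esub> T) \<otimes>\<^bsub>BB\<^esub> U = S \<otimes>\<^bsub>BB\<^esub> (T \<otimes>\<^bsub>BB\<^esub> U)"
    if S: "S \<in> carrier EG" and T: "T \<in> carrier EG" and U: "U \<in> carrier EG" for S T U
  proof -
    have 1: "pe a b \<otimes>\<^bsub>BB\<^esub> pe c d \<otimes>\<^bsub>BB\<^esub> U = pe a b \<otimes>\<^bsub>BB\<^esub> (pe c d \<otimes>\<^bsub>BB\<^esub> U)"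
      if "a \<in> carrier B" "b \<in> carrier B" "c \<in> carrier B" "d \<in> carrier B" for a b c d
      using U by (induction U rule: EG.tensor_induct)
        (simp_all add: that env_mult_pure B.m_assoc env_mult_add env_mult_closed)
    have "pe a b \<otimes>\<^bsub>BB\<^esub> T \<otimes>\<^bsub>BB\<^esub> U = pe a b \<otimes>\<^bsub>BB\<^esub> (T \<otimes>\<^bsub>BB\<^esub> U)"
      if "a \<in> carrier B" "b \<in> carrier B" for a b
      using T by (induction T rule: EG.tensor_induct)
        (simp_all add: that 1 env_mult_add env_mult_closed U)
    with S show ?thesis
      by (induction S rule: EG.tensor_induct) (simp_all add: T U env_mult_add env_mult_closed)
  qed
  have one: "\<one>\<^bsub>BB\<^esub> \<otimes>\<^bsub>BB\<^esub> S = S" if "S \<in> carrier EG" for S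
    using that by (induction S rule: EG.tensor_induct) (simp_all add: env_mult_pure env_mult_add env_simps)
  show ?thesis
  proof (rule cringI)
    show "abelian_group BB"
    proof (rule abelian_groupI)
      fix x assume "x \<in> carrier BB"
      then show "\<exists>y\<in>carrier BB. y \<oplus>\<^bsub>BB\<^esub> x = \<zero>\<^bsub>BB\<^esub>"
        by (auto simp: env_simps intro!: bexI[of _ "inv\<^bsub>EG\<^esub> x"])
    qed (simp_all add: env_simps EG.m_ac)
    show "comm_monoid BB"
    proof (rule comm_monoidI)
      fix x y assume "x \<in> carrier BB" "y \<in> carrier BB"
      then show "x \<otimes>\<^bsub>BB\<^esub> y = y \<otimes>\<^bsub>BB\<^esub> x" unfolding env_simps(1) by (rule comm)
    qed (simp_all add: env_simps(1) env_mult_closed assoc one, simp_all add: env_simps)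
  qed (simp add: env_simps env_mult_add)
qed

sublocale BB: cring BB by (rule env_cring)

lemma pe_closed [simp]: "\<lbrakk>a \<in> carrier B; b \<in> carrier B\<rbrakk> \<Longrightarrow> pe a b \<in> carrier BB"
  by (simp add: env_simps)

lemma pe_add:
  "\<lbrakk>a \<in> carrier B; a' \<in> carrier B; b \<in> carrier B\<rbrakk> \<Longrightarrow> pe (a \<oplus> a') b = pe a b \<oplus>\<^bsub>BB\<^esub> pe a' b"
  "\<lbrakk>a \<in> carrier B; b \<in> carrier B; b' \<in> carrier B\<rbrakk> \<Longrightarrow> pe a (b \<oplus> b') = pe a b \<oplus>\<^bsub>BB\<^esub> pe a b'"
  by (simp_all add: env_simps env_pure)

lemma env_induct [consumes 1, case_names pure add]:
  assumes "S \<in> carrier BB"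
    and "\<And>a b. \<lbrakk>a \<in> carrier B; b \<in> carrier B\<rbrakk> \<Longrightarrow> Q (pe a b)"
    and "\<And>S T. \<lbrakk>S \<in> carrier BB; T \<in> carrier BB; Q S; Q T\<rbrakk> \<Longrightarrow> Q (S \<oplus>\<^bsub>BB\<^esub> T)"
  shows "Q S"
  using assms unfolding env_simps by (rule EG.tensor_induct)

lemma env_lift:
  assumes "comm_group H" "EG.bal H f"
  shows "S \<in> carrier BB \<Longrightarrow> tensor_lift H (\<lambda>(a, b). f a b) S \<in> carrier H"
    and "\<lbrakk>S \<in> carrier BB; T \<in> carrier BB\<rbrakk> \<Longrightarrow> tensor_lift H (\<lambda>(a, b). f a b) (S \<oplus>\<^bsub>BB\<^esub> T) =
      tensor_lift H (\<lambda>(a, b). f a b) S \<otimes>\<^bsub>H\<^esub> tensor_lift H (\<lambda>(a, b). f a b) T"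
    and "\<lbrakk>a \<in> carrier B; b \<in> carrier B\<rbrakk> \<Longrightarrow> tensor_lift H (\<lambda>(a, b). f a b) (pe a b) = f a b"
  using EG.tensor_lift_hom[OF assms] by (simp_all add: hom_in_carrier hom_mult env_simps)

abbreviation prod_map ("\<epsilon>") where "prod_map \<equiv> tensor_lift (add_monoid B) (\<lambda>(a, b). a \<otimes> b)"

lemma balanced_prod: "EG.bal (add_monoid B) (mult B)"
  by (rule balancedI) (simp_all add: B.l_distr B.r_distr smult_left smult_right)

lemmas prod_map = env_lift[OF B.a_comm_group balanced_prod, simplified]

lemma prod_map_ring_hom: "ring_hom_ring BB B prod_map"
proof (rule ring_hom_ringI2)
  show "prod_map \<in> ring_hom BB B"
  proof (rule ring_hom_memI)
    fix S T assume S: "S \<in> carrier BB" and T: "T \<in> carrier BB"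
    have "prod_map (pe a b \<otimes>\<^bsub>BB\<^esub> T) = prod_map (pe a b) \<otimes> prod_map T" if "a \<in> carrier B" "b \<in> carrier B" for a b
      using T by (induction T rule: env_induct) (simp_all add: that env_mult_pure prod_map BB.r_distr B.r_distr B.m_ac)
    with S show "prod_map (S \<otimes>\<^bsub>BB\<^esub> T) = prod_map S \<otimes> prod_map T"
      by (induction S rule: env_induct) (simp_all add: T prod_map BB.l_distr B.l_distr)
  qed (simp_all add: prod_map env_simps(2))
qed unfold_locales

abbreviation "\<mu> \<equiv> diagonal_ideal K B"

lemma diagonal_ideal: "ideal \<mu> BB"
  unfolding diagonal_ideal_def by (rule ring_hom_ring.kernel_is_ideal[OF prod_map_ring_hom])

lemma mem_diagonal_ideal: "Z \<in> \<mu> \<longleftrightarrow> Z \<in> carrier BB \<and> prod_map Z = \<zero>"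
  by (simp add: diagonal_ideal_def a_kernel_def kernel_def)

text \<open>The universal differential \<open>1 \<otimes> b - b \<otimes> 1\<close>.\<close>

definition differential ("\<d>") where "\<d> b = pe \<one> b \<ominus>\<^bsub>BB\<^esub> pe b \<one>"

lemma differential_closed [simp]: "b \<in> carrier B \<Longrightarrow> \<d> b \<in> carrier BB"
  by (simp add: differential_def)

lemma differential_in_diagonal: "b \<in> carrier B \<Longrightarrow> \<d> b \<in> \<mu>"
proof -
  interpret h: ring_hom_ring BB B prod_map by (rule prod_map_ring_hom)
  show "b \<in> carrier B \<Longrightarrow> \<d> b \<in> \<mu>"
    by (simp add: mem_diagonal_ideal differential_def BB.minus_eq h.hom_add h.hom_a_inv prod_map B.r_neg)
qed

text \<open>The additive map \<open>S \<mapsto> S - \<epsilon>(S) \<otimes> 1\<close> is the identity on the diagonal ideal and sends \<open>a \<otimes> b\<close> to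
  the multiple \<open>a \<cdot> db\<close> of the differential of \<open>b\<close>.\<close>

lemma diagonal_induct [consumes 1, case_names generator add]:
  assumes Z: "Z \<in> \<mu>"
    and gen: "\<And>a b. \<lbrakk>a \<in> carrier B; b \<in> carrier B\<rbrakk> \<Longrightarrow> Q (pe a \<one> \<otimes>\<^bsub>BB\<^esub> \<d> b)"
    and add: "\<And>S T. \<lbrakk>S \<in> \<mu>; T \<in> \<mu>; Q S; Q T\<rbrakk> \<Longrightarrow> Q (S \<oplus>\<^bsub>BB\<^esub> T)"
  shows "Q Z"
proof -
  interpret \<mu>: ideal \<mu> BB by (rule diagonal_ideal)
  have "S \<ominus>\<^bsub>BB\<^esub> pe (prod_map S) \<one> \<in> \<mu> \<and> Q (S \<ominus>\<^bsub>BB\<^esub> pe (prod_map S) \<one>)" if "S \<in> carrier BB" for S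
    using that
  proof (induction S rule: env_induct)
    case (pure a b)
    have "pe a b \<ominus>\<^bsub>BB\<^esub> pe (prod_map (pe a b)) \<one> = pe a \<one> \<otimes>\<^bsub>BB\<^esub> \<d> b"
      using pure by (simp add: differential_def prod_map BB.minus_eq BB.r_distr BB.r_minus env_mult_pure)
    then show ?case using pure gen \<mu>.I_l_closed differential_in_diagonal by simp
  next
    case (add S T)
    have eq: "S \<oplus>\<^bsub>BB\<^esub> T \<ominus>\<^bsub>BB\<^esub> pe (prod_map (S \<oplus>\<^bsub>BB\<^esub> T)) \<one> =
      (S \<ominus>\<^bsub>BB\<^esub> pe (prod_map S) \<one>) \<oplus>\<^bsub>BB\<^esub> (T \<ominus>\<^bsub>BB\<^esub> pe (prod_map T) \<one>)"
      using add by (simp add: prod_map pe_add BB.minus_eq BB.minus_add BB.a_ac)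
    show ?case unfolding eq using add assms(3) by simp
  qed
  moreover have "Z \<ominus>\<^bsub>BB\<^esub> pe (prod_map Z) \<one> = Z"
    using Z EG.pure_zero[of "\<one>"] by (simp add: mem_diagonal_ideal BB.minus_eq env_simps(3)[symmetric])
  ultimately show ?thesis using Z by (metis mem_diagonal_ideal)
qed

text \<open>The powers of the diagonal ideal, the power with exponent zero being the whole ring.\<close>

fun mu where
  "mu 0 = carrier BB"
| "mu (Suc n) = jet_ideal K B n"

lemma mu_ideal: "ideal (mu n) BB"
proof (cases n)
  case 0 then show ?thesis by (simp add: BB.oneideal)
next
  case (Suc m)
  have "ideal (jet_ideal K B m) BB"
    by (induction m) (simp_all add: diagonal_ideal BB.ideal_prod_is_ideal)
  then show ?thesis using Suc by simp
qed

lemma mu_carrier: "Z \<in> mu n \<Longrightarrow> Z \<in> carrier BB"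
  using ideal.Icarr[OF mu_ideal] by blast

lemma mu_Suc_induct [consumes 1, case_names generator add]:
  assumes Z: "Z \<in> mu (Suc n)"
    and gen: "\<And>W b. \<lbrakk>W \<in> mu n; b \<in> carrier B\<rbrakk> \<Longrightarrow> Q (W \<otimes>\<^bsub>BB\<^esub> \<d> b)"
    and add: "\<And>S T. \<lbrakk>S \<in> carrier BB; T \<in> carrier BB; Q S; Q T\<rbrakk> \<Longrightarrow> Q (S \<oplus>\<^bsub>BB\<^esub> T)"
  shows "Q Z"
proof (cases n)
  case 0
  then have "Z \<in> \<mu>" using Z by simp
  then show ?thesis
    by (induction Z rule: diagonal_induct) (use gen 0 add in \<open>auto simp: mem_diagonal_ideal\<close>)
next
  case (Suc m)
  interpret m: ideal "mu n" BB by (rule mu_ideal)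
  have prod: "Q (W \<otimes>\<^bsub>BB\<^esub> Y)" if W: "W \<in> mu n" and Y: "Y \<in> \<mu>" for W Y
    using Y
  proof (induction Y rule: diagonal_induct)
    case (generator a b)
    then have "W \<otimes>\<^bsub>BB\<^esub> (pe a \<one> \<otimes>\<^bsub>BB\<^esub> \<d> b) = (W \<otimes>\<^bsub>BB\<^esub> pe a \<one>) \<otimes>\<^bsub>BB\<^esub> \<d> b"
      using W mu_carrier by (simp add: BB.m_assoc)
    then show ?case using generator gen[OF m.I_r_closed[OF W, of "pe a \<one>"]] by simp
  next
    case (add S T)
    then show ?case using W mu_carrier assms(3) by (simp add: BB.r_distr mem_diagonal_ideal)
  qed
  have "Z \<in> ideal_prod BB (mu n) \<mu>" using Z Suc by simp
  then have "Q Z \<and> Z \<in> carrier BB"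
  proof (induction Z rule: ideal_prod.induct)
    case (prod i j)
    then show ?case using \<open>\<And>Y W. \<lbrakk>W \<in> mu n; Y \<in> \<mu>\<rbrakk> \<Longrightarrow> Q (W \<otimes>\<^bsub>BB\<^esub> Y)\<close> mu_carrier
      by (auto simp: mem_diagonal_ideal)
  next
    case (sum s1 s2) then show ?case using add by auto
  qed
  then show ?thesis by simp
qed

lemma mu_mult_differential: "\<lbrakk>W \<in> mu n; b \<in> carrier B\<rbrakk> \<Longrightarrow> W \<otimes>\<^bsub>BB\<^esub> \<d> b \<in> mu (Suc n)"
proof (cases n)
  case 0
  assume "W \<in> mu n" "b \<in> carrier B"
  then show ?thesis
    using 0 ideal.I_l_closed[OF diagonal_ideal differential_in_diagonal] by simp
next
  case (Suc m)
  assume "W \<in> mu n" "b \<in> carrier B"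
  then show ?thesis
    using Suc by (auto intro: ideal_prod.prod differential_in_diagonal)
qed

end

subsection \<open>The stable ideal and jets\<close>

locale stable_jets = commutative_algebra +
  assumes stab: "jets_stabilise K B"
begin

abbreviation "\<I> \<equiv> stable_ideal K B"
abbreviation "\<J> \<equiv> jets K B"
abbreviation jt where "jt \<equiv> jet K B"
abbreviation jet_mult (infixl "\<bullet>" 70) where "X \<bullet> Y \<equiv> X \<otimes>\<^bsub>\<J>\<^esub> Y"
abbreviation "QQ \<equiv> env K B Quot stable_ideal K B"

text \<open>The successor accounts for the shift of exponents between \<open>mu\<close> and \<open>jet_ideal\<close>.\<close>

definition stable_index where
  "stable_index = Suc (LEAST k. \<forall>j\<ge>k. jet_ideal K B j = jet_ideal K B k)"

lemma stable_mu: "n \<ge> stable_index \<Longrightarrow> mu n = \<I>"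
proof -
  let ?k = "LEAST k. \<forall>j\<ge>k. jet_ideal K B j = jet_ideal K B k"
  have k: "\<forall>j\<ge>?k. jet_ideal K B j = jet_ideal K B ?k"
    using stab unfolding jets_stabilise_def by (rule LeastI_ex)
  assume "n \<ge> stable_index"
  then obtain m where m: "n = Suc m" "m \<ge> ?k" unfolding stable_index_def by (cases n) auto
  have "jet_ideal K B m = jet_ideal K B ?k" using k m(2) by blast
  then show ?thesis by (simp only: m(1) mu.simps stable_ideal_def)
qed

sublocale I: ideal \<I> BB
proof -
  have "mu stable_index = \<I>" by (rule stable_mu) simp
  then show "ideal \<I> BB" by (metis mu_ideal)
qed

lemma stable_ideal_diagonal: "Z \<in> \<I> \<Longrightarrow> prod_map Z = \<zero>"
proof -
  have "Z \<in> mu (Suc n) \<Longrightarrow> prod_map Z = \<zero>" for n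
  proof (induction Z rule: mu_Suc_induct)
    case (generator W b)
    then have "W \<otimes>\<^bsub>BB\<^esub> \<d> b \<in> \<mu>"
      using ideal.I_l_closed[OF diagonal_ideal differential_in_diagonal] mu_carrier by simp
    then show ?case by (simp add: mem_diagonal_ideal)
  next
    case (add S T) then show ?case by (simp add: prod_map)
  qed
  moreover have "mu (Suc stable_index) = \<I>" by (rule stable_mu) simp
  ultimately show "Z \<in> \<I> \<Longrightarrow> prod_map Z = \<zero>" by metis
qed

lemma jet_eq_coset: "jt a b = \<I> +>\<^bsub>BB\<^esub> pe a b"
  by (simp add: jet_def)

sublocale QQ: cring QQ by (rule I.quotient_is_cring[OF env_cring])

lemma coset_hom: "ring_hom_ring BB QQ ((+>\<^bsub>BB\<^esub>) \<I>)"
  by (rule I.rcos_ring_hom_ring)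

interpretation q: ring_hom_ring BB QQ "(+>\<^bsub>BB\<^esub>) \<I>" by (rule coset_hom)

lemma carrier_QQ: "carrier QQ = (\<lambda>S. \<I> +>\<^bsub>BB\<^esub> S) ` carrier BB"
  unfolding FactRing_def A_RCOSETS_def' by (simp add: UNION_singleton_eq_range)

lemma jets_fields:
  "carrier \<J> = carrier QQ" "mult \<J> = mult QQ" "one \<J> = one QQ" "zero \<J> = zero QQ" "add \<J> = add QQ"
  "smult \<J> = (\<lambda>k. jet_lift (add_monoid QQ) (\<lambda>(a, b). jt (k \<odot> a) b))"
  "src \<J> = (\<lambda>a. jt a \<one>)" "tgt \<J> = (\<lambda>b. jt \<one> b)"
  "cop \<J> = jet_lift (diamond K B (jets_st K B))
        (\<lambda>(a, b). pure (diamond K B (jets_st K B)) (jt a \<one>, jt \<one> b))"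
  "cou \<J> = jet_lift (add_monoid B) (\<lambda>(a, b). a \<otimes> b)"
  by (simp_all add: jets_def jets_st_def st_algebra.extend_def bialgebroid.fields_def Let_def)

lemma diamond_jets_st: "diamond K B (jets_st K B) = diamond K B \<J>"
  by (simp add: diamond_def diamond_mod_def tensor_def jets_def st_algebra.extend_def)

text \<open>The chosen element of a coset differs from any other one by an element of the stable ideal.\<close>

lemma jet_lift_coset:
  assumes H: "comm_group H" and f: "EG.bal H f"
    and kills: "\<And>Z. Z \<in> \<I> \<Longrightarrow> tensor_lift H (\<lambda>(a, b). f a b) Z = \<one>\<^bsub>H\<^esub>" and S: "S \<in> carrier BB"
  shows "jet_lift H (\<lambda>(a, b). f a b) (\<I> +>\<^bsub>BB\<^esub> S) = tensor_lift H (\<lambda>(a, b). f a b) S"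
proof -
  interpret H: comm_group H by (rule H)
  have "S \<in> \<I> +>\<^bsub>BB\<^esub> S" using S by (rule I.a_rcos_self)
  then have "(SOME T. T \<in> \<I> +>\<^bsub>BB\<^esub> S) \<in> \<I> +>\<^bsub>BB\<^esub> S" by (rule someI)
  then obtain Z where Z: "Z \<in> \<I>" "(SOME T. T \<in> \<I> +>\<^bsub>BB\<^esub> S) = Z \<oplus>\<^bsub>BB\<^esub> S"
    by (auto simp: a_r_coset_def')
  then show ?thesis using S env_lift(1)[OF H f S]
    by (simp add: jet_lift_def env_lift(2)[OF H f] kills I.Icarr)
qed

lemma jet_lift:
  assumes H: "comm_group H" and f: "EG.bal H f"
    and kills: "\<And>Z. Z \<in> \<I> \<Longrightarrow> tensor_lift H (\<lambda>(a, b). f a b) Z = \<one>\<^bsub>H\<^esub>"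
  shows "jet_lift H (\<lambda>(a, b). f a b) \<in> hom (add_monoid \<J>) H"
    and "\<lbrakk>a \<in> carrier B; b \<in> carrier B\<rbrakk> \<Longrightarrow> jet_lift H (\<lambda>(a, b). f a b) (jt a b) = f a b"
proof -
  note c = jet_lift_coset[OF H f kills]
  show "jet_lift H (\<lambda>(a, b). f a b) \<in> hom (add_monoid \<J>) H"
  proof (rule homI)
    fix X assume "X \<in> carrier (add_monoid \<J>)"
    then show "jet_lift H (\<lambda>(a, b). f a b) X \<in> carrier H"
      by (auto simp: jets_fields carrier_QQ c env_lift(1)[OF H f])
  next
    fix X Y assume "X \<in> carrier (add_monoid \<J>)" "Y \<in> carrier (add_monoid \<J>)"
    then obtain S T where ST: "S \<in> carrier BB" "X = \<I> +>\<^bsub>BB\<^esub> S" "T \<in> carrier BB" "Y = \<I> +>\<^bsub>BB\<^esub> T"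
      by (auto simp: jets_fields carrier_QQ)
    then have eq: "X \<otimes>\<^bsub>add_monoid \<J>\<^esub> Y = \<I> +>\<^bsub>BB\<^esub> (S \<oplus>\<^bsub>BB\<^esub> T)"
      using q.hom_add by (simp add: jets_fields)
    show "jet_lift H (\<lambda>(a, b). f a b) (X \<otimes>\<^bsub>add_monoid \<J>\<^esub> Y) =
        jet_lift H (\<lambda>(a, b). f a b) X \<otimes>\<^bsub>H\<^esub> jet_lift H (\<lambda>(a, b). f a b) Y"
      using ST unfolding eq by (simp add: c env_lift(2)[OF H f] del: q.hom_add)
  qed
  show "\<lbrakk>a \<in> carrier B; b \<in> carrier B\<rbrakk> \<Longrightarrow> jet_lift H (\<lambda>(a, b). f a b) (jt a b) = f a b"
    by (simp add: jet_eq_coset c env_lift(3)[OF H f])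
qed

lemma jt_closed [simp]: "\<lbrakk>a \<in> carrier B; b \<in> carrier B\<rbrakk> \<Longrightarrow> jt a b \<in> carrier \<J>"
  by (simp add: jet_eq_coset jets_fields carrier_QQ)

lemma jt_mult: "\<lbrakk>a \<in> carrier B; b \<in> carrier B; c \<in> carrier B; d \<in> carrier B\<rbrakk> \<Longrightarrow>
    jt a b \<bullet> jt c d = jt (a \<otimes> c) (d \<otimes> b)"
  by (simp add: jet_eq_coset jets_fields env_mult_pure[symmetric])

lemma jt_add:
  "\<lbrakk>a \<in> carrier B; a' \<in> carrier B; b \<in> carrier B\<rbrakk> \<Longrightarrow> jt (a \<oplus> a') b = jt a b \<oplus>\<^bsub>\<J>\<^esub> jt a' b"
  "\<lbrakk>a \<in> carrier B; b \<in> carrier B; b' \<in> carrier B\<rbrakk> \<Longrightarrow> jt a (b \<oplus> b') = jt a b \<oplus>\<^bsub>\<J>\<^esub> jt a b'"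
  by (simp_all add: jet_eq_coset jets_fields pe_add)

lemma jt_one: "\<one>\<^bsub>\<J>\<^esub> = jt \<one> \<one>"
  using q.hom_one by (simp add: jets_fields jet_eq_coset env_simps(2))

lemma jt_balance:
  assumes "k \<in> carrier K" "a \<in> carrier B" "b \<in> carrier B"
  shows "jt (k \<odot> a) b = jt a (k \<odot> b)"
  using assms by (simp add: jet_eq_coset env_pure(4))

lemma jet_generates [consumes 1, case_names jet add]:
  assumes "X \<in> carrier \<J>"
    and jet: "\<And>a b. \<lbrakk>a \<in> carrier B; b \<in> carrier B\<rbrakk> \<Longrightarrow> Q (jt a b)"
    and add: "\<And>X Y. \<lbrakk>X \<in> carrier \<J>; Y \<in> carrier \<J>; Q X; Q Y\<rbrakk> \<Longrightarrow> Q (X \<oplus>\<^bsub>\<J>\<^esub> Y)"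
  shows "Q X"
proof -
  obtain S where S: "S \<in> carrier BB" "X = \<I> +>\<^bsub>BB\<^esub> S" using assms(1) by (auto simp: jets_fields carrier_QQ)
  have "Q (\<I> +>\<^bsub>BB\<^esub> S)" using S(1)
  proof (induction S rule: env_induct)
    case (pure a b) then show ?case using jet by (simp add: jet_eq_coset)
  next
    case (add S T)
    then show ?case using assms(3)[of "\<I> +>\<^bsub>BB\<^esub> S" "\<I> +>\<^bsub>BB\<^esub> T"]
      by (simp add: jets_fields q.hom_add carrier_QQ)
  qed
  then show ?thesis using S by simp
qed

lemma jets_cring: "cring \<J>"
proof (rule cringI)
  show "abelian_group \<J>"
  proof (rule abelian_groupI)
    fix x assume "x \<in> carrier \<J>"
    then show "\<exists>y\<in>carrier \<J>. y \<oplus>\<^bsub>\<J>\<^esub> x = \<zero>\<^bsub>\<J>\<^esub>"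
      using QQ.l_neg by (auto simp: jets_fields intro!: bexI[of _ "\<ominus>\<^bsub>QQ\<^esub> x"])
  qed (simp_all add: jets_fields QQ.a_assoc, simp add: QQ.a_comm)
  show "comm_monoid \<J>"
    by (rule comm_monoidI) (simp_all add: jets_fields QQ.m_assoc, simp add: QQ.m_comm)
qed (simp add: jets_fields QQ.l_distr)

sublocale J: cring \<J> by (rule jets_cring)

lemma smult_jets:
  assumes "k \<in> carrier K" "X \<in> carrier \<J>"
  shows "k \<odot>\<^bsub>\<J>\<^esub> X = jt (k \<odot> \<one>) \<one> \<bullet> X"
proof -
  let ?k = "pe (k \<odot> \<one>) \<one>"
  have H: "comm_group (add_monoid QQ)" by (rule QQ.a_comm_group)
  have kk: "k \<odot> (l \<odot> a) = l \<odot> (k \<odot> a)" if "l \<in> carrier K" "a \<in> carrier B" for l a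
    using that assms by (metis B.R.m_comm B.smult_assoc1)
  have f: "EG.bal (add_monoid QQ) (\<lambda>a b. jt (k \<odot> a) b)"
    using assms(1)
    by (intro balancedI)
      (simp_all add: jets_fields[symmetric] jt_add B.smult_r_distr kk jt_balance[symmetric])
  have val: "tensor_lift (add_monoid QQ) (\<lambda>(a, b). jt (k \<odot> a) b) S = \<I> +>\<^bsub>BB\<^esub> (?k \<otimes>\<^bsub>BB\<^esub> S)"
    if "S \<in> carrier BB" for S
    using that
  proof (induction S rule: env_induct)
    case (pure a b)
    then show ?case using assms(1)
      by (subst env_lift(3)[OF H f]) (simp_all add: env_mult_pure smult_left jet_eq_coset del: q.hom_mult)
  next
    case (add S T)
    then show ?case using assms(1) by (subst env_lift(2)[OF H f]) (simp_all add: BB.r_distr)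
  qed
  have kills: "tensor_lift (add_monoid QQ) (\<lambda>(a, b). jt (k \<odot> a) b) Z = \<one>\<^bsub>add_monoid QQ\<^esub>" if "Z \<in> \<I>" for Z
  proof -
    have "?k \<otimes>\<^bsub>BB\<^esub> Z \<in> \<I>" using I.I_l_closed[OF that] assms(1) by simp
    then have "\<I> +>\<^bsub>BB\<^esub> (?k \<otimes>\<^bsub>BB\<^esub> Z) = \<I>" by (rule I.a_rcos_const)
    moreover have "\<one>\<^bsub>add_monoid QQ\<^esub> = \<I>"
      unfolding FactRing_def by (simp only: ring.select_convs monoid.select_convs)
    ultimately show ?thesis using val[OF I.Icarr[OF that]] by (simp only:)
  qed
  obtain S where S: "S \<in> carrier BB" "X = \<I> +>\<^bsub>BB\<^esub> S" using assms(2) by (auto simp: jets_fields carrier_QQ)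
  have "k \<odot>\<^bsub>\<J>\<^esub> X = jet_lift (add_monoid QQ) (\<lambda>(a, b). jt (k \<odot> a) b) (\<I> +>\<^bsub>BB\<^esub> S)"
    by (simp only: jets_fields S)
  also have "\<dots> = tensor_lift (add_monoid QQ) (\<lambda>(a, b). jt (k \<odot> a) b) S"
    by (rule jet_lift_coset[OF H f kills S(1)])
  also have "\<dots> = \<I> +>\<^bsub>BB\<^esub> (?k \<otimes>\<^bsub>BB\<^esub> S)" by (rule val[OF S(1)])
  also have "\<dots> = (\<I> +>\<^bsub>BB\<^esub> ?k) \<otimes>\<^bsub>QQ\<^esub> (\<I> +>\<^bsub>BB\<^esub> S)" using assms(1) S by simp
  finally show ?thesis by (simp only: jets_fields jet_eq_coset S)
qed

lemma jt_smult:
  assumes "k \<in> carrier K" "a \<in> carrier B" "b \<in> carrier B"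
  shows "k \<odot>\<^bsub>\<J>\<^esub> jt a b = jt (k \<odot> a) b" "k \<odot>\<^bsub>\<J>\<^esub> jt a b = jt a (k \<odot> b)"
  using assms by (simp_all add: smult_jets jt_mult smult_left jt_balance[symmetric])

lemma jets_module: "module K \<J>"
proof (rule moduleI)
  show "cring K" by unfold_locales
  show "abelian_group \<J>" by unfold_locales
  fix k l X Y assume h: "k \<in> carrier K" "l \<in> carrier K" "X \<in> carrier \<J>" "Y \<in> carrier \<J>"
  have "jt ((k \<otimes>\<^bsub>K\<^esub> l) \<odot> \<one>) \<one> = jt (k \<odot> \<one>) \<one> \<bullet> jt (l \<odot> \<one>) \<one>"
    using h by (simp add: jt_mult B.smult_assoc1 smult_left)
  with h show "(k \<otimes>\<^bsub>K\<^esub> l) \<odot>\<^bsub>\<J>\<^esub> X = k \<odot>\<^bsub>\<J>\<^esub> (l \<odot>\<^bsub>\<J>\<^esub> X)"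
    by (simp add: smult_jets J.m_assoc)
  show "(k \<oplus>\<^bsub>K\<^esub> l) \<odot>\<^bsub>\<J>\<^esub> X = k \<odot>\<^bsub>\<J>\<^esub> X \<oplus>\<^bsub>\<J>\<^esub> l \<odot>\<^bsub>\<J>\<^esub> X"
    using h by (simp add: smult_jets B.smult_l_distr jt_add J.l_distr)
qed (simp_all add: smult_jets J.r_distr jt_one[symmetric])

end

section \<open>Differential operators and jets\<close>

context commutative_algebra
begin

interpretation EG: comm_group EG by (rule EG.comm_group_tensor)

definition left_op where "left_op D = tensor_lift EG (\<lambda>(a, b). pe (D a) b)"
definition swap where "swap = tensor_lift EG (\<lambda>(a, b). pe b a)"

lemma linearD:
  assumes "linear_map K B B D"
  shows "a \<in> carrier B \<Longrightarrow> D a \<in> carrier B"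
    "\<lbrakk>a \<in> carrier B; b \<in> carrier B\<rbrakk> \<Longrightarrow> D (a \<oplus> b) = D a \<oplus> D b"
    "\<lbrakk>k \<in> carrier K; a \<in> carrier B\<rbrakk> \<Longrightarrow> D (k \<odot> a) = k \<odot> D a"
  using assms by (auto simp: linear_map_def)

lemma pe_zero: "b \<in> carrier B \<Longrightarrow> pe \<zero> b = \<zero>\<^bsub>BB\<^esub>"
  by (simp add: env_simps(3) EG.pure_zero)

lemma balanced_left_op: "linear_map K B B D \<Longrightarrow> EG.bal EG (\<lambda>a b. pe (D a) b)"
  by (rule balancedI) (simp_all add: linearD env_pure)

lemma balanced_swap: "EG.bal EG (\<lambda>a b. pe b a)"
  by (rule balancedI) (simp_all add: env_pure)

lemmas left_op = env_lift[OF EG.comm_group_axioms balanced_left_op, folded left_op_def env_simps]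
lemmas swap = env_lift[OF EG.comm_group_axioms balanced_swap, folded swap_def env_simps]

lemma swap_mult:
  assumes "S \<in> carrier BB" "T \<in> carrier BB"
  shows "swap (S \<otimes>\<^bsub>BB\<^esub> T) = swap S \<otimes>\<^bsub>BB\<^esub> swap T"
proof -
  have "swap (pe a b \<otimes>\<^bsub>BB\<^esub> T) = swap (pe a b) \<otimes>\<^bsub>BB\<^esub> swap T" if "a \<in> carrier B" "b \<in> carrier B" for a b
    using assms(2) by (induction T rule: env_induct) (simp_all add: that swap env_mult_pure B.m_comm BB.r_distr)
  with assms(1) show ?thesis
    by (induction S rule: env_induct) (simp_all add: assms(2) swap BB.l_distr)
qed

lemma swap_group_hom: "abelian_group_hom BB BB swap"
  by (rule abelian_group_homI; unfold_locales)
    (auto simp: hom_def swap)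

lemma swap_minus: "S \<in> carrier BB \<Longrightarrow> swap (\<ominus>\<^bsub>BB\<^esub> S) = \<ominus>\<^bsub>BB\<^esub> swap S"
  by (rule abelian_group_hom.hom_a_inv[OF swap_group_hom])

lemma swap_differential: "b \<in> carrier B \<Longrightarrow> swap (\<d> b) = \<ominus>\<^bsub>BB\<^esub> \<d> b"
  by (simp add: differential_def BB.minus_eq swap swap_minus BB.minus_add BB.a_comm)

text \<open>The exchange of the factors only changes the sign of a differential.\<close>

lemma swap_mu: "Z \<in> mu n \<Longrightarrow> swap Z \<in> mu n"
proof (induction n arbitrary: Z)
  case 0 then show ?case by (simp add: swap)
next
  case (Suc n)
  interpret m: ideal "mu (Suc n)" BB by (rule mu_ideal)
  show ?case using Suc.prems
  proof (induction Z rule: mu_Suc_induct)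
    case (generator W b)
    then have "swap (W \<otimes>\<^bsub>BB\<^esub> \<d> b) = \<ominus>\<^bsub>BB\<^esub> (swap W \<otimes>\<^bsub>BB\<^esub> \<d> b)"
      using mu_carrier by (simp add: swap_mult swap_differential BB.r_minus swap)
    moreover have "swap W \<otimes>\<^bsub>BB\<^esub> \<d> b \<in> mu (Suc n)"
      using generator Suc.IH by (intro mu_mult_differential)
    ultimately show ?case by (simp only: m.a_inv_closed)
  next
    case (add S T) then show ?case by (simp only: swap m.a_closed)
  qed
qed

text \<open>The order of a differential operator, by recursion: \<open>order_lt n D\<close> says that all iterated
  commutators of length \<open>n\<close> vanish.\<close>

primrec order_lt where
  "order_lt 0 D \<longleftrightarrow> (\<forall>a\<in>carrier B. D a = \<zero>)"
| "order_lt (Suc n) D \<longleftrightarrow> (\<forall>b\<in>carrier B. order_lt n (diff_delta B b D))"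

lemma order_lt_cong: "(\<And>a. a \<in> carrier B \<Longrightarrow> D a = D' a) \<Longrightarrow> order_lt n D = order_lt n D'"
proof (induction n arbitrary: D D')
  case (Suc n)
  then have "diff_delta B b D = diff_delta B b D'" if "b \<in> carrier B" for b
    using that by (auto simp: diff_delta_def)
  then show ?case by simp
qed simp

text \<open>The innermost commutator in \<open>foldr\<close> belongs to the last entry, so the recursion takes a list apart
  from its end.\<close>

lemma order_lt_foldr:
  assumes "D \<in> extensional (carrier B)"
  shows "(\<forall>bs. set bs \<subseteq> carrier B \<and> length bs = n \<longrightarrow> foldr (diff_delta B) bs D = (\<lambda>a\<in>carrier B. \<zero>)) \<longleftrightarrow>
    order_lt n D"
  using assms
proof (induction n arbitrary: D)
  case 0
  then show ?case by (auto simp: fun_eq_iff extensional_def)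
next
  case (Suc n)
  have ext: "diff_delta B b D \<in> extensional (carrier B)" for b by (simp add: diff_delta_def)
  have "(\<forall>bs. set bs \<subseteq> carrier B \<and> length bs = Suc n \<longrightarrow> foldr (diff_delta B) bs D = (\<lambda>a\<in>carrier B. \<zero>)) \<longleftrightarrow>
    (\<forall>b\<in>carrier B. \<forall>bs. set bs \<subseteq> carrier B \<and> length bs = n \<longrightarrow>
       foldr (diff_delta B) bs (diff_delta B b D) = (\<lambda>a\<in>carrier B. \<zero>))" (is "?l \<longleftrightarrow> ?r")
  proof
    assume l: ?l
    have "foldr (diff_delta B) (bs @ [b]) D = (\<lambda>a\<in>carrier B. \<zero>)"
      if "b \<in> carrier B" "set bs \<subseteq> carrier B" "length bs = n" for b bs
      using that by (intro l[rule_format]) simp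
    then show ?r by simp
  next
    assume r: ?r
    show ?l
    proof (intro allI impI)
      fix bs :: "'b list" assume bs: "set bs \<subseteq> carrier B \<and> length bs = Suc n"
      then obtain cs c where "bs = cs @ [c]" by (metis length_Suc_conv_rev)
      then show "foldr (diff_delta B) bs D = (\<lambda>a\<in>carrier B. \<zero>)" using r bs by auto
    qed
  qed
  then show ?case unfolding order_lt.simps Suc.IH[OF ext] .
qed

lemma linear_delta:
  assumes D: "linear_map K B B D" and b: "b \<in> carrier B"
  shows "linear_map K B B (diff_delta B b D)"
  unfolding linear_map_def
proof (intro conjI ballI)
  fix x y assume h: "x \<in> carrier B" "y \<in> carrier B"
  have "D (x \<oplus> y) \<otimes> b \<ominus> D ((x \<oplus> y) \<otimes> b) =
    (D x \<otimes> b \<ominus> D (x \<otimes> b)) \<oplus> (D y \<otimes> b \<ominus> D (y \<otimes> b))"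
    using h b linearD[OF D] by (simp add: B.l_distr a_minus_def B.minus_add B.a_ac)
  then show "diff_delta B b D (x \<oplus> y) = diff_delta B b D x \<oplus> diff_delta B b D y"
    using h by (simp add: diff_delta_def)
next
  fix k x assume h: "k \<in> carrier K" "x \<in> carrier B"
  have "D (k \<odot> x) \<otimes> b \<ominus> D ((k \<odot> x) \<otimes> b) =
    k \<odot> (D x \<otimes> b \<ominus> D (x \<otimes> b))"
    using h b linearD[OF D] by (simp add: smult_left a_minus_def B.smult_r_distr B.smult_r_minus)
  then show "diff_delta B b D (k \<odot> x) = k \<odot> diff_delta B b D x"
    using h by (simp add: diff_delta_def)
qed (use b linearD[OF D] in \<open>auto simp: diff_delta_def\<close>)

lemma left_op_mult_right:
  assumes D: "linear_map K B B D" and "Z \<in> carrier BB" and "b \<in> carrier B"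
  shows "left_op D (Z \<otimes>\<^bsub>BB\<^esub> pe \<one> b) = left_op D Z \<otimes>\<^bsub>BB\<^esub> pe \<one> b"
  using assms(2)
  by (induction Z rule: env_induct)
    (use assms(3) linearD[OF D] in \<open>simp_all add: env_mult_pure left_op[OF D] BB.l_distr\<close>)

lemma four_sum:
  assumes "p \<in> carrier BB" "q \<in> carrier BB" "r \<in> carrier BB" "t \<in> carrier BB"
  shows "p \<oplus>\<^bsub>BB\<^esub> q \<oplus>\<^bsub>BB\<^esub> (r \<oplus>\<^bsub>BB\<^esub> t) = p \<oplus>\<^bsub>BB\<^esub> r \<oplus>\<^bsub>BB\<^esub> (q \<oplus>\<^bsub>BB\<^esub> t)"
  using assms by (simp add: BB.a_ac)

text \<open>The operator \<open>D \<otimes> 1\<close> commutes with multiplication by \<open>1 \<otimes> b\<close>, and its commutator with multiplication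
  by \<open>b \<otimes> 1\<close> is the commutator of \<open>D\<close> with \<open>b\<close>, acting on the left factor. This relates the order of \<open>D\<close> to the powers of the
  diagonal ideal.\<close>

lemma left_op_delta:
  assumes D: "linear_map K B B D" and Z: "Z \<in> carrier BB" and b: "b \<in> carrier B"
  shows "left_op D (Z \<otimes>\<^bsub>BB\<^esub> \<d> b) = left_op D Z \<otimes>\<^bsub>BB\<^esub> \<d> b \<oplus>\<^bsub>BB\<^esub> left_op (diff_delta B b D) Z"
proof -
  interpret h: abelian_group_hom BB BB "left_op D"
    by (rule abelian_group_homI; unfold_locales) (auto simp: hom_def left_op[OF D])
  note D' = linear_delta[OF D b]
  have *: "left_op D (Z \<otimes>\<^bsub>BB\<^esub> pe b \<one>) \<oplus>\<^bsub>BB\<^esub> left_op (diff_delta B b D) Z = left_op D Z \<otimes>\<^bsub>BB\<^esub> pe b \<one>"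
    using Z
  proof (induction Z rule: env_induct)
    case (pure x y)
    have "D (x \<otimes> b) \<oplus> diff_delta B b D x = D x \<otimes> b"
      using pure b linearD[OF D] by (simp add: diff_delta_def a_minus_def B.a_comm[of "D x \<otimes> b"] B.r_neg2)
    then show ?case
      using pure b linearD[OF D] linearD[OF D']
      by (simp add: env_mult_pure left_op[OF D] left_op[OF D'] pe_add[symmetric])
  next
    case (add S T)
    have "left_op D ((S \<oplus>\<^bsub>BB\<^esub> T) \<otimes>\<^bsub>BB\<^esub> pe b \<one>) \<oplus>\<^bsub>BB\<^esub> left_op (diff_delta B b D) (S \<oplus>\<^bsub>BB\<^esub> T) =
      (left_op D (S \<otimes>\<^bsub>BB\<^esub> pe b \<one>) \<oplus>\<^bsub>BB\<^esub> left_op (diff_delta B b D) S) \<oplus>\<^bsub>BB\<^esub>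
      (left_op D (T \<otimes>\<^bsub>BB\<^esub> pe b \<one>) \<oplus>\<^bsub>BB\<^esub> left_op (diff_delta B b D) T)"
      using add b by (simp add: BB.l_distr left_op[OF D] left_op[OF D'] four_sum)
    then show ?case unfolding add.IH using add b by (simp add: BB.l_distr left_op[OF D])
  qed
  have "left_op D (Z \<otimes>\<^bsub>BB\<^esub> \<d> b) = left_op D (Z \<otimes>\<^bsub>BB\<^esub> pe \<one> b) \<oplus>\<^bsub>BB\<^esub> \<ominus>\<^bsub>BB\<^esub> left_op D (Z \<otimes>\<^bsub>BB\<^esub> pe b \<one>)"
    using Z b by (simp add: differential_def a_minus_def BB.r_distr BB.r_minus h.hom_a_inv)
  also have "\<dots> = left_op D Z \<otimes>\<^bsub>BB\<^esub> \<d> b \<oplus>\<^bsub>BB\<^esub> left_op (diff_delta B b D) Z"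
    using Z b left_op(1)[OF D] left_op(1)[OF D']
    by (simp add: left_op_mult_right[OF D] differential_def a_minus_def BB.r_distr BB.r_minus *[symmetric]
        BB.minus_add BB.a_ac BB.r_neg1 BB.r_neg2)
  finally show ?thesis .
qed

text \<open>By induction on the order and on the exponent: in \<open>(D \<otimes> 1)(W \<cdot> db)\<close> either the factor \<open>db\<close> survives or
  \<open>D\<close> is replaced by a commutator, which has smaller order.\<close>

lemma order_lowers:
  "\<lbrakk>linear_map K B B D; order_lt n D; Z \<in> mu (n + i)\<rbrakk> \<Longrightarrow> left_op D Z \<in> mu i"
proof (induction n arbitrary: D i Z)
  case 0
  interpret m: ideal "mu i" BB by (rule mu_ideal)
  have "left_op D Z = \<zero>\<^bsub>BB\<^esub>"
    using mu_carrier[OF 0(3)]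
    by (induction Z rule: env_induct) (use 0 in \<open>simp_all add: left_op[OF 0(1)] pe_zero\<close>)
  then show ?case by simp
next
  case (Suc n)
  note D = Suc.prems(1) and IHn = Suc.IH
  show ?case using Suc.prems(3)
  proof (induction i arbitrary: Z)
    case 0 then show ?case using mu_carrier[OF 0] by (simp add: left_op(1)[OF D])
  next
    case (Suc i)
    note IHi = Suc.IH
    interpret m: ideal "mu (Suc i)" BB by (rule mu_ideal)
    have "Z \<in> mu (Suc (Suc n + i))" using Suc.prems by simp
    then show ?case
    proof (induction Z rule: mu_Suc_induct)
      case (generator W b)
      have W: "W \<in> mu (Suc n + i)" "W \<in> mu (n + Suc i)" using generator by simp_all
      have "left_op D W \<otimes>\<^bsub>BB\<^esub> \<d> b \<in> mu (Suc i)"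
        using generator IHi[OF W(1)] by (intro mu_mult_differential)
      moreover have "left_op (diff_delta B b D) W \<in> mu (Suc i)"
        using \<open>order_lt (Suc n) D\<close> generator by (intro IHn[OF linear_delta[OF D] _ W(2)]) auto
      ultimately show ?case
        using mu_carrier generator by (simp only: left_op_delta[OF D] m.a_closed)
    next
      case (add S T) then show ?case by (simp only: left_op[OF D] m.a_closed)
    qed
  qed
qed

text \<open>A converse of the preceding lemma. The commutator of \<open>b \<mapsto> \<phi>(1 \<otimes> b)\<close> with \<open>c\<close> comes from the functional
  \<open>Z \<mapsto> \<phi>(-Z \<cdot> dc)\<close>, which kills one power less.\<close>

lemma functional_order:
  assumes "\<And>Z. Z \<in> carrier BB \<Longrightarrow> \<phi> Z \<in> carrier B"
    and "\<And>S T. \<lbrakk>S \<in> carrier BB; T \<in> carrier BB\<rbrakk> \<Longrightarrow> \<phi> (S \<oplus>\<^bsub>BB\<^esub> T) = \<phi> S \<oplus> \<phi> T"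
    and "\<And>a Z. \<lbrakk>a \<in> carrier B; Z \<in> carrier BB\<rbrakk> \<Longrightarrow> \<phi> (pe a \<one> \<otimes>\<^bsub>BB\<^esub> Z) = a \<otimes> \<phi> Z"
    and "\<And>Z. Z \<in> mu n \<Longrightarrow> \<phi> Z = \<zero>"
  shows "order_lt n (\<lambda>b. \<phi> (pe \<one> b))"
  using assms
proof (induction n arbitrary: \<phi>)
  case 0 then show ?case by simp
next
  case (Suc n)
  have "order_lt n (diff_delta B b (\<lambda>b. \<phi> (pe \<one> b)))" if b: "b \<in> carrier B" for b
  proof -
    interpret h: abelian_group_hom BB B \<phi>
      by (rule abelian_group_homI; unfold_locales) (auto simp: hom_def Suc.prems)
    let ?\<phi> = "\<lambda>Z. \<phi> (\<ominus>\<^bsub>BB\<^esub> (Z \<otimes>\<^bsub>BB\<^esub> \<d> b))"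
    have "order_lt n (\<lambda>b. ?\<phi> (pe \<one> b))"
    proof (rule Suc.IH)
      fix a Z assume "a \<in> carrier B" "Z \<in> carrier BB"
      then show "?\<phi> (pe a \<one> \<otimes>\<^bsub>BB\<^esub> Z) = a \<otimes> ?\<phi> Z"
        using b by (simp add: BB.m_assoc h.hom_a_inv Suc.prems B.r_minus)
    next
      fix Z assume "Z \<in> mu n"
      then show "?\<phi> Z = \<zero>"
        using b mu_mult_differential[of Z n b] mu_carrier[of Z n] by (simp add: h.hom_a_inv Suc.prems del: mu.simps)
    next
      fix S T assume "S \<in> carrier BB" "T \<in> carrier BB"
      then show "?\<phi> (S \<oplus>\<^bsub>BB\<^esub> T) = ?\<phi> S \<oplus> ?\<phi> T"
        using b by (simp add: BB.l_distr BB.minus_add Suc.prems)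
    qed (use b in \<open>simp add: Suc.prems\<close>)
    moreover have *: "diff_delta B b (\<lambda>b. \<phi> (pe \<one> b)) a = ?\<phi> (pe \<one> a)" if a: "a \<in> carrier B" for a
    proof -
      have "\<ominus>\<^bsub>BB\<^esub> (pe \<one> a \<otimes>\<^bsub>BB\<^esub> \<d> b) = pe b \<one> \<otimes>\<^bsub>BB\<^esub> pe \<one> a \<oplus>\<^bsub>BB\<^esub> \<ominus>\<^bsub>BB\<^esub> pe \<one> (a \<otimes> b)"
        using a b by (simp add: differential_def a_minus_def BB.r_distr BB.r_minus BB.minus_add env_mult_pure
            BB.a_comm B.m_comm)
      then show ?thesis
        using a b Suc.prems(1) by (simp add: diff_delta_def Suc.prems(2,3) h.hom_a_inv a_minus_def B.m_comm)
    qed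
    ultimately show ?thesis
      using order_lt_cong[of "diff_delta B b (\<lambda>b. \<phi> (pe \<one> b))" "\<lambda>b. ?\<phi> (pe \<one> b)" n] by blast
  qed
  then show ?case by simp
qed

end

context stable_jets
begin

abbreviation "\<D> \<equiv> diffops K B"
abbreviation diffop_mult (infixl "\<cdot>" 70) where "D \<cdot> E \<equiv> D \<otimes>\<^bsub>\<D>\<^esub> E"

lemma diffops_fields:
  "mult \<D> = compose (carrier B)" "one \<D> = (\<lambda>a\<in>carrier B. a)" "zero \<D> = (\<lambda>a\<in>carrier B. \<zero>)"
  "add \<D> = (\<lambda>D E. \<lambda>a\<in>carrier B. D a \<oplus> E a)" "smult \<D> = (\<lambda>k D. \<lambda>a\<in>carrier B. k \<odot> D a)"
  "src \<D> = (\<lambda>a. \<lambda>b\<in>carrier B. a \<otimes> b)" "tgt \<D> = (\<lambda>a. \<lambda>b\<in>carrier B. b \<otimes> a)"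
  "cop \<D> = (\<lambda>D. THE T. T \<in> carrier (diamond K B (diffops_st K B)) \<and>
        (\<forall>a\<in>carrier B. \<forall>b\<in>carrier B.
           tensor_lift (add_monoid B) (\<lambda>(D1, D2). D1 a \<otimes> D2 b) T = D (a \<otimes> b)))"
  "cou \<D> = (\<lambda>D. D \<one>)"
  by (simp_all add: diffops_def diffops_st_def st_algebra.extend_def bialgebroid.fields_def)

lemma diamond_diffops_st: "diamond K B (diffops_st K B) = diamond K B \<D>"
  by (simp add: diamond_def diamond_mod_def tensor_def diffops_def st_algebra.extend_def)

lemma diffop_iff_order:
  "D \<in> carrier \<D> \<longleftrightarrow> D \<in> extensional (carrier B) \<and> linear_map K B B D \<and> (\<exists>k. order_lt (Suc k) D)"
  by (auto simp: diffops_def diffops_st_def st_algebra.extend_def order_lt_foldr simp del: order_lt.simps)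

lemma diffop_linear: "D \<in> carrier \<D> \<Longrightarrow> linear_map K B B D"
  by (simp add: diffop_iff_order)

lemmas diffop = linearD[OF diffop_linear]

lemma diffop_ext: "D \<in> carrier \<D> \<Longrightarrow> D \<in> extensional (carrier B)"
  by (simp add: diffop_iff_order)

lemma diffop_eqI:
  assumes "D \<in> carrier \<D>" "E \<in> carrier \<D>" "\<And>a. a \<in> carrier B \<Longrightarrow> D a = E a"
  shows "D = E"
  using assms diffop_ext by (intro extensionalityI) auto

text \<open>A large power of the diagonal ideal and its \<open>k\<close>-th successor are both the stable ideal, so losing
  \<open>k\<close> powers does no harm.\<close>

lemma left_op_stable: "\<lbrakk>D \<in> carrier \<D>; Z \<in> \<I>\<rbrakk> \<Longrightarrow> left_op D Z \<in> \<I>"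
proof -
  assume D: "D \<in> carrier \<D>" and Z: "Z \<in> \<I>"
  then obtain k where k: "order_lt (Suc k) D" by (auto simp: diffop_iff_order)
  have "mu (Suc k + stable_index) = \<I>" "mu stable_index = \<I>" by (rule stable_mu; simp)+
  then show ?thesis using order_lowers[OF diffop_linear[OF D] k, of Z stable_index] Z by metis
qed

lemma swap_stable: "Z \<in> \<I> \<Longrightarrow> swap Z \<in> \<I>"
  using swap_mu[of Z stable_index] stable_mu[of stable_index] by simp

lemma diffop_of_functional:
  assumes "\<And>Z. Z \<in> carrier BB \<Longrightarrow> \<phi> Z \<in> carrier B"
    and "\<And>S T. \<lbrakk>S \<in> carrier BB; T \<in> carrier BB\<rbrakk> \<Longrightarrow> \<phi> (S \<oplus>\<^bsub>BB\<^esub> T) = \<phi> S \<oplus> \<phi> T"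
    and "\<And>a Z. \<lbrakk>a \<in> carrier B; Z \<in> carrier BB\<rbrakk> \<Longrightarrow> \<phi> (pe a \<one> \<otimes>\<^bsub>BB\<^esub> Z) = a \<otimes> \<phi> Z"
    and "\<And>Z. Z \<in> \<I> \<Longrightarrow> \<phi> Z = \<zero>"
    and "D \<in> extensional (carrier B)" "\<And>b. b \<in> carrier B \<Longrightarrow> D b = \<phi> (pe \<one> b)"
  shows "D \<in> carrier \<D>"
proof -
  have "mu stable_index = \<I>" by (rule stable_mu) simp
  then have "order_lt stable_index (\<lambda>b. \<phi> (pe \<one> b))"
    using assms(1-4) by (intro functional_order) auto
  then have o: "order_lt stable_index D" using order_lt_cong[of D "\<lambda>b. \<phi> (pe \<one> b)"] assms(6) by simp
  have "pe \<one> (k \<odot> b) = pe (k \<odot> \<one>) \<one> \<otimes>\<^bsub>BB\<^esub> pe \<one> b" if "k \<in> carrier K" "b \<in> carrier B" for k b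
    using that by (simp add: env_mult_pure env_pure(4) smult_right)
  then have "linear_map K B B D"
    using assms(1) by (auto simp: linear_map_def assms(6) pe_add assms(2,3) smult_left)
  then show ?thesis using o assms(5) unfolding diffop_iff_order stable_index_def by blast
qed

text \<open>The functional \<open>a \<otimes> b \<mapsto> a D(b)\<close> is linear over the left factor and determines \<open>D\<close>. This criterion does
  not involve orders and gives the closure properties of differential operators.\<close>

lemma diffopI:
  assumes ext: "D \<in> extensional (carrier B)" and lin: "linear_map K B B D"
    and kills: "\<And>Z. Z \<in> \<I> \<Longrightarrow> prod_map (left_op D Z) = \<zero>"
  shows "D \<in> carrier \<D>"
proof (rule diffop_of_functional[where \<phi> = "\<lambda>Z. prod_map (left_op D (swap Z))"])
  fix a Z assume a: "a \<in> carrier B" and Z: "Z \<in> carrier BB"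
  show "prod_map (left_op D (swap (pe a \<one> \<otimes>\<^bsub>BB\<^esub> Z))) = a \<otimes> prod_map (left_op D (swap Z))"
    using Z
  proof (induction Z rule: env_induct)
    case (pure x y)
    then show ?case using a linearD[OF lin]
      by (simp add: env_mult_pure swap left_op[OF lin] prod_map B.m_ac)
  next
    case (add S T)
    then show ?case using a by (simp add: BB.r_distr swap left_op[OF lin] prod_map B.r_distr)
  qed
next
  fix b assume "b \<in> carrier B"
  then show "D b = prod_map (left_op D (swap (pe \<one> b)))"
    using linearD[OF lin] by (simp add: swap left_op[OF lin] prod_map)
qed (simp_all add: swap left_op[OF lin] prod_map kills swap_stable ext)

lemma diffop_kills_of:
  assumes "D \<in> extensional (carrier B)" "linear_map K B B D"
    and "\<And>S. S \<in> carrier BB \<Longrightarrow> prod_map (left_op D S) = \<phi> S" "\<And>Z. Z \<in> \<I> \<Longrightarrow> \<phi> Z = \<zero>"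
  shows "D \<in> carrier \<D>"
  using assms I.Icarr by (intro diffopI) auto

lemma left_op_compose:
  assumes D: "linear_map K B B D" and E: "linear_map K B B E" and S: "S \<in> carrier BB"
    and DE: "linear_map K B B F" "\<And>a. a \<in> carrier B \<Longrightarrow> F a = D (E a)"
  shows "left_op F S = left_op D (left_op E S)"
  using S by (induction S rule: env_induct)
    (simp_all add: left_op[OF D] left_op[OF E] left_op[OF DE(1)] DE(2) linearD[OF E])

lemma diffop_compose: "\<lbrakk>D \<in> carrier \<D>; E \<in> carrier \<D>\<rbrakk> \<Longrightarrow> compose (carrier B) D E \<in> carrier \<D>"
proof -
  assume D: "D \<in> carrier \<D>" and E: "E \<in> carrier \<D>"
  have lin: "linear_map K B B (compose (carrier B) D E)"
    using diffop[OF D] diffop[OF E] by (auto simp: linear_map_def compose_def)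
  have "left_op (compose (carrier B) D E) S = left_op D (left_op E S)" if "S \<in> carrier BB" for S
    using left_op_compose[OF diffop_linear[OF D] diffop_linear[OF E] that lin] by (simp add: compose_def)
  then show ?thesis
    using lin D E by (intro diffop_kills_of[where \<phi> = "\<lambda>S. prod_map (left_op D (left_op E S))"])
      (simp_all add: compose_extensional left_op_stable stable_ideal_diagonal)
qed

lemma diffop_add: "\<lbrakk>D \<in> carrier \<D>; E \<in> carrier \<D>\<rbrakk> \<Longrightarrow> (\<lambda>a\<in>carrier B. D a \<oplus> E a) \<in> carrier \<D>"
proof -
  assume D: "D \<in> carrier \<D>" and E: "E \<in> carrier \<D>"
  define F where "F = (\<lambda>a\<in>carrier B. D a \<oplus> E a)"
  have F: "F a = D a \<oplus> E a" if "a \<in> carrier B" for a using that by (simp add: F_def)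
  have lin: "linear_map K B B F"
    using diffop[OF D] diffop[OF E] by (auto simp: linear_map_def F B.smult_r_distr B.a_ac)
  have "left_op F S = left_op D S \<oplus>\<^bsub>BB\<^esub> left_op E S" if "S \<in> carrier BB" for S
    using that
  proof (induction S rule: env_induct)
    case (pure a b)
    then show ?case using diffop[OF D] diffop[OF E]
      by (simp add: left_op[OF lin] F left_op[OF diffop_linear[OF D]] left_op[OF diffop_linear[OF E]] pe_add)
  next
    case (add S T)
    then show ?case
      by (simp add: left_op[OF lin] left_op[OF diffop_linear[OF D]] left_op[OF diffop_linear[OF E]] BB.a_ac)
  qed
  then show ?thesis
    unfolding F_def[symmetric] using lin D E
    by (intro diffop_kills_of[where \<phi> = "\<lambda>S. prod_map (left_op D S) \<oplus> prod_map (left_op E S)"])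
      (simp_all add: left_op[OF diffop_linear] prod_map left_op_stable stable_ideal_diagonal F_def)
qed

lemma multiplication_diffop: "c \<in> carrier B \<Longrightarrow> (\<lambda>a\<in>carrier B. c \<otimes> a) \<in> carrier \<D>"
proof -
  assume c: "c \<in> carrier B"
  define F where "F = (\<lambda>a\<in>carrier B. c \<otimes> a)"
  have F: "F a = c \<otimes> a" if "a \<in> carrier B" for a using that by (simp add: F_def)
  have lin: "linear_map K B B F"
    using c by (auto simp: linear_map_def F B.r_distr smult_right)
  have "left_op F S = pe c \<one> \<otimes>\<^bsub>BB\<^esub> S" if "S \<in> carrier BB" for S
    using that
    by (induction S rule: env_induct) (use c in \<open>simp_all add: left_op[OF lin] F env_mult_pure BB.r_distr\<close>)
  then show ?thesis
    unfolding F_def[symmetric] using lin c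
    by (intro diffop_kills_of[where \<phi> = "\<lambda>S. prod_map (pe c \<one> \<otimes>\<^bsub>BB\<^esub> S)"])
      (simp_all add: I.I_l_closed stable_ideal_diagonal F_def)
qed

lemma src_diffop: "a \<in> carrier B \<Longrightarrow> src \<D> a \<in> carrier \<D>"
  by (simp add: diffops_fields multiplication_diffop)

lemma tgt_eq_src: "a \<in> carrier B \<Longrightarrow> tgt \<D> a = src \<D> a"
  by (auto simp: diffops_fields B.m_comm)

lemma diffop_apply:
  "\<lbrakk>a \<in> carrier B\<rbrakk> \<Longrightarrow> (D \<cdot> E) a = D (E a)"
  "\<lbrakk>a \<in> carrier B\<rbrakk> \<Longrightarrow> (D \<oplus>\<^bsub>\<D>\<^esub> E) a = D a \<oplus> E a"
  "\<lbrakk>a \<in> carrier B\<rbrakk> \<Longrightarrow> (k \<odot>\<^bsub>\<D>\<^esub> D) a = k \<odot> D a"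
  "\<lbrakk>a \<in> carrier B\<rbrakk> \<Longrightarrow> \<one>\<^bsub>\<D>\<^esub> a = a" "\<lbrakk>a \<in> carrier B\<rbrakk> \<Longrightarrow> \<zero>\<^bsub>\<D>\<^esub> a = \<zero>"
  "\<lbrakk>a \<in> carrier B\<rbrakk> \<Longrightarrow> src \<D> c a = c \<otimes> a" "\<lbrakk>a \<in> carrier B\<rbrakk> \<Longrightarrow> tgt \<D> c a = a \<otimes> c"
  by (simp_all add: diffops_fields compose_def)

lemma diffop_closed:
  "\<lbrakk>D \<in> carrier \<D>; E \<in> carrier \<D>\<rbrakk> \<Longrightarrow> D \<cdot> E \<in> carrier \<D>"
  "\<lbrakk>D \<in> carrier \<D>; E \<in> carrier \<D>\<rbrakk> \<Longrightarrow> D \<oplus>\<^bsub>\<D>\<^esub> E \<in> carrier \<D>"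
  "\<lbrakk>k \<in> carrier K; D \<in> carrier \<D>\<rbrakk> \<Longrightarrow> k \<odot>\<^bsub>\<D>\<^esub> D \<in> carrier \<D>"
  "\<one>\<^bsub>\<D>\<^esub> \<in> carrier \<D>" "\<zero>\<^bsub>\<D>\<^esub> \<in> carrier \<D>"
  "c \<in> carrier B \<Longrightarrow> src \<D> c \<in> carrier \<D>" "c \<in> carrier B \<Longrightarrow> tgt \<D> c \<in> carrier \<D>"
proof -
  assume k: "k \<in> carrier K" and D: "D \<in> carrier \<D>"
  have "k \<odot>\<^bsub>\<D>\<^esub> D = compose (carrier B) (\<lambda>a\<in>carrier B. (k \<odot> \<one>) \<otimes> a) D"
    using k diffop[OF D] by (auto simp: diffops_fields compose_def smult_left)
  then show "k \<odot>\<^bsub>\<D>\<^esub> D \<in> carrier \<D>"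
    using k D by (simp add: diffop_compose multiplication_diffop)
next
  have "\<one>\<^bsub>\<D>\<^esub> = (\<lambda>a\<in>carrier B. \<one> \<otimes> a)" by (auto simp: diffops_fields)
  then show "\<one>\<^bsub>\<D>\<^esub> \<in> carrier \<D>" by (simp add: multiplication_diffop)
  have "\<zero>\<^bsub>\<D>\<^esub> = (\<lambda>a\<in>carrier B. \<zero> \<otimes> a)" by (auto simp: diffops_fields)
  then show "\<zero>\<^bsub>\<D>\<^esub> \<in> carrier \<D>" by (simp add: multiplication_diffop)
qed (simp_all add: diffops_fields diffop_compose diffop_add src_diffop tgt_eq_src,
     simp_all add: diffops_fields B.m_comm[of _ c] multiplication_diffop cong: restrict_cong)

lemma unital_algebra_diffops: "unital_algebra K \<D>"
proof -
  have cl: "D a \<in> carrier B" if "D \<in> carrier \<D>" "a \<in> carrier B" for D a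
    using diffop[OF that(1)] that(2) by simp
  have group: "abelian_group \<D>"
  proof (rule abelian_groupI)
    fix D assume D: "D \<in> carrier \<D>"
    let ?m = "src \<D> (\<ominus> \<one>) \<cdot> D"
    have "?m \<oplus>\<^bsub>\<D>\<^esub> D = \<zero>\<^bsub>\<D>\<^esub>"
      using D by (intro diffop_eqI) (simp_all add: diffop_closed diffop_apply cl B.l_minus B.l_neg)
    then show "\<exists>E\<in>carrier \<D>. E \<oplus>\<^bsub>\<D>\<^esub> D = \<zero>\<^bsub>\<D>\<^esub>"
      using D by (intro bexI[of _ ?m]) (simp_all add: diffop_closed)
  qed (simp_all add: diffop_closed, (rule diffop_eqI; simp add: diffop_closed diffop_apply cl B.a_ac)+)
  have monoid: "monoid \<D>"
    by (rule monoidI; (rule diffop_eqI)?; simp add: diffop_closed diffop_apply cl)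
  have "module K \<D>"
  proof (rule moduleI)
    show "cring K" by unfold_locales
  qed (simp_all add: group diffop_closed,
      (rule diffop_eqI; simp add: diffop_closed diffop_apply cl B.smult_l_distr B.smult_r_distr B.smult_assoc1)+)
  moreover have "ring \<D>"
    by (rule ringI[OF group monoid]; rule diffop_eqI; simp add: diffop_closed diffop_apply cl diffop)
  moreover have "unital_algebra_axioms K \<D>"
    by (rule unital_algebra_axioms.intro; rule diffop_eqI; simp add: diffop_closed diffop_apply cl diffop)
  ultimately show ?thesis by (rule unital_algebra.intro)
qed

sublocale DD: unital_algebra K \<D> by (rule unital_algebra_diffops)

end

context stable_jets
begin

interpretation q: ring_hom_ring BB QQ "(+>\<^bsub>BB\<^esub>) \<I>" by (rule coset_hom)

lemma coset_zero: "Z \<in> \<I> \<Longrightarrow> \<I> +>\<^bsub>BB\<^esub> Z = \<zero>\<^bsub>\<J>\<^esub>"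
proof -
  have z: "\<zero>\<^bsub>QQ\<^esub> = \<I>" unfolding FactRing_def by (simp only: ring.select_convs)
  show "Z \<in> \<I> \<Longrightarrow> \<I> +>\<^bsub>BB\<^esub> Z = \<zero>\<^bsub>\<J>\<^esub>" by (simp only: jets_fields z I.a_rcos_const)
qed

lemma coset_closed: "S \<in> carrier BB \<Longrightarrow> \<I> +>\<^bsub>BB\<^esub> S \<in> carrier \<J>"
  by (simp add: jets_fields)

lemma coset_add: "\<lbrakk>S \<in> carrier BB; T \<in> carrier BB\<rbrakk> \<Longrightarrow>
    \<I> +>\<^bsub>BB\<^esub> (S \<oplus>\<^bsub>BB\<^esub> T) = (\<I> +>\<^bsub>BB\<^esub> S) \<oplus>\<^bsub>\<J>\<^esub> (\<I> +>\<^bsub>BB\<^esub> T)"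
  by (simp add: jets_fields)

text \<open>Operators on one factor and the exchange of the factors are defined on \<open>B \<otimes> B\<close> first. Preserving
  the stable ideal is what lets them descend to jets.\<close>

lemma jet_lift_of_map:
  assumes H: "comm_group H" and f: "EG.bal H f" and h: "h \<in> hom (add_monoid \<J>) H"
    and \<Phi>: "\<And>S. S \<in> carrier BB \<Longrightarrow> \<Phi> S \<in> carrier BB"
      "\<And>S T. \<lbrakk>S \<in> carrier BB; T \<in> carrier BB\<rbrakk> \<Longrightarrow> \<Phi> (S \<oplus>\<^bsub>BB\<^esub> T) = \<Phi> S \<oplus>\<^bsub>BB\<^esub> \<Phi> T"
      "\<And>Z. Z \<in> \<I> \<Longrightarrow> \<Phi> Z \<in> \<I>"
    and val: "\<And>a b. \<lbrakk>a \<in> carrier B; b \<in> carrier B\<rbrakk> \<Longrightarrow> f a b = h (\<I> +>\<^bsub>BB\<^esub> \<Phi> (pe a b))"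
  shows "jet_lift H (\<lambda>(a, b). f a b) \<in> hom (add_monoid \<J>) H"
    and "\<lbrakk>a \<in> carrier B; b \<in> carrier B\<rbrakk> \<Longrightarrow> jet_lift H (\<lambda>(a, b). f a b) (jt a b) = f a b"
proof -
  interpret H: comm_group H by (rule H)
  interpret h: group_hom "add_monoid \<J>" H h
    by (simp add: group_hom_def group_hom_axioms_def J.a_group H.is_group h)
  have eq: "tensor_lift H (\<lambda>(a, b). f a b) S = h (\<I> +>\<^bsub>BB\<^esub> \<Phi> S)" if "S \<in> carrier BB" for S
    using that
  proof (induction S rule: env_induct)
    case (pure a b)
    show ?case unfolding env_lift(3)[OF H f pure] by (rule val[OF pure])
  next
    case (add S T)
    then show ?case unfolding env_lift(2)[OF H f add.hyps] add.IH
      using h.hom_mult[of "\<I> +>\<^bsub>BB\<^esub> \<Phi> S" "\<I> +>\<^bsub>BB\<^esub> \<Phi> T"] by (simp add: \<Phi> coset_add coset_closed del: q.hom_add)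
  qed
  have kills: "tensor_lift H (\<lambda>(a, b). f a b) Z = \<one>\<^bsub>H\<^esub>" if "Z \<in> \<I>" for Z
    using h.hom_one by (simp only: eq[OF I.Icarr[OF that]] coset_zero[OF \<Phi>(3)[OF that]]) simp
  show "jet_lift H (\<lambda>(a, b). f a b) \<in> hom (add_monoid \<J>) H"
    "\<lbrakk>a \<in> carrier B; b \<in> carrier B\<rbrakk> \<Longrightarrow> jet_lift H (\<lambda>(a, b). f a b) (jt a b) = f a b"
    using jet_lift[OF H f kills] by auto
qed

definition op_left where "op_left D = jet_lift (add_monoid \<J>) (\<lambda>(a, b). jt (D a) b)"
definition flip where "flip = jet_lift (add_monoid \<J>) (\<lambda>(a, b). jt b a)"
definition op_right where "op_right D X = flip (op_left D (flip X))"

lemma op_left_hom: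
  assumes D: "D \<in> carrier \<D>"
  shows "op_left D \<in> hom (add_monoid \<J>) (add_monoid \<J>)"
    and "\<lbrakk>a \<in> carrier B; b \<in> carrier B\<rbrakk> \<Longrightarrow> op_left D (jt a b) = jt (D a) b"
proof -
  have f: "EG.bal (add_monoid \<J>) (\<lambda>a b. jt (D a) b)"
    by (rule balancedI) (simp_all add: diffop[OF D] jt_add jt_balance)
  have id: "(\<lambda>X. X) \<in> hom (add_monoid \<J>) (add_monoid \<J>)" by (simp add: hom_def)
  note l = jet_lift_of_map[OF J.a_comm_group f id, of "left_op D"]
  show "op_left D \<in> hom (add_monoid \<J>) (add_monoid \<J>)"
    "\<lbrakk>a \<in> carrier B; b \<in> carrier B\<rbrakk> \<Longrightarrow> op_left D (jt a b) = jt (D a) b"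
    unfolding op_left_def
    by (rule l; simp add: left_op[OF diffop_linear[OF D]] left_op_stable[OF D] jet_eq_coset)+
qed

lemma flip_hom: "flip \<in> hom (add_monoid \<J>) (add_monoid \<J>)"
  and flip_jet: "\<lbrakk>a \<in> carrier B; b \<in> carrier B\<rbrakk> \<Longrightarrow> flip (jt a b) = jt b a"
proof -
  have f: "EG.bal (add_monoid \<J>) (\<lambda>a b. jt b a)"
    by (rule balancedI) (simp_all add: jt_add jt_balance)
  have id: "(\<lambda>X. X) \<in> hom (add_monoid \<J>) (add_monoid \<J>)" by (simp add: hom_def)
  note l = jet_lift_of_map[OF J.a_comm_group f id, of swap]
  show "flip \<in> hom (add_monoid \<J>) (add_monoid \<J>)"
    "\<lbrakk>a \<in> carrier B; b \<in> carrier B\<rbrakk> \<Longrightarrow> flip (jt a b) = jt b a"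
    unfolding flip_def by (rule l; simp add: swap swap_stable jet_eq_coset)+
qed

lemma op_right_hom:
  assumes D: "D \<in> carrier \<D>"
  shows "op_right D \<in> hom (add_monoid \<J>) (add_monoid \<J>)"
    and "\<lbrakk>a \<in> carrier B; b \<in> carrier B\<rbrakk> \<Longrightarrow> op_right D (jt a b) = jt a (D b)"
  using flip_hom op_left_hom(1)[OF D]
  by (auto simp: hom_def Pi_iff op_right_def flip_jet op_left_hom(2)[OF D] diffop[OF D])

lemma jets_cou_hom: "cou \<J> \<in> hom (add_monoid \<J>) (add_monoid B)"
  and jets_cou_jet: "\<lbrakk>a \<in> carrier B; b \<in> carrier B\<rbrakk> \<Longrightarrow> cou \<J> (jt a b) = a \<otimes> b"
  using jet_lift[OF B.a_comm_group balanced_prod] stable_ideal_diagonal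
  by (simp_all add: jets_fields)

abbreviation pairing where "pairing \<equiv> jet_pairing B"

lemma pairing_hom:
  assumes D: "D \<in> carrier \<D>"
  shows "pairing D \<in> hom (add_monoid \<J>) (add_monoid B)"
    and "\<lbrakk>a \<in> carrier B; b \<in> carrier B\<rbrakk> \<Longrightarrow> pairing D (jt a b) = D a \<otimes> b"
proof -
  have f: "EG.bal (add_monoid B) (\<lambda>a b. D a \<otimes> b)"
    by (rule balancedI) (simp_all add: diffop[OF D] B.l_distr B.r_distr smult_left smult_right)
  note l = jet_lift_of_map[OF B.a_comm_group f jets_cou_hom, of "left_op D"]
  show "pairing D \<in> hom (add_monoid \<J>) (add_monoid B)"
    "\<lbrakk>a \<in> carrier B; b \<in> carrier B\<rbrakk> \<Longrightarrow> pairing D (jt a b) = D a \<otimes> b"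
    unfolding jet_pairing_def
    by (rule l; simp add: left_op[OF diffop_linear[OF D]] left_op_stable[OF D] jet_eq_coset[symmetric] jets_cou_jet diffop[OF D])+
qed

lemma pairing:
  assumes "D \<in> carrier \<D>"
  shows "X \<in> carrier \<J> \<Longrightarrow> pairing D X \<in> carrier B"
    and "\<lbrakk>X \<in> carrier \<J>; Y \<in> carrier \<J>\<rbrakk> \<Longrightarrow> pairing D (X \<oplus>\<^bsub>\<J>\<^esub> Y) = pairing D X \<oplus> pairing D Y"
    and "\<lbrakk>a \<in> carrier B; b \<in> carrier B\<rbrakk> \<Longrightarrow> pairing D (jt a b) = D a \<otimes> b"
  using pairing_hom[OF assms] hom_in_carrier hom_mult by fastforce+

subsection \<open>Coevaluation\<close>

text \<open>Sums of such functions are again of this form, so the summands of a dual basis expansion can be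
  treated one at a time.\<close>

definition coevaluable where
  "coevaluable g \<longleftrightarrow> (\<exists>n (u :: nat \<Rightarrow> 'b) E. (\<forall>i<n. u i \<in> carrier B \<and> E i \<in> carrier \<D>) \<and>
     (\<forall>a\<in>carrier B. g a = (\<Oplus>\<^bsub>\<J>\<^esub>i\<in>{..<n}. jt (u i) (E i a))))"

lemma coevaluableE:
  assumes "coevaluable g"
  obtains n and u :: "nat \<Rightarrow> 'b" and E where "\<And>i. i < n \<Longrightarrow> u i \<in> carrier B" "\<And>i. i < n \<Longrightarrow> E i \<in> carrier \<D>"
    "\<And>a. a \<in> carrier B \<Longrightarrow> g a = (\<Oplus>\<^bsub>\<J>\<^esub>i\<in>{..<n}. jt (u i) (E i a))"
  using assms unfolding coevaluable_def by (elim exE conjE) (rule that; simp)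

lemma coevaluableI:
  fixes u :: "nat \<Rightarrow> 'b"
  assumes "\<And>i. i < n \<Longrightarrow> u i \<in> carrier B" "\<And>i. i < n \<Longrightarrow> E i \<in> carrier \<D>"
    "\<And>a. a \<in> carrier B \<Longrightarrow> g a = (\<Oplus>\<^bsub>\<J>\<^esub>i\<in>{..<n}. jt (u i) (E i a))"
  shows "coevaluable g"
  unfolding coevaluable_def by (intro exI[of _ n] exI[of _ u] exI[of _ E]) (simp add: assms)

lemma coevaluable_add_term:
  assumes "coevaluable g" and u: "u \<in> carrier B" and E: "E \<in> carrier \<D>"
    and g': "\<And>a. a \<in> carrier B \<Longrightarrow> g' a = g a \<oplus>\<^bsub>\<J>\<^esub> jt u (E a)"
  shows "coevaluable g'"
proof -
  obtain n :: nat and v F where rep: "(\<forall>i<n. v i \<in> carrier B \<and> F i \<in> carrier \<D>) \<and>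
      (\<forall>a\<in>carrier B. g a = (\<Oplus>\<^bsub>\<J>\<^esub>i\<in>{..<n}. jt (v i) (F i a)))"
    using assms(1) unfolding coevaluable_def by (elim exE) (rule that, assumption)
  then have g: "\<And>i. i < n \<Longrightarrow> v i \<in> carrier B" "\<And>i. i < n \<Longrightarrow> F i \<in> carrier \<D>"
      "\<And>a. a \<in> carrier B \<Longrightarrow> g a = (\<Oplus>\<^bsub>\<J>\<^esub>i\<in>{..<n}. jt (v i) (F i a))" by auto
  let ?v = "v(n := u)" and ?F = "F(n := E)"
  have "g' a = (\<Oplus>\<^bsub>\<J>\<^esub>i\<in>{..<Suc n}. jt (?v i) (?F i a))" if a: "a \<in> carrier B" for a
  proof -
    have cl: "(\<lambda>i. jt (v i) (F i a)) \<in> {..<n} \<rightarrow> carrier \<J>" "jt u (E a) \<in> carrier \<J>"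
      using g a u E diffop by auto
    have "(\<Oplus>\<^bsub>\<J>\<^esub>i\<in>{..<Suc n}. jt (?v i) (?F i a)) = jt u (E a) \<oplus>\<^bsub>\<J>\<^esub> (\<Oplus>\<^bsub>\<J>\<^esub>i\<in>{..<n}. jt (?v i) (?F i a))"
      using cl by (simp add: lessThan_Suc Pi_iff)
    also have "(\<Oplus>\<^bsub>\<J>\<^esub>i\<in>{..<n}. jt (?v i) (?F i a)) = (\<Oplus>\<^bsub>\<J>\<^esub>i\<in>{..<n}. jt (v i) (F i a))"
      using cl by (intro J.finsum_cong') auto
    finally show ?thesis using g' g a cl J.finsum_closed[OF cl(1)] by (simp add: J.a_comm)
  qed
  moreover have "?v i \<in> carrier B" "?F i \<in> carrier \<D>" if "i < Suc n" for i
    using that g u E by (auto simp: less_Suc_eq)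
  ultimately show ?thesis by (intro coevaluableI[of "Suc n" ?v ?F])
qed

lemma coevaluable_cong: "\<lbrakk>coevaluable g; \<And>a. a \<in> carrier B \<Longrightarrow> g a = h a\<rbrakk> \<Longrightarrow> coevaluable h"
  unfolding coevaluable_def by (elim exE conjE, intro exI conjI) auto

lemma coevaluable_closed: "\<lbrakk>coevaluable g; a \<in> carrier B\<rbrakk> \<Longrightarrow> g a \<in> carrier \<J>"
  by (erule coevaluableE) (auto intro!: J.finsum_closed jt_closed intro: diffop(1))

lemma coevaluable_add:
  assumes g: "coevaluable g" and h: "coevaluable h"
  shows "coevaluable (\<lambda>a. g a \<oplus>\<^bsub>\<J>\<^esub> h a)"
proof -
  obtain n :: nat and v F where rep: "(\<forall>i<n. v i \<in> carrier B \<and> F i \<in> carrier \<D>) \<and>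
      (\<forall>a\<in>carrier B. h a = (\<Oplus>\<^bsub>\<J>\<^esub>i\<in>{..<n}. jt (v i) (F i a)))"
    using h unfolding coevaluable_def by (elim exE) (rule that, assumption)
  then have F: "\<And>i. i < n \<Longrightarrow> v i \<in> carrier B" "\<And>i. i < n \<Longrightarrow> F i \<in> carrier \<D>"
      and hF: "\<And>a. a \<in> carrier B \<Longrightarrow> h a = (\<Oplus>\<^bsub>\<J>\<^esub>i\<in>{..<n}. jt (v i) (F i a))" by auto
  have "coevaluable (\<lambda>a. g a \<oplus>\<^bsub>\<J>\<^esub> (\<Oplus>\<^bsub>\<J>\<^esub>i\<in>{..<m}. jt (v i) (F i a)))" if "m \<le> n" for m
    using that
  proof (induction m)
    case 0
    have "g a = g a \<oplus>\<^bsub>\<J>\<^esub> (\<Oplus>\<^bsub>\<J>\<^esub>i\<in>{..<0::nat}. jt (v i) (F i a))" if "a \<in> carrier B" for a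
      using coevaluable_closed[OF g that] by simp
    then show ?case by (rule coevaluable_cong[OF g])
  next
    case (Suc m)
    show ?case
    proof (rule coevaluable_add_term)
      show "coevaluable (\<lambda>a. g a \<oplus>\<^bsub>\<J>\<^esub> (\<Oplus>\<^bsub>\<J>\<^esub>i\<in>{..<m}. jt (v i) (F i a)))" using Suc by simp
      show "v m \<in> carrier B" "F m \<in> carrier \<D>" using F Suc.prems by auto
      fix a assume a: "a \<in> carrier B"
      have cl: "(\<lambda>i. jt (v i) (F i a)) \<in> {..<m} \<rightarrow> carrier \<J>" "jt (v m) (F m a) \<in> carrier \<J>"
        using F Suc.prems a diffop by auto
      then show "g a \<oplus>\<^bsub>\<J>\<^esub> (\<Oplus>\<^bsub>\<J>\<^esub>i\<in>{..<Suc m}. jt (v i) (F i a)) =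
          g a \<oplus>\<^bsub>\<J>\<^esub> (\<Oplus>\<^bsub>\<J>\<^esub>i\<in>{..<m}. jt (v i) (F i a)) \<oplus>\<^bsub>\<J>\<^esub> jt (v m) (F m a)"
        using coevaluable_closed[OF g a] J.finsum_closed[OF cl(1)]
        by (simp add: lessThan_Suc Pi_iff J.a_ac)
    qed
  qed
  from this[of n] have "coevaluable (\<lambda>a. g a \<oplus>\<^bsub>\<J>\<^esub> (\<Oplus>\<^bsub>\<J>\<^esub>i\<in>{..<n}. jt (v i) (F i a)))" by simp
  moreover have "g a \<oplus>\<^bsub>\<J>\<^esub> (\<Oplus>\<^bsub>\<J>\<^esub>i\<in>{..<n}. jt (v i) (F i a)) = g a \<oplus>\<^bsub>\<J>\<^esub> h a" if "a \<in> carrier B" for a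
    using hF that by simp
  ultimately show ?thesis by (rule coevaluable_cong)
qed

lemma coevaluable_zero: "coevaluable (\<lambda>a. \<zero>\<^bsub>\<J>\<^esub>)"
  unfolding coevaluable_def by (rule exI[of _ 0]) simp

lemma coevaluable_tgt:
  assumes "X \<in> carrier \<J>" and D: "D \<in> carrier \<D>"
  shows "coevaluable (\<lambda>a. tgt \<J> (D a) \<bullet> X)"
  using assms(1)
proof (induction X rule: jet_generates)
  case (jet u v)
  show ?case
  proof (rule coevaluable_add_term[OF coevaluable_zero jet(1)])
    show "src \<D> v \<cdot> D \<in> carrier \<D>" using jet D by (simp add: diffop_closed)
    fix a assume "a \<in> carrier B"
    then show "tgt \<J> (D a) \<bullet> jt u v = \<zero>\<^bsub>\<J>\<^esub> \<oplus>\<^bsub>\<J>\<^esub> jt u ((src \<D> v \<cdot> D) a)"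
      using jet diffop[OF D] by (simp add: diffop_apply jets_fields(8) jt_mult)
  qed
next
  case (add X Y)
  have "tgt \<J> (D a) \<bullet> X \<oplus>\<^bsub>\<J>\<^esub> tgt \<J> (D a) \<bullet> Y = tgt \<J> (D a) \<bullet> (X \<oplus>\<^bsub>\<J>\<^esub> Y)" if "a \<in> carrier B" for a
    using add that diffop[OF D] by (simp add: J.r_distr jets_fields(8))
  then show ?case by (rule coevaluable_cong[OF coevaluable_add[OF add.IH]])
qed

text \<open>The coordinates of the embedding into the free module, and the images of the standard basis under
  the projection. The vectors \<open>cut m v\<close> interpolate between zero and \<open>v\<close> one coordinate at a time.\<close>

lemma fg_projective_dual_basis:
  fixes R :: "('r, 'z) ring_scheme" and M :: "('r, 'm, 'w) module_scheme"
  assumes "fg_projective R M"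
  obtains n \<iota> f where "\<And>i. i < n \<Longrightarrow> linear_map R M \<lparr>carrier = carrier R, mult = mult R, one = one R,
      zero = zero R, add = add R, smult = mult R\<rparr> (\<iota> i)"
    and "\<And>i. i < (n::nat) \<Longrightarrow> f i \<in> carrier M"
    and "\<And>x. x \<in> carrier M \<Longrightarrow> x = (\<Oplus>\<^bsub>M\<^esub>i\<in>{..<n}. \<iota> i x \<odot>\<^bsub>M\<^esub> f i)"
proof -
  interpret M: module R M using assms by (simp add: fg_projective_def)
  obtain n \<iota> \<pi> where \<iota>: "linear_map R M (power_module R n) \<iota>" and \<pi>: "linear_map R (power_module R n) M \<pi>"
    and \<pi>\<iota>: "\<And>x. x \<in> carrier M \<Longrightarrow> \<pi> (\<iota> x) = x"
    using assms unfolding fg_projective_def by blast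
  define e where "e i = (\<lambda>j\<in>{..<n}. if j = i then \<one>\<^bsub>R\<^esub> else \<zero>\<^bsub>R\<^esub>)" for i
  define cut where "cut m v = (\<lambda>j\<in>{..<n}. if j < m then v j else \<zero>\<^bsub>R\<^esub>)" for m :: nat and v
  have \<iota>c: "\<iota> x i \<in> carrier R" if "x \<in> carrier M" "i < n" for x i
    using \<iota> that by (auto simp: linear_map_def power_module_def)
  have e: "e i \<in> carrier (power_module R n)" for i by (auto simp: e_def power_module_def)
  have \<pi>c: "\<pi> v \<in> carrier M" if "v \<in> carrier (power_module R n)" for v
    using \<pi> that by (auto simp: linear_map_def)
  have sum: "\<pi> (cut m v) = (\<Oplus>\<^bsub>M\<^esub>i\<in>{..<m}. v i \<odot>\<^bsub>M\<^esub> \<pi> (e i))"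
    if v: "v \<in> carrier (power_module R n)" and vc: "\<And>k. k < n \<Longrightarrow> v k \<in> carrier R" and "m \<le> n" for v m
    using \<open>m \<le> n\<close>
  proof (induction m)
    case 0
    have z: "cut 0 v \<in> carrier (power_module R n)" by (auto simp: cut_def power_module_def)
    have "cut 0 v = \<zero>\<^bsub>R\<^esub> \<odot>\<^bsub>power_module R n\<^esub> cut 0 v"
      by (auto simp: cut_def power_module_def)
    then have "\<pi> (cut 0 v) = \<zero>\<^bsub>R\<^esub> \<odot>\<^bsub>M\<^esub> \<pi> (cut 0 v)"
      using \<pi> z unfolding linear_map_def by (metis M.R.zero_closed)
    then show ?case using \<pi>c[OF z] by simp
  next
    case (Suc m)
    have vm: "v m \<in> carrier R" using vc Suc.prems by simp
    have c: "cut m v \<in> carrier (power_module R n)" using vc by (auto simp: cut_def power_module_def)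
    have s: "v m \<odot>\<^bsub>power_module R n\<^esub> e m \<in> carrier (power_module R n)"
      using vm by (auto simp: e_def power_module_def)
    have "cut (Suc m) v = v m \<odot>\<^bsub>power_module R n\<^esub> e m \<oplus>\<^bsub>power_module R n\<^esub> cut m v"
    proof
      fix k
      show "cut (Suc m) v k = (v m \<odot>\<^bsub>power_module R n\<^esub> e m \<oplus>\<^bsub>power_module R n\<^esub> cut m v) k"
        using vm vc[of k] Suc.prems by (cases "k = m"; cases "k < m") (simp_all add: cut_def e_def power_module_def)
    qed
    then have "\<pi> (cut (Suc m) v) = v m \<odot>\<^bsub>M\<^esub> \<pi> (e m) \<oplus>\<^bsub>M\<^esub> \<pi> (cut m v)"
      using \<pi> c s vm e unfolding linear_map_def by metis
    moreover have "(\<lambda>i. v i \<odot>\<^bsub>M\<^esub> \<pi> (e i)) \<in> {..<m} \<rightarrow> carrier M"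
      using vc Suc.prems \<pi>c[OF e] by auto
    ultimately show ?case using Suc vm \<pi>c[OF e] by (simp add: lessThan_Suc)
  qed
  show ?thesis
  proof (rule that[of n "\<lambda>i x. \<iota> x i" "\<lambda>i. \<pi> (e i)"])
    fix i assume "i < n"
    then show "linear_map R M \<lparr>carrier = carrier R, mult = mult R, one = one R,
      zero = zero R, add = add R, smult = mult R\<rparr> (\<lambda>x. \<iota> x i)"
      using \<iota> \<iota>c by (auto simp: linear_map_def power_module_def)
    show "\<pi> (e i) \<in> carrier M" by (rule \<pi>c[OF e])
  next
    fix x assume x: "x \<in> carrier M"
    have v: "\<iota> x \<in> carrier (power_module R n)" using \<iota> x by (auto simp: linear_map_def)
    have "cut n (\<iota> x) = \<iota> x" using v by (auto simp: cut_def power_module_def fun_eq_iff PiE_def extensional_def)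
    then show "x = (\<Oplus>\<^bsub>M\<^esub>i\<in>{..<n}. \<iota> x i \<odot>\<^bsub>M\<^esub> \<pi> (e i))" using sum[OF v \<iota>c[OF x], of n] \<pi>\<iota>[OF x] by simp
  qed
qed

text \<open>In a dual basis for the action through the source, the coordinates of \<open>[1 \<otimes> a]\<close> are differential
  operators applied to \<open>a\<close>: they are restrictions of functionals on jets which are linear over the
  left factor. Exchanging the two factors gives the expansion of \<open>[a \<otimes> 1]\<close>.\<close>

theorem coevaluation:
  assumes "fg_projective B (src_module \<J>)"
  shows "coevaluable (\<lambda>a. jt a \<one>)"
proof -
  obtain n \<iota> f where \<iota>: "\<And>i. i < n \<Longrightarrow> linear_map B (src_module \<J>) \<lparr>carrier = carrier B, mult = mult B, one = one B,
      zero = zero B, add = add B, smult = mult B\<rparr> (\<iota> i)"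
    and f: "\<And>i. i < (n::nat) \<Longrightarrow> f i \<in> carrier (src_module \<J>)"
    and sum: "\<And>X. X \<in> carrier (src_module \<J>) \<Longrightarrow> X = (\<Oplus>\<^bsub>src_module \<J>\<^esub>i\<in>{..<n}. \<iota> i X \<odot>\<^bsub>src_module \<J>\<^esub> f i)"
    using fg_projective_dual_basis[OF assms] by blast
  have fJ: "f i \<in> carrier \<J>" if "i < n" for i using f[OF that] by (simp add: src_module_def)
  have \<iota>': "\<iota> i X \<in> carrier B" "\<iota> i (X \<oplus>\<^bsub>\<J>\<^esub> Y) = \<iota> i X \<oplus> \<iota> i Y" "\<iota> i (src \<J> a \<bullet> X) = a \<otimes> \<iota> i X"
    if "i < n" "X \<in> carrier \<J>" "Y \<in> carrier \<J>" "a \<in> carrier B" for i X Y a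
    using \<iota>[OF that(1)] that by (auto simp: linear_map_def src_module_def)
  have sumJ: "X = (\<Oplus>\<^bsub>\<J>\<^esub>i\<in>{..<n}. src \<J> (\<iota> i X) \<bullet> f i)" if "X \<in> carrier \<J>" for X
    using sum[of X] that by (simp add: src_module_def finsum_def finprod_def)
  define D where "D i = (\<lambda>b\<in>carrier B. \<iota> i (jt \<one> b))" for i
  have D: "D i \<in> carrier \<D>" if i: "i < n" for i
  proof (rule diffop_of_functional[where \<phi> = "\<lambda>Z. \<iota> i (\<I> +>\<^bsub>BB\<^esub> Z)"])
    fix Z assume "Z \<in> \<I>"
    moreover have "\<iota> i \<zero>\<^bsub>\<J>\<^esub> = \<zero>"
      using \<iota>'(3)[OF i J.zero_closed J.zero_closed B.zero_closed] \<iota>'(1)[OF i J.zero_closed J.zero_closed B.zero_closed]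
      by (simp add: jets_fields(7))
    ultimately show "\<iota> i (\<I> +>\<^bsub>BB\<^esub> Z) = \<zero>" by (simp only: coset_zero)
  next
    fix a Z assume "a \<in> carrier B" "Z \<in> carrier BB"
    then show "\<iota> i (\<I> +>\<^bsub>BB\<^esub> (pe a \<one> \<otimes>\<^bsub>BB\<^esub> Z)) = a \<otimes> \<iota> i (\<I> +>\<^bsub>BB\<^esub> Z)"
      using \<iota>'(3)[OF i coset_closed J.zero_closed, of Z a] by (simp add: jets_fields jet_eq_coset)
  next
    fix b assume "b \<in> carrier B"
    then show "D i b = \<iota> i (\<I> +>\<^bsub>BB\<^esub> pe \<one> b)" by (simp add: D_def jet_eq_coset)
  next
    fix S T assume "S \<in> carrier BB" "T \<in> carrier BB"
    then show "\<iota> i (\<I> +>\<^bsub>BB\<^esub> (S \<oplus>\<^bsub>BB\<^esub> T)) = \<iota> i (\<I> +>\<^bsub>BB\<^esub> S) \<oplus> \<iota> i (\<I> +>\<^bsub>BB\<^esub> T)"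
      using \<iota>'(2)[OF i coset_closed coset_closed B.zero_closed, of S T] by (simp only: coset_add)
  qed (use \<iota>'(1)[OF i coset_closed J.zero_closed B.zero_closed] in \<open>auto simp: D_def\<close>)
  have flipped: "jt a \<one> = (\<Oplus>\<^bsub>\<J>\<^esub>i\<in>{..<n}. tgt \<J> (D i a) \<bullet> flip (f i))" if a: "a \<in> carrier B" for a
  proof -
    have fm: "flip (src \<J> c \<bullet> X) = tgt \<J> c \<bullet> flip X" if "c \<in> carrier B" "X \<in> carrier \<J>" for c X
      using that(2)
    proof (induction X rule: jet_generates)
      case (jet x y)
      then show ?case using that(1) by (simp add: jets_fields(7,8) jt_mult flip_jet B.m_comm)
    next
      case (add X Y)
      then show ?case using that(1) hom_mult[OF flip_hom] hom_in_carrier[OF flip_hom]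
        by (simp add: J.r_distr jets_fields(7,8))
    qed
    have "jt a \<one> = flip (jt \<one> a)" using a by (simp add: flip_jet)
    also have "jt \<one> a = (\<Oplus>\<^bsub>\<J>\<^esub>i\<in>{..<n}. src \<J> (D i a) \<bullet> f i)"
      using sumJ[of "jt \<one> a"] a by (simp add: D_def)
    also have "flip \<dots> = (\<Oplus>\<^bsub>\<J>\<^esub>i\<in>{..<n}. flip (src \<J> (D i a) \<bullet> f i))"
      unfolding finsum_def
      by (rule hom_finprod_finsum[OF J.abelian_group_axioms J.a_comm_group flip_hom, unfolded finsum_def])
        (use a diffop[OF D] fJ in \<open>auto simp: jets_fields(7)\<close>)
    also have "\<dots> = (\<Oplus>\<^bsub>\<J>\<^esub>i\<in>{..<n}. tgt \<J> (D i a) \<bullet> flip (f i))"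
      using a diffop[OF D] fJ hom_in_carrier[OF flip_hom]
      by (intro J.finsum_cong') (auto simp: fm jets_fields(8))
    finally show ?thesis .
  qed
  have "coevaluable (\<lambda>a. \<Oplus>\<^bsub>\<J>\<^esub>i\<in>{..<m}. tgt \<J> (D i a) \<bullet> flip (f i))" if "m \<le> n" for m
    using that
  proof (induction m)
    case 0 then show ?case using coevaluable_zero by simp
  next
    case (Suc m)
    have "coevaluable (\<lambda>a. (\<Oplus>\<^bsub>\<J>\<^esub>i\<in>{..<m}. tgt \<J> (D i a) \<bullet> flip (f i)) \<oplus>\<^bsub>\<J>\<^esub> tgt \<J> (D m a) \<bullet> flip (f m))"
      using Suc hom_in_carrier[OF flip_hom] by (intro coevaluable_add coevaluable_tgt D) (simp_all add: fJ)
    moreover have "(\<Oplus>\<^bsub>\<J>\<^esub>i\<in>{..<m}. tgt \<J> (D i a) \<bullet> flip (f i)) \<oplus>\<^bsub>\<J>\<^esub> tgt \<J> (D m a) \<bullet> flip (f m) =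
      (\<Oplus>\<^bsub>\<J>\<^esub>i\<in>{..<Suc m}. tgt \<J> (D i a) \<bullet> flip (f i))"
      if "a \<in> carrier B" for a
    proof -
      have "(\<lambda>i. tgt \<J> (D i a) \<bullet> flip (f i)) \<in> {..<m} \<rightarrow> carrier \<J>"
        "tgt \<J> (D m a) \<bullet> flip (f m) \<in> carrier \<J>"
        using Suc.prems that diffop[OF D] fJ hom_in_carrier[OF flip_hom] by (auto simp: jets_fields(8))
      then show ?thesis using J.finsum_closed by (simp add: lessThan_Suc J.a_comm)
    qed
    ultimately show ?case by (rule coevaluable_cong)
  qed
  from this[of n] have "coevaluable (\<lambda>a. \<Oplus>\<^bsub>\<J>\<^esub>i\<in>{..<n}. tgt \<J> (D i a) \<bullet> flip (f i))" by simp
  then show ?thesis by (rule coevaluable_cong) (simp only: flipped)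
qed

end

section \<open>Two-cocycles on algebroids spanned by jets\<close>

context jet_bialgebroid
begin

interpretation B: unital_algebra K B by (rule base)
interpretation Lm: module K L by (rule space)
interpretation L: unital_algebra K L by (rule total)

definition cocycle_product where
  "cocycle_product G Y Z = tensor_lift (add_monoid L) (\<lambda>(y1, y2). tensor_lift (add_monoid L)
     (\<lambda>(z1, z2). src L (G y1 z1) \<otimes> y2 \<otimes> z2) (cop L Z)) (cop L Y)"

lemma src_hom_simps:
  "\<lbrakk>a \<in> carrier B; b \<in> carrier B\<rbrakk> \<Longrightarrow> src L (a \<oplus>\<^bsub>B\<^esub> b) = src L a \<oplus> src L b"
  "\<lbrakk>a \<in> carrier B; b \<in> carrier B\<rbrakk> \<Longrightarrow> src L (a \<otimes>\<^bsub>B\<^esub> b) = src L a \<otimes> src L b"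
  by (simp_all add: src_jet jet_add mult_jet)

lemma tgt_hom_simps:
  "\<lbrakk>a \<in> carrier B; b \<in> carrier B\<rbrakk> \<Longrightarrow> tgt L (a \<oplus>\<^bsub>B\<^esub> b) = tgt L a \<oplus> tgt L b"
  "\<lbrakk>a \<in> carrier B; b \<in> carrier B\<rbrakk> \<Longrightarrow> tgt L (a \<otimes>\<^bsub>B\<^esub> b) = tgt L b \<otimes> tgt L a"
  by (simp_all add: tgt_jet jet_add mult_jet)

text \<open>A form on the symbols is well defined over the base if it moves scalars as in \<open>G_jet\<close>. Its cocycle
  identity only involves the product \<open>G [a \<otimes> 1] [b \<otimes> 1]\<close>.\<close>

context
  fixes G :: "'l \<Rightarrow> 'l \<Rightarrow> 'b"
  assumes G_closed: "\<lbrakk>X \<in> carrier L; Y \<in> carrier L\<rbrakk> \<Longrightarrow> G X Y \<in> carrier B"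
    and G_add: "\<lbrakk>X \<in> carrier L; X' \<in> carrier L; Y \<in> carrier L\<rbrakk> \<Longrightarrow> G (X \<oplus> X') Y = G X Y \<oplus>\<^bsub>B\<^esub> G X' Y"
      "\<lbrakk>X \<in> carrier L; Y \<in> carrier L; Y' \<in> carrier L\<rbrakk> \<Longrightarrow> G X (Y \<oplus> Y') = G X Y \<oplus>\<^bsub>B\<^esub> G X Y'"
    and G_jet: "\<lbrakk>a \<in> carrier B; b \<in> carrier B; c \<in> carrier B; d \<in> carrier B; e \<in> carrier B\<rbrakk> \<Longrightarrow>
        G (j a (e \<otimes>\<^bsub>B\<^esub> b)) (j c d) = G (j a b) (j c (d \<otimes>\<^bsub>B\<^esub> e))"
      "\<lbrakk>a \<in> carrier B; b \<in> carrier B; c \<in> carrier B; d \<in> carrier B; e \<in> carrier B\<rbrakk> \<Longrightarrow>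
        G (j a (b \<otimes>\<^bsub>B\<^esub> e)) (j c d) = G (j a b) (j c d) \<otimes>\<^bsub>B\<^esub> e"
begin

lemma G_balanced:
  assumes "X \<in> carrier L" "Y \<in> carrier L" "e \<in> carrier B"
  shows "G (X \<otimes> tgt L e) Y = G X (tgt L e \<otimes> Y)"
    and "G (tgt L e \<otimes> X) Y = G X Y \<otimes>\<^bsub>B\<^esub> e"
  subgoal
    by (rule biadditive_eqI[where f = "\<lambda>X Y. G (X \<otimes> tgt L e) Y" and g = "\<lambda>X Y. G X (tgt L e \<otimes> Y)"
        and H = "add_monoid B"])
      (simp_all add: assms G_add L.l_distr L.r_distr G_jet(1))
  subgoal
    by (rule biadditive_eqI[where f = "\<lambda>X Y. G (tgt L e \<otimes> X) Y" and g = "\<lambda>X Y. G X Y \<otimes>\<^bsub>B\<^esub> e"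
        and H = "add_monoid B"])
      (simp_all add: assms G_add G_closed L.r_distr B.l_distr G_jet(2))
  done

lemma cocycle_product_balanced:
  assumes "Z \<in> carrier L"
  shows "D.bal (add_monoid L) (\<lambda>y1 y2. tensor_lift (add_monoid L)
     (\<lambda>(z1, z2). src L (G y1 z1) \<otimes> y2 \<otimes> z2) (cop L Z))"
proof -
  have "D.bal (add_monoid L) (\<lambda>y1 y2. src L (G y1 z1) \<otimes> y2 \<otimes> z2)"
    if "z1 \<in> carrier L" "z2 \<in> carrier L" for z1 z2
    using that
    by (intro diamond_balancedI)
      (simp_all add: G_closed G_add src_hom_simps L.l_distr L.r_distr G_balanced(2) L.m_assoc)
  then show ?thesis
    using balanced_tensor_lift[OF D.tensor_data_axioms D.tensor_data_axioms Lm.a_comm_group,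
        unfolded diamond_tensor, of "cop L Z" "\<lambda>y1 y2 z1 z2. src L (G y1 z1) \<otimes> y2 \<otimes> z2"] assms
    by (simp add: cop_closed)
qed

lemma cocycle_product_balanced2:
  assumes "c \<in> carrier B" "d \<in> carrier B"
  shows "D.bal (add_monoid L) (\<lambda>z1 z2. src L (G (j c \<one>\<^bsub>B\<^esub>) z1) \<otimes> j \<one>\<^bsub>B\<^esub> d \<otimes> z2)"
proof (rule diamond_balancedI)
  fix b x y assume h: "b \<in> carrier B" "x \<in> carrier L" "y \<in> carrier L"
  have "G (j c \<one>\<^bsub>B\<^esub>) (tgt L b \<otimes> x) = G (j c \<one>\<^bsub>B\<^esub> \<otimes> tgt L b) x"
    using h assms by (simp only: G_balanced jet_closed B.one_closed)
  also have "j c \<one>\<^bsub>B\<^esub> \<otimes> tgt L b = tgt L b \<otimes> j c \<one>\<^bsub>B\<^esub>" using h assms by simp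
  also have "G (tgt L b \<otimes> j c \<one>\<^bsub>B\<^esub>) x = G (j c \<one>\<^bsub>B\<^esub>) x \<otimes>\<^bsub>B\<^esub> b"
    using h assms by (simp only: G_balanced jet_closed B.one_closed)
  finally have 1: "G (j c \<one>\<^bsub>B\<^esub>) (tgt L b \<otimes> x) = G (j c \<one>\<^bsub>B\<^esub>) x \<otimes>\<^bsub>B\<^esub> b" .
  have 2: "src L b \<otimes> (j \<one>\<^bsub>B\<^esub> d \<otimes> y) = j \<one>\<^bsub>B\<^esub> d \<otimes> (src L b \<otimes> y)"
    using h assms by (simp add: L.m_assoc[symmetric] jet_closed)
  show "src L (G (j c \<one>\<^bsub>B\<^esub>) (tgt L b \<otimes> x)) \<otimes> j \<one>\<^bsub>B\<^esub> d \<otimes> y =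
      src L (G (j c \<one>\<^bsub>B\<^esub>) x) \<otimes> j \<one>\<^bsub>B\<^esub> d \<otimes> (src L b \<otimes> y)"
    using h assms unfolding 1 by (simp add: src_hom_simps(2) G_closed L.m_assoc jet_closed 2 del: src_mult_jet)
qed (use assms in \<open>simp_all add: jet_closed G_closed G_add src_hom_simps(1) L.l_distr L.r_distr\<close>)

lemma cocycle_product:
  shows "\<lbrakk>Y \<in> carrier L; Z \<in> carrier L\<rbrakk> \<Longrightarrow> cocycle_product G Y Z \<in> carrier L"
    and "\<lbrakk>Y \<in> carrier L; Y' \<in> carrier L; Z \<in> carrier L\<rbrakk> \<Longrightarrow>
      cocycle_product G (Y \<oplus> Y') Z = cocycle_product G Y Z \<oplus> cocycle_product G Y' Z"
    and "\<lbrakk>Y \<in> carrier L; Z \<in> carrier L; Z' \<in> carrier L\<rbrakk> \<Longrightarrow>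
      cocycle_product G Y (Z \<oplus> Z') = cocycle_product G Y Z \<oplus> cocycle_product G Y Z'"
    and "\<lbrakk>c \<in> carrier B; d \<in> carrier B; e \<in> carrier B; f \<in> carrier B\<rbrakk> \<Longrightarrow>
      cocycle_product G (j c d) (j e f) = j (G (j c \<one>\<^bsub>B\<^esub>) (j e \<one>\<^bsub>B\<^esub>)) (f \<otimes>\<^bsub>B\<^esub> d)"
proof -
  note l1 = cop_lift[OF Lm.a_comm_group cocycle_product_balanced]
  note l2 = cop_lift[OF Lm.a_comm_group cocycle_product_balanced2]
  show cl: "\<lbrakk>Y \<in> carrier L; Z \<in> carrier L\<rbrakk> \<Longrightarrow> cocycle_product G Y Z \<in> carrier L" for Y Z
    unfolding cocycle_product_def using l1(1) by simp
  show cp_add: "\<lbrakk>Y \<in> carrier L; Y' \<in> carrier L; Z \<in> carrier L\<rbrakk> \<Longrightarrow>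
      cocycle_product G (Y \<oplus> Y') Z = cocycle_product G Y Z \<oplus> cocycle_product G Y' Z" for Y Y' Z
    unfolding cocycle_product_def using l1(2) by simp
  have on_jet: "cocycle_product G (j c d) Z = tensor_lift (add_monoid L)
     (\<lambda>(z1, z2). src L (G (j c \<one>\<^bsub>B\<^esub>) z1) \<otimes> j \<one>\<^bsub>B\<^esub> d \<otimes> z2) (cop L Z)"
    if "c \<in> carrier B" "d \<in> carrier B" "Z \<in> carrier L" for c d Z
    unfolding cocycle_product_def by (rule l1(3)[OF that(3,1,2)])
  show "\<lbrakk>Y \<in> carrier L; Z \<in> carrier L; Z' \<in> carrier L\<rbrakk> \<Longrightarrow>
      cocycle_product G Y (Z \<oplus> Z') = cocycle_product G Y Z \<oplus> cocycle_product G Y Z'"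
  proof (induction Y rule: jet_induct)
    case (jet a b)
    then show ?case using l2(2) by (simp add: on_jet)
  next
    case (add X Y)
    then show ?case by (simp add: cp_add cl Lm.a_ac)
  qed
  show "\<lbrakk>c \<in> carrier B; d \<in> carrier B; e \<in> carrier B; f \<in> carrier B\<rbrakk> \<Longrightarrow>
      cocycle_product G (j c d) (j e f) = j (G (j c \<one>\<^bsub>B\<^esub>) (j e \<one>\<^bsub>B\<^esub>)) (f \<otimes>\<^bsub>B\<^esub> d)"
    by (simp add: on_jet jet_closed l2(3) G_closed mult_jet)
qed

lemma left_2cocycle_onI:
  assumes smult: "\<And>k a b c d. \<lbrakk>k \<in> carrier K; a \<in> carrier B; b \<in> carrier B; c \<in> carrier B; d \<in> carrier B\<rbrakk> \<Longrightarrow>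
        G (j (k \<odot>\<^bsub>B\<^esub> a) b) (j c d) = k \<odot>\<^bsub>B\<^esub> G (j a b) (j c d)"
      "\<And>k a b c d. \<lbrakk>k \<in> carrier K; a \<in> carrier B; b \<in> carrier B; c \<in> carrier B; d \<in> carrier B\<rbrakk> \<Longrightarrow>
        G (j a b) (j (k \<odot>\<^bsub>B\<^esub> c) d) = k \<odot>\<^bsub>B\<^esub> G (j a b) (j c d)"
    and cocycle: "\<And>a b c d e f. \<lbrakk>a \<in> carrier B; b \<in> carrier B; c \<in> carrier B; d \<in> carrier B; e \<in> carrier B; f \<in> carrier B\<rbrakk> \<Longrightarrow>
        G (j a b) (j (G (j c \<one>\<^bsub>B\<^esub>) (j e \<one>\<^bsub>B\<^esub>)) (f \<otimes>\<^bsub>B\<^esub> d)) = G (j (G (j a \<one>\<^bsub>B\<^esub>) (j c \<one>\<^bsub>B\<^esub>)) (d \<otimes>\<^bsub>B\<^esub> b)) (j e f)"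
    and unit: "\<And>a b. \<lbrakk>a \<in> carrier B; b \<in> carrier B\<rbrakk> \<Longrightarrow> G (j \<one>\<^bsub>B\<^esub> \<one>\<^bsub>B\<^esub>) (j a b) = a \<otimes>\<^bsub>B\<^esub> b"
      "\<And>a b. \<lbrakk>a \<in> carrier B; b \<in> carrier B\<rbrakk> \<Longrightarrow> G (j a b) (j \<one>\<^bsub>B\<^esub> \<one>\<^bsub>B\<^esub>) = a \<otimes>\<^bsub>B\<^esub> b"
  shows "left_2cocycle_on K B L G"
proof -
  have sm: "G (k \<odot> X) Y = k \<odot>\<^bsub>B\<^esub> G X Y" "G X (k \<odot> Y) = k \<odot>\<^bsub>B\<^esub> G X Y"
    if k: "k \<in> carrier K" and XY: "X \<in> carrier L" "Y \<in> carrier L" for k X Y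
    subgoal
      using XY by (rule_tac biadditive_eqI[where f = "\<lambda>X Y. G (k \<odot> X) Y" and g = "\<lambda>X Y. k \<odot>\<^bsub>B\<^esub> G X Y"
        and H = "add_monoid B"])
       (simp_all add: k G_add G_closed Lm.smult_r_distr B.smult_r_distr jet_smult(1) smult(1))
    subgoal
      using XY by (rule_tac biadditive_eqI[where f = "\<lambda>X Y. G X (k \<odot> Y)" and g = "\<lambda>X Y. k \<odot>\<^bsub>B\<^esub> G X Y"
        and H = "add_monoid B"])
       (simp_all add: k G_add G_closed Lm.smult_r_distr B.smult_r_distr jet_smult(1) smult(2))
    done
  have bil: "bilinear_map K L L B G"
    by (auto simp: bilinear_map_def linear_map_def G_closed G_add sm)
  have cocycle: "G X (cocycle_product G Y Z) = G (cocycle_product G X Y) Z"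
    if "X \<in> carrier L" "Y \<in> carrier L" "Z \<in> carrier L" for X Y Z
    using that(1)
  proof (induction X rule: jet_induct)
    case (jet a b)
    show ?case
      using that(2,3) jet
      by (rule_tac biadditive_eqI[where f = "\<lambda>Y Z. G (j a b) (cocycle_product G Y Z)"
        and g = "\<lambda>Y Z. G (cocycle_product G (j a b) Y) Z" and H = "add_monoid B"])
        (simp_all add: jet_closed cocycle_product G_add G_closed cocycle)
  next
    case (add X X')
    then show ?case using that(2,3) by (simp add: cocycle_product G_add)
  qed
  have un: "G \<one> X = cou L X" "G X \<one> = cou L X" if "X \<in> carrier L" for X
    using that by (induction X rule: jet_induct; simp add: one_jet unit cou_jet cou_add G_add jet_closed)+
  show ?thesis
    unfolding left_2cocycle_on_def cocycle_product_def[symmetric]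
    using bil cocycle un by (simp add: G_balanced)
qed

end

end

section \<open>Jets with a coevaluation\<close>

locale coev_jets = stable_jets K B for K :: "'k ring" and B :: "('k, 'b) module" (structure) +
  fixes N :: nat and u :: "nat \<Rightarrow> 'b" and E :: "nat \<Rightarrow> 'b \<Rightarrow> 'b"
  assumes u_closed: "i < N \<Longrightarrow> u i \<in> carrier B"
    and E_diffop: "i < N \<Longrightarrow> E i \<in> carrier \<D>"
    and jet_coev: "a \<in> carrier B \<Longrightarrow> jt a \<one> = (\<Oplus>\<^bsub>\<J>\<^esub>i\<in>{..<N}. jt (u i) (E i a))"
begin

text \<open>The additive map \<open>X \<mapsto> \<Sum> [u\<^sub>i \<otimes> 1] \<diamond> (E\<^sub>i \<otimes> 1)X\<close> takes \<open>[a \<otimes> b]\<close> to \<open>[a \<otimes> 1] \<diamond> [1 \<otimes> b]\<close>, so the prescription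
  on symbols respects the stable ideal.\<close>

lemma jets_cop:
  shows "cop \<J> \<in> hom (add_monoid \<J>) (diamond K B \<J>)"
    and "\<lbrakk>a \<in> carrier B; b \<in> carrier B\<rbrakk> \<Longrightarrow> cop \<J> (jt a b) = pure (diamond K B \<J>) (jt a \<one>, jt \<one> b)"
proof -
  let ?LL = "diamond K B \<J>"
  interpret D: tensor_data K \<J> \<J> "carrier B" "\<lambda>b. mult \<J> (tgt \<J> b)" "\<lambda>b. mult \<J> (src \<J> b)"
    rewrites "tensor K \<J> \<J> (carrier B) (\<lambda>b. mult \<J> (tgt \<J> b)) (\<lambda>b. mult \<J> (src \<J> b)) = diamond K B \<J>"
    by (rule tensor_data.intro; (rule jets_module | simp add: jets_fields(7,8)))
      (simp only: diamond_def diamond_mod_def)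
  note p = balancedD[OF D.balanced_pure]
  interpret LL: comm_group ?LL by (rule D.comm_group_tensor)
  have f: "EG.bal ?LL (\<lambda>a b. pure ?LL (jt a \<one>, jt \<one> b))"
    by (rule balancedI) (simp_all add: p(2,3) jt_add jt_smult(1)[symmetric] jt_smult(2)[symmetric] p(4))
  define h where "h X = (\<Otimes>\<^bsub>?LL\<^esub>i\<in>{..<N}. pure ?LL (jt (u i) \<one>, op_left (E i) X))" for X
  have ol: "op_left (E i) X \<in> carrier \<J>" "op_left (E i) (X \<oplus>\<^bsub>\<J>\<^esub> Y) = op_left (E i) X \<oplus>\<^bsub>\<J>\<^esub> op_left (E i) Y"
    if "i < N" "X \<in> carrier \<J>" "Y \<in> carrier \<J>" for i X Y
    using op_left_hom(1)[OF E_diffop[OF that(1)]] that by (auto simp: hom_def)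
  have olc: "op_left (E i) X \<in> carrier \<J>" if "i < N" "X \<in> carrier \<J>" for i X
    by (rule ol(1)[OF that that(2)])
  have h: "h \<in> hom (add_monoid \<J>) ?LL"
  proof (rule homI)
    fix X Y assume "X \<in> carrier (add_monoid \<J>)" "Y \<in> carrier (add_monoid \<J>)"
    then show "h (X \<otimes>\<^bsub>add_monoid \<J>\<^esub> Y) = h X \<otimes>\<^bsub>?LL\<^esub> h Y"
      unfolding h_def by (intro LL.finprod_mult_cong) (auto simp: ol olc p u_closed)
  qed (auto simp: h_def olc u_closed)
  have val: "pure ?LL (jt a \<one>, jt \<one> b) = h (\<I> +>\<^bsub>BB\<^esub> pe a b)" if ab: "a \<in> carrier B" "b \<in> carrier B" for a b
  proof -
    have cl: "E i a \<in> carrier B" if "i < N" for i using diffop[OF E_diffop[OF that]] ab by simp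
    have hom: "(\<lambda>Z. pure ?LL (Z, jt \<one> b)) \<in> hom (add_monoid \<J>) ?LL"
      using ab by (intro homI) (auto simp: p)
    have "pure ?LL (jt a \<one>, jt \<one> b) = (\<Otimes>\<^bsub>?LL\<^esub>i\<in>{..<N}. pure ?LL (jt (u i) (E i a), jt \<one> b))"
      unfolding jet_coev[OF ab(1)]
      by (rule hom_finprod_finsum[OF J.abelian_group_axioms LL.comm_group_axioms hom]) (auto simp: u_closed cl)
    also have "\<dots> = h (jt a b)"
      unfolding h_def
    proof (rule LL.finprod_cong')
      fix i assume i: "i \<in> {..<N}"
      have "pure ?LL (tgt \<J> (E i a) \<bullet> jt (u i) \<one>, jt \<one> b) =
          pure ?LL (jt (u i) \<one>, src \<J> (E i a) \<bullet> jt \<one> b)"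
        using i ab cl by (intro p(5)) (auto simp: u_closed)
      then show "pure ?LL (jt (u i) (E i a), jt \<one> b) = pure ?LL (jt (u i) \<one>, op_left (E i) (jt a b))"
        using i ab cl u_closed by (simp add: jets_fields(7,8) jt_mult op_left_hom(2)[OF E_diffop])
    qed (use ab cl olc u_closed in auto)
    finally show ?thesis by (simp add: jet_eq_coset)
  qed
  note l = jet_lift_of_map[OF LL.comm_group_axioms f h, of "\<lambda>S. S"]
  show "cop \<J> \<in> hom (add_monoid \<J>) ?LL"
    "\<lbrakk>a \<in> carrier B; b \<in> carrier B\<rbrakk> \<Longrightarrow> cop \<J> (jt a b) = pure ?LL (jt a \<one>, jt \<one> b)"
    unfolding jets_fields(9) diamond_jets_st by (rule l; simp add: val)+
qed

lemma base_algebra: "unital_algebra K B"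
  by (intro unital_algebra.intro unital_algebra_axioms.intro B.module cring.axioms(1)[OF B.M_cring] smult_left smult_right)

lemma diffop_E: "\<lbrakk>i < N; a \<in> carrier B\<rbrakk> \<Longrightarrow> E i a \<in> carrier B"
  using diffop[OF E_diffop] by blast

sublocale JH: jet_bialgebroid K B \<J> jt "{..<N}" u E "\<lambda>i. op_right (E i)"
proof (rule jet_bialgebroid.intro)
  show "unital_algebra K B" by (rule base_algebra)
  show "module K \<J>" by (rule jets_module)
  fix X and Q assume "X \<in> carrier \<J>"
    and "\<And>a b. \<lbrakk>a \<in> carrier B; b \<in> carrier B\<rbrakk> \<Longrightarrow> Q (jt a b)"
    and "\<And>X Y. \<lbrakk>X \<in> carrier \<J>; Y \<in> carrier \<J>; Q X; Q Y\<rbrakk> \<Longrightarrow> Q (X \<oplus>\<^bsub>\<J>\<^esub> Y)"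
  then show "Q X" by (rule jet_generates)
qed (simp_all add: jt_smult(1) jt_smult(2)[symmetric] jt_add jt_one J.l_distr J.r_distr jt_mult jets_fields(7,8) jets_cop
    jets_cou_hom jets_cou_jet u_closed diffop_E op_right_hom E_diffop jet_coev, (simp_all add: jt_smult(1)[symmetric] jt_smult(2))?)

text \<open>The pairing of \<open>D\<close> with both sides of the coevaluation of \<open>a\<close>.\<close>

lemma diffop_expand:
  assumes D: "D \<in> carrier \<D>" and a: "a \<in> carrier B"
  shows "D a = (\<Oplus>i\<in>{..<N}. D (u i) \<otimes> E i a)"
proof -
  have "D a = pairing D (jt a \<one>)" using a diffop[OF D] by (simp add: pairing[OF D])
  also have "\<dots> = (\<Otimes>\<^bsub>add_monoid B\<^esub>i\<in>{..<N}. pairing D (jt (u i) (E i a)))"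
    unfolding jet_coev[OF a]
    by (rule hom_finprod_finsum[OF J.abelian_group_axioms B.a_comm_group pairing_hom(1)[OF D]])
      (auto simp: u_closed diffop_E a)
  also have "\<dots> = (\<Otimes>\<^bsub>add_monoid B\<^esub>i\<in>{..<N}. D (u i) \<otimes> E i a)"
    by (rule comm_monoid.finprod_cong'[OF comm_group.axioms(1)[OF B.a_comm_group] refl])
      (use diffop[OF D] in \<open>auto simp: pairing[OF D] u_closed diffop_E a\<close>)
  finally show ?thesis by (simp add: finsum_def)
qed

text \<open>The coevaluation of \<open>a\<close> multiplied by \<open>[1 \<otimes> b]\<close>.\<close>

lemma jets_expand:
  assumes "X \<in> carrier \<J>"
  shows "X = (\<Oplus>\<^bsub>\<J>\<^esub>i\<in>{..<N}. jt (u i) (pairing (E i) X))"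
  using assms
proof (induction X rule: jet_generates)
  case (jet a b)
  have hom: "(\<lambda>X. X \<bullet> jt \<one> b) \<in> hom (add_monoid \<J>) (add_monoid \<J>)"
    using jet by (intro homI) (auto simp: J.l_distr)
  have "jt a b = jt a \<one> \<bullet> jt \<one> b" using jet by (simp add: jt_mult)
  also have "\<dots> = (\<Oplus>\<^bsub>\<J>\<^esub>i\<in>{..<N}. jt (u i) (E i a) \<bullet> jt \<one> b)"
    unfolding jet_coev[OF jet(1)] finsum_def
    by (rule hom_finprod_finsum[OF J.abelian_group_axioms J.a_comm_group hom, unfolded finsum_def])
      (use jet in \<open>auto simp: u_closed diffop_E\<close>)
  also have "\<dots> = (\<Oplus>\<^bsub>\<J>\<^esub>i\<in>{..<N}. jt (u i) (pairing (E i) (jt a b)))"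
    using jet by (intro J.finsum_cong') (auto simp: u_closed diffop_E jt_mult pairing[OF E_diffop] B.m_comm)
  finally show ?case .
next
  case (add X Y)
  have cl: "(\<lambda>i. jt (u i) (pairing (E i) X)) \<in> {..<N} \<rightarrow> carrier \<J>" if "X \<in> carrier \<J>" for X
    using that by (auto simp: u_closed pairing[OF E_diffop])
  have "X \<oplus>\<^bsub>\<J>\<^esub> Y = (\<Oplus>\<^bsub>\<J>\<^esub>i\<in>{..<N}. jt (u i) (pairing (E i) X)) \<oplus>\<^bsub>\<J>\<^esub> (\<Oplus>\<^bsub>\<J>\<^esub>i\<in>{..<N}. jt (u i) (pairing (E i) Y))"
    using add.IH by simp
  also have "\<dots> = (\<Oplus>\<^bsub>\<J>\<^esub>i\<in>{..<N}. jt (u i) (pairing (E i) X) \<oplus>\<^bsub>\<J>\<^esub> jt (u i) (pairing (E i) Y))"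
    by (rule J.finsum_addf[symmetric]) (use cl add in auto)
  also have "\<dots> = (\<Oplus>\<^bsub>\<J>\<^esub>i\<in>{..<N}. jt (u i) (pairing (E i) (X \<oplus>\<^bsub>\<J>\<^esub> Y)))"
    using add by (intro J.finsum_cong') (auto simp: u_closed pairing[OF E_diffop] jt_add)
  finally show ?case .
qed

end

context coev_jets
begin

section \<open>The coproduct of differential operators\<close>

abbreviation "\<D>\<D> \<equiv> diamond K B \<D>"

lemma diffops_module: "module K \<D>"
  using unital_algebra_diffops by (simp add: unital_algebra_def)

lemma diffops_tensor_eq: "tensor K \<D> \<D> (carrier B) (\<lambda>b. mult \<D> (tgt \<D> b)) (\<lambda>b. mult \<D> (src \<D> b)) = \<D>\<D>"
  by (simp only: diamond_def diamond_mod_def)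

sublocale DT: tensor_data K \<D> \<D> "carrier B" "\<lambda>b. mult \<D> (tgt \<D> b)" "\<lambda>b. mult \<D> (src \<D> b)"
  rewrites "tensor K \<D> \<D> (carrier B) (\<lambda>b. mult \<D> (tgt \<D> b)) (\<lambda>b. mult \<D> (src \<D> b)) = diamond K B \<D>"
  by (rule tensor_data.intro; (rule diffops_module | simp add: diffop_closed)) (rule diffops_tensor_eq)

lemmas diffop_pure = balancedD[OF DT.balanced_pure]

lemma diffops_abelian: "abelian_group \<D>"
  using diffops_module by (simp add: module_def)

lemma diffops_comm_group: "comm_group (add_monoid \<D>)"
  by (rule abelian_group.a_comm_group[OF diffops_abelian])

text \<open>The bidifferential operator defined by an element of \<open>\<D> \<diamond> \<D>\<close>.\<close>

definition ev where "ev a b = tensor_lift (add_monoid B) (\<lambda>(x, y). x a \<otimes> y b)"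

lemma ev_balanced: "\<lbrakk>a \<in> carrier B; b \<in> carrier B\<rbrakk> \<Longrightarrow> DT.bal (add_monoid B) (\<lambda>x y. x a \<otimes> y b)"
  by (rule balancedI) (simp_all add: diffop_apply diffop B.l_distr B.r_distr smult_left smult_right B.m_assoc)

lemma ev:
  assumes "a \<in> carrier B" "b \<in> carrier B"
  shows "T \<in> carrier \<D>\<D> \<Longrightarrow> ev a b T \<in> carrier B"
    and "\<lbrakk>T \<in> carrier \<D>\<D>; U \<in> carrier \<D>\<D>\<rbrakk> \<Longrightarrow> ev a b (T \<otimes>\<^bsub>\<D>\<D>\<^esub> U) = ev a b T \<oplus> ev a b U"
    and "\<lbrakk>x \<in> carrier \<D>; y \<in> carrier \<D>\<rbrakk> \<Longrightarrow> ev a b (pure \<D>\<D> (x, y)) = x a \<otimes> y b"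
  using DT.tensor_lift_hom[OF B.a_comm_group ev_balanced[OF assms]]
  by (simp_all add: ev_def hom_in_carrier hom_mult) (auto simp: hom_def)

text \<open>The coefficients in \<open>T = \<Sum> E\<^sub>i \<diamond> coord i T\<close>.\<close>

definition coord where "coord i = tensor_lift (add_monoid \<D>) (\<lambda>(x, y). src \<D> (x (u i)) \<cdot> y)"

lemma coord_balanced: "i < N \<Longrightarrow> DT.bal (add_monoid \<D>) (\<lambda>x y. src \<D> (x (u i)) \<cdot> y)"
  by (rule balancedI)
    (simp_all add: u_closed diffop diffop_closed,
      (rule diffop_eqI; simp add: u_closed diffop_closed diffop_apply diffop B.l_distr B.r_distr smult_left smult_right B.m_ac)+)

lemma coord:
  assumes "i < N"
  shows "T \<in> carrier \<D>\<D> \<Longrightarrow> coord i T \<in> carrier \<D>"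
    and "\<lbrakk>T \<in> carrier \<D>\<D>; U \<in> carrier \<D>\<D>\<rbrakk> \<Longrightarrow> coord i (T \<otimes>\<^bsub>\<D>\<D>\<^esub> U) = coord i T \<oplus>\<^bsub>\<D>\<^esub> coord i U"
    and "\<lbrakk>x \<in> carrier \<D>; y \<in> carrier \<D>\<rbrakk> \<Longrightarrow> coord i (pure \<D>\<D> (x, y)) = src \<D> (x (u i)) \<cdot> y"
  using DT.tensor_lift_hom[OF diffops_comm_group coord_balanced[OF assms]]
  by (simp_all add: coord_def hom_in_carrier hom_mult) (auto simp: hom_def)

lemma apply_hom: "a \<in> carrier B \<Longrightarrow> (\<lambda>D. D a) \<in> hom (add_monoid \<D>) (add_monoid B)"
  by (rule homI) (simp_all add: diffop diffop_apply)

lemma coord_apply: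
  assumes "i < N" "T \<in> carrier \<D>\<D>" "b \<in> carrier B"
  shows "coord i T b = ev (u i) b T"
proof -
  have "coord i T b = tensor_lift (add_monoid B) (\<lambda>(x, y). (src \<D> (x (u i)) \<cdot> y) b) T"
    unfolding coord_def
    using assms by (intro DT.tensor_lift_comp_hom2[OF diffops_comm_group B.a_comm_group assms(2) apply_hom[OF assms(3)]])
      (simp add: diffop_closed diffop u_closed)
  also have "\<dots> = ev (u i) b T"
    unfolding ev_def
    using assms by (intro DT.tensor_lift_cong2[OF B.a_comm_group assms(2)]) (simp_all add: diffop_apply diffop u_closed)
  finally show ?thesis .
qed

interpretation DD: comm_group \<D>\<D> by (rule DT.comm_group_tensor)

lemma diffop_finsum_apply:
  assumes "finite I" "f \<in> I \<rightarrow> carrier \<D>" "a \<in> carrier B"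
  shows "(\<Oplus>\<^bsub>\<D>\<^esub>i\<in>I. f i) a = (\<Oplus>i\<in>I. f i a)"
  unfolding finsum_def
  by (rule hom_finprod_finsum[OF diffops_abelian B.a_comm_group apply_hom[OF assms(3)] assms(1,2), unfolded finsum_def])

lemma diffop_expand_sum:
  assumes "D \<in> carrier \<D>"
  shows "D = (\<Oplus>\<^bsub>\<D>\<^esub>i\<in>{..<N}. src \<D> (D (u i)) \<cdot> E i)"
proof -
  have f: "(\<lambda>i. src \<D> (D (u i)) \<cdot> E i) \<in> {..<N} \<rightarrow> carrier \<D>"
    by (auto simp: diffop_closed E_diffop diffop[OF assms] u_closed)
  show ?thesis
  proof (rule diffop_eqI[OF assms])
    show "(\<Oplus>\<^bsub>\<D>\<^esub>i\<in>{..<N}. src \<D> (D (u i)) \<cdot> E i) \<in> carrier \<D>"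
      by (rule abelian_monoid.finsum_closed[OF abelian_group.axioms(1)[OF diffops_abelian] f])
    fix a assume a: "a \<in> carrier B"
    have "(\<Oplus>\<^bsub>\<D>\<^esub>i\<in>{..<N}. src \<D> (D (u i)) \<cdot> E i) a = (\<Oplus>i\<in>{..<N}. (src \<D> (D (u i)) \<cdot> E i) a)"
      by (rule diffop_finsum_apply[OF _ f a]) simp
    also have "\<dots> = (\<Oplus>i\<in>{..<N}. D (u i) \<otimes> E i a)"
      using a by (intro B.finsum_cong') (auto simp: diffop_apply diffop_E diffop[OF assms] u_closed)
    finally show "D a = (\<Oplus>\<^bsub>\<D>\<^esub>i\<in>{..<N}. src \<D> (D (u i)) \<cdot> E i) a"
      using diffop_expand[OF assms a] by simp
  qed
qed

lemma tensor_expand: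
  assumes "T \<in> carrier \<D>\<D>"
  shows "T = (\<Otimes>\<^bsub>\<D>\<D>\<^esub>i\<in>{..<N}. pure \<D>\<D> (E i, coord i T))"
  using assms
proof (induction T rule: DT.tensor_induct)
  case (pure x y)
  have hom: "(\<lambda>D. pure \<D>\<D> (D, y)) \<in> hom (add_monoid \<D>) \<D>\<D>"
    using pure by (intro homI) (auto simp: diffop_pure)
  have "pure \<D>\<D> (x, y) = (\<Otimes>\<^bsub>\<D>\<D>\<^esub>i\<in>{..<N}. pure \<D>\<D> (src \<D> (x (u i)) \<cdot> E i, y))"
    by (subst diffop_expand_sum[OF pure(1)], rule hom_finprod_finsum[OF diffops_abelian DD.comm_group_axioms hom])
      (auto simp: diffop_closed E_diffop diffop[OF pure(1)] u_closed)
  also have "\<dots> = (\<Otimes>\<^bsub>\<D>\<D>\<^esub>i\<in>{..<N}. pure \<D>\<D> (E i, coord i (pure \<D>\<D> (x, y))))"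
  proof (rule DD.finprod_cong')
    fix i assume i: "i \<in> {..<N}"
    have "x (u i) \<in> carrier B" using i pure by (simp add: diffop u_closed)
    then show "pure \<D>\<D> (src \<D> (x (u i)) \<cdot> E i, y) = pure \<D>\<D> (E i, coord i (pure \<D>\<D> (x, y)))"
      using diffop_pure(5)[of "x (u i)" "E i" y] i pure by (simp add: coord E_diffop tgt_eq_src)
  qed (use pure in \<open>auto simp: coord E_diffop diffop_closed diffop u_closed\<close>)
  finally show ?case .
next
  case (mult U V)
  have "U \<otimes>\<^bsub>\<D>\<D>\<^esub> V = (\<Otimes>\<^bsub>\<D>\<D>\<^esub>i\<in>{..<N}. pure \<D>\<D> (E i, coord i U)) \<otimes>\<^bsub>\<D>\<D>\<^esub> (\<Otimes>\<^bsub>\<D>\<D>\<^esub>i\<in>{..<N}. pure \<D>\<D> (E i, coord i V))"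
    using mult.IH by simp
  also have "\<dots> = (\<Otimes>\<^bsub>\<D>\<D>\<^esub>i\<in>{..<N}. pure \<D>\<D> (E i, coord i (U \<otimes>\<^bsub>\<D>\<D>\<^esub> V)))"
    using mult.hyps
    by (intro DD.finprod_mult_cong[symmetric]) (auto simp: coord E_diffop diffop_pure)
  finally show ?case .
qed

text \<open>The coefficients of \<open>T\<close> with respect to the \<open>E\<^sub>i\<close> are the operators \<open>b \<mapsto> ev (u\<^sub>i) b T\<close>.\<close>

lemma ev_inject:
  assumes "T \<in> carrier \<D>\<D>" "U \<in> carrier \<D>\<D>"
    and "\<And>a b. \<lbrakk>a \<in> carrier B; b \<in> carrier B\<rbrakk> \<Longrightarrow> ev a b T = ev a b U"
  shows "T = U"
proof -
  have "coord i T = coord i U" if "i < N" for i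
    using that assms by (intro diffop_eqI) (simp_all add: coord coord_apply u_closed)
  then have "(\<Otimes>\<^bsub>\<D>\<D>\<^esub>i\<in>{..<N}. pure \<D>\<D> (E i, coord i T)) = (\<Otimes>\<^bsub>\<D>\<D>\<^esub>i\<in>{..<N}. pure \<D>\<D> (E i, coord i U))"
    using assms by (intro DD.finprod_cong') (auto simp: coord E_diffop)
  then show ?thesis
    by (simp only: tensor_expand[OF assms(1), symmetric] tensor_expand[OF assms(2), symmetric])
qed

text \<open>The coproduct is \<open>\<Sum> E\<^sub>i \<diamond> (D \<cdot> u\<^sub>i)\<close>, since \<open>D(ab) = \<Sum> D(u\<^sub>i b) E\<^sub>i(a)\<close> by the expansion of the operator
  \<open>a \<mapsto> D(ab)\<close>. It is unique because a tensor is determined by its bidifferential operator.\<close>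

lemma cop_diffop:
  assumes D: "D \<in> carrier \<D>"
  shows "cop \<D> D \<in> carrier \<D>\<D>"
    and "\<lbrakk>a \<in> carrier B; b \<in> carrier B\<rbrakk> \<Longrightarrow> ev a b (cop \<D> D) = D (a \<otimes> b)"
proof -
  define T where "T = (\<Otimes>\<^bsub>\<D>\<D>\<^esub>i\<in>{..<N}. pure \<D>\<D> (E i, D \<cdot> src \<D> (u i)))"
  have T: "T \<in> carrier \<D>\<D>"
    unfolding T_def by (intro DD.finprod_closed) (auto simp: D E_diffop diffop_closed u_closed)
  have evT: "ev a b T = D (a \<otimes> b)" if ab: "a \<in> carrier B" "b \<in> carrier B" for a b
  proof -
    interpret h: group_hom \<D>\<D> "add_monoid B" "ev a b"
      using ev[OF ab] by (auto simp: group_hom_def group_hom_axioms_def DD.is_group B.a_group hom_def)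
    have "ev a b (finprod \<D>\<D> (\<lambda>i. pure \<D>\<D> (E i, D \<cdot> src \<D> (u i))) A) =
        (\<Oplus>i\<in>A. E i a \<otimes> D (u i \<otimes> b))" if "finite A" "A \<subseteq> {..<N}" for A
      using that
    proof (induction A)
      case empty then show ?case using h.hom_one by simp
    next
      case (insert i A)
      have "(\<lambda>i. pure \<D>\<D> (E i, D \<cdot> src \<D> (u i))) \<in> A \<rightarrow> carrier \<D>\<D>" "i < N"
        "(\<lambda>i. E i a \<otimes> D (u i \<otimes> b)) \<in> A \<rightarrow> carrier B"
        using insert ab by (auto simp: D E_diffop diffop_closed u_closed diffop_E diffop[OF D])
      then show ?case
        using insert ab
        by (simp add: ev D E_diffop diffop_closed u_closed diffop_apply diffop_E diffop[OF D])
    qed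
    then have "ev a b T = (\<Oplus>i\<in>{..<N}. E i a \<otimes> D (u i \<otimes> b))" unfolding T_def by simp
    also have "\<dots> = (\<Oplus>i\<in>{..<N}. (D \<cdot> src \<D> b) (u i) \<otimes> E i a)"
      using ab by (intro B.finsum_cong') (auto simp: diffop_apply u_closed B.m_comm diffop_E diffop[OF D])
    also have "\<dots> = (D \<cdot> src \<D> b) a"
      using ab by (intro diffop_expand[symmetric]) (simp_all add: D diffop_closed)
    finally show ?thesis using ab by (simp add: diffop_apply B.m_comm)
  qed
  have "cop \<D> D = (THE T. T \<in> carrier \<D>\<D> \<and> (\<forall>a\<in>carrier B. \<forall>b\<in>carrier B. ev a b T = D (a \<otimes> b)))"
    by (simp add: diffops_fields diamond_diffops_st ev_def)
  also have "\<dots> = T"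
  proof (rule the_equality)
    fix U assume "U \<in> carrier \<D>\<D> \<and> (\<forall>a\<in>carrier B. \<forall>b\<in>carrier B. ev a b U = D (a \<otimes> b))"
    then show "U = T" by (intro ev_inject) (simp_all add: T evT)
  qed (simp add: T evT)
  finally show "cop \<D> D \<in> carrier \<D>\<D>"
    "\<lbrakk>a \<in> carrier B; b \<in> carrier B\<rbrakk> \<Longrightarrow> ev a b (cop \<D> D) = D (a \<otimes> b)"
    using T evT by auto
qed

lemma ev_mult_right:
  assumes "T \<in> carrier \<D>\<D>" "a \<in> carrier B" "b \<in> carrier B"
    and h: "h \<in> hom (add_monoid B) (add_monoid B)"
  shows "tensor_lift (add_monoid B) (\<lambda>(x, y). h (x a \<otimes> y b)) T = h (ev a b T)"
  unfolding ev_def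
  by (rule DT.tensor_lift_comp_hom2[OF B.a_comm_group B.a_comm_group assms(1) h, symmetric])
    (simp add: diffop assms)

end

section \<open>The twisted product\<close>

locale jet_cocycle = coev_jets K B N u E
  for K :: "'k ring" and B :: "('k, 'b) module" (structure) and N u E +
  fixes F :: "(('b \<Rightarrow> 'b) \<times> ('b \<Rightarrow> 'b)) tens"
  assumes cocycle: "left_2cocycle_in K B (diffops K B) F"
begin

definition star (infixl "\<star>" 70) where "a \<star> b = ev a b F"

lemma F_closed: "F \<in> carrier \<D>\<D>"
  using cocycle by (simp add: left_2cocycle_in_def)

lemma star_closed [simp]: "\<lbrakk>a \<in> carrier B; b \<in> carrier B\<rbrakk> \<Longrightarrow> a \<star> b \<in> carrier B"
  by (simp add: star_def ev F_closed)

lemma star_add: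
  "\<lbrakk>a \<in> carrier B; a' \<in> carrier B; b \<in> carrier B\<rbrakk> \<Longrightarrow> (a \<oplus> a') \<star> b = a \<star> b \<oplus> a' \<star> b"
  "\<lbrakk>a \<in> carrier B; b \<in> carrier B; b' \<in> carrier B\<rbrakk> \<Longrightarrow> a \<star> (b \<oplus> b') = a \<star> b \<oplus> a \<star> b'"
  unfolding star_def ev_def
  by (rule DT.tensor_lift_add_cong[OF B.a_comm_group F_closed, simplified monoid.select_convs];
      simp add: diffop B.l_distr B.r_distr)+

lemma smult_hom: "k \<in> carrier K \<Longrightarrow> (\<lambda>a. k \<odot> a) \<in> hom (add_monoid B) (add_monoid B)"
  by (rule homI) (simp_all add: B.smult_r_distr)

lemma star_smult:
  assumes "k \<in> carrier K" "a \<in> carrier B" "b \<in> carrier B"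
  shows "(k \<odot> a) \<star> b = k \<odot> (a \<star> b)" "a \<star> (k \<odot> b) = k \<odot> (a \<star> b)"
  unfolding star_def ev_mult_right[OF F_closed assms(2,3) smult_hom[OF assms(1)], symmetric]
  unfolding ev_def
  by (rule DT.tensor_lift_cong2[OF B.a_comm_group F_closed]; simp add: diffop assms smult_left smult_right)+

lemma star_unit:
  assumes "b \<in> carrier B"
  shows "\<one> \<star> b = b" "b \<star> \<one> = b"
proof -
  have u: "tensor_lift (add_monoid \<D>) (\<lambda>(x, y). src \<D> (cou \<D> x) \<cdot> y) F = \<one>\<^bsub>\<D>\<^esub>"
    "tensor_lift (add_monoid \<D>) (\<lambda>(x, y). tgt \<D> (cou \<D> y) \<cdot> x) F = \<one>\<^bsub>\<D>\<^esub>"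
    using cocycle by (simp_all add: left_2cocycle_in_def)
  have "b = tensor_lift (add_monoid \<D>) (\<lambda>(x, y). src \<D> (cou \<D> x) \<cdot> y) F b"
    using assms by (simp add: u diffop_apply)
  also have "\<dots> = tensor_lift (add_monoid B) (\<lambda>(x, y). (src \<D> (cou \<D> x) \<cdot> y) b) F"
    by (intro DT.tensor_lift_comp_hom2[OF diffops_comm_group B.a_comm_group F_closed apply_hom[OF assms]])
      (simp add: diffop_closed diffop diffops_fields(9))
  also have "\<dots> = \<one> \<star> b"
    unfolding star_def ev_def
    by (intro DT.tensor_lift_cong2[OF B.a_comm_group F_closed])
      (simp_all add: assms diffop_apply diffop diffops_fields(9))
  finally show "\<one> \<star> b = b" by simp
  have "b = tensor_lift (add_monoid \<D>) (\<lambda>(x, y). tgt \<D> (cou \<D> y) \<cdot> x) F b"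
    using assms by (simp add: u diffop_apply)
  also have "\<dots> = tensor_lift (add_monoid B) (\<lambda>(x, y). (tgt \<D> (cou \<D> y) \<cdot> x) b) F"
    by (intro DT.tensor_lift_comp_hom2[OF diffops_comm_group B.a_comm_group F_closed apply_hom[OF assms]])
      (simp add: diffop_closed diffop diffops_fields(9))
  also have "\<dots> = b \<star> \<one>"
    unfolding star_def ev_def
    by (intro DT.tensor_lift_cong2[OF B.a_comm_group F_closed])
      (simp_all add: assms diffop_apply diffop diffops_fields(9))
  finally show "b \<star> \<one> = b" by simp
qed

text \<open>The trilinear form \<open>x \<otimes> y \<otimes> z \<mapsto> x(a) y(b) z(c)\<close> takes the two sides of the cocycle identity to the
  two sides of associativity.\<close>

lemma star_assoc:
  assumes a: "a \<in> carrier B" and b: "b \<in> carrier B" and c: "c \<in> carrier B"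
  shows "(a \<star> b) \<star> c = a \<star> (b \<star> c)"
proof -
  let ?T = "diamond3 K B \<D> \<D> (\<lambda>b y. src \<D> b \<cdot> y)"
  let ?B = "add_monoid B"
  interpret T3: tensor3_data K \<D> \<D> \<D> "carrier B" "\<lambda>b x. tgt \<D> b \<cdot> x" "\<lambda>b y. src \<D> b \<cdot> y"
    "\<lambda>b y. tgt \<D> b \<cdot> y" "\<lambda>b y. src \<D> b \<cdot> y"
    rewrites "tensor3 K \<D> \<D> \<D> (carrier B) (\<lambda>b x. tgt \<D> b \<cdot> x) (\<lambda>b y. src \<D> b \<cdot> y)
      (\<lambda>b y. tgt \<D> b \<cdot> y) (\<lambda>b y. src \<D> b \<cdot> y) = ?T"
    by (rule tensor3_data.intro; (rule diffops_module | simp add: diffop_closed)) (simp only: diamond3_def)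
  have bal: "T3.bal ?B (\<lambda>x y z. x a \<otimes> y b \<otimes> z c)"
    by (rule balanced3I)
      (simp_all add: assms diffop diffop_apply B.l_distr B.r_distr smult_left smult_right B.m_assoc)
  define ev3 where "ev3 = tensor_lift ?B (\<lambda>(x, y, z). x a \<otimes> y b \<otimes> z c)"
  have ev3: "ev3 \<in> hom ?T ?B" "\<And>x y z. \<lbrakk>x \<in> carrier \<D>; y \<in> carrier \<D>; z \<in> carrier \<D>\<rbrakk> \<Longrightarrow>
      ev3 (pure ?T (x, y, z)) = x a \<otimes> y b \<otimes> z c"
    unfolding ev3_def using T3.tensor3_lift_hom[OF B.a_comm_group bal] by auto
  note comp = DT.tensor_lift_comp_hom2[OF T3.comm_group_tensor3 B.a_comm_group _ ev3(1)]
  note cong = DT.tensor_lift_cong2[OF B.a_comm_group]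
  note closed = DT.tensor_lift_closed2[OF T3.comm_group_tensor3]
  have mult_hom: "(\<lambda>t. t \<otimes> r) \<in> hom ?B ?B" "(\<lambda>t. r \<otimes> t) \<in> hom ?B ?B" if "r \<in> carrier B" for r
    using that by (auto intro!: homI simp: B.l_distr B.r_distr)
  have op_hom: "(\<lambda>t. x t \<otimes> r) \<in> hom ?B ?B" "(\<lambda>t. r \<otimes> x t) \<in> hom ?B ?B"
    if "x \<in> carrier \<D>" "r \<in> carrier B" for x r
    using that by (auto intro!: homI simp: B.l_distr B.r_distr diffop)
  define left where "left x y = tensor_lift ?T (\<lambda>(x1, x2). tensor_lift ?T (\<lambda>(p, q).
        pure ?T (x1 \<cdot> p, x2 \<cdot> q, y)) F) (cop \<D> x)" for x y
  define right where "right x y = tensor_lift ?T (\<lambda>(y1, y2). tensor_lift ?T (\<lambda>(p, q).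
        pure ?T (x, y1 \<cdot> p, y2 \<cdot> q)) F) (cop \<D> y)" for x y
  have left_closed: "left x y \<in> carrier ?T" and right_closed: "right x y \<in> carrier ?T"
    if "x \<in> carrier \<D>" "y \<in> carrier \<D>" for x y
    using that unfolding left_def right_def by (auto intro!: closed simp: cop_diffop F_closed diffop_closed)
  have left: "ev3 (left x y) = x (a \<star> b) \<otimes> y c" if x: "x \<in> carrier \<D>" and y: "y \<in> carrier \<D>" for x y
  proof -
    have yc: "y c \<in> carrier B" using y c by (simp add: diffop)
    have "ev3 (left x y) = tensor_lift ?B (\<lambda>(x1, x2). ev3 (tensor_lift ?T (\<lambda>(p, q).
        pure ?T (x1 \<cdot> p, x2 \<cdot> q, y)) F)) (cop \<D> x)"
      unfolding left_def using x y by (intro comp closed) (simp_all add: cop_diffop F_closed diffop_closed)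
    also have "\<dots> = tensor_lift ?B (\<lambda>(x1, x2). tensor_lift ?B (\<lambda>(p, q).
        x1 (p a) \<otimes> x2 (q b) \<otimes> y c) F) (cop \<D> x)"
    proof (rule cong[OF cop_diffop(1)[OF x]])
      fix x1 x2 assume h: "x1 \<in> carrier \<D>" "x2 \<in> carrier \<D>"
      have "ev3 (tensor_lift ?T (\<lambda>(p, q). pure ?T (x1 \<cdot> p, x2 \<cdot> q, y)) F) =
          tensor_lift ?B (\<lambda>(p, q). ev3 (pure ?T (x1 \<cdot> p, x2 \<cdot> q, y))) F"
        using h y by (intro comp) (simp_all add: F_closed diffop_closed)
      also have "\<dots> = tensor_lift ?B (\<lambda>(p, q). x1 (p a) \<otimes> x2 (q b) \<otimes> y c) F"
        using h y by (intro cong) (simp_all add: F_closed diffop_closed ev3(2) diffop_apply assms diffop)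
      finally show "ev3 (tensor_lift ?T (\<lambda>(p, q). pure ?T (x1 \<cdot> p, x2 \<cdot> q, y)) F) =
          tensor_lift ?B (\<lambda>(p, q). x1 (p a) \<otimes> x2 (q b) \<otimes> y c) F" .
    next
      fix x1 x2 assume "x1 \<in> carrier \<D>" "x2 \<in> carrier \<D>"
      then show "tensor_lift ?B (\<lambda>(p, q). x1 (p a) \<otimes> x2 (q b) \<otimes> y c) F \<in> carrier ?B"
        using yc assms by (intro DT.tensor_lift_closed2[OF B.a_comm_group F_closed]) (simp add: diffop)
    qed
    also have "\<dots> = tensor_lift ?B (\<lambda>(p, q). tensor_lift ?B (\<lambda>(x1, x2).
        x1 (p a) \<otimes> x2 (q b) \<otimes> y c) (cop \<D> x)) F"
      using yc assms x
      by (intro tensor_lift_swap2[OF DT.tensor_data_axioms DT.tensor_data_axioms B.a_comm_group, unfolded diffops_tensor_eq])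
        (simp_all add: cop_diffop F_closed diffop)
    also have "\<dots> = tensor_lift ?B (\<lambda>(p, q). x (p a \<otimes> q b) \<otimes> y c) F"
      using yc assms x
      by (intro cong[OF F_closed])
        (simp_all add: ev_mult_right[OF cop_diffop(1)[OF x] _ _ mult_hom(1)] cop_diffop diffop)
    also have "\<dots> = x (a \<star> b) \<otimes> y c"
      unfolding star_def by (rule ev_mult_right[OF F_closed a b op_hom(1)[OF x yc]])
    finally show ?thesis .
  qed
  have right: "ev3 (right x y) = x a \<otimes> y (b \<star> c)" if x: "x \<in> carrier \<D>" and y: "y \<in> carrier \<D>" for x y
  proof -
    have xa: "x a \<in> carrier B" using x a by (simp add: diffop)
    have "ev3 (right x y) = tensor_lift ?B (\<lambda>(y1, y2). ev3 (tensor_lift ?T (\<lambda>(p, q).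
        pure ?T (x, y1 \<cdot> p, y2 \<cdot> q)) F)) (cop \<D> y)"
      unfolding right_def using x y by (intro comp closed) (simp_all add: cop_diffop F_closed diffop_closed)
    also have "\<dots> = tensor_lift ?B (\<lambda>(y1, y2). tensor_lift ?B (\<lambda>(p, q).
        x a \<otimes> (y1 (p b) \<otimes> y2 (q c))) F) (cop \<D> y)"
    proof (rule cong[OF cop_diffop(1)[OF y]])
      fix y1 y2 assume h: "y1 \<in> carrier \<D>" "y2 \<in> carrier \<D>"
      have "ev3 (tensor_lift ?T (\<lambda>(p, q). pure ?T (x, y1 \<cdot> p, y2 \<cdot> q)) F) =
          tensor_lift ?B (\<lambda>(p, q). ev3 (pure ?T (x, y1 \<cdot> p, y2 \<cdot> q))) F"
        using h x by (intro comp) (simp_all add: F_closed diffop_closed)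
      also have "\<dots> = tensor_lift ?B (\<lambda>(p, q). x a \<otimes> (y1 (p b) \<otimes> y2 (q c))) F"
        using h x by (intro cong) (simp_all add: F_closed diffop_closed ev3(2) diffop_apply assms diffop B.m_assoc)
      finally show "ev3 (tensor_lift ?T (\<lambda>(p, q). pure ?T (x, y1 \<cdot> p, y2 \<cdot> q)) F) =
          tensor_lift ?B (\<lambda>(p, q). x a \<otimes> (y1 (p b) \<otimes> y2 (q c))) F" .
    next
      fix y1 y2 assume "y1 \<in> carrier \<D>" "y2 \<in> carrier \<D>"
      then show "tensor_lift ?B (\<lambda>(p, q). x a \<otimes> (y1 (p b) \<otimes> y2 (q c))) F \<in> carrier ?B"
        using xa assms by (intro DT.tensor_lift_closed2[OF B.a_comm_group F_closed]) (simp add: diffop)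
    qed
    also have "\<dots> = tensor_lift ?B (\<lambda>(p, q). tensor_lift ?B (\<lambda>(y1, y2).
        x a \<otimes> (y1 (p b) \<otimes> y2 (q c))) (cop \<D> y)) F"
      using xa assms y
      by (intro tensor_lift_swap2[OF DT.tensor_data_axioms DT.tensor_data_axioms B.a_comm_group, unfolded diffops_tensor_eq])
        (simp_all add: cop_diffop F_closed diffop)
    also have "\<dots> = tensor_lift ?B (\<lambda>(p, q). x a \<otimes> y (p b \<otimes> q c)) F"
      using xa assms y
      by (intro cong[OF F_closed])
        (simp_all add: ev_mult_right[OF cop_diffop(1)[OF y] _ _ mult_hom(2)] cop_diffop diffop)
    also have "\<dots> = x a \<otimes> y (b \<star> c)"
      unfolding star_def by (rule ev_mult_right[OF F_closed b c op_hom(2)[OF y xa]])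
    finally show ?thesis .
  qed
  have eq: "tensor_lift ?T (\<lambda>(x, y). left x y) F = tensor_lift ?T (\<lambda>(x, y). right x y) F"
    using cocycle by (simp add: left_2cocycle_in_def Let_def left_def right_def)
  have "(a \<star> b) \<star> c = tensor_lift ?B (\<lambda>(x, y). ev3 (left x y)) F"
    unfolding star_def[of _ c] ev_def using assms
    by (intro cong[OF F_closed]) (simp_all add: left diffop)
  also have "\<dots> = ev3 (tensor_lift ?T (\<lambda>(x, y). left x y) F)"
    by (intro comp[OF F_closed, symmetric] left_closed)
  also have "\<dots> = ev3 (tensor_lift ?T (\<lambda>(x, y). right x y) F)" by (simp only: eq)
  also have "\<dots> = tensor_lift ?B (\<lambda>(x, y). ev3 (right x y)) F"
    by (intro comp[OF F_closed] right_closed)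
  also have "\<dots> = a \<star> (b \<star> c)"
    unfolding star_def[of a] ev_def using assms
    by (intro cong[OF F_closed]) (simp_all add: right diffop)
  finally show ?thesis .
qed

lemma twist_base_mult: "\<lbrakk>a \<in> carrier B; b \<in> carrier B\<rbrakk> \<Longrightarrow> a \<otimes>\<^bsub>twist_base B \<D> F\<^esub> b = a \<star> b"
  unfolding star_def ev_def twist_base_def
  by (simp, intro DT.tensor_lift_cong2[OF B.a_comm_group F_closed])
    (simp_all add: diffops_fields(9) diffop_apply diffop)

subsection \<open>The cocycle on jets\<close>

definition \<Gamma> where
  "\<Gamma> X Y = tensor_lift (add_monoid B) (\<lambda>(x, y). pairing x X \<otimes> pairing y Y) F"

lemma \<Gamma>_closed [simp]: "\<lbrakk>X \<in> carrier \<J>; Y \<in> carrier \<J>\<rbrakk> \<Longrightarrow> \<Gamma> X Y \<in> carrier B"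
  unfolding \<Gamma>_def using DT.tensor_lift_closed2[OF B.a_comm_group F_closed] by (simp add: pairing)

lemma \<Gamma>_add:
  "\<lbrakk>X \<in> carrier \<J>; X' \<in> carrier \<J>; Y \<in> carrier \<J>\<rbrakk> \<Longrightarrow> \<Gamma> (X \<oplus>\<^bsub>\<J>\<^esub> X') Y = \<Gamma> X Y \<oplus> \<Gamma> X' Y"
  "\<lbrakk>X \<in> carrier \<J>; Y \<in> carrier \<J>; Y' \<in> carrier \<J>\<rbrakk> \<Longrightarrow> \<Gamma> X (Y \<oplus>\<^bsub>\<J>\<^esub> Y') = \<Gamma> X Y \<oplus> \<Gamma> X Y'"
  unfolding \<Gamma>_def
  by (rule DT.tensor_lift_add_cong[OF B.a_comm_group F_closed, simplified monoid.select_convs];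
      simp add: pairing B.l_distr B.r_distr)+

lemma \<Gamma>_jet:
  assumes "a \<in> carrier B" "b \<in> carrier B" "c \<in> carrier B" "d \<in> carrier B"
  shows "\<Gamma> (jt a b) (jt c d) = (a \<star> c) \<otimes> d \<otimes> b"
proof -
  have h: "(\<lambda>t. t \<otimes> d \<otimes> b) \<in> hom (add_monoid B) (add_monoid B)"
    using assms by (intro homI) (auto simp: B.l_distr)
  show ?thesis
    unfolding star_def ev_mult_right[OF F_closed assms(1,3) h, symmetric] \<Gamma>_def
    using assms by (intro DT.tensor_lift_cong2[OF B.a_comm_group F_closed]) (simp_all add: pairing diffop B.m_ac)
qed

theorem \<Gamma>_cocycle: "left_2cocycle_on K B \<J> \<Gamma>"
  by (rule JH.left_2cocycle_onI)
    (simp_all add: \<Gamma>_add \<Gamma>_jet star_smult star_unit star_assoc smult_left smult_right B.m_ac)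

lemma \<Gamma>_balanced:
  assumes "X \<in> carrier \<J>" "Y \<in> carrier \<J>" "e \<in> carrier B"
  shows "\<Gamma> (X \<bullet> tgt \<J> e) Y = \<Gamma> X Y \<otimes> e" "\<Gamma> X (tgt \<J> e \<bullet> Y) = \<Gamma> X Y \<otimes> e"
    "\<Gamma> (tgt \<J> e \<bullet> X) Y = \<Gamma> X Y \<otimes> e" "\<Gamma> X (Y \<bullet> tgt \<J> e) = \<Gamma> X Y \<otimes> e"
proof -
  have 1: "\<Gamma> (X \<bullet> tgt \<J> e) Y = \<Gamma> X (tgt \<J> e \<bullet> Y)"
    and 2: "\<Gamma> (tgt \<J> e \<bullet> X) Y = \<Gamma> X Y \<otimes> e"
    using \<Gamma>_cocycle assms unfolding left_2cocycle_on_def by blast+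
  note comm = J.m_comm[OF JH.tgt_closed[OF assms(3)]]
  show "\<Gamma> (tgt \<J> e \<bullet> X) Y = \<Gamma> X Y \<otimes> e" by (rule 2)
  then show 3: "\<Gamma> (X \<bullet> tgt \<J> e) Y = \<Gamma> X Y \<otimes> e" by (simp only: comm assms)
  show 4: "\<Gamma> X (tgt \<J> e \<bullet> Y) = \<Gamma> X Y \<otimes> e" using 1 3 by (simp only:)
  then show "\<Gamma> X (Y \<bullet> tgt \<J> e) = \<Gamma> X Y \<otimes> e" by (simp only: comm assms)
qed

end

section \<open>The cotwist\<close>

context jet_cocycle
begin

interpretation JJ: comm_group "diamond K B \<J>" by (rule JH.D.comm_group_tensor)

text \<open>The part of the product of the cotwist which involves translations; the factor \<open>c\<close> stands for the
  value of the cocycle on the first legs.\<close>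

definition transl_prod where
  "transl_prod c x y = tensor_lift (add_monoid \<J>) (\<lambda>(xp, xm). tensor_lift (add_monoid \<J>)
     (\<lambda>(yp, ym). c \<bullet> xp \<bullet> yp \<bullet> tgt \<J> (\<Gamma> ym xm)) (translation K B \<J> y)) (translation K B \<J> x)"

lemma transl_prod_bal1:
  assumes "c \<in> carrier \<J>" "x \<in> carrier \<J>" "z \<in> carrier \<J>"
  shows "JH.T.bal (add_monoid \<J>) (\<lambda>yp ym. c \<bullet> x \<bullet> yp \<bullet> tgt \<J> (\<Gamma> ym z))"
    and "JH.T.bal (add_monoid \<J>) (\<lambda>xp xm. c \<bullet> xp \<bullet> x \<bullet> tgt \<J> (\<Gamma> z xm))"
  by (rule JH.bar_balancedI;
      simp add: assms \<Gamma>_add \<Gamma>_balanced JH.tgt_hom_simps J.l_distr J.r_distr J.m_ac)+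

lemma bar_tensor_eq: "tensor K \<J> \<J> (carrier B) (\<lambda>b x. x \<bullet> tgt \<J> b) (\<lambda>b y. tgt \<J> b \<bullet> y) = bar_tensor K B \<J>"
  by (simp only: bar_tensor_def)

lemma transl_prod_bal2:
  assumes "c \<in> carrier \<J>" "y \<in> carrier \<J>"
  shows "JH.T.bal (add_monoid \<J>) (\<lambda>xp xm. tensor_lift (add_monoid \<J>)
     (\<lambda>(yp, ym). c \<bullet> xp \<bullet> yp \<bullet> tgt \<J> (\<Gamma> ym xm)) (translation K B \<J> y))"
  using balanced_tensor_lift[OF JH.T.tensor_data_axioms JH.T.tensor_data_axioms J.a_comm_group,
      unfolded bar_tensor_eq, of "translation K B \<J> y"
        "\<lambda>xp xm yp ym. c \<bullet> xp \<bullet> yp \<bullet> tgt \<J> (\<Gamma> ym xm)"] assms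
  by (simp add: JH.translation_closed transl_prod_bal1)

lemma transl_prod:
  shows "\<lbrakk>c \<in> carrier \<J>; x \<in> carrier \<J>; y \<in> carrier \<J>\<rbrakk> \<Longrightarrow> transl_prod c x y \<in> carrier \<J>"
    and "\<lbrakk>c \<in> carrier \<J>; x \<in> carrier \<J>; x' \<in> carrier \<J>; y \<in> carrier \<J>\<rbrakk> \<Longrightarrow>
      transl_prod c (x \<oplus>\<^bsub>\<J>\<^esub> x') y = transl_prod c x y \<oplus>\<^bsub>\<J>\<^esub> transl_prod c x' y"
    and "\<lbrakk>c \<in> carrier \<J>; x \<in> carrier \<J>; y \<in> carrier \<J>; y' \<in> carrier \<J>\<rbrakk> \<Longrightarrow>
      transl_prod c x (y \<oplus>\<^bsub>\<J>\<^esub> y') = transl_prod c x y \<oplus>\<^bsub>\<J>\<^esub> transl_prod c x y'"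
    and "\<lbrakk>c \<in> carrier \<J>; a \<in> carrier B; b \<in> carrier B; e \<in> carrier B; d \<in> carrier B\<rbrakk> \<Longrightarrow>
      transl_prod c (jt a b) (jt e d) = c \<bullet> jt (a \<otimes> e) (d \<star> b)"
proof -
  note l1 = JH.translation_lift[OF J.a_comm_group transl_prod_bal1(1)]
  note l2 = JH.translation_lift[OF J.a_comm_group transl_prod_bal2]
  show "\<lbrakk>c \<in> carrier \<J>; x \<in> carrier \<J>; y \<in> carrier \<J>\<rbrakk> \<Longrightarrow> transl_prod c x y \<in> carrier \<J>"
    unfolding transl_prod_def using l2(1) by simp
  show "\<lbrakk>c \<in> carrier \<J>; x \<in> carrier \<J>; x' \<in> carrier \<J>; y \<in> carrier \<J>\<rbrakk> \<Longrightarrow>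
      transl_prod c (x \<oplus>\<^bsub>\<J>\<^esub> x') y = transl_prod c x y \<oplus>\<^bsub>\<J>\<^esub> transl_prod c x' y"
    unfolding transl_prod_def using l2(2) by simp
  show "\<lbrakk>c \<in> carrier \<J>; x \<in> carrier \<J>; y \<in> carrier \<J>; y' \<in> carrier \<J>\<rbrakk> \<Longrightarrow>
      transl_prod c x (y \<oplus>\<^bsub>\<J>\<^esub> y') = transl_prod c x y \<oplus>\<^bsub>\<J>\<^esub> transl_prod c x y'"
    unfolding transl_prod_def
    by (rule JH.T.tensor_lift_add_cong[OF J.a_comm_group, simplified monoid.select_convs])
      (use l1(1,2) in \<open>simp_all add: JH.translation_closed\<close>)
  show "\<lbrakk>c \<in> carrier \<J>; a \<in> carrier B; b \<in> carrier B; e \<in> carrier B; d \<in> carrier B\<rbrakk> \<Longrightarrow>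
      transl_prod c (jt a b) (jt e d) = c \<bullet> jt (a \<otimes> e) (d \<star> b)"
    unfolding transl_prod_def
    by (simp only: l2(3) l1(3) jt_closed B.one_closed) (simp add: \<Gamma>_jet J.m_assoc jt_mult jets_fields(8))
qed

definition unit_prod where "unit_prod = transl_prod \<one>\<^bsub>\<J>\<^esub>"

lemma unit_prod:
  "\<lbrakk>x \<in> carrier \<J>; y \<in> carrier \<J>\<rbrakk> \<Longrightarrow> unit_prod x y \<in> carrier \<J>"
  "\<lbrakk>x \<in> carrier \<J>; x' \<in> carrier \<J>; y \<in> carrier \<J>\<rbrakk> \<Longrightarrow> unit_prod (x \<oplus>\<^bsub>\<J>\<^esub> x') y = unit_prod x y \<oplus>\<^bsub>\<J>\<^esub> unit_prod x' y"
  "\<lbrakk>x \<in> carrier \<J>; y \<in> carrier \<J>; y' \<in> carrier \<J>\<rbrakk> \<Longrightarrow> unit_prod x (y \<oplus>\<^bsub>\<J>\<^esub> y') = unit_prod x y \<oplus>\<^bsub>\<J>\<^esub> unit_prod x y'"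
  "\<lbrakk>a \<in> carrier B; b \<in> carrier B; e \<in> carrier B; d \<in> carrier B\<rbrakk> \<Longrightarrow>
      unit_prod (jt a b) (jt e d) = jt (a \<otimes> e) (d \<star> b)"
  by (simp_all add: unit_prod_def transl_prod)

lemma transl_prod_unit_prod:
  assumes "c \<in> carrier \<J>" "x \<in> carrier \<J>" "y \<in> carrier \<J>"
  shows "transl_prod c x y = c \<bullet> unit_prod x y"
  using assms(2,3)
  by (rule_tac JH.biadditive_eqI[where f = "transl_prod c" and g = "\<lambda>x y. c \<bullet> unit_prod x y" and H = "add_monoid \<J>"])
    (simp_all add: assms(1) transl_prod unit_prod J.r_distr)

lemma unit_prod_src:
  assumes "e \<in> carrier B" "x \<in> carrier \<J>" "y \<in> carrier \<J>"
  shows "unit_prod (src \<J> e \<bullet> x) y = src \<J> e \<bullet> unit_prod x y"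
    "unit_prod x (src \<J> e \<bullet> y) = src \<J> e \<bullet> unit_prod x y"
  subgoal
    using assms(2,3)
    by (rule_tac JH.biadditive_eqI[where f = "\<lambda>x y. unit_prod (src \<J> e \<bullet> x) y"
          and g = "\<lambda>x y. src \<J> e \<bullet> unit_prod x y" and H = "add_monoid \<J>"])
      (simp_all add: assms(1) unit_prod J.r_distr B.m_assoc)
  subgoal
    using assms(2,3)
    by (rule_tac JH.biadditive_eqI[where f = "\<lambda>x y. unit_prod x (src \<J> e \<bullet> y)"
          and g = "\<lambda>x y. src \<J> e \<bullet> unit_prod x y" and H = "add_monoid \<J>"])
      (simp_all add: assms(1) unit_prod J.r_distr B.m_ac)
  done

abbreviation JG where "JG \<equiv> cotwist K B \<J> \<Gamma>"
abbreviation BG where "BG \<equiv> cotwist_base B \<J> \<Gamma>"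

lemma BG_fields [simp]:
  "carrier BG = carrier B" "add BG = add B" "zero BG = zero B" "one BG = one B" "smult BG = smult B"
  by (simp_all add: cotwist_base_def)

lemma BG_mult [simp]: "\<lbrakk>a \<in> carrier B; b \<in> carrier B\<rbrakk> \<Longrightarrow> a \<otimes>\<^bsub>BG\<^esub> b = a \<star> b"
  by (simp add: cotwist_base_def jets_fields(7) \<Gamma>_jet)

lemma JG_fields [simp]:
  "carrier JG = carrier \<J>" "add JG = add \<J>" "zero JG = zero \<J>" "one JG = one \<J>" "smult JG = smult \<J>"
  "src JG = src \<J>" "tgt JG = tgt \<J>"
  by (simp_all add: cotwist_def cotwist_algebra_def)

lemma JG_mult_def:
  assumes "X \<in> carrier \<J>" "Y \<in> carrier \<J>"
  shows "X \<otimes>\<^bsub>JG\<^esub> Y = tensor_lift (add_monoid \<J>) (\<lambda>(x1, x2). tensor_lift (add_monoid \<J>)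
    (\<lambda>(y1, y2). src \<J> (\<Gamma> x1 y1) \<bullet> unit_prod x2 y2) (cop \<J> Y)) (cop \<J> X)"
proof -
  have "X \<otimes>\<^bsub>JG\<^esub> Y = tensor_lift (add_monoid \<J>) (\<lambda>(x1, x2). tensor_lift (add_monoid \<J>)
    (\<lambda>(y1, y2). transl_prod (src \<J> (\<Gamma> x1 y1)) x2 y2) (cop \<J> Y)) (cop \<J> X)"
    by (simp add: cotwist_def cotwist_algebra_def transl_prod_def)
  also have "\<dots> = tensor_lift (add_monoid \<J>) (\<lambda>(x1, x2). tensor_lift (add_monoid \<J>)
    (\<lambda>(y1, y2). src \<J> (\<Gamma> x1 y1) \<bullet> unit_prod x2 y2) (cop \<J> Y)) (cop \<J> X)"
    using assms
    by (intro JH.D.tensor_lift_cong2[OF J.a_comm_group] JH.D.tensor_lift_closed2[OF J.a_comm_group])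
      (simp_all add: JH.cop_closed transl_prod_unit_prod unit_prod)
  finally show ?thesis .
qed

lemma JG_mult_bal1:
  assumes "x1 \<in> carrier \<J>" "x2 \<in> carrier \<J>"
  shows "JH.D.bal (add_monoid \<J>) (\<lambda>y1 y2. src \<J> (\<Gamma> x1 y1) \<bullet> unit_prod x2 y2)"
    and "JH.D.bal (add_monoid \<J>) (\<lambda>y1 y2. src \<J> (\<Gamma> y1 x1) \<bullet> unit_prod y2 x2)"
  by (rule JH.diamond_balancedI;
      simp add: assms \<Gamma>_add unit_prod J.l_distr J.r_distr \<Gamma>_balanced unit_prod_src JH.src_hom_simps J.m_assoc)+

lemma JG_mult_bal2:
  assumes "Y \<in> carrier \<J>"
  shows "JH.D.bal (add_monoid \<J>) (\<lambda>x1 x2. tensor_lift (add_monoid \<J>)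
    (\<lambda>(y1, y2). src \<J> (\<Gamma> x1 y1) \<bullet> unit_prod x2 y2) (cop \<J> Y))"
  using balanced_tensor_lift[OF JH.D.tensor_data_axioms JH.D.tensor_data_axioms J.a_comm_group,
      unfolded JH.diamond_tensor, of "cop \<J> Y"
        "\<lambda>x1 x2 y1 y2. src \<J> (\<Gamma> x1 y1) \<bullet> unit_prod x2 y2"] assms
  by (simp add: JH.cop_closed JG_mult_bal1)

lemma JG_mult:
  shows "\<lbrakk>X \<in> carrier \<J>; Y \<in> carrier \<J>\<rbrakk> \<Longrightarrow> X \<otimes>\<^bsub>JG\<^esub> Y \<in> carrier \<J>"
    and "\<lbrakk>X \<in> carrier \<J>; X' \<in> carrier \<J>; Y \<in> carrier \<J>\<rbrakk> \<Longrightarrow>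
      (X \<oplus>\<^bsub>\<J>\<^esub> X') \<otimes>\<^bsub>JG\<^esub> Y = X \<otimes>\<^bsub>JG\<^esub> Y \<oplus>\<^bsub>\<J>\<^esub> X' \<otimes>\<^bsub>JG\<^esub> Y"
    and "\<lbrakk>X \<in> carrier \<J>; Y \<in> carrier \<J>; Y' \<in> carrier \<J>\<rbrakk> \<Longrightarrow>
      X \<otimes>\<^bsub>JG\<^esub> (Y \<oplus>\<^bsub>\<J>\<^esub> Y') = X \<otimes>\<^bsub>JG\<^esub> Y \<oplus>\<^bsub>\<J>\<^esub> X \<otimes>\<^bsub>JG\<^esub> Y'"
    and "\<lbrakk>a \<in> carrier B; b \<in> carrier B; c \<in> carrier B; d \<in> carrier B\<rbrakk> \<Longrightarrow>
      jt a b \<otimes>\<^bsub>JG\<^esub> jt c d = jt (a \<star> c) (d \<star> b)"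
proof -
  note l1 = JH.cop_lift[OF J.a_comm_group JG_mult_bal1(1)]
  note l2 = JH.cop_lift[OF J.a_comm_group JG_mult_bal2]
  show "\<lbrakk>X \<in> carrier \<J>; Y \<in> carrier \<J>\<rbrakk> \<Longrightarrow> X \<otimes>\<^bsub>JG\<^esub> Y \<in> carrier \<J>"
    using l2(1) by (simp add: JG_mult_def)
  show "\<lbrakk>X \<in> carrier \<J>; X' \<in> carrier \<J>; Y \<in> carrier \<J>\<rbrakk> \<Longrightarrow>
      (X \<oplus>\<^bsub>\<J>\<^esub> X') \<otimes>\<^bsub>JG\<^esub> Y = X \<otimes>\<^bsub>JG\<^esub> Y \<oplus>\<^bsub>\<J>\<^esub> X' \<otimes>\<^bsub>JG\<^esub> Y"
    using l2(2) by (simp add: JG_mult_def)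
  show "\<lbrakk>X \<in> carrier \<J>; Y \<in> carrier \<J>; Y' \<in> carrier \<J>\<rbrakk> \<Longrightarrow>
      X \<otimes>\<^bsub>JG\<^esub> (Y \<oplus>\<^bsub>\<J>\<^esub> Y') = X \<otimes>\<^bsub>JG\<^esub> Y \<oplus>\<^bsub>\<J>\<^esub> X \<otimes>\<^bsub>JG\<^esub> Y'"
    by (simp add: JG_mult_def,
        rule JH.D.tensor_lift_add_cong[OF J.a_comm_group, simplified monoid.select_convs])
      (use l1(1,2) in \<open>simp_all add: JH.cop_closed\<close>)
  show "\<lbrakk>a \<in> carrier B; b \<in> carrier B; c \<in> carrier B; d \<in> carrier B\<rbrakk> \<Longrightarrow>
      jt a b \<otimes>\<^bsub>JG\<^esub> jt c d = jt (a \<star> c) (d \<star> b)"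
    by (simp add: JG_mult_def l2(3) l1(3) \<Gamma>_jet unit_prod)
qed

lemma BG_algebra: "unital_algebra K BG"
proof -
  have "abelian_group BG"
    by (rule abelian_groupI) (auto simp: B.a_ac intro!: bexI[of _ "\<ominus> _"] B.l_neg)
  then show ?thesis
    by (intro unital_algebra.intro unital_algebra_axioms.intro moduleI ringI monoidI B.R.cring_axioms)
      (simp_all add: B.smult_l_distr B.smult_r_distr B.smult_assoc1 star_assoc star_unit star_add star_smult)
qed

lemma JG_module: "module K JG"
proof -
  interpret Jm: module K \<J> by (rule jets_module)
  have "abelian_group JG"
    by (rule abelian_groupI) (auto simp: J.a_ac intro!: bexI[of _ "\<ominus>\<^bsub>\<J>\<^esub> _"] J.l_neg)
  then show ?thesis
    by (intro moduleI B.R.cring_axioms) (simp_all add: Jm.smult_l_distr Jm.smult_r_distr Jm.smult_assoc1)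
qed

subsection \<open>The coproduct of the cotwist\<close>

abbreviation JJG where "JJG \<equiv> diamond K BG JG"

lemma tgt_JG_mult: "\<lbrakk>e \<in> carrier B; a \<in> carrier B; b \<in> carrier B\<rbrakk> \<Longrightarrow> tgt \<J> e \<otimes>\<^bsub>JG\<^esub> jt a b = jt a (b \<star> e)"
  "\<lbrakk>e \<in> carrier B; a \<in> carrier B; b \<in> carrier B\<rbrakk> \<Longrightarrow> src \<J> e \<otimes>\<^bsub>JG\<^esub> jt a b = jt (e \<star> a) b"
  by (simp_all add: jets_fields(7,8) JG_mult star_unit)

lemma JJG_eq: "tensor K JG JG (carrier B) (\<lambda>b. mult JG (tgt \<J> b)) (\<lambda>b. mult JG (src \<J> b)) = JJG"
  by (simp add: diamond_def diamond_mod_def)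

interpretation G: tensor_data K JG JG "carrier B" "\<lambda>b. mult JG (tgt \<J> b)" "\<lambda>b. mult JG (src \<J> b)"
    rewrites "tensor K JG JG (carrier B) (\<lambda>b. mult JG (tgt \<J> b)) (\<lambda>b. mult JG (src \<J> b)) = JJG"
  by (rule tensor_data.intro; (rule JG_module | simp add: JG_mult jets_fields(7,8))) (rule JJG_eq)

interpretation JJG: comm_group JJG by (rule G.comm_group_tensor)

lemmas G_pure = balancedD[OF G.balanced_pure, simplified]

lemma G_pure_jet:
  assumes "a \<in> carrier B" "b \<in> carrier B" "c \<in> carrier B" "d \<in> carrier B"
  shows "pure JJG (jt a b, jt c d) = pure JJG (jt a (b \<star> c), jt \<one> d)"
  using G_pure(5)[of c "jt a b" "jt \<one> d"] assms by (simp add: tgt_JG_mult star_unit)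

lemma G_balanced_jetI:
  assumes "\<And>x y. \<lbrakk>x \<in> carrier \<J>; y \<in> carrier \<J>\<rbrakk> \<Longrightarrow> f x y \<in> carrier H"
    and "\<And>x x' y. \<lbrakk>x \<in> carrier \<J>; x' \<in> carrier \<J>; y \<in> carrier \<J>\<rbrakk> \<Longrightarrow> f (x \<oplus>\<^bsub>\<J>\<^esub> x') y = f x y \<otimes>\<^bsub>H\<^esub> f x' y"
    and "\<And>x y y'. \<lbrakk>x \<in> carrier \<J>; y \<in> carrier \<J>; y' \<in> carrier \<J>\<rbrakk> \<Longrightarrow> f x (y \<oplus>\<^bsub>\<J>\<^esub> y') = f x y \<otimes>\<^bsub>H\<^esub> f x y'"
    and "\<And>e a b c d. \<lbrakk>e \<in> carrier B; a \<in> carrier B; b \<in> carrier B; c \<in> carrier B; d \<in> carrier B\<rbrakk> \<Longrightarrow>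
      f (jt a (b \<star> e)) (jt c d) = f (jt a b) (jt (e \<star> c) d)"
  shows "G.bal H f"
proof (rule balancedI; simp)
  interpret Jm: module K \<J> by (rule jets_module)
  have b: "f (tgt \<J> e \<otimes>\<^bsub>JG\<^esub> x) y = f x (src \<J> e \<otimes>\<^bsub>JG\<^esub> y)"
    if e: "e \<in> carrier B" and xy: "x \<in> carrier \<J>" "y \<in> carrier \<J>" for e x y
    using xy
    by (rule_tac JH.biadditive_eqI[where f = "\<lambda>x y. f (tgt \<J> e \<otimes>\<^bsub>JG\<^esub> x) y"
          and g = "\<lambda>x y. f x (src \<J> e \<otimes>\<^bsub>JG\<^esub> y)" and H = H])
      (simp_all add: e JG_mult assms tgt_JG_mult)
  show "f (tgt \<J> e \<otimes>\<^bsub>JG\<^esub> x) y = f x (src \<J> e \<otimes>\<^bsub>JG\<^esub> y)"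
    if "e \<in> carrier B" "x \<in> carrier \<J>" "y \<in> carrier \<J>" for e x y
    by (rule b[OF that])
  show "f (k \<odot>\<^bsub>\<J>\<^esub> x) y = f x (k \<odot>\<^bsub>\<J>\<^esub> y)" if k: "k \<in> carrier K" and xy: "x \<in> carrier \<J>" "y \<in> carrier \<J>" for k x y
    using xy
  proof (rule_tac JH.biadditive_eqI[where f = "\<lambda>x y. f (k \<odot>\<^bsub>\<J>\<^esub> x) y" and g = "\<lambda>x y. f x (k \<odot>\<^bsub>\<J>\<^esub> y)" and H = H])
    fix a b c d assume h: "a \<in> carrier B" "b \<in> carrier B" "c \<in> carrier B" "d \<in> carrier B"
    have k1: "b \<star> (k \<odot> \<one>) = k \<odot> b" "(k \<odot> \<one>) \<star> c = k \<odot> c"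
      using h k by (simp_all add: star_smult star_unit)
    show "f (k \<odot>\<^bsub>\<J>\<^esub> jt a b) (jt c d) = f (jt a b) (k \<odot>\<^bsub>\<J>\<^esub> jt c d)"
      using assms(4)[of "k \<odot> \<one>" a b c d] h k unfolding k1 by (simp add: jt_smult(2)[of _ a] jt_smult(1)[of _ c])
  qed (simp_all add: k assms Jm.smult_r_distr)
qed (simp_all add: assms)

definition cotwist_term where
  "cotwist_term X Y = tensor_lift (diamond K B \<J>) (\<lambda>(xp, xm). tensor_lift (diamond K B \<J>)
     (\<lambda>(y1, y2). pure (diamond K B \<J>) (xp \<bullet> tgt \<J> (\<Gamma> xm y1), y2)) (cop \<J> Y)) (translation K B \<J> X)"

lemma cotwist_term_bal1:
  "\<lbrakk>xp \<in> carrier \<J>; xm \<in> carrier \<J>\<rbrakk> \<Longrightarrow>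
    JH.D.bal (diamond K B \<J>) (\<lambda>y1 y2. pure (diamond K B \<J>) (xp \<bullet> tgt \<J> (\<Gamma> xm y1), y2))"
proof (rule JH.diamond_balancedI)
  fix b x y assume h: "xp \<in> carrier \<J>" "xm \<in> carrier \<J>" "b \<in> carrier B" "x \<in> carrier \<J>" "y \<in> carrier \<J>"
  have "xp \<bullet> tgt \<J> (\<Gamma> xm (tgt \<J> b \<bullet> x)) = tgt \<J> b \<bullet> (xp \<bullet> tgt \<J> (\<Gamma> xm x))"
    using h by (simp add: \<Gamma>_balanced JH.tgt_hom_simps J.m_ac)
  then show "pure (diamond K B \<J>) (xp \<bullet> tgt \<J> (\<Gamma> xm (tgt \<J> b \<bullet> x)), y) =
      pure (diamond K B \<J>) (xp \<bullet> tgt \<J> (\<Gamma> xm x), src \<J> b \<bullet> y)"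
    using h by (simp add: JH.diamond_pure(5))
qed (simp_all add: \<Gamma>_add JH.tgt_hom_simps J.r_distr JH.diamond_pure(2,3))

lemma cotwist_term_bal2:
  assumes "Y \<in> carrier \<J>"
  shows "JH.T.bal (diamond K B \<J>) (\<lambda>xp xm. tensor_lift (diamond K B \<J>)
     (\<lambda>(y1, y2). pure (diamond K B \<J>) (xp \<bullet> tgt \<J> (\<Gamma> xm y1), y2)) (cop \<J> Y))"
proof -
  have "JH.T.bal (diamond K B \<J>) (\<lambda>xp xm. pure (diamond K B \<J>) (xp \<bullet> tgt \<J> (\<Gamma> xm y1), y2))"
    if "y1 \<in> carrier \<J>" "y2 \<in> carrier \<J>" for y1 y2
    using that
    by (rule_tac JH.bar_balancedI)
      (simp_all add: \<Gamma>_add \<Gamma>_balanced JH.tgt_hom_simps J.l_distr J.r_distr JH.diamond_pure(2,3) J.m_ac)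
  then show ?thesis
    using balanced_tensor_lift[OF JH.T.tensor_data_axioms JH.D.tensor_data_axioms JJ.comm_group_axioms,
        unfolded bar_tensor_eq JH.diamond_tensor, of "cop \<J> Y"
          "\<lambda>xp xm y1 y2. pure (diamond K B \<J>) (xp \<bullet> tgt \<J> (\<Gamma> xm y1), y2)"] assms
    by (simp add: JH.cop_closed)
qed

lemma cotwist_term:
  shows "\<lbrakk>X \<in> carrier \<J>; Y \<in> carrier \<J>\<rbrakk> \<Longrightarrow> cotwist_term X Y \<in> carrier (diamond K B \<J>)"
    and "\<lbrakk>X \<in> carrier \<J>; X' \<in> carrier \<J>; Y \<in> carrier \<J>\<rbrakk> \<Longrightarrow>
      cotwist_term (X \<oplus>\<^bsub>\<J>\<^esub> X') Y = cotwist_term X Y \<otimes>\<^bsub>diamond K B \<J>\<^esub> cotwist_term X' Y"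
    and "\<lbrakk>X \<in> carrier \<J>; Y \<in> carrier \<J>; Y' \<in> carrier \<J>\<rbrakk> \<Longrightarrow>
      cotwist_term X (Y \<oplus>\<^bsub>\<J>\<^esub> Y') = cotwist_term X Y \<otimes>\<^bsub>diamond K B \<J>\<^esub> cotwist_term X Y'"
    and "\<lbrakk>a \<in> carrier B; b \<in> carrier B; c \<in> carrier B; d \<in> carrier B\<rbrakk> \<Longrightarrow>
      cotwist_term (jt a b) (jt c d) = pure (diamond K B \<J>) (jt a (b \<star> c), jt \<one> d)"
proof -
  note l1 = JH.cop_lift[OF JJ.comm_group_axioms cotwist_term_bal1]
  note l2 = JH.translation_lift[OF JJ.comm_group_axioms cotwist_term_bal2]
  show "\<lbrakk>X \<in> carrier \<J>; Y \<in> carrier \<J>\<rbrakk> \<Longrightarrow> cotwist_term X Y \<in> carrier (diamond K B \<J>)"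
    unfolding cotwist_term_def using l2(1) by simp
  show "\<lbrakk>X \<in> carrier \<J>; X' \<in> carrier \<J>; Y \<in> carrier \<J>\<rbrakk> \<Longrightarrow>
      cotwist_term (X \<oplus>\<^bsub>\<J>\<^esub> X') Y = cotwist_term X Y \<otimes>\<^bsub>diamond K B \<J>\<^esub> cotwist_term X' Y"
    unfolding cotwist_term_def using l2(2) by simp
  show "\<lbrakk>X \<in> carrier \<J>; Y \<in> carrier \<J>; Y' \<in> carrier \<J>\<rbrakk> \<Longrightarrow>
      cotwist_term X (Y \<oplus>\<^bsub>\<J>\<^esub> Y') = cotwist_term X Y \<otimes>\<^bsub>diamond K B \<J>\<^esub> cotwist_term X Y'"
    unfolding cotwist_term_def
    by (rule JH.T.tensor_lift_add_cong[OF JJ.comm_group_axioms])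
      (use l1(1,2) in \<open>simp_all add: JH.translation_closed\<close>)
  show "\<lbrakk>a \<in> carrier B; b \<in> carrier B; c \<in> carrier B; d \<in> carrier B\<rbrakk> \<Longrightarrow>
      cotwist_term (jt a b) (jt c d) = pure (diamond K B \<J>) (jt a (b \<star> c), jt \<one> d)"
    unfolding cotwist_term_def
    by (simp only: l2(3) l1(3) jt_closed B.one_closed) (simp add: \<Gamma>_jet jets_fields(8) jt_mult)
qed

abbreviation "\<Phi> \<equiv> cotwist_map K B \<J> \<Gamma>"

lemma cotwist_map_hom: "\<Phi> \<in> hom JJG (diamond K B \<J>)"
  and cotwist_map_pure: "\<lbrakk>a \<in> carrier B; b \<in> carrier B; c \<in> carrier B; d \<in> carrier B\<rbrakk> \<Longrightarrow>
    \<Phi> (pure JJG (jt a b, jt c d)) = pure (diamond K B \<J>) (jt a (b \<star> c), jt \<one> d)"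
proof -
  have bal: "G.bal (diamond K B \<J>) cotwist_term"
    by (rule G_balanced_jetI) (simp_all add: cotwist_term star_assoc)
  have eq: "\<Phi> = tensor_lift (diamond K B \<J>) (\<lambda>(X, Y). cotwist_term X Y)"
    by (simp add: cotwist_map_def cotwist_term_def Let_def)
  note l = G.tensor_lift_hom[OF JJ.comm_group_axioms bal]
  show "\<Phi> \<in> hom JJG (diamond K B \<J>)"
    unfolding eq by (rule l(1))
  show "\<lbrakk>a \<in> carrier B; b \<in> carrier B; c \<in> carrier B; d \<in> carrier B\<rbrakk> \<Longrightarrow>
    \<Phi> (pure JJG (jt a b, jt c d)) = pure (diamond K B \<J>) (jt a (b \<star> c), jt \<one> d)"
    unfolding eq using l(2)[of "jt a b" "jt c d"] by (simp add: cotwist_term)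
qed

text \<open>On symbols \<open>\<Gamma>\<^sup>#\<close> takes \<open>[a \<otimes> b] \<diamond> [c \<otimes> d]\<close> to \<open>[a \<otimes> b \<star> c] \<diamond> [1 \<otimes> d]\<close>. Over the twisted base every pair
  of symbols equals one with \<open>c = 1\<close>, so the inverse has to take \<open>[a \<otimes> b] \<diamond> [c \<otimes> d]\<close> to
  \<open>[a \<otimes> bc] \<diamond> [1 \<otimes> d]\<close>. Expanding the jet \<open>[a \<otimes> bc]\<close> gives a formula for arbitrary arguments.\<close>

definition untwist where
  "untwist = tensor_lift JJG (\<lambda>(X, Y). \<Otimes>\<^bsub>JJG\<^esub>i\<in>{..<N}. pure JJG (jt (u i) \<one>, src \<J> (pairing (E i) X) \<bullet> Y))"

lemma untwist_term:
  assumes h: "a \<in> carrier B" "b \<in> carrier B" "c \<in> carrier B" "d \<in> carrier B"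
  shows "(\<Otimes>\<^bsub>JJG\<^esub>i\<in>{..<N}. pure JJG (jt (u i) \<one>, src \<J> (pairing (E i) (jt a b)) \<bullet> jt c d)) =
    pure JJG (jt a (b \<otimes> c), jt \<one> d)"
proof -
  have hom: "(\<lambda>X. pure JJG (X, jt \<one> d)) \<in> hom (add_monoid \<J>) JJG"
    using h G.pure_tensor_closed by (intro homI) (auto simp: G_pure)
  let ?X = "jt a (b \<otimes> c)"
  have pc: "pure JJG (X, Y) \<in> carrier JJG" if "X \<in> carrier \<J>" "Y \<in> carrier \<J>" for X Y
    using that by (simp add: G_pure)
  have "(\<Otimes>\<^bsub>JJG\<^esub>i\<in>{..<N}. pure JJG (jt (u i) \<one>, src \<J> (pairing (E i) (jt a b)) \<bullet> jt c d)) =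
      (\<Otimes>\<^bsub>JJG\<^esub>i\<in>{..<N}. pure JJG (jt (u i) (pairing (E i) ?X), jt \<one> d))"
  proof (rule JJG.finprod_cong')
    fix i assume "i \<in> {..<N}"
    then have i: "i < N" by simp
    have "pure JJG (jt (u i) \<one>, jt (E i a \<otimes> b \<otimes> c) d) = pure JJG (jt (u i) (\<one> \<star> (E i a \<otimes> b \<otimes> c)), jt \<one> d)"
      using i h by (intro G_pure_jet) (auto simp: u_closed diffop_E)
    then show "pure JJG (jt (u i) \<one>, src \<J> (pairing (E i) (jt a b)) \<bullet> jt c d) =
        pure JJG (jt (u i) (pairing (E i) ?X), jt \<one> d)"
      using i h by (simp add: pairing[OF E_diffop] diffop_E star_unit B.m_assoc)
  qed (use h in \<open>auto intro!: pc jt_closed B.m_closed simp: u_closed pairing[OF E_diffop] diffop[OF E_diffop]\<close>)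
  also have "\<dots> = pure JJG (\<Oplus>\<^bsub>\<J>\<^esub>i\<in>{..<N}. jt (u i) (pairing (E i) ?X), jt \<one> d)"
    by (rule hom_finprod_finsum[OF J.abelian_group_axioms JJG.comm_group_axioms hom, symmetric])
      (use h in \<open>simp_all add: Pi_iff u_closed pairing(1)[OF E_diffop]\<close>)
  also have "(\<Oplus>\<^bsub>\<J>\<^esub>i\<in>{..<N}. jt (u i) (pairing (E i) ?X)) = ?X"
    using h by (intro jets_expand[symmetric]) simp
  finally show ?thesis .
qed

lemma untwist_hom: "untwist \<in> hom (diamond K B \<J>) JJG"
  and untwist_pure: "\<lbrakk>a \<in> carrier B; b \<in> carrier B; c \<in> carrier B; d \<in> carrier B\<rbrakk> \<Longrightarrow>
    untwist (pure (diamond K B \<J>) (jt a b, jt c d)) = pure JJG (jt a (b \<otimes> c), jt \<one> d)"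
proof -
  have pc: "pure JJG (X, Y) \<in> carrier JJG" if "X \<in> carrier \<J>" "Y \<in> carrier \<J>" for X Y
    using that by (simp add: G_pure)
  have bal: "JH.D.bal JJG (\<lambda>X Y. \<Otimes>\<^bsub>JJG\<^esub>i\<in>{..<N}. pure JJG (jt (u i) \<one>, src \<J> (pairing (E i) X) \<bullet> Y))"
  proof (rule JH.diamond_balanced_jetI)
    fix e a b c d assume "e \<in> carrier B" "a \<in> carrier B" "b \<in> carrier B" "c \<in> carrier B" "d \<in> carrier B"
    then show "(\<Otimes>\<^bsub>JJG\<^esub>i\<in>{..<N}. pure JJG (jt (u i) \<one>, src \<J> (pairing (E i) (jt a (b \<otimes> e))) \<bullet> jt c d)) =
      (\<Otimes>\<^bsub>JJG\<^esub>i\<in>{..<N}. pure JJG (jt (u i) \<one>, src \<J> (pairing (E i) (jt a b)) \<bullet> jt (e \<otimes> c) d))"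
      by (simp only: untwist_term B.m_closed B.m_assoc)
  next
    fix x x' y assume "x \<in> carrier \<J>" "x' \<in> carrier \<J>" "y \<in> carrier \<J>"
    then show "(\<Otimes>\<^bsub>JJG\<^esub>i\<in>{..<N}. pure JJG (jt (u i) \<one>, src \<J> (pairing (E i) (x \<oplus>\<^bsub>\<J>\<^esub> x')) \<bullet> y)) =
      (\<Otimes>\<^bsub>JJG\<^esub>i\<in>{..<N}. pure JJG (jt (u i) \<one>, src \<J> (pairing (E i) x) \<bullet> y)) \<otimes>\<^bsub>JJG\<^esub>
      (\<Otimes>\<^bsub>JJG\<^esub>i\<in>{..<N}. pure JJG (jt (u i) \<one>, src \<J> (pairing (E i) x') \<bullet> y))"
      by (intro JJG.finprod_mult_cong)
        (auto intro!: pc simp: u_closed pairing[OF E_diffop] JH.src_hom_simps J.l_distr G_pure(3))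
  next
    fix x y y' assume "x \<in> carrier \<J>" "y \<in> carrier \<J>" "y' \<in> carrier \<J>"
    then show "(\<Otimes>\<^bsub>JJG\<^esub>i\<in>{..<N}. pure JJG (jt (u i) \<one>, src \<J> (pairing (E i) x) \<bullet> (y \<oplus>\<^bsub>\<J>\<^esub> y'))) =
      (\<Otimes>\<^bsub>JJG\<^esub>i\<in>{..<N}. pure JJG (jt (u i) \<one>, src \<J> (pairing (E i) x) \<bullet> y)) \<otimes>\<^bsub>JJG\<^esub>
      (\<Otimes>\<^bsub>JJG\<^esub>i\<in>{..<N}. pure JJG (jt (u i) \<one>, src \<J> (pairing (E i) x) \<bullet> y'))"
      by (intro JJG.finprod_mult_cong)
        (auto intro!: pc simp: u_closed pairing[OF E_diffop] J.r_distr G_pure(3))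
  next
    fix x y assume "x \<in> carrier \<J>" "y \<in> carrier \<J>"
    then show "(\<Otimes>\<^bsub>JJG\<^esub>i\<in>{..<N}. pure JJG (jt (u i) \<one>, src \<J> (pairing (E i) x) \<bullet> y)) \<in> carrier JJG"
      by (intro JJG.finprod_closed) (auto intro!: pc simp: u_closed pairing[OF E_diffop])
  qed
  note l = JH.D.tensor_lift_hom[OF JJG.comm_group_axioms bal]
  show "untwist \<in> hom (diamond K B \<J>) JJG"
    unfolding untwist_def by (rule l(1))
  show "\<lbrakk>a \<in> carrier B; b \<in> carrier B; c \<in> carrier B; d \<in> carrier B\<rbrakk> \<Longrightarrow>
    untwist (pure (diamond K B \<J>) (jt a b, jt c d)) = pure JJG (jt a (b \<otimes> c), jt \<one> d)"
    unfolding untwist_def by (simp only: l(2) jt_closed untwist_term)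
qed

lemma untwist_cotwist_map:
  assumes "T \<in> carrier JJG"
  shows "untwist (\<Phi> T) = T"
  using assms
proof (induction T rule: G.tensor_induct)
  case (pure x y)
  have h: "(\<lambda>T. untwist (\<Phi> T)) \<in> hom JJG JJG"
    using hom_compose[OF cotwist_map_hom untwist_hom] by (simp add: comp_def)
  have jet: "untwist (\<Phi> (pure JJG (jt a b, jt c d))) = pure JJG (jt a b, jt c d)"
    if "a \<in> carrier B" "b \<in> carrier B" "c \<in> carrier B" "d \<in> carrier B" for a b c d
    using that G_pure_jet[of a b c d] by (simp add: untwist_pure cotwist_map_pure star_unit)
  show ?case
    using pure
    by (rule_tac JH.biadditive_eqI[where f = "\<lambda>x y. untwist (\<Phi> (pure JJG (x, y)))" and g = "\<lambda>x y. pure JJG (x, y)" and H = JJG])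
      (simp_all add: G_pure hom_mult[OF h] jet)
next
  case (mult U V)
  then show ?case
    by (simp add: hom_mult[OF cotwist_map_hom] hom_mult[OF untwist_hom] hom_in_carrier[OF cotwist_map_hom])
qed

lemma cotwist_map_untwist:
  assumes "T \<in> carrier (diamond K B \<J>)"
  shows "\<Phi> (untwist T) = T"
  using assms
proof (induction T rule: JH.D.tensor_induct)
  case (pure x y)
  have h: "(\<lambda>T. \<Phi> (untwist T)) \<in> hom (diamond K B \<J>) (diamond K B \<J>)"
    using hom_compose[OF untwist_hom cotwist_map_hom] by (simp add: comp_def)
  have jet: "\<Phi> (untwist (pure (diamond K B \<J>) (jt a b, jt c d))) = pure (diamond K B \<J>) (jt a b, jt c d)"
    if "a \<in> carrier B" "b \<in> carrier B" "c \<in> carrier B" "d \<in> carrier B" for a b c d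
    using that JH.diamond_pure_jet[of c a b "\<one>" d] by (simp add: untwist_pure cotwist_map_pure star_unit)
  show ?case
    using pure
    by (rule_tac JH.biadditive_eqI[where f = "\<lambda>x y. \<Phi> (untwist (pure (diamond K B \<J>) (x, y)))"
          and g = "\<lambda>x y. pure (diamond K B \<J>) (x, y)" and H = "diamond K B \<J>"])
      (simp_all add: JH.diamond_pure(2,3) hom_mult[OF h] jet)
next
  case (mult U V)
  then show ?case
    by (simp add: hom_mult[OF cotwist_map_hom] hom_mult[OF untwist_hom] hom_in_carrier[OF untwist_hom])
qed

lemma JG_cop:
  assumes "X \<in> carrier \<J>"
  shows "cop JG X = untwist (cop \<J> X)"
proof -
  have c: "cop \<J> X \<in> carrier (diamond K B \<J>)" using assms by (rule JH.cop_closed)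
  have inj: "inj_on \<Phi> (carrier JJG)" by (rule inj_on_inverseI[of _ untwist]) (rule untwist_cotwist_map)
  have upd: "diamond K BG (L\<lparr>cop := c, cou := e\<rparr>) = diamond K BG L"
    for L :: "('k, 'b, ('b \<times> 'b) tens set) bialgebroid" and c e
    by (simp add: diamond_def diamond_mod_def tensor_def)
  have e: "diamond K BG (cotwist_algebra K B \<J> \<Gamma>) = JJG"
    unfolding cotwist_def by (rule upd[symmetric])
  have upd': "cop (L\<lparr>cop := c, cou := e\<rparr>) = c"
    for L :: "('k, 'b, ('b \<times> 'b) tens set) bialgebroid" and c e
    by simp
  have "cop JG X = inv_into (carrier (diamond K BG (cotwist_algebra K B \<J> \<Gamma>))) \<Phi> (cop \<J> X)"
    unfolding cotwist_def upd' ..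
  also have "\<dots> = inv_into (carrier JJG) \<Phi> (cop \<J> X)"
    by (simp only: e)
  also have "\<dots> = untwist (cop \<J> X)"
    by (rule inv_into_f_eq[OF inj]) (simp_all add: c hom_in_carrier[OF untwist_hom] cotwist_map_untwist)
  finally show ?thesis .
qed

lemma JG_cou:
  shows "X \<in> carrier \<J> \<Longrightarrow> cou JG X \<in> carrier B"
    and "\<lbrakk>X \<in> carrier \<J>; Y \<in> carrier \<J>\<rbrakk> \<Longrightarrow> cou JG (X \<oplus>\<^bsub>\<J>\<^esub> Y) = cou JG X \<oplus> cou JG Y"
    and "\<lbrakk>a \<in> carrier B; b \<in> carrier B\<rbrakk> \<Longrightarrow> cou JG (jt a b) = a \<star> b"
proof -
  have bal: "JH.T.bal (add_monoid B) \<Gamma>"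
    by (rule JH.bar_balancedI) (simp_all add: \<Gamma>_add \<Gamma>_balanced)
  have eq: "cou JG = (\<lambda>X. tensor_lift (add_monoid B) (\<lambda>(xp, xm). \<Gamma> xp xm) (translation K B \<J> X))"
    by (simp add: cotwist_def)
  note l = JH.translation_lift[OF B.a_comm_group bal]
  show "X \<in> carrier \<J> \<Longrightarrow> cou JG X \<in> carrier B"
    "\<lbrakk>X \<in> carrier \<J>; Y \<in> carrier \<J>\<rbrakk> \<Longrightarrow> cou JG (X \<oplus>\<^bsub>\<J>\<^esub> Y) = cou JG X \<oplus> cou JG Y"
    "\<lbrakk>a \<in> carrier B; b \<in> carrier B\<rbrakk> \<Longrightarrow> cou JG (jt a b) = a \<star> b"
    unfolding eq using l(1)[of X] l(2)[of X Y] l(3)[of a b] by (simp_all add: \<Gamma>_jet)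
qed

text \<open>The cotwist has the same additive group as the jets, and therefore the same coevaluation.\<close>

sublocale JHG: jet_bialgebroid K BG JG jt "{..<N}" u E "\<lambda>i. op_right (E i)"
proof (rule jet_bialgebroid.intro)
  show "unital_algebra K BG" by (rule BG_algebra)
  show "module K JG" by (rule JG_module)
  fix X and Q assume "X \<in> carrier JG"
    and "\<And>a b. \<lbrakk>a \<in> carrier BG; b \<in> carrier BG\<rbrakk> \<Longrightarrow> Q (jt a b)"
    and "\<And>X Y. \<lbrakk>X \<in> carrier JG; Y \<in> carrier JG; Q X; Q Y\<rbrakk> \<Longrightarrow> Q (X \<oplus>\<^bsub>JG\<^esub> Y)"
  then show "Q X" using jet_generates[of X Q] by simp
next
  show "cop JG \<in> hom (add_monoid JG) JJG"
    by (rule homI)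
      (simp_all add: JG_cop JH.cop_closed JH.cop_add hom_mult[OF untwist_hom] hom_in_carrier[OF untwist_hom])
  show "cou JG \<in> hom (add_monoid JG) (add_monoid BG)"
    by (rule homI) (simp_all add: JG_cou)
  fix a b assume "a \<in> carrier BG" "b \<in> carrier BG"
  then show "cop JG (jt a b) = pure JJG (jt a \<one>\<^bsub>BG\<^esub>, jt \<one>\<^bsub>BG\<^esub> b)"
    by (simp add: JG_cop JH.cop_jet untwist_pure)
next
  fix a assume "a \<in> carrier BG"
  then show "jt a \<one>\<^bsub>BG\<^esub> = (\<Oplus>\<^bsub>JG\<^esub>i\<in>{..<N}. jt (u i) (E i a))"
    using jet_coev[of a] by (simp add: finsum_def)
next
  fix k a b assume "k \<in> carrier K" "a \<in> carrier BG" "b \<in> carrier BG"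
  then show "k \<odot>\<^bsub>JG\<^esub> jt a b = jt (k \<odot>\<^bsub>BG\<^esub> a) b" "k \<odot>\<^bsub>JG\<^esub> jt a b = jt a (k \<odot>\<^bsub>BG\<^esub> b)"
    by (simp add: jt_smult(1)) (use \<open>k \<in> _\<close> \<open>a \<in> _\<close> \<open>b \<in> _\<close> in \<open>simp add: jt_smult(2)\<close>)
next
  fix i assume "i \<in> {..<N}"
  then show "op_right (E i) \<in> hom (add_monoid JG) (add_monoid JG)"
    using op_right_hom(1)[OF E_diffop] by simp
qed (simp_all add: jt_add jt_one jets_fields(7,8) JG_mult JG_cou u_closed diffop_E op_right_hom(2) E_diffop)

subsection \<open>The inverse cocycle\<close>

abbreviation "\<Gamma>inv \<equiv> cocycle_inverse K B \<J> \<Gamma>"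
abbreviation "CP \<equiv> JH.cocycle_product \<Gamma>"

lemma CP:
  "\<lbrakk>Y \<in> carrier \<J>; Z \<in> carrier \<J>\<rbrakk> \<Longrightarrow> CP Y Z \<in> carrier \<J>"
  "\<lbrakk>Y \<in> carrier \<J>; Y' \<in> carrier \<J>; Z \<in> carrier \<J>\<rbrakk> \<Longrightarrow> CP (Y \<oplus>\<^bsub>\<J>\<^esub> Y') Z = CP Y Z \<oplus>\<^bsub>\<J>\<^esub> CP Y' Z"
  "\<lbrakk>Y \<in> carrier \<J>; Z \<in> carrier \<J>; Z' \<in> carrier \<J>\<rbrakk> \<Longrightarrow> CP Y (Z \<oplus>\<^bsub>\<J>\<^esub> Z') = CP Y Z \<oplus>\<^bsub>\<J>\<^esub> CP Y Z'"
  "\<lbrakk>c \<in> carrier B; d \<in> carrier B; e \<in> carrier B; f \<in> carrier B\<rbrakk> \<Longrightarrow> CP (jt c d) (jt e f) = jt (c \<star> e) (f \<otimes> d)"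
proof -
  have g: "\<And>a b c d e. \<lbrakk>a \<in> carrier B; b \<in> carrier B; c \<in> carrier B; d \<in> carrier B; e \<in> carrier B\<rbrakk> \<Longrightarrow>
        \<Gamma> (jt a (e \<otimes> b)) (jt c d) = \<Gamma> (jt a b) (jt c (d \<otimes> e))"
      "\<And>a b c d e. \<lbrakk>a \<in> carrier B; b \<in> carrier B; c \<in> carrier B; d \<in> carrier B; e \<in> carrier B\<rbrakk> \<Longrightarrow>
        \<Gamma> (jt a (b \<otimes> e)) (jt c d) = \<Gamma> (jt a b) (jt c d) \<otimes> e"
    by (simp_all add: \<Gamma>_jet B.m_ac)
  note cp = JH.cocycle_product[OF \<Gamma>_closed \<Gamma>_add g]
  show "\<lbrakk>Y \<in> carrier \<J>; Z \<in> carrier \<J>\<rbrakk> \<Longrightarrow> CP Y Z \<in> carrier \<J>" by (rule cp(1))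
  show "\<lbrakk>Y \<in> carrier \<J>; Y' \<in> carrier \<J>; Z \<in> carrier \<J>\<rbrakk> \<Longrightarrow> CP (Y \<oplus>\<^bsub>\<J>\<^esub> Y') Z = CP Y Z \<oplus>\<^bsub>\<J>\<^esub> CP Y' Z" by (rule cp(2))
  show "\<lbrakk>Y \<in> carrier \<J>; Z \<in> carrier \<J>; Z' \<in> carrier \<J>\<rbrakk> \<Longrightarrow> CP Y (Z \<oplus>\<^bsub>\<J>\<^esub> Z') = CP Y Z \<oplus>\<^bsub>\<J>\<^esub> CP Y Z'" by (rule cp(3))
  assume h: "c \<in> carrier B" "d \<in> carrier B" "e \<in> carrier B" "f \<in> carrier B"
  have "CP (jt c d) (jt e f) = jt (\<Gamma> (jt c \<one>) (jt e \<one>)) (f \<otimes> d)" by (rule cp(4)) (use h in auto)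
  then show "CP (jt c d) (jt e f) = jt (c \<star> e) (f \<otimes> d)" using h by (simp add: \<Gamma>_jet)
qed

lemma CP_tgt:
  assumes "b \<in> carrier B" "Y \<in> carrier \<J>" "Z \<in> carrier \<J>"
  shows "CP (tgt \<J> b \<bullet> Y) Z = tgt \<J> b \<bullet> CP Y Z" "CP Y (tgt \<J> b \<bullet> Z) = tgt \<J> b \<bullet> CP Y Z"
  subgoal
    using assms(2,3)
    by (rule_tac JH.biadditive_eqI[where f = "\<lambda>Y Z. CP (tgt \<J> b \<bullet> Y) Z"
          and g = "\<lambda>Y Z. tgt \<J> b \<bullet> CP Y Z" and H = "add_monoid \<J>"])
      (simp_all add: assms(1) CP J.r_distr B.m_ac)
  subgoal
    using assms(2,3)
    by (rule_tac JH.biadditive_eqI[where f = "\<lambda>Y Z. CP Y (tgt \<J> b \<bullet> Z)"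
          and g = "\<lambda>Y Z. tgt \<J> b \<bullet> CP Y Z" and H = "add_monoid \<J>"])
      (simp_all add: assms(1) CP J.r_distr B.m_ac)
  done

lemma \<Gamma>inv_def: "\<Gamma>inv X Y = tensor_lift (add_monoid B) (\<lambda>(xp, xm). tensor_lift (add_monoid B) (\<lambda>(yp, ym).
    \<Gamma> (xp \<bullet> yp) (CP ym xm)) (translation K B \<J> Y)) (translation K B \<J> X)"
  by (simp add: cocycle_inverse_def JH.cocycle_product_def)

lemma \<Gamma>inv_bal1:
  assumes "xp \<in> carrier \<J>" "xm \<in> carrier \<J>"
  shows "JH.T.bal (add_monoid B) (\<lambda>yp ym. \<Gamma> (xp \<bullet> yp) (CP ym xm))"
    and "JH.T.bal (add_monoid B) (\<lambda>yp ym. \<Gamma> (yp \<bullet> xp) (CP xm ym))"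
proof -
  have "yp \<bullet> tgt \<J> b \<bullet> xp = yp \<bullet> xp \<bullet> tgt \<J> b" if "yp \<in> carrier \<J>" "b \<in> carrier B" for yp b
    using that assms by (simp add: J.m_ac)
  then show "JH.T.bal (add_monoid B) (\<lambda>yp ym. \<Gamma> (xp \<bullet> yp) (CP ym xm))"
    "JH.T.bal (add_monoid B) (\<lambda>yp ym. \<Gamma> (yp \<bullet> xp) (CP xm ym))"
    using assms
    by (rule_tac JH.bar_balancedI; simp add: \<Gamma>_add CP J.l_distr J.r_distr CP_tgt \<Gamma>_balanced J.m_assoc[symmetric])+
qed

lemma \<Gamma>inv_bal2:
  assumes "Y \<in> carrier \<J>"
  shows "JH.T.bal (add_monoid B) (\<lambda>xp xm. tensor_lift (add_monoid B) (\<lambda>(yp, ym).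
    \<Gamma> (xp \<bullet> yp) (CP ym xm)) (translation K B \<J> Y))"
  using balanced_tensor_lift[OF JH.T.tensor_data_axioms JH.T.tensor_data_axioms B.a_comm_group,
      unfolded bar_tensor_eq, of "translation K B \<J> Y" "\<lambda>xp xm yp ym. \<Gamma> (xp \<bullet> yp) (CP ym xm)"] assms
  by (simp add: JH.translation_closed \<Gamma>inv_bal1)

lemma \<Gamma>inv:
  shows "\<lbrakk>X \<in> carrier \<J>; Y \<in> carrier \<J>\<rbrakk> \<Longrightarrow> \<Gamma>inv X Y \<in> carrier B"
    and "\<lbrakk>X \<in> carrier \<J>; X' \<in> carrier \<J>; Y \<in> carrier \<J>\<rbrakk> \<Longrightarrow> \<Gamma>inv (X \<oplus>\<^bsub>\<J>\<^esub> X') Y = \<Gamma>inv X Y \<oplus> \<Gamma>inv X' Y"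
    and "\<lbrakk>X \<in> carrier \<J>; Y \<in> carrier \<J>; Y' \<in> carrier \<J>\<rbrakk> \<Longrightarrow> \<Gamma>inv X (Y \<oplus>\<^bsub>\<J>\<^esub> Y') = \<Gamma>inv X Y \<oplus> \<Gamma>inv X Y'"
    and "\<lbrakk>a \<in> carrier B; b \<in> carrier B; c \<in> carrier B; d \<in> carrier B\<rbrakk> \<Longrightarrow>
      \<Gamma>inv (jt a b) (jt c d) = (a \<otimes> c) \<star> (d \<star> b)"
proof -
  note l1 = JH.translation_lift[OF B.a_comm_group \<Gamma>inv_bal1(1)]
  note l2 = JH.translation_lift[OF B.a_comm_group \<Gamma>inv_bal2]
  show "\<lbrakk>X \<in> carrier \<J>; Y \<in> carrier \<J>\<rbrakk> \<Longrightarrow> \<Gamma>inv X Y \<in> carrier B"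
    unfolding \<Gamma>inv_def using l2(1) by simp
  show "\<lbrakk>X \<in> carrier \<J>; X' \<in> carrier \<J>; Y \<in> carrier \<J>\<rbrakk> \<Longrightarrow> \<Gamma>inv (X \<oplus>\<^bsub>\<J>\<^esub> X') Y = \<Gamma>inv X Y \<oplus> \<Gamma>inv X' Y"
    unfolding \<Gamma>inv_def using l2(2) by simp
  show "\<lbrakk>X \<in> carrier \<J>; Y \<in> carrier \<J>; Y' \<in> carrier \<J>\<rbrakk> \<Longrightarrow> \<Gamma>inv X (Y \<oplus>\<^bsub>\<J>\<^esub> Y') = \<Gamma>inv X Y \<oplus> \<Gamma>inv X Y'"
    unfolding \<Gamma>inv_def
    by (rule JH.T.tensor_lift_add_cong[OF B.a_comm_group, simplified monoid.select_convs])
      (use l1(1,2) in \<open>simp_all add: JH.translation_closed\<close>)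
  show "\<lbrakk>a \<in> carrier B; b \<in> carrier B; c \<in> carrier B; d \<in> carrier B\<rbrakk> \<Longrightarrow>
      \<Gamma>inv (jt a b) (jt c d) = (a \<otimes> c) \<star> (d \<star> b)"
    unfolding \<Gamma>inv_def by (simp add: l2(3) l1(3) CP jt_mult \<Gamma>_jet)
qed

theorem \<Gamma>inv_cocycle: "left_2cocycle_on K BG JG \<Gamma>inv"
  by (rule JHG.left_2cocycle_onI)
    (simp_all add: \<Gamma>inv star_assoc star_smult star_unit smult_left smult_right B.m_assoc)

end

section \<open>Invertible cocycles and modules over differential operators\<close>

context jet_cocycle
begin

interpretation DD: comm_group \<D>\<D> by (rule DT.comm_group_tensor)

abbreviation \<sigma> where "\<sigma> \<equiv> twist_src \<D> F"
abbreviation \<tau> where "\<tau> \<equiv> twist_tgt \<D> F"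
abbreviation BF where "BF \<equiv> twist_base B \<D> F"
abbreviation \<D>F where "\<D>F \<equiv> twist_st \<D> F"
abbreviation "\<D>\<D>F \<equiv> diamond K BF \<D>F"

lemma BF_fields [simp]:
  "carrier BF = carrier B" "add BF = add B" "zero BF = zero B" "one BF = one B" "smult BF = smult B"
  by (simp_all add: twist_base_def)

lemma twist_src:
  shows "b \<in> carrier B \<Longrightarrow> \<sigma> b \<in> carrier \<D>"
    and "\<lbrakk>b \<in> carrier B; a \<in> carrier B\<rbrakk> \<Longrightarrow> \<sigma> b a = b \<star> a"
proof -
  show "b \<in> carrier B \<Longrightarrow> \<sigma> b \<in> carrier \<D>"
    unfolding twist_src_def
    using DT.tensor_lift_closed2[OF diffops_comm_group F_closed] by (simp add: diffop_closed diffops_fields(9) diffop)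
  assume h: "b \<in> carrier B" "a \<in> carrier B"
  have "\<sigma> b a = tensor_lift (add_monoid B) (\<lambda>(x, y). (src \<D> (cou \<D> (x \<cdot> src \<D> b)) \<cdot> y) a) F"
    unfolding twist_src_def
    using h by (intro DT.tensor_lift_comp_hom2[OF diffops_comm_group B.a_comm_group F_closed apply_hom])
      (simp_all add: diffop_closed diffops_fields(9) diffop)
  also have "\<dots> = b \<star> a"
    unfolding star_def ev_def
    using h by (intro DT.tensor_lift_cong2[OF B.a_comm_group F_closed])
      (simp_all add: diffops_fields(9) diffop_apply diffop)
  finally show "\<sigma> b a = b \<star> a" .
qed

lemma twist_tgt:
  shows "b \<in> carrier B \<Longrightarrow> \<tau> b \<in> carrier \<D>"
    and "\<lbrakk>b \<in> carrier B; a \<in> carrier B\<rbrakk> \<Longrightarrow> \<tau> b a = a \<star> b"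
proof -
  show "b \<in> carrier B \<Longrightarrow> \<tau> b \<in> carrier \<D>"
    unfolding twist_tgt_def
    using DT.tensor_lift_closed2[OF diffops_comm_group F_closed] by (simp add: diffop_closed diffops_fields(9) diffop)
  assume h: "b \<in> carrier B" "a \<in> carrier B"
  have "\<tau> b a = tensor_lift (add_monoid B) (\<lambda>(x, y). (tgt \<D> (cou \<D> (y \<cdot> src \<D> b)) \<cdot> x) a) F"
    unfolding twist_tgt_def
    using h by (intro DT.tensor_lift_comp_hom2[OF diffops_comm_group B.a_comm_group F_closed apply_hom])
      (simp_all add: diffop_closed diffops_fields(9) diffop)
  also have "\<dots> = a \<star> b"
    unfolding star_def ev_def
    using h by (intro DT.tensor_lift_cong2[OF B.a_comm_group F_closed])
      (simp_all add: diffops_fields(9) diffop_apply diffop)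
  finally show "\<tau> b a = a \<star> b" .
qed

lemma ev_hom: "\<lbrakk>a \<in> carrier B; b \<in> carrier B\<rbrakk> \<Longrightarrow> ev a b \<in> hom \<D>\<D> (add_monoid B)"
  by (rule homI) (simp_all add: ev)

definition "cocycle_times x y = tensor_lift \<D>\<D> (\<lambda>(f, g). pure \<D>\<D> (f \<cdot> x, g \<cdot> y)) F"

lemma cocycle_times:
  assumes "x \<in> carrier \<D>" "y \<in> carrier \<D>"
  shows "cocycle_times x y \<in> carrier \<D>\<D>"
    and "\<lbrakk>a \<in> carrier B; b \<in> carrier B\<rbrakk> \<Longrightarrow> ev a b (cocycle_times x y) = x a \<star> y b"
proof -
  show "cocycle_times x y \<in> carrier \<D>\<D>"
    unfolding cocycle_times_def
    using assms by (intro DT.tensor_lift_closed2[OF DD.comm_group_axioms F_closed]) (auto simp: diffop_closed)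
  assume h: "a \<in> carrier B" "b \<in> carrier B"
  have "ev a b (cocycle_times x y) =
      tensor_lift (add_monoid B) (\<lambda>(f, g). ev a b (pure \<D>\<D> (f \<cdot> x, g \<cdot> y))) F"
    unfolding cocycle_times_def
    using assms by (intro DT.tensor_lift_comp_hom2[OF DD.comm_group_axioms B.a_comm_group F_closed ev_hom[OF h]])
      (auto simp: diffop_closed)
  also have "\<dots> = x a \<star> y b"
    unfolding star_def ev_def[of "x a"]
    using assms h by (intro DT.tensor_lift_cong2[OF B.a_comm_group F_closed])
      (simp_all add: ev diffop_closed diffop_apply diffop)
  finally show "ev a b (cocycle_times x y) = x a \<star> y b" .
qed

text \<open>This is associativity of the twisted product; it makes \<open>F\<^sup>#\<close> well defined over the twisted base.\<close>

lemma cocycle_times_slide: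
  "b \<in> carrier B \<Longrightarrow> cocycle_times (\<tau> b) \<one>\<^bsub>\<D>\<^esub> = cocycle_times \<one>\<^bsub>\<D>\<^esub> (\<sigma> b)"
  by (rule ev_inject) (simp_all add: cocycle_times twist_src twist_tgt diffop_closed diffop_apply star_assoc)

lemma twist_tensor_eq:
  "tensor K M P (carrier B) (\<lambda>b. \<alpha> (\<tau> b)) (\<lambda>b. \<beta> (\<sigma> b)) = diamond_mod K BF \<D>F M \<alpha> P \<beta>"
  by (simp add: diamond_mod_def twist_st_def)

sublocale DTF: tensor_data K \<D> \<D> "carrier B" "\<lambda>b. mult \<D> (\<tau> b)" "\<lambda>b. mult \<D> (\<sigma> b)"
  rewrites "tensor K \<D> \<D> (carrier B) (\<lambda>b. mult \<D> (\<tau> b)) (\<lambda>b. mult \<D> (\<sigma> b)) = diamond K BF \<D>F"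
proof (rule tensor_data.intro; (rule diffops_module | simp add: diffop_closed twist_src twist_tgt)?)
  show "tensor K \<D> \<D> (carrier B) (\<lambda>b. mult \<D> (\<tau> b)) (\<lambda>b. mult \<D> (\<sigma> b)) = diamond K BF \<D>F"
    by (simp add: diamond_def diamond_mod_def tensor_def twist_st_def)
qed

lemma left_module_regular: "left_module K \<D> \<D> (mult \<D>)"
proof -
  show ?thesis
    using unital_algebra_diffops
    by (auto intro!: left_module.intro simp: bilinear_map_def linear_map_def diffops_module DD.l_distr DD.r_distr
        unital_algebra.smult_mult_left unital_algebra.smult_mult_right monoid.m_assoc[OF ring.is_monoid[OF unital_algebra.axioms(2)[OF unital_algebra_diffops]]])
qed

end

locale diffop_modules = jet_cocycle K B N u E F
  for K :: "'k ring" and B :: "('k, 'b) module" (structure) and N u E F +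
  fixes M :: "('k, 'm, 'x) module_scheme" and \<alpha> :: "('b \<Rightarrow> 'b) \<Rightarrow> 'm \<Rightarrow> 'm"
    and P :: "('k, 'n, 'y) module_scheme" and \<beta> :: "('b \<Rightarrow> 'b) \<Rightarrow> 'n \<Rightarrow> 'n"
  assumes left: "left_module K \<D> M \<alpha>" and right: "left_module K \<D> P \<beta>"
begin

interpretation DD: comm_group \<D>\<D> by (rule DT.comm_group_tensor)

abbreviation "MP \<equiv> diamond_mod K B \<D> M \<alpha> P \<beta>"
abbreviation "MPF \<equiv> diamond_mod K BF \<D>F M \<alpha> P \<beta>"

lemma act:
  "\<lbrakk>x \<in> carrier \<D>; m \<in> carrier M\<rbrakk> \<Longrightarrow> \<alpha> x m \<in> carrier M"
  "\<lbrakk>x \<in> carrier \<D>; m \<in> carrier M; m' \<in> carrier M\<rbrakk> \<Longrightarrow> \<alpha> x (m \<oplus>\<^bsub>M\<^esub> m') = \<alpha> x m \<oplus>\<^bsub>M\<^esub> \<alpha> x m'"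
  "\<lbrakk>k \<in> carrier K; x \<in> carrier \<D>; m \<in> carrier M\<rbrakk> \<Longrightarrow> \<alpha> x (k \<odot>\<^bsub>M\<^esub> m) = k \<odot>\<^bsub>M\<^esub> \<alpha> x m"
  "\<lbrakk>x \<in> carrier \<D>; y \<in> carrier \<D>; m \<in> carrier M\<rbrakk> \<Longrightarrow> \<alpha> (x \<oplus>\<^bsub>\<D>\<^esub> y) m = \<alpha> x m \<oplus>\<^bsub>M\<^esub> \<alpha> y m"
  "\<lbrakk>k \<in> carrier K; x \<in> carrier \<D>; m \<in> carrier M\<rbrakk> \<Longrightarrow> \<alpha> (k \<odot>\<^bsub>\<D>\<^esub> x) m = k \<odot>\<^bsub>M\<^esub> \<alpha> x m"
  "\<lbrakk>x \<in> carrier \<D>; y \<in> carrier \<D>; m \<in> carrier M\<rbrakk> \<Longrightarrow> \<alpha> (x \<cdot> y) m = \<alpha> x (\<alpha> y m)"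
  "m \<in> carrier M \<Longrightarrow> \<alpha> \<one>\<^bsub>\<D>\<^esub> m = m"
  using left_module.act_bilinear[OF left] left_module.act_mult[OF left] left_module.act_one[OF left]
  by (auto simp: bilinear_map_def linear_map_def Pi_iff)

lemma act':
  "\<lbrakk>x \<in> carrier \<D>; m \<in> carrier P\<rbrakk> \<Longrightarrow> \<beta> x m \<in> carrier P"
  "\<lbrakk>x \<in> carrier \<D>; m \<in> carrier P; m' \<in> carrier P\<rbrakk> \<Longrightarrow> \<beta> x (m \<oplus>\<^bsub>P\<^esub> m') = \<beta> x m \<oplus>\<^bsub>P\<^esub> \<beta> x m'"
  "\<lbrakk>k \<in> carrier K; x \<in> carrier \<D>; m \<in> carrier P\<rbrakk> \<Longrightarrow> \<beta> x (k \<odot>\<^bsub>P\<^esub> m) = k \<odot>\<^bsub>P\<^esub> \<beta> x m"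
  "\<lbrakk>x \<in> carrier \<D>; y \<in> carrier \<D>; m \<in> carrier P\<rbrakk> \<Longrightarrow> \<beta> (x \<oplus>\<^bsub>\<D>\<^esub> y) m = \<beta> x m \<oplus>\<^bsub>P\<^esub> \<beta> y m"
  "\<lbrakk>k \<in> carrier K; x \<in> carrier \<D>; m \<in> carrier P\<rbrakk> \<Longrightarrow> \<beta> (k \<odot>\<^bsub>\<D>\<^esub> x) m = k \<odot>\<^bsub>P\<^esub> \<beta> x m"
  "\<lbrakk>x \<in> carrier \<D>; y \<in> carrier \<D>; m \<in> carrier P\<rbrakk> \<Longrightarrow> \<beta> (x \<cdot> y) m = \<beta> x (\<beta> y m)"
  "m \<in> carrier P \<Longrightarrow> \<beta> \<one>\<^bsub>\<D>\<^esub> m = m"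
  using left_module.act_bilinear[OF right] left_module.act_mult[OF right] left_module.act_one[OF right]
  by (auto simp: bilinear_map_def linear_map_def Pi_iff)

lemma tensor_eq: "tensor K M P (carrier B) (\<lambda>b. \<alpha> (tgt \<D> b)) (\<lambda>b. \<beta> (src \<D> b)) = diamond_mod K B \<D> M \<alpha> P \<beta>"
  by (simp only: diamond_mod_def)

sublocale TM: tensor_data K M P "carrier B" "\<lambda>b. \<alpha> (tgt \<D> b)" "\<lambda>b. \<beta> (src \<D> b)"
  rewrites "tensor K M P (carrier B) (\<lambda>b. \<alpha> (tgt \<D> b)) (\<lambda>b. \<beta> (src \<D> b)) = diamond_mod K B \<D> M \<alpha> P \<beta>"
  by (rule tensor_data.intro; (rule left_module.vector_space[OF left] left_module.vector_space[OF right] |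
        simp add: diffop_closed act act')?)
    (rule tensor_eq)

sublocale TMF: tensor_data K M P "carrier B" "\<lambda>b. \<alpha> (\<tau> b)" "\<lambda>b. \<beta> (\<sigma> b)"
  rewrites "tensor K M P (carrier B) (\<lambda>b. \<alpha> (\<tau> b)) (\<lambda>b. \<beta> (\<sigma> b)) = diamond_mod K BF \<D>F M \<alpha> P \<beta>"
  by (rule tensor_data.intro; (rule left_module.vector_space[OF left] left_module.vector_space[OF right] |
        simp add: twist_src twist_tgt act act')?)
    (rule twist_tensor_eq)

interpretation MP: comm_group MP by (rule TM.comm_group_tensor)
interpretation MPF: comm_group MPF by (rule TMF.comm_group_tensor)

lemmas MP_pure = balancedD[OF TM.balanced_pure]
lemmas MPF_pure = balancedD[OF TMF.balanced_pure]

definition "act_on m p = tensor_lift MP (\<lambda>(x, y). pure MP (\<alpha> x m, \<beta> y p))"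
definition "act_onF m p = tensor_lift MPF (\<lambda>(x, y). pure MPF (\<alpha> x m, \<beta> y p))"

lemma act_on:
  assumes "m \<in> carrier M" "p \<in> carrier P"
  shows "act_on m p \<in> hom \<D>\<D> MP"
    and "\<lbrakk>x \<in> carrier \<D>; y \<in> carrier \<D>\<rbrakk> \<Longrightarrow> act_on m p (pure \<D>\<D> (x, y)) = pure MP (\<alpha> x m, \<beta> y p)"
proof -
  have "DT.bal MP (\<lambda>x y. pure MP (\<alpha> x m, \<beta> y p))"
    by (rule balancedI) (simp_all add: assms act act' MP_pure diffop_closed)
  note l = DT.tensor_lift_hom[OF MP.comm_group_axioms this]
  show "act_on m p \<in> hom \<D>\<D> MP"
    and "\<lbrakk>x \<in> carrier \<D>; y \<in> carrier \<D>\<rbrakk> \<Longrightarrow> act_on m p (pure \<D>\<D> (x, y)) = pure MP (\<alpha> x m, \<beta> y p)"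
    unfolding act_on_def by (rule l(1), rule l(2))
qed

lemma act_onF:
  assumes "m \<in> carrier M" "p \<in> carrier P"
  shows "act_onF m p \<in> hom \<D>\<D>F MPF"
    and "\<lbrakk>x \<in> carrier \<D>; y \<in> carrier \<D>\<rbrakk> \<Longrightarrow> act_onF m p (pure \<D>\<D>F (x, y)) = pure MPF (\<alpha> x m, \<beta> y p)"
proof -
  have "DTF.bal MPF (\<lambda>x y. pure MPF (\<alpha> x m, \<beta> y p))"
    by (rule balancedI) (simp_all add: assms act act' MPF_pure diffop_closed twist_src twist_tgt)
  note l = DTF.tensor_lift_hom[OF MPF.comm_group_axioms this]
  show "act_onF m p \<in> hom \<D>\<D>F MPF"
    and "\<lbrakk>x \<in> carrier \<D>; y \<in> carrier \<D>\<rbrakk> \<Longrightarrow> act_onF m p (pure \<D>\<D>F (x, y)) = pure MPF (\<alpha> x m, \<beta> y p)"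
    unfolding act_onF_def by (rule l(1), rule l(2))
qed

lemma act_on_cocycle_times:
  assumes "m \<in> carrier M" "p \<in> carrier P" "x \<in> carrier \<D>" "y \<in> carrier \<D>"
  shows "act_on m p (cocycle_times x y) = act_on (\<alpha> x m) (\<beta> y p) F"
proof -
  have "act_on m p (cocycle_times x y) =
      tensor_lift MP (\<lambda>(f, g). act_on m p (pure \<D>\<D> (f \<cdot> x, g \<cdot> y))) F"
    unfolding cocycle_times_def
    using assms by (intro DT.tensor_lift_comp_hom2[OF DD.comm_group_axioms MP.comm_group_axioms F_closed act_on(1)])
      (auto simp: diffop_closed)
  also have "\<dots> = act_on (\<alpha> x m) (\<beta> y p) F"
    unfolding act_on_def[of "\<alpha> x m"]
    using assms by (intro DT.tensor_lift_cong2[OF MP.comm_group_axioms F_closed])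
      (simp_all add: act_on diffop_closed act act' MP_pure)
  finally show ?thesis .
qed

lemma act_on_cocycle:
  shows "\<lbrakk>m \<in> carrier M; p \<in> carrier P\<rbrakk> \<Longrightarrow> act_on m p F \<in> carrier MP"
    and "\<lbrakk>m \<in> carrier M; m' \<in> carrier M; p \<in> carrier P\<rbrakk> \<Longrightarrow>
      act_on (m \<oplus>\<^bsub>M\<^esub> m') p F = act_on m p F \<otimes>\<^bsub>MP\<^esub> act_on m' p F"
    and "\<lbrakk>m \<in> carrier M; p \<in> carrier P; p' \<in> carrier P\<rbrakk> \<Longrightarrow>
      act_on m (p \<oplus>\<^bsub>P\<^esub> p') F = act_on m p F \<otimes>\<^bsub>MP\<^esub> act_on m p' F"
    and "\<lbrakk>k \<in> carrier K; m \<in> carrier M; p \<in> carrier P\<rbrakk> \<Longrightarrow> act_on (k \<odot>\<^bsub>M\<^esub> m) p F = act_on m (k \<odot>\<^bsub>P\<^esub> p) F"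
    and "\<lbrakk>b \<in> carrier B; m \<in> carrier M; p \<in> carrier P\<rbrakk> \<Longrightarrow> act_on (\<alpha> (\<tau> b) m) p F = act_on m (\<beta> (\<sigma> b) p) F"
proof -
  interpret Mm: module K M by (rule TM.modM)
  interpret Pm: module K P by (rule TM.modN)
  show "\<lbrakk>m \<in> carrier M; p \<in> carrier P\<rbrakk> \<Longrightarrow> act_on m p F \<in> carrier MP"
    by (rule hom_in_carrier[OF act_on(1) F_closed])
  show "\<lbrakk>m \<in> carrier M; m' \<in> carrier M; p \<in> carrier P\<rbrakk> \<Longrightarrow>
      act_on (m \<oplus>\<^bsub>M\<^esub> m') p F = act_on m p F \<otimes>\<^bsub>MP\<^esub> act_on m' p F"
    unfolding act_on_def
    by (rule DT.tensor_lift_add_cong[OF MP.comm_group_axioms F_closed]) (simp_all add: act act' MP_pure)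
  show "\<lbrakk>m \<in> carrier M; p \<in> carrier P; p' \<in> carrier P\<rbrakk> \<Longrightarrow>
      act_on m (p \<oplus>\<^bsub>P\<^esub> p') F = act_on m p F \<otimes>\<^bsub>MP\<^esub> act_on m p' F"
    unfolding act_on_def
    by (rule DT.tensor_lift_add_cong[OF MP.comm_group_axioms F_closed]) (simp_all add: act act' MP_pure)
  show "\<lbrakk>k \<in> carrier K; m \<in> carrier M; p \<in> carrier P\<rbrakk> \<Longrightarrow> act_on (k \<odot>\<^bsub>M\<^esub> m) p F = act_on m (k \<odot>\<^bsub>P\<^esub> p) F"
    unfolding act_on_def
    by (rule DT.tensor_lift_cong2[OF MP.comm_group_axioms F_closed]) (simp_all add: act act' MP_pure)
  assume h: "b \<in> carrier B" "m \<in> carrier M" "p \<in> carrier P"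
  show "act_on (\<alpha> (\<tau> b) m) p F = act_on m (\<beta> (\<sigma> b) p) F"
    using act_on_cocycle_times[OF h(2,3), of "\<tau> b" "\<one>\<^bsub>\<D>\<^esub>"] act_on_cocycle_times[OF h(2,3), of "\<one>\<^bsub>\<D>\<^esub>" "\<sigma> b"] h
    by (simp add: cocycle_times_slide diffop_closed act act' twist_src twist_tgt)
qed

abbreviation "\<Theta> \<equiv> twist_map K B \<D> F M \<alpha> P \<beta>"

lemma twist_map_eq: "\<Theta> = tensor_lift MP (\<lambda>(m, p). act_on m p F)"
  by (simp add: twist_map_def act_on_def Let_def)

lemma twist_map:
  shows "\<Theta> \<in> hom MPF MP"
    and "\<lbrakk>m \<in> carrier M; p \<in> carrier P\<rbrakk> \<Longrightarrow> \<Theta> (pure MPF (m, p)) = act_on m p F"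
proof -
  have "TMF.bal MP (\<lambda>m p. act_on m p F)"
    by (rule balancedI; rule act_on_cocycle)
  note l = TMF.tensor_lift_hom[OF MP.comm_group_axioms this]
  show "\<Theta> \<in> hom MPF MP" "\<lbrakk>m \<in> carrier M; p \<in> carrier P\<rbrakk> \<Longrightarrow> \<Theta> (pure MPF (m, p)) = act_on m p F"
    unfolding twist_map_eq by (rule l(1), rule l(2))
qed

text \<open>On the orbit of a pair \<open>(m, p)\<close> the map \<open>F\<^sup>#\<close> is its counterpart for the regular modules.\<close>

lemma twist_map_act_onF:
  assumes "m \<in> carrier M" "p \<in> carrier P" "T \<in> carrier \<D>\<D>F"
  shows "\<Theta> (act_onF m p T) = act_on m p (tensor_lift \<D>\<D> (\<lambda>(x, y). cocycle_times x y) T)"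
proof -
  have "\<Theta> (act_onF m p T) = tensor_lift MP (\<lambda>(x, y). \<Theta> (pure MPF (\<alpha> x m, \<beta> y p))) T"
    unfolding act_onF_def
    by (rule DTF.tensor_lift_comp_hom2[OF MPF.comm_group_axioms MP.comm_group_axioms assms(3) twist_map(1)])
      (simp add: assms act act' MPF_pure)
  also have "\<dots> = tensor_lift MP (\<lambda>(x, y). act_on m p (cocycle_times x y)) T"
    by (rule DTF.tensor_lift_cong2[OF MP.comm_group_axioms assms(3)])
      (simp_all add: assms act act' act_on_cocycle_times twist_map act_on_cocycle)
  also have "\<dots> = act_on m p (tensor_lift \<D>\<D> (\<lambda>(x, y). cocycle_times x y) T)"
    by (rule DTF.tensor_lift_comp_hom2[OF DD.comm_group_axioms MP.comm_group_axioms assms(3) act_on(1), symmetric])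
      (simp_all add: assms cocycle_times)
  finally show ?thesis .
qed

end

locale invertible_jet_cocycle = jet_cocycle K B N u E F
  for K :: "'k ring" and B :: "('k, 'b) module" (structure) and N u E F +
  assumes regular_bij: "bij_betw (twist_map K B (diffops K B) F (diffops K B) (mult (diffops K B)) (diffops K B) (mult (diffops K B)))
    (carrier (diamond K (twist_base B (diffops K B) F) (twist_st (diffops K B) F))) (carrier (diamond K B (diffops K B)))"
begin

interpretation DD: comm_group \<D>\<D> by (rule DT.comm_group_tensor)
interpretation DDF: comm_group \<D>\<D>F by (rule DTF.comm_group_tensor)
interpretation R: diffop_modules K B N u E F \<D> "mult \<D>" \<D> "mult \<D>"
  by (rule diffop_modules.intro[OF jet_cocycle_axioms], rule diffop_modules_axioms.intro)
    (rule left_module_regular)+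

abbreviation "\<Psi> \<equiv> twist_map K B \<D> F \<D> (mult \<D>) \<D> (mult \<D>)"

lemma regular_map_eq: "\<Psi> = tensor_lift \<D>\<D> (\<lambda>(x, y). cocycle_times x y)"
  by (simp add: twist_map_def cocycle_times_def Let_def diamond_def)

text \<open>The counterpart of \<open>ev\<close> over the twisted base. It factors through \<open>F\<^sup>#\<close>, whose injectivity makes it
  separate the elements of the tensor product over the twisted base.\<close>

definition "evF a b = tensor_lift (add_monoid B) (\<lambda>(x, y). x a \<star> y b)"

lemma regular_map_closed: "T \<in> carrier \<D>\<D>F \<Longrightarrow> \<Psi> T \<in> carrier \<D>\<D>"
  using regular_bij by (rule bij_betw_apply)

lemma ev_regular_map:
  assumes "T \<in> carrier \<D>\<D>F" "a \<in> carrier B" "b \<in> carrier B"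
  shows "ev a b (\<Psi> T) = evF a b T"
proof -
  have "ev a b (\<Psi> T) = tensor_lift (add_monoid B) (\<lambda>(x, y). ev a b (cocycle_times x y)) T"
    unfolding regular_map_eq
    by (rule DTF.tensor_lift_comp_hom2[OF DD.comm_group_axioms B.a_comm_group assms(1) ev_hom[OF assms(2,3)]])
      (rule cocycle_times)
  also have "\<dots> = evF a b T"
    unfolding evF_def
    by (rule DTF.tensor_lift_cong2[OF B.a_comm_group assms(1)]) (simp_all add: cocycle_times assms diffop)
  finally show ?thesis .
qed

lemma evF_inject:
  assumes "T \<in> carrier \<D>\<D>F" "U \<in> carrier \<D>\<D>F"
    and "\<And>a b. \<lbrakk>a \<in> carrier B; b \<in> carrier B\<rbrakk> \<Longrightarrow> evF a b T = evF a b U"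
  shows "T = U"
proof -
  have "\<Psi> T = \<Psi> U"
    by (rule ev_inject) (simp_all add: assms regular_map_closed ev_regular_map)
  then show ?thesis
    using assms(1,2) bij_betw_imp_inj_on[OF regular_bij] by (simp add: inj_on_eq_iff)
qed

lemma evF:
  assumes "a \<in> carrier B" "b \<in> carrier B"
  shows "evF a b \<in> hom \<D>\<D>F (add_monoid B)"
    and "\<lbrakk>x \<in> carrier \<D>; y \<in> carrier \<D>\<rbrakk> \<Longrightarrow> evF a b (pure \<D>\<D>F (x, y)) = x a \<star> y b"
proof -
  have "DTF.bal (add_monoid B) (\<lambda>x y. x a \<star> y b)"
    by (rule balancedI)
      (simp_all add: assms diffop diffop_apply star_add star_smult star_assoc twist_src twist_tgt)
  note l = DTF.tensor_lift_hom[OF B.a_comm_group this]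
  show "evF a b \<in> hom \<D>\<D>F (add_monoid B)"
    and "\<lbrakk>x \<in> carrier \<D>; y \<in> carrier \<D>\<rbrakk> \<Longrightarrow> evF a b (pure \<D>\<D>F (x, y)) = x a \<star> y b"
    unfolding evF_def by (rule l(1), rule l(2))
qed

text \<open>The element inverse to \<open>F\<close>.\<close>

definition G where "G = inv_into (carrier \<D>\<D>F) \<Psi> (pure \<D>\<D> (\<one>\<^bsub>\<D>\<^esub>, \<one>\<^bsub>\<D>\<^esub>))"

lemma G:
  shows "G \<in> carrier \<D>\<D>F" and "\<Psi> G = pure \<D>\<D> (\<one>\<^bsub>\<D>\<^esub>, \<one>\<^bsub>\<D>\<^esub>)"
    and "\<lbrakk>a \<in> carrier B; b \<in> carrier B\<rbrakk> \<Longrightarrow> evF a b G = a \<otimes> b"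
proof -
  have c: "pure \<D>\<D> (\<one>\<^bsub>\<D>\<^esub>, \<one>\<^bsub>\<D>\<^esub>) \<in> \<Psi> ` carrier \<D>\<D>F"
    using bij_betw_imp_surj_on[OF regular_bij] by (simp add: diffop_closed)
  show g: "G \<in> carrier \<D>\<D>F" and e: "\<Psi> G = pure \<D>\<D> (\<one>\<^bsub>\<D>\<^esub>, \<one>\<^bsub>\<D>\<^esub>)"
    unfolding G_def using inv_into_into[OF c] f_inv_into_f[OF c] by auto
  assume h: "a \<in> carrier B" "b \<in> carrier B"
  show "evF a b G = a \<otimes> b"
    using ev_regular_map[OF g h] h by (simp add: e ev diffop_closed diffop_apply)
qed

definition "inverse_times x y = tensor_lift \<D>\<D>F (\<lambda>(f, g). pure \<D>\<D>F (f \<cdot> x, g \<cdot> y)) G"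

lemma inverse_times:
  assumes "x \<in> carrier \<D>" "y \<in> carrier \<D>"
  shows "inverse_times x y \<in> carrier \<D>\<D>F"
    and "\<lbrakk>a \<in> carrier B; b \<in> carrier B\<rbrakk> \<Longrightarrow> evF a b (inverse_times x y) = x a \<otimes> y b"
proof -
  show "inverse_times x y \<in> carrier \<D>\<D>F"
    unfolding inverse_times_def
    using assms by (intro DTF.tensor_lift_closed2[OF DDF.comm_group_axioms G(1)]) (auto simp: diffop_closed)
  assume h: "a \<in> carrier B" "b \<in> carrier B"
  have "evF a b (inverse_times x y) =
      tensor_lift (add_monoid B) (\<lambda>(f, g). evF a b (pure \<D>\<D>F (f \<cdot> x, g \<cdot> y))) G"
    unfolding inverse_times_def
    using assms by (intro DTF.tensor_lift_comp_hom2[OF DDF.comm_group_axioms B.a_comm_group G(1) evF(1)[OF h]])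
      (auto simp: diffop_closed)
  also have "\<dots> = evF (x a) (y b) G"
    unfolding evF_def[of "x a"]
    using assms h by (intro DTF.tensor_lift_cong2[OF B.a_comm_group G(1)])
      (simp_all add: evF diffop_closed diffop_apply diffop)
  finally show "evF a b (inverse_times x y) = x a \<otimes> y b"
    using assms h by (simp add: G(3) diffop)
qed

lemma inverse_times_slide:
  assumes "b \<in> carrier B"
  shows "inverse_times (tgt \<D> b) \<one>\<^bsub>\<D>\<^esub> = inverse_times \<one>\<^bsub>\<D>\<^esub> (src \<D> b)"
  using assms by (intro evF_inject) (simp_all add: inverse_times diffop_closed diffop_apply B.m_assoc)

lemma inverse_times_cocycle:
  "tensor_lift \<D>\<D>F (\<lambda>(x, y). inverse_times x y) F = pure \<D>\<D>F (\<one>\<^bsub>\<D>\<^esub>, \<one>\<^bsub>\<D>\<^esub>)"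
proof (rule evF_inject)
  show "tensor_lift \<D>\<D>F (\<lambda>(x, y). inverse_times x y) F \<in> carrier \<D>\<D>F"
    by (rule DT.tensor_lift_closed2[OF DDF.comm_group_axioms F_closed]) (rule inverse_times)
  fix a b assume h: "a \<in> carrier B" "b \<in> carrier B"
  have "evF a b (tensor_lift \<D>\<D>F (\<lambda>(x, y). inverse_times x y) F) =
      tensor_lift (add_monoid B) (\<lambda>(x, y). evF a b (inverse_times x y)) F"
    by (rule DT.tensor_lift_comp_hom2[OF DDF.comm_group_axioms B.a_comm_group F_closed evF(1)[OF h]])
      (rule inverse_times)
  also have "\<dots> = a \<star> b"
    unfolding star_def ev_def
    by (rule DT.tensor_lift_cong2[OF B.a_comm_group F_closed]) (simp_all add: inverse_times h diffop)
  finally show "evF a b (tensor_lift \<D>\<D>F (\<lambda>(x, y). inverse_times x y) F) = evF a b (pure \<D>\<D>F (\<one>\<^bsub>\<D>\<^esub>, \<one>\<^bsub>\<D>\<^esub>))"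
    using h by (simp add: evF diffop_closed diffop_apply)
qed (simp add: diffop_closed)

end

locale invertible_diffop_modules =
  invertible_jet_cocycle K B N u E F + diffop_modules K B N u E F M \<alpha> P \<beta>
  for K :: "'k ring" and B :: "('k, 'b) module" (structure) and N u E F
    and M :: "('k, 'm, 'x) module_scheme" and \<alpha> and P :: "('k, 'n, 'y) module_scheme" and \<beta>
begin

interpretation DD: comm_group \<D>\<D> by (rule DT.comm_group_tensor)
interpretation DDF: comm_group \<D>\<D>F by (rule DTF.comm_group_tensor)
interpretation MP: comm_group MP by (rule TM.comm_group_tensor)
interpretation MPF: comm_group MPF by (rule TMF.comm_group_tensor)

lemma act_onF_inverse_times:
  assumes "m \<in> carrier M" "p \<in> carrier P" "x \<in> carrier \<D>" "y \<in> carrier \<D>"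
  shows "act_onF m p (inverse_times x y) = act_onF (\<alpha> x m) (\<beta> y p) G"
proof -
  have "act_onF m p (inverse_times x y) =
      tensor_lift MPF (\<lambda>(f, g). act_onF m p (pure \<D>\<D>F (f \<cdot> x, g \<cdot> y))) G"
    unfolding inverse_times_def
    using assms by (intro DTF.tensor_lift_comp_hom2[OF DDF.comm_group_axioms MPF.comm_group_axioms G(1) act_onF(1)])
      (auto simp: diffop_closed)
  also have "\<dots> = act_onF (\<alpha> x m) (\<beta> y p) G"
    unfolding act_onF_def[of "\<alpha> x m"]
    using assms by (intro DTF.tensor_lift_cong2[OF MPF.comm_group_axioms G(1)])
      (simp_all add: act_onF diffop_closed act act' MPF_pure)
  finally show ?thesis .
qed

lemma act_onF_inverse:
  shows "\<lbrakk>m \<in> carrier M; p \<in> carrier P\<rbrakk> \<Longrightarrow> act_onF m p G \<in> carrier MPF"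
    and "\<lbrakk>m \<in> carrier M; m' \<in> carrier M; p \<in> carrier P\<rbrakk> \<Longrightarrow>
      act_onF (m \<oplus>\<^bsub>M\<^esub> m') p G = act_onF m p G \<otimes>\<^bsub>MPF\<^esub> act_onF m' p G"
    and "\<lbrakk>m \<in> carrier M; p \<in> carrier P; p' \<in> carrier P\<rbrakk> \<Longrightarrow>
      act_onF m (p \<oplus>\<^bsub>P\<^esub> p') G = act_onF m p G \<otimes>\<^bsub>MPF\<^esub> act_onF m p' G"
    and "\<lbrakk>k \<in> carrier K; m \<in> carrier M; p \<in> carrier P\<rbrakk> \<Longrightarrow> act_onF (k \<odot>\<^bsub>M\<^esub> m) p G = act_onF m (k \<odot>\<^bsub>P\<^esub> p) G"
    and "\<lbrakk>b \<in> carrier B; m \<in> carrier M; p \<in> carrier P\<rbrakk> \<Longrightarrow>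
      act_onF (\<alpha> (tgt \<D> b) m) p G = act_onF m (\<beta> (src \<D> b) p) G"
proof -
  interpret Mm: module K M by (rule TM.modM)
  interpret Pm: module K P by (rule TM.modN)
  show "\<lbrakk>m \<in> carrier M; p \<in> carrier P\<rbrakk> \<Longrightarrow> act_onF m p G \<in> carrier MPF"
    by (rule hom_in_carrier[OF act_onF(1) G(1)])
  show "\<lbrakk>m \<in> carrier M; m' \<in> carrier M; p \<in> carrier P\<rbrakk> \<Longrightarrow>
      act_onF (m \<oplus>\<^bsub>M\<^esub> m') p G = act_onF m p G \<otimes>\<^bsub>MPF\<^esub> act_onF m' p G"
    unfolding act_onF_def
    by (rule DTF.tensor_lift_add_cong[OF MPF.comm_group_axioms G(1)]) (simp_all add: act act' MPF_pure)
  show "\<lbrakk>m \<in> carrier M; p \<in> carrier P; p' \<in> carrier P\<rbrakk> \<Longrightarrow>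
      act_onF m (p \<oplus>\<^bsub>P\<^esub> p') G = act_onF m p G \<otimes>\<^bsub>MPF\<^esub> act_onF m p' G"
    unfolding act_onF_def
    by (rule DTF.tensor_lift_add_cong[OF MPF.comm_group_axioms G(1)]) (simp_all add: act act' MPF_pure)
  show "\<lbrakk>k \<in> carrier K; m \<in> carrier M; p \<in> carrier P\<rbrakk> \<Longrightarrow> act_onF (k \<odot>\<^bsub>M\<^esub> m) p G = act_onF m (k \<odot>\<^bsub>P\<^esub> p) G"
    unfolding act_onF_def
    by (rule DTF.tensor_lift_cong2[OF MPF.comm_group_axioms G(1)]) (simp_all add: act act' MPF_pure)
  assume h: "b \<in> carrier B" "m \<in> carrier M" "p \<in> carrier P"
  show "act_onF (\<alpha> (tgt \<D> b) m) p G = act_onF m (\<beta> (src \<D> b) p) G"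
    using act_onF_inverse_times[OF h(2,3), of "tgt \<D> b" "\<one>\<^bsub>\<D>\<^esub>"] act_onF_inverse_times[OF h(2,3), of "\<one>\<^bsub>\<D>\<^esub>" "src \<D> b"] h
    by (simp add: inverse_times_slide diffop_closed act act')
qed

definition "untwist_modules = tensor_lift MPF (\<lambda>(m, p). act_onF m p G)"

lemma untwist_modules:
  shows "untwist_modules \<in> hom MP MPF"
    and "\<lbrakk>m \<in> carrier M; p \<in> carrier P\<rbrakk> \<Longrightarrow> untwist_modules (pure MP (m, p)) = act_onF m p G"
proof -
  have "TM.bal MPF (\<lambda>m p. act_onF m p G)"
    by (rule balancedI; rule act_onF_inverse)
  note l = TM.tensor_lift_hom[OF MPF.comm_group_axioms this]
  show "untwist_modules \<in> hom MP MPF"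
    "\<lbrakk>m \<in> carrier M; p \<in> carrier P\<rbrakk> \<Longrightarrow> untwist_modules (pure MP (m, p)) = act_onF m p G"
    unfolding untwist_modules_def by (rule l(1), rule l(2))
qed

lemma untwist_modules_act_on:
  assumes "m \<in> carrier M" "p \<in> carrier P"
  shows "untwist_modules (act_on m p F) = pure MPF (m, p)"
proof -
  have "untwist_modules (act_on m p F) = tensor_lift MPF (\<lambda>(x, y). untwist_modules (pure MP (\<alpha> x m, \<beta> y p))) F"
    unfolding act_on_def
    by (rule DT.tensor_lift_comp_hom2[OF MP.comm_group_axioms MPF.comm_group_axioms F_closed untwist_modules(1)])
      (simp add: assms act act' MP_pure)
  also have "\<dots> = tensor_lift MPF (\<lambda>(x, y). act_onF m p (inverse_times x y)) F"
    by (rule DT.tensor_lift_cong2[OF MPF.comm_group_axioms F_closed])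
      (simp_all add: assms act act' act_onF_inverse_times untwist_modules act_onF_inverse)
  also have "\<dots> = act_onF m p (tensor_lift \<D>\<D>F (\<lambda>(x, y). inverse_times x y) F)"
    by (rule DT.tensor_lift_comp_hom2[OF DDF.comm_group_axioms MPF.comm_group_axioms F_closed act_onF(1), symmetric])
      (simp_all add: assms inverse_times)
  also have "\<dots> = pure MPF (m, p)"
    using assms by (simp add: inverse_times_cocycle act_onF diffop_closed act act')
  finally show ?thesis .
qed

text \<open>The inverse is \<open>m \<otimes> p \<mapsto> \<Sum> G\<^sup>i \<triangleright> m \<otimes> G\<^sub>i \<triangleright> p\<close>. It is well defined because \<open>G\<close> satisfies
  \<open>G\<^sup>i b \<otimes> G\<^sub>i = G\<^sup>i \<otimes> G\<^sub>i b\<close> over the twisted base. The two compositions are the identity because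
  \<open>F\<^sup>i G\<^sup>j \<otimes> F\<^sub>i G\<^sub>j\<close> and \<open>G\<^sup>j F\<^sup>i \<otimes> G\<^sub>j F\<^sub>i\<close> are \<open>1 \<otimes> 1\<close> in the respective tensor products.\<close>

theorem twist_map_bij: "bij_betw (twist_map K B \<D> F M \<alpha> P \<beta>) (carrier MPF) (carrier MP)"
proof (rule bij_betw_byWitness[where f' = untwist_modules])
  show "\<forall>T\<in>carrier MPF. untwist_modules (twist_map K B \<D> F M \<alpha> P \<beta> T) = T"
  proof
    fix T assume "T \<in> carrier MPF"
    then show "untwist_modules (twist_map K B \<D> F M \<alpha> P \<beta> T) = T"
      by (induction T rule: TMF.tensor_induct)
        (simp_all add: twist_map(2) untwist_modules_act_on hom_mult[OF twist_map(1)] hom_mult[OF untwist_modules(1)]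
          hom_in_carrier[OF twist_map(1)])
  qed
  show "\<forall>T\<in>carrier MP. twist_map K B \<D> F M \<alpha> P \<beta> (untwist_modules T) = T"
  proof
    fix T assume "T \<in> carrier MP"
    then show "twist_map K B \<D> F M \<alpha> P \<beta> (untwist_modules T) = T"
    proof (induction T rule: TM.tensor_induct)
      case (pure m p)
      then show ?case
        by (simp add: untwist_modules(2) twist_map_act_onF G(1) regular_map_eq[symmetric] G(2) act_on diffop_closed act act')
    next
      case (mult S T)
      then show ?case
        by (simp add: hom_mult[OF twist_map(1)] hom_mult[OF untwist_modules(1)] hom_in_carrier[OF untwist_modules(1)])
    qed
  qed
qed (use hom_in_carrier[OF twist_map(1)] hom_in_carrier[OF untwist_modules(1)] in auto)

end

section \<open>Comodules over the jets\<close>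

lemma tensor_cong:
  assumes "\<And>b x. \<lbrakk>b \<in> A; x \<in> carrier M\<rbrakk> \<Longrightarrow> r b x = r' b x" "\<And>b y. \<lbrakk>b \<in> A; y \<in> carrier N\<rbrakk> \<Longrightarrow> l b y = l' b y"
  shows "tensor K M N A r l = tensor K M N A r' l'"
proof -
  have "{frag_of (r b x, y) - frag_of (x, l b y) | b x y. b \<in> A \<and> x \<in> carrier M \<and> y \<in> carrier N} =
      {frag_of (r' b x, y) - frag_of (x, l' b y) | b x y. b \<in> A \<and> x \<in> carrier M \<and> y \<in> carrier N}"
    using assms by (intro Collect_cong) metis
  then show ?thesis by (simp only: tensor_def)
qed

context coev_jets
begin

lemma pairing_act:
  assumes D: "D \<in> carrier \<D>" and X: "X \<in> carrier \<J>" and b: "b \<in> carrier B"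
  shows "pairing D (tgt \<J> b \<bullet> X) = b \<otimes> pairing D X"
    and "pairing D (src \<J> b \<bullet> X) = pairing (D \<cdot> src \<D> b) X"
    and "k \<in> carrier K \<Longrightarrow> pairing D (k \<odot>\<^bsub>\<J>\<^esub> X) = k \<odot> pairing D X"
proof -
  interpret Jm: module K \<J> by (rule jets_module)
  have Db: "D \<cdot> src \<D> b \<in> carrier \<D>" using D b by (simp add: diffop_closed)
  show "pairing D (tgt \<J> b \<bullet> X) = b \<otimes> pairing D X"
    using X by (rule jet_generates)
      (simp_all add: b pairing[OF D] J.r_distr B.r_distr diffop[OF D] B.m_ac)
  show "pairing D (src \<J> b \<bullet> X) = pairing (D \<cdot> src \<D> b) X"
    using X by (rule jet_generates)
      (simp_all add: b pairing[OF D] pairing[OF Db] J.r_distr diffop_apply)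
  show "pairing D (k \<odot>\<^bsub>\<J>\<^esub> X) = k \<odot> pairing D X" if k: "k \<in> carrier K"
    using X by (rule jet_generates)
      (simp_all add: k pairing[OF D] Jm.smult_r_distr B.smult_r_distr diffop[OF D] jt_smult(1) smult_left)
qed

lemma pairing_lin:
  assumes D: "D \<in> carrier \<D>" and D': "D' \<in> carrier \<D>" and X: "X \<in> carrier \<J>"
  shows "pairing (D \<oplus>\<^bsub>\<D>\<^esub> D') X = pairing D X \<oplus> pairing D' X"
    and "k \<in> carrier K \<Longrightarrow> pairing (k \<odot>\<^bsub>\<D>\<^esub> D) X = k \<odot> pairing D X"
    and "pairing \<one>\<^bsub>\<D>\<^esub> X = cou \<J> X"
proof -
  note c = diffop_closed(2)[OF D D'] diffop_closed(4) diffop_closed(3)[OF _ D]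
  show "pairing (D \<oplus>\<^bsub>\<D>\<^esub> D') X = pairing D X \<oplus> pairing D' X"
    using X by (rule jet_generates)
      (simp_all add: pairing[OF D] pairing[OF D'] pairing[OF c(1)] B.l_distr B.a_ac diffop[OF D] diffop[OF D'] diffop_apply)
  show "pairing (k \<odot>\<^bsub>\<D>\<^esub> D) X = k \<odot> pairing D X" if k: "k \<in> carrier K"
    using X by (rule jet_generates)
      (simp_all add: k pairing[OF D] pairing[OF c(3)[OF k]] B.smult_r_distr diffop[OF D] diffop_apply smult_left)
  show "pairing \<one>\<^bsub>\<D>\<^esub> X = cou \<J> X"
    using X by (rule jet_generates)
      (simp_all add: pairing[OF c(2)] diffop_apply JH.cou_jet JH.cou_add)
qed

end

locale jet_comodule = coev_jets K B N u E + left_comodule K B "jets K B" M l r \<delta>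
  for K :: "'k ring" and B :: "('k, 'b) module" (structure) and N u E
    and M :: "('k, 'm, 'x) module_scheme" and l r \<delta>
begin

sublocale Mm: module K M by (rule left_module.vector_space[OF left_act])

abbreviation "JM \<equiv> diamond_comod K B \<J> M l"

lemma lact:
  "\<lbrakk>b \<in> carrier B; m \<in> carrier M\<rbrakk> \<Longrightarrow> l b m \<in> carrier M"
  "\<lbrakk>b \<in> carrier B; m \<in> carrier M; m' \<in> carrier M\<rbrakk> \<Longrightarrow> l b (m \<oplus>\<^bsub>M\<^esub> m') = l b m \<oplus>\<^bsub>M\<^esub> l b m'"
  "\<lbrakk>k \<in> carrier K; b \<in> carrier B; m \<in> carrier M\<rbrakk> \<Longrightarrow> l b (k \<odot>\<^bsub>M\<^esub> m) = k \<odot>\<^bsub>M\<^esub> l b m"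
  "\<lbrakk>b \<in> carrier B; c \<in> carrier B; m \<in> carrier M\<rbrakk> \<Longrightarrow> l (b \<oplus> c) m = l b m \<oplus>\<^bsub>M\<^esub> l c m"
  "\<lbrakk>k \<in> carrier K; b \<in> carrier B; m \<in> carrier M\<rbrakk> \<Longrightarrow> l (k \<odot> b) m = k \<odot>\<^bsub>M\<^esub> l b m"
  "\<lbrakk>b \<in> carrier B; c \<in> carrier B; m \<in> carrier M\<rbrakk> \<Longrightarrow> l (b \<otimes> c) m = l b (l c m)"
  "m \<in> carrier M \<Longrightarrow> l \<one> m = m"
  using left_module.act_bilinear[OF left_act] left_module.act_mult[OF left_act] left_module.act_one[OF left_act]
  by (auto simp: bilinear_map_def linear_map_def Pi_iff)

lemma ract:
  "\<lbrakk>b \<in> carrier B; m \<in> carrier M\<rbrakk> \<Longrightarrow> r b m \<in> carrier M"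
  "m \<in> carrier M \<Longrightarrow> r \<one> m = m"
  using left_module.act_bilinear[OF right_act] left_module.act_one[OF right_act]
  by (auto simp: bilinear_map_def linear_map_def Pi_iff opposite_def)

lemma comod_tensor_eq: "tensor K \<J> M (carrier B) (\<lambda>b x. tgt \<J> b \<bullet> x) l = diamond_comod K B \<J> M l"
  by (simp only: diamond_comod_def)

sublocale C: tensor_data K \<J> M "carrier B" "\<lambda>b x. tgt \<J> b \<bullet> x" l
  rewrites "tensor K \<J> M (carrier B) (\<lambda>b x. tgt \<J> b \<bullet> x) l = diamond_comod K B \<J> M l"
  by (rule tensor_data.intro; (rule jets_module Mm.module_axioms | simp add: JH.tgt_closed lact)?)
    (rule comod_tensor_eq)

interpretation JM: comm_group JM by (rule C.comm_group_tensor)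

definition act where
  "act D m = tensor_lift (add_monoid M) (\<lambda>(x, y). l (pairing D x) y) (\<delta> m)"

lemma act_lift:
  assumes D: "D \<in> carrier \<D>"
  shows "tensor_lift (add_monoid M) (\<lambda>(x, y). l (pairing D x) y) \<in> hom JM (add_monoid M)"
    and "\<lbrakk>x \<in> carrier \<J>; y \<in> carrier M\<rbrakk> \<Longrightarrow>
      tensor_lift (add_monoid M) (\<lambda>(x, y). l (pairing D x) y) (pure JM (x, y)) = l (pairing D x) y"
proof -
  have "C.bal (add_monoid M) (\<lambda>x y. l (pairing D x) y)"
  proof (rule balancedI)
    fix b x y assume h: "b \<in> carrier B" "x \<in> carrier \<J>" "y \<in> carrier M"
    have "b \<otimes> pairing D x = pairing D x \<otimes> b" using h by (simp add: B.m_comm pairing[OF D])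
    then show "l (pairing D (tgt \<J> b \<bullet> x)) y = l (pairing D x) (l b y)"
      using h by (simp only: pairing_act[OF D]) (simp add: lact pairing[OF D])
  qed (simp_all add: lact pairing[OF D] pairing_act[OF D _ B.one_closed])
  note l = C.tensor_lift_hom[OF Mm.a_comm_group this]
  show "tensor_lift (add_monoid M) (\<lambda>(x, y). l (pairing D x) y) \<in> hom JM (add_monoid M)"
    by (rule l(1))
  show "\<lbrakk>x \<in> carrier \<J>; y \<in> carrier M\<rbrakk> \<Longrightarrow>
      tensor_lift (add_monoid M) (\<lambda>(x, y). l (pairing D x) y) (pure JM (x, y)) = l (pairing D x) y"
    by (rule l(2))
qed

lemma act_hom: "D \<in> carrier \<D> \<Longrightarrow> act D \<in> hom (add_monoid M) (add_monoid M)"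
  by (rule homI)
    (simp_all add: act_def coact_add coact_closed hom_in_carrier[OF act_lift(1), simplified] hom_mult[OF act_lift(1), simplified])

lemma act_closed: "\<lbrakk>D \<in> carrier \<D>; m \<in> carrier M\<rbrakk> \<Longrightarrow> act D m \<in> carrier M"
  using hom_in_carrier[OF act_hom] by simp

lemma act_one: "m \<in> carrier M \<Longrightarrow> act \<one>\<^bsub>\<D>\<^esub> m = m"
  unfolding act_def
  by (subst (2) coact_counit[symmetric], assumption, rule C.tensor_lift_cong2[OF Mm.a_comm_group coact_closed])
    (simp_all add: pairing_lin[OF diffop_closed(4) diffop_closed(4)] lact JH.cou_closed)

text \<open>The coaction is linear over the source, and the pairing moves the source to the operator.\<close>

lemma act_lact:
  assumes "D \<in> carrier \<D>" "b \<in> carrier B" "m \<in> carrier M"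
  shows "act D (l b m) = act (D \<cdot> src \<D> b) m"
proof -
  have "\<delta> (l b m) = tensor_lift JM (\<lambda>(x, y). pure JM (src \<J> b \<bullet> x \<bullet> src \<J> \<one>, y)) (\<delta> m)"
    using coact_bimodule[OF assms(3,2) B.one_closed] assms by (simp add: ract Let_def)
  then have "act D (l b m) = tensor_lift (add_monoid M) (\<lambda>(x, y). tensor_lift (add_monoid M) (\<lambda>(x, y). l (pairing D x) y)
      (pure JM (src \<J> b \<bullet> x \<bullet> src \<J> \<one>, y))) (\<delta> m)"
    unfolding act_def
    using assms
    by (simp only:, intro C.tensor_lift_comp_hom2[OF JM.comm_group_axioms Mm.a_comm_group coact_closed act_lift(1)])
      (auto simp: JH.src_closed)
  also have "\<dots> = act (D \<cdot> src \<D> b) m"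
    unfolding act_def
  proof (rule C.tensor_lift_cong2[OF Mm.a_comm_group coact_closed[OF assms(3)]])
    fix x y assume h: "x \<in> carrier \<J>" "y \<in> carrier M"
    have "src \<J> \<one> = \<one>\<^bsub>\<J>\<^esub>" by (simp add: jets_fields(7) jt_one)
    then have s: "src \<J> b \<bullet> x \<bullet> src \<J> \<one> = src \<J> b \<bullet> x"
      using h assms by (simp add: JH.src_closed)
    show "tensor_lift (add_monoid M) (\<lambda>(x, y). l (pairing D x) y)
      (pure JM (src \<J> b \<bullet> x \<bullet> src \<J> \<one>, y)) = l (pairing (D \<cdot> src \<D> b) x) y"
      unfolding s using h assms by (simp add: act_lift pairing_act JH.src_closed)
    show "l (pairing (D \<cdot> src \<D> b) x) y \<in> carrier (add_monoid M)"
      using h assms by (simp add: lact pairing diffop_closed)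
  qed
  finally show ?thesis .
qed

lemma act_src:
  assumes "b \<in> carrier B" "m \<in> carrier M"
  shows "act (src \<D> b) m = l b m"
  using act_lact[OF diffop_closed(4) assms] assms act_one[OF lact(1)[OF assms]]
  by (simp add: diffop_closed)

text \<open>In a commutative algebra of jets, multiplication by the source on the left and on the right agree, so
  that the two actions on a comodule have the same coaction. The counit then identifies them.\<close>

lemma ract_eq_lact:
  assumes "b \<in> carrier B" "m \<in> carrier M"
  shows "r b m = l b m"
proof -
  have "\<delta> (l b (r \<one> m)) = \<delta> (l \<one> (r b m))"
    using coact_bimodule[OF assms(2,1) B.one_closed] coact_bimodule[OF assms(2) B.one_closed assms(1)]
    unfolding Let_def
  proof (elim ssubst, intro C.tensor_lift_cong2[OF JM.comm_group_axioms coact_closed[OF assms(2)]])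
    fix x y assume h: "x \<in> carrier \<J>" "y \<in> carrier M"
    have "src \<J> b \<bullet> x \<bullet> src \<J> \<one> = src \<J> \<one> \<bullet> x \<bullet> src \<J> b"
      using h assms by (simp add: JH.src_closed J.m_ac)
    then show "pure JM (src \<J> b \<bullet> x \<bullet> src \<J> \<one>, y) = pure JM (src \<J> \<one> \<bullet> x \<bullet> src \<J> b, y)"
      by simp
  qed (use assms in \<open>auto simp: JH.src_closed\<close>)
  then have "act \<one>\<^bsub>\<D>\<^esub> (l b m) = act \<one>\<^bsub>\<D>\<^esub> (r b m)"
    using assms by (simp add: ract lact act_def)
  then show ?thesis using assms by (simp add: act_one lact ract)
qed

text \<open>The map \<open>x \<otimes> z \<otimes> w \<mapsto> \<langle>D|s(\<langle>D'|x\<rangle>)z\<rangle> w\<close> takes the two sides of coassociativity to the action of the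
  product and to the iterated action.\<close>

lemma act_mult:
  assumes D: "D \<in> carrier \<D>" and D': "D' \<in> carrier \<D>" and m: "m \<in> carrier M"
  shows "act (D \<cdot> D') m = act D (act D' m)"
proof -
  define T where "T = diamond3 K B \<J> M l"
  interpret T: tensor3_data K \<J> \<J> M "carrier B" "\<lambda>b x. tgt \<J> b \<bullet> x" "\<lambda>b y. src \<J> b \<bullet> y"
      "\<lambda>b y. tgt \<J> b \<bullet> y" l
    rewrites "tensor3 K \<J> \<J> M (carrier B) (\<lambda>b x. tgt \<J> b \<bullet> x) (\<lambda>b y. src \<J> b \<bullet> y)
      (\<lambda>b y. tgt \<J> b \<bullet> y) l = T"
    by (rule tensor3_data.intro; (rule jets_module Mm.module_axioms | simp add: JH.tgt_closed JH.src_closed lact)?)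
      (simp only: T_def diamond3_def)
  interpret TG: comm_group T by (rule T.comm_group_tensor3)
  define g where "g x z w = l (pairing D (src \<J> (pairing D' x) \<bullet> z)) w" for x z w
  have g: "g x z w = act_term" if "act_term = l (pairing (D \<cdot> src \<D> (pairing D' x)) z) w"
    "x \<in> carrier \<J>" "z \<in> carrier \<J>" for x z w act_term
    using that D D' by (simp add: g_def pairing_act pairing)
  have pD': "pairing D' x \<in> carrier B" if "x \<in> carrier \<J>" for x using that D' by (simp add: pairing)
  have gc: "g x z w \<in> carrier M" if "x \<in> carrier \<J>" "z \<in> carrier \<J>" "w \<in> carrier M" for x z w
    using that D D' by (simp add: g_def pairing lact JH.src_closed)
  have bal: "T.bal (add_monoid M) g"
  proof (rule balanced3I)
    fix b x y z assume h: "b \<in> carrier B" "x \<in> carrier \<J>" "y \<in> carrier \<J>" "z \<in> carrier M"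
    have "src \<J> (b \<otimes> pairing D' x) \<bullet> y = src \<J> (pairing D' x) \<bullet> (src \<J> b \<bullet> y)"
      using h pD' by (simp add: JH.src_hom_simps JH.src_closed J.m_ac)
    then show "g (tgt \<J> b \<bullet> x) y z = g x (src \<J> b \<bullet> y) z"
      using h by (simp only: g_def pairing_act[OF D'])
    have "src \<J> (pairing D' x) \<bullet> (tgt \<J> b \<bullet> y) = tgt \<J> b \<bullet> (src \<J> (pairing D' x) \<bullet> y)"
      using h pD' by (simp add: JH.src_closed JH.tgt_closed J.m_ac)
    moreover have "b \<otimes> pairing D (src \<J> (pairing D' x) \<bullet> y) = pairing D (src \<J> (pairing D' x) \<bullet> y) \<otimes> b"
      using h pD' D by (simp add: B.m_comm pairing JH.src_closed)
    ultimately show "g x (tgt \<J> b \<bullet> y) z = g x y (l b z)"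
      using h pD' D by (simp add: g_def pairing_act lact JH.src_closed pairing diffop_closed)
  next
    fix k x y z assume h: "k \<in> carrier K" "x \<in> carrier \<J>" "y \<in> carrier \<J>" "z \<in> carrier M"
    interpret Jm: module K \<J> by (rule jets_module)
    have c: "pairing D (src \<J> (pairing D' x) \<bullet> y) \<in> carrier B" using h pD' D by (simp add: pairing JH.src_closed)
    have sm: "(k \<odot>\<^bsub>\<J>\<^esub> X) \<bullet> Y = k \<odot>\<^bsub>\<J>\<^esub> (X \<bullet> Y)"
      if "k \<in> carrier K" "X \<in> carrier \<J>" "Y \<in> carrier \<J>" for k X Y
      using that by (simp add: smult_jets J.m_assoc)
    have ks: "src \<J> (k \<odot> e) = k \<odot>\<^bsub>\<J>\<^esub> src \<J> e" if "e \<in> carrier B" for e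
      using that h by (simp add: jets_fields(7) jt_smult(1))
    have k: "src \<J> (k \<odot> pairing D' x) \<bullet> y = k \<odot>\<^bsub>\<J>\<^esub> (src \<J> (pairing D' x) \<bullet> y)"
      "src \<J> (pairing D' x) \<bullet> (k \<odot>\<^bsub>\<J>\<^esub> y) = k \<odot>\<^bsub>\<J>\<^esub> (src \<J> (pairing D' x) \<bullet> y)"
      using h pD' sm[of k "src \<J> (pairing D' x)" y] sm[of k y "src \<J> (pairing D' x)"] ks[of "pairing D' x"]
      by (simp_all add: JH.src_closed J.m_comm)
    show "g (k \<odot>\<^bsub>\<J>\<^esub> x) y z = g x (k \<odot>\<^bsub>\<J>\<^esub> y) z"
      using h by (simp only: g_def pairing_act(3)[OF D' _ B.one_closed] k)
    show "g x (k \<odot>\<^bsub>\<J>\<^esub> y) z = g x y (k \<odot>\<^bsub>M\<^esub> z)"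
      using h pD' D c by (simp add: g_def k pairing_act(3)[OF D _ B.one_closed] JH.src_closed lact)
  qed (use D D' pD' in \<open>simp_all add: gc, simp_all add: g_def pairing JH.src_hom_simps JH.src_closed J.l_distr J.r_distr lact\<close>)
  define h where "h = tensor_lift (add_monoid M) (\<lambda>(x, y, z). g x y z)"
  note hh = T.tensor3_lift_hom[OF Mm.a_comm_group bal, folded h_def]
  have cong1: "h (tensor_lift T (\<lambda>(x1, x2). pure T (x1, x2, y)) (cop \<J> x)) = l (pairing (D \<cdot> D') x) y"
    if x: "x \<in> carrier \<J>" and y: "y \<in> carrier M" for x y
  proof -
    have b: "JH.D.bal (add_monoid M) (\<lambda>x1 x2. g x1 x2 y)"
      by (rule balancedI)
        (use balanced3D[OF bal] y in \<open>simp_all\<close>)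
    have "h (tensor_lift T (\<lambda>(x1, x2). pure T (x1, x2, y)) (cop \<J> x)) =
        tensor_lift (add_monoid M) (\<lambda>(x1, x2). h (pure T (x1, x2, y))) (cop \<J> x)"
      by (rule JH.D.tensor_lift_comp_hom2[OF TG.comm_group_axioms Mm.a_comm_group JH.cop_closed[OF x] hh(1)])
        (simp add: y)
    also have "\<dots> = tensor_lift (add_monoid M) (\<lambda>(x1, x2). g x1 x2 y) (cop \<J> x)"
      by (rule JH.D.tensor_lift_cong2[OF Mm.a_comm_group JH.cop_closed[OF x]]) (simp_all add: y hh gc)
    also have "\<dots> = l (pairing (D \<cdot> D') x) y"
    proof (rule jet_generates[OF x])
      fix a b assume ab: "a \<in> carrier B" "b \<in> carrier B"
      then have "tensor_lift (add_monoid M) (\<lambda>(x1, x2). g x1 x2 y) (cop \<J> (jt a b)) = g (jt a \<one>) (jt \<one> b) y"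
        by (rule JH.cop_lift(3)[OF Mm.a_comm_group b])
      also have "\<dots> = l (pairing (D \<cdot> D') (jt a b)) y"
        using ab D D' by (simp add: g_def pairing diffop diffop_closed diffop_apply)
      finally show "tensor_lift (add_monoid M) (\<lambda>(x1, x2). g x1 x2 y) (cop \<J> (jt a b)) = l (pairing (D \<cdot> D') (jt a b)) y" .
    next
      fix X Y assume "X \<in> carrier \<J>" "Y \<in> carrier \<J>"
        and "tensor_lift (add_monoid M) (\<lambda>(x1, x2). g x1 x2 y) (cop \<J> X) = l (pairing (D \<cdot> D') X) y"
        and "tensor_lift (add_monoid M) (\<lambda>(x1, x2). g x1 x2 y) (cop \<J> Y) = l (pairing (D \<cdot> D') Y) y"
      then show "tensor_lift (add_monoid M) (\<lambda>(x1, x2). g x1 x2 y) (cop \<J> (X \<oplus>\<^bsub>\<J>\<^esub> Y)) = l (pairing (D \<cdot> D') (X \<oplus>\<^bsub>\<J>\<^esub> Y)) y"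
        using JH.cop_lift(2)[OF Mm.a_comm_group b, of X Y] y D D' by (simp add: pairing lact diffop_closed)
    qed
    finally show ?thesis .
  qed
  have cong2: "h (tensor_lift T (\<lambda>(z, w). pure T (x, z, w)) (\<delta> y)) = act D (l (pairing D' x) y)"
    if x: "x \<in> carrier \<J>" and y: "y \<in> carrier M" for x y
  proof -
    have "h (tensor_lift T (\<lambda>(z, w). pure T (x, z, w)) (\<delta> y)) = tensor_lift (add_monoid M) (\<lambda>(z, w). h (pure T (x, z, w))) (\<delta> y)"
      by (rule C.tensor_lift_comp_hom2[OF TG.comm_group_axioms Mm.a_comm_group coact_closed[OF y] hh(1)]) (simp add: x)
    also have "\<dots> = act (D \<cdot> src \<D> (pairing D' x)) y"
      unfolding act_def
      by (rule C.tensor_lift_cong2[OF Mm.a_comm_group coact_closed[OF y]])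
        (use x D pD' in \<open>simp_all add: hh g_def pairing_act pairing diffop_closed lact\<close>)
    finally show ?thesis using x y D pD' by (simp add: act_lact)
  qed
  have i1: "tensor_lift T (\<lambda>(x1, x2). pure T (x1, x2, y)) (cop \<J> x) \<in> carrier T" if "x \<in> carrier \<J>" "y \<in> carrier M" for x y
    using that by (intro JH.D.tensor_lift_closed2[OF TG.comm_group_axioms JH.cop_closed]) auto
  have i2: "tensor_lift T (\<lambda>(z, w). pure T (x, z, w)) (\<delta> y) \<in> carrier T" if "x \<in> carrier \<J>" "y \<in> carrier M" for x y
    using that by (intro C.tensor_lift_closed2[OF TG.comm_group_axioms coact_closed]) auto
  have "act (D \<cdot> D') m =
      tensor_lift (add_monoid M) (\<lambda>(x, y). h (tensor_lift T (\<lambda>(x1, x2). pure T (x1, x2, y)) (cop \<J> x))) (\<delta> m)"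
    unfolding act_def
    by (rule C.tensor_lift_cong2[OF Mm.a_comm_group coact_closed[OF m]])
      (use hom_in_carrier[OF hh(1) i1] in \<open>simp_all add: cong1\<close>)
  also have "\<dots> = h (tensor_lift T (\<lambda>(x, y). tensor_lift T (\<lambda>(x1, x2). pure T (x1, x2, y)) (cop \<J> x)) (\<delta> m))"
    by (rule C.tensor_lift_comp_hom2[OF TG.comm_group_axioms Mm.a_comm_group coact_closed[OF m] hh(1), symmetric]) (rule i1)
  also have "\<dots> = h (tensor_lift T (\<lambda>(x, y). tensor_lift T (\<lambda>(z, w). pure T (x, z, w)) (\<delta> y)) (\<delta> m))"
    using coact_coassoc[OF m] by (simp add: Let_def T_def)
  also have "\<dots> = tensor_lift (add_monoid M) (\<lambda>(x, y). h (tensor_lift T (\<lambda>(z, w). pure T (x, z, w)) (\<delta> y))) (\<delta> m)"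
    by (rule C.tensor_lift_comp_hom2[OF TG.comm_group_axioms Mm.a_comm_group coact_closed[OF m] hh(1)]) (rule i2)
  also have "\<dots> = tensor_lift (add_monoid M) (\<lambda>(x, y). act D (l (pairing D' x) y)) (\<delta> m)"
    by (rule C.tensor_lift_cong2[OF Mm.a_comm_group coact_closed[OF m]])
      (use D pD' in \<open>simp_all add: cong2 act_closed lact\<close>)
  also have "\<dots> = act D (act D' m)"
    unfolding act_def[of D']
    by (rule C.tensor_lift_comp_hom2[OF Mm.a_comm_group Mm.a_comm_group coact_closed[OF m] act_hom[OF D], symmetric])
      (simp add: lact pD')
  finally show ?thesis .
qed

lemma act_add_left:
  "\<lbrakk>D \<in> carrier \<D>; D' \<in> carrier \<D>; m \<in> carrier M\<rbrakk> \<Longrightarrow> act (D \<oplus>\<^bsub>\<D>\<^esub> D') m = act D m \<oplus>\<^bsub>M\<^esub> act D' m"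
  unfolding act_def
  by (rule C.tensor_lift_add_cong[OF Mm.a_comm_group coact_closed, simplified monoid.select_convs])
    (simp_all add: pairing pairing_lin lact)

lemma smult_eq_lact: "\<lbrakk>k \<in> carrier K; m \<in> carrier M\<rbrakk> \<Longrightarrow> k \<odot>\<^bsub>M\<^esub> m = l (k \<odot> \<one>) m"
  by (simp add: lact)

lemma diffop_smult_right:
  "\<lbrakk>k \<in> carrier K; D \<in> carrier \<D>\<rbrakk> \<Longrightarrow> k \<odot>\<^bsub>\<D>\<^esub> D = D \<cdot> src \<D> (k \<odot> \<one>)"
  "\<lbrakk>k \<in> carrier K; D \<in> carrier \<D>\<rbrakk> \<Longrightarrow> k \<odot>\<^bsub>\<D>\<^esub> D = src \<D> (k \<odot> \<one>) \<cdot> D"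
  by (rule diffop_eqI; simp add: diffop_closed diffop_apply diffop smult_left)+

theorem act_module: "left_module K \<D> M act"
proof -
  have k: "act D (k \<odot>\<^bsub>M\<^esub> m) = act (k \<odot>\<^bsub>\<D>\<^esub> D) m" "act (k \<odot>\<^bsub>\<D>\<^esub> D) m = k \<odot>\<^bsub>M\<^esub> act D m"
    if "D \<in> carrier \<D>" "k \<in> carrier K" "m \<in> carrier M" for D k m
  proof -
    show "act D (k \<odot>\<^bsub>M\<^esub> m) = act (k \<odot>\<^bsub>\<D>\<^esub> D) m"
      using that by (simp only: smult_eq_lact diffop_smult_right(1)) (simp add: act_lact)
    show "act (k \<odot>\<^bsub>\<D>\<^esub> D) m = k \<odot>\<^bsub>M\<^esub> act D m"
      using that by (simp only: smult_eq_lact diffop_smult_right(2) act_closed) (simp add: act_mult diffop_closed act_src act_closed)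
  qed
  have a: "act D (m \<oplus>\<^bsub>M\<^esub> m') = act D m \<oplus>\<^bsub>M\<^esub> act D m'"
    if "D \<in> carrier \<D>" "m \<in> carrier M" "m' \<in> carrier M" for D m m'
    using hom_mult[OF act_hom[OF that(1)]] that by simp
  show ?thesis
    by (rule left_module.intro)
      (auto simp: bilinear_map_def linear_map_def Mm.module_axioms act_closed a k act_add_left act_mult act_one)
qed

end

context jet_cocycle
begin

lemma \<Gamma>_src:
  assumes "X \<in> carrier \<J>" "a \<in> carrier B"
  shows "\<Gamma> X (src \<J> a) = pairing (\<tau> a) X" "\<Gamma> (src \<J> a) X = pairing (\<sigma> a) X"
proof -
  note p = pairing[OF twist_src(1)[OF assms(2)]] pairing[OF twist_tgt(1)[OF assms(2)]]
  have s: "src \<J> a \<in> carrier \<J>" using assms by (simp add: JH.src_closed)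
  show "\<Gamma> X (src \<J> a) = pairing (\<tau> a) X"
    using assms(1)
    by (rule jet_generates) (simp_all add: p s \<Gamma>_add, simp add: jets_fields(7) \<Gamma>_jet assms twist_tgt)
  show "\<Gamma> (src \<J> a) X = pairing (\<sigma> a) X"
    using assms(1)
    by (rule jet_generates) (simp_all add: p s \<Gamma>_add, simp add: jets_fields(7) \<Gamma>_jet assms twist_src)
qed

end

context invertible_jet_cocycle
begin

text \<open>Both comodules are modules over \<open>\<D>\<close>, the actions of the twisted base on them are those through \<open>s\<^sup>F\<close>
  and \<open>t\<^sup>F\<close>, and \<open>\<Gamma>(m\<^sub>-\<^sub>1, n\<^sub>-\<^sub>1)m\<^sub>0 \<otimes> n\<^sub>0 = \<Sum> F\<^sup>i \<triangleright> m \<otimes> F\<^sub>i \<triangleright> n\<close>. So the map in question is \<open>F\<^sup>#\<close>.\<close>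

theorem \<Gamma>_invertible: "invertible_on TYPE('m) TYPE('n) K B \<J> \<Gamma>"
  unfolding invertible_on_def
proof (intro allI impI, elim conjE)
  fix M :: "('k, 'm) module" and l r \<delta> and P :: "('k, 'n) module" and l' r' \<delta>'
  assume M: "left_comodule K B \<J> M l r \<delta>" and P: "left_comodule K B \<J> P l' r' \<delta>'"
  interpret c: jet_comodule K B N u E M l r \<delta>
    by (intro jet_comodule.intro coev_jets_axioms M)
  interpret d: jet_comodule K B N u E P l' r' \<delta>'
    by (intro jet_comodule.intro coev_jets_axioms P)
  interpret D: invertible_diffop_modules K B N u E F M c.act P d.act
    by (intro invertible_diffop_modules.intro diffop_modules.intro diffop_modules_axioms.intro
        invertible_jet_cocycle_axioms jet_cocycle_axioms c.act_module d.act_module)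
  interpret MP: comm_group "diamond_mod K B \<D> M c.act P d.act" by (rule D.TM.comm_group_tensor)
  have tgt: "c.act (tgt \<D> b) m = l b m" if "b \<in> carrier B" "m \<in> carrier M" for b m
    using that by (simp add: tgt_eq_src c.act_src)
  have T: "tensor K M P (carrier B) r l' = diamond_mod K B \<D> M c.act P d.act"
    unfolding diamond_mod_def
    by (rule tensor_cong) (simp_all add: c.ract_eq_lact tgt d.act_src)
  have TF: "tensor K M P (carrier BG) (cotwist_ract \<J> \<Gamma> M l \<delta>) (cotwist_lact \<J> \<Gamma> P l' \<delta>') =
      diamond_mod K BF \<D>F M c.act P d.act"
    unfolding twist_tensor_eq[symmetric] BG_fields
  proof (rule tensor_cong)
    fix b m assume "b \<in> carrier B" "m \<in> carrier M"
    then show "cotwist_ract \<J> \<Gamma> M l \<delta> b m = c.act (\<tau> b) m"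
      unfolding cotwist_ract_def c.act_def
      by (intro c.C.tensor_lift_cong2[OF c.Mm.a_comm_group c.coact_closed])
        (simp_all add: \<Gamma>_src c.lact pairing twist_tgt)
  next
    fix b m assume "b \<in> carrier B" "m \<in> carrier P"
    then show "cotwist_lact \<J> \<Gamma> P l' \<delta>' b m = d.act (\<sigma> b) m"
      unfolding cotwist_lact_def d.act_def
      by (intro d.C.tensor_lift_cong2[OF d.Mm.a_comm_group d.coact_closed])
        (simp_all add: \<Gamma>_src d.lact pairing twist_src)
  qed
  let ?T = "diamond_mod K B \<D> M c.act P d.act"
  have summand: "tensor_lift ?T (\<lambda>(x, m0). tensor_lift ?T (\<lambda>(y, n0). pure ?T (l (\<Gamma> x y) m0, n0)) (\<delta>' p)) (\<delta> m) = D.act_on m p F"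
    if m: "m \<in> carrier M" and p: "p \<in> carrier P" for m p
  proof -
    note dm = c.coact_closed[OF m] and dp = d.coact_closed[OF p]
    have lc: "pure ?T (l b m0, n0) \<in> carrier ?T" if "b \<in> carrier B" "m0 \<in> carrier M" "n0 \<in> carrier P" for b m0 n0
      using that by (simp add: c.lact D.MP_pure)
    have step: "pure ?T (c.act f m, d.act g p) = tensor_lift ?T (\<lambda>(x, m0). tensor_lift ?T (\<lambda>(y, n0).
        pure ?T (l (pairing f x \<otimes> pairing g y) m0, n0)) (\<delta>' p)) (\<delta> m)"
      if f: "f \<in> carrier \<D>" and g: "g \<in> carrier \<D>" for f g
    proof -
      have h1: "(\<lambda>v. pure ?T (v, d.act g p)) \<in> hom (add_monoid M) ?T"
        using g p by (intro homI) (auto simp: D.MP_pure d.act_closed)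
      have "pure ?T (c.act f m, d.act g p) = tensor_lift ?T (\<lambda>(x, m0). pure ?T (l (pairing f x) m0, d.act g p)) (\<delta> m)"
        unfolding c.act_def[of f m]
        by (rule c.C.tensor_lift_comp_hom2[OF c.Mm.a_comm_group MP.comm_group_axioms dm h1])
          (simp add: f pairing c.lact)
      also have "\<dots> = tensor_lift ?T (\<lambda>(x, m0). tensor_lift ?T (\<lambda>(y, n0).
        pure ?T (l (pairing f x \<otimes> pairing g y) m0, n0)) (\<delta>' p)) (\<delta> m)"
      proof (rule c.C.tensor_lift_cong2[OF MP.comm_group_axioms dm])
        fix x m0 assume x: "x \<in> carrier \<J>" and m0: "m0 \<in> carrier M"
        have v: "l (pairing f x) m0 \<in> carrier M" using x m0 f by (simp add: pairing c.lact)
        have h2: "(\<lambda>v. pure ?T (l (pairing f x) m0, v)) \<in> hom (add_monoid P) ?T"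
          using v by (intro homI) (auto simp: D.MP_pure)
        have "pure ?T (l (pairing f x) m0, d.act g p) =
            tensor_lift ?T (\<lambda>(y, n0). pure ?T (l (pairing f x) m0, l' (pairing g y) n0)) (\<delta>' p)"
          unfolding d.act_def[of g p]
          by (rule d.C.tensor_lift_comp_hom2[OF d.Mm.a_comm_group MP.comm_group_axioms dp h2])
            (simp add: g pairing d.lact)
        also have "\<dots> = tensor_lift ?T (\<lambda>(y, n0). pure ?T (l (pairing f x \<otimes> pairing g y) m0, n0)) (\<delta>' p)"
        proof (rule d.C.tensor_lift_cong2[OF MP.comm_group_axioms dp])
          fix y n0 assume y: "y \<in> carrier \<J>" and n0: "n0 \<in> carrier P"
          have b: "pairing g y \<in> carrier B" "pairing f x \<in> carrier B" using g f x y by (simp_all add: pairing)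
          have "l (pairing f x \<otimes> pairing g y) m0 = l (pairing g y) (l (pairing f x) m0)"
            using b m0 by (simp add: B.m_comm c.lact(6)[symmetric])
          then show "pure ?T (l (pairing f x) m0, l' (pairing g y) n0) = pure ?T (l (pairing f x \<otimes> pairing g y) m0, n0)"
            using D.MP_pure(5)[OF b(1) v n0] b v n0 by (simp add: tgt d.act_src)
          show "pure ?T (l (pairing f x \<otimes> pairing g y) m0, n0) \<in> carrier ?T"
            using b m0 n0 by (intro lc) auto
        qed
        finally show "pure ?T (l (pairing f x) m0, d.act g p) =
            tensor_lift ?T (\<lambda>(y, n0). pure ?T (l (pairing f x \<otimes> pairing g y) m0, n0)) (\<delta>' p)" .
        show "tensor_lift ?T (\<lambda>(y, n0). pure ?T (l (pairing f x \<otimes> pairing g y) m0, n0)) (\<delta>' p) \<in> carrier ?T"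
          by (rule d.C.tensor_lift_closed2[OF MP.comm_group_axioms dp], rule lc) (use f g x m0 in \<open>auto simp: pairing\<close>)
      qed
      finally show ?thesis .
    qed
    let ?t = "\<lambda>f g x m0 y n0. pure ?T (l (pairing f x \<otimes> pairing g y) m0, n0)"
    have tc: "?t f g x m0 y n0 \<in> carrier ?T"
      if "f \<in> carrier \<D>" "g \<in> carrier \<D>" "x \<in> carrier \<J>" "m0 \<in> carrier M" "y \<in> carrier \<J>" "n0 \<in> carrier P" for f g x m0 y n0
      using that by (intro lc) (auto simp: pairing)
    have tc2: "tensor_lift ?T (\<lambda>(y, n0). ?t f g x m0 y n0) (\<delta>' p) \<in> carrier ?T"
      if "f \<in> carrier \<D>" "g \<in> carrier \<D>" "x \<in> carrier \<J>" "m0 \<in> carrier M" for f g x m0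
      using that by (intro d.C.tensor_lift_closed2[OF MP.comm_group_axioms dp] tc)
    have "D.act_on m p F = tensor_lift ?T (\<lambda>(f, g). tensor_lift ?T (\<lambda>(x, m0). tensor_lift ?T (\<lambda>(y, n0). ?t f g x m0 y n0) (\<delta>' p)) (\<delta> m)) F"
      unfolding D.act_on_def
      by (rule DT.tensor_lift_cong2[OF MP.comm_group_axioms F_closed])
        (simp_all add: step c.C.tensor_lift_closed2[OF MP.comm_group_axioms dm] tc2)
    also have "\<dots> = tensor_lift ?T (\<lambda>(x, m0). tensor_lift ?T (\<lambda>(f, g). tensor_lift ?T (\<lambda>(y, n0). ?t f g x m0 y n0) (\<delta>' p)) F) (\<delta> m)"
      by (rule tensor_lift_swap2[OF DT.tensor_data_axioms c.C.tensor_data_axioms MP.comm_group_axioms,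
            unfolded diffops_tensor_eq c.comod_tensor_eq, OF F_closed dm tc2])
    also have "\<dots> = tensor_lift ?T (\<lambda>(x, m0). tensor_lift ?T (\<lambda>(y, n0). pure ?T (l (\<Gamma> x y) m0, n0)) (\<delta>' p)) (\<delta> m)"
    proof (rule c.C.tensor_lift_cong2[OF MP.comm_group_axioms dm])
      fix x m0 assume x: "x \<in> carrier \<J>" and m0: "m0 \<in> carrier M"
      have "tensor_lift ?T (\<lambda>(f, g). tensor_lift ?T (\<lambda>(y, n0). ?t f g x m0 y n0) (\<delta>' p)) F =
          tensor_lift ?T (\<lambda>(y, n0). tensor_lift ?T (\<lambda>(f, g). ?t f g x m0 y n0) F) (\<delta>' p)"
        by (rule tensor_lift_swap2[OF DT.tensor_data_axioms d.C.tensor_data_axioms MP.comm_group_axioms,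
            unfolded diffops_tensor_eq d.comod_tensor_eq, OF F_closed dp]) (rule tc[OF _ _ x m0])
      also have "\<dots> = tensor_lift ?T (\<lambda>(y, n0). pure ?T (l (\<Gamma> x y) m0, n0)) (\<delta>' p)"
      proof (rule d.C.tensor_lift_cong2[OF MP.comm_group_axioms dp])
        fix y n0 assume y: "y \<in> carrier \<J>" and n0: "n0 \<in> carrier P"
        have h3: "(\<lambda>b. pure ?T (l b m0, n0)) \<in> hom (add_monoid B) ?T"
          using m0 n0 by (intro homI) (auto simp: D.MP_pure c.lact)
        show "tensor_lift ?T (\<lambda>(f, g). ?t f g x m0 y n0) F = pure ?T (l (\<Gamma> x y) m0, n0)"
          unfolding \<Gamma>_def
          by (rule DT.tensor_lift_comp_hom2[OF B.a_comm_group MP.comm_group_axioms F_closed h3, symmetric])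
            (simp add: x y pairing)
        show "pure ?T (l (\<Gamma> x y) m0, n0) \<in> carrier ?T" using x y m0 n0 by (intro lc) auto
      qed
      finally show "tensor_lift ?T (\<lambda>(f, g). tensor_lift ?T (\<lambda>(y, n0). ?t f g x m0 y n0) (\<delta>' p)) F =
          tensor_lift ?T (\<lambda>(y, n0). pure ?T (l (\<Gamma> x y) m0, n0)) (\<delta>' p)" .
      show "tensor_lift ?T (\<lambda>(y, n0). pure ?T (l (\<Gamma> x y) m0, n0)) (\<delta>' p) \<in> carrier ?T"
        by (rule d.C.tensor_lift_closed2[OF MP.comm_group_axioms dp], rule lc) (use x m0 in auto)
    qed
    finally show ?thesis by simp
  qed
  show "let T = tensor K M P (carrier B) r l' in
    bij_betw (tensor_lift T (\<lambda>(m, n). tensor_lift T (\<lambda>(x, m0). tensor_lift T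
              (\<lambda>(y, n0). pure T (l (\<Gamma> x y) m0, n0)) (\<delta>' n)) (\<delta> m)))
      (carrier (tensor K M P (carrier BG) (cotwist_ract \<J> \<Gamma> M l \<delta>) (cotwist_lact \<J> \<Gamma> P l' \<delta>'))) (carrier T)"
    unfolding Let_def T TF
  proof (rule iffD1[OF bij_betw_cong D.twist_map_bij])
    fix S assume S: "S \<in> carrier (diamond_mod K BF \<D>F M c.act P d.act)"
    show "twist_map K B \<D> F M c.act P d.act S = tensor_lift ?T (\<lambda>(m, n). tensor_lift ?T (\<lambda>(x, m0). tensor_lift ?T
              (\<lambda>(y, n0). pure ?T (l (\<Gamma> x y) m0, n0)) (\<delta>' n)) (\<delta> m)) S"
      unfolding D.twist_map_eq
      by (rule D.TMF.tensor_lift_cong2[OF MP.comm_group_axioms S]) (simp_all add: summand D.act_on_cocycle)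
  qed
qed

end

section \<open>The twist and its pairing with the cotwist\<close>

context invertible_jet_cocycle
begin

interpretation DD: comm_group \<D>\<D> by (rule DT.comm_group_tensor)
interpretation DDF: comm_group \<D>\<D>F by (rule DTF.comm_group_tensor)

abbreviation TW where "TW \<equiv> twist K B \<D> F"

lemma TW_fields [simp]:
  "carrier TW = carrier \<D>" "add TW = add \<D>" "zero TW = zero \<D>" "one TW = one \<D>" "smult TW = smult \<D>"
  "mult TW = mult \<D>" "src TW = \<sigma>" "tgt TW = \<tau>" "cou TW = cou \<D>"
  by (simp_all add: twist_def twist_st_def)

text \<open>The element \<open>\<Delta>(x)F\<close>, whose preimage under \<open>F\<^sup>#\<close> is the twisted coproduct of \<open>x\<close>.\<close>

definition "cop_times_cocycle x = tensor_lift \<D>\<D> (\<lambda>(x1, x2). tensor_lift \<D>\<D>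
  (\<lambda>(f, g). pure \<D>\<D> (x1 \<cdot> f, x2 \<cdot> g)) F) (cop \<D> x)"

lemma cop_times_cocycle:
  assumes x: "x \<in> carrier \<D>"
  shows "cop_times_cocycle x \<in> carrier \<D>\<D>"
    and "\<lbrakk>a \<in> carrier B; b \<in> carrier B\<rbrakk> \<Longrightarrow> ev a b (cop_times_cocycle x) = x (a \<star> b)"
proof -
  note cx = cop_diffop(1)[OF x]
  have p: "pure \<D>\<D> (x1 \<cdot> f, x2 \<cdot> g) \<in> carrier \<D>\<D>"
    if "x1 \<in> carrier \<D>" "x2 \<in> carrier \<D>" "f \<in> carrier \<D>" "g \<in> carrier \<D>" for x1 x2 f g
    using that by (simp add: diffop_closed)
  have q: "tensor_lift \<D>\<D> (\<lambda>(f, g). pure \<D>\<D> (x1 \<cdot> f, x2 \<cdot> g)) F \<in> carrier \<D>\<D>"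
    if "x1 \<in> carrier \<D>" "x2 \<in> carrier \<D>" for x1 x2
    using that by (intro DT.tensor_lift_closed2[OF DD.comm_group_axioms F_closed] p)
  show "cop_times_cocycle x \<in> carrier \<D>\<D>"
    unfolding cop_times_cocycle_def by (rule DT.tensor_lift_closed2[OF DD.comm_group_axioms cx q])
  assume h: "a \<in> carrier B" "b \<in> carrier B"
  have "ev a b (cop_times_cocycle x) = tensor_lift (add_monoid B) (\<lambda>(x1, x2). ev a b (tensor_lift \<D>\<D>
      (\<lambda>(f, g). pure \<D>\<D> (x1 \<cdot> f, x2 \<cdot> g)) F)) (cop \<D> x)"
    unfolding cop_times_cocycle_def
    by (rule DT.tensor_lift_comp_hom2[OF DD.comm_group_axioms B.a_comm_group cx ev_hom[OF h] q])
  also have "\<dots> = tensor_lift (add_monoid B) (\<lambda>(x1, x2). tensor_lift (add_monoid B)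
      (\<lambda>(f, g). x1 (f a) \<otimes> x2 (g b)) F) (cop \<D> x)"
  proof (rule DT.tensor_lift_cong2[OF B.a_comm_group cx])
    fix x1 x2 assume x12: "x1 \<in> carrier \<D>" "x2 \<in> carrier \<D>"
    have "ev a b (tensor_lift \<D>\<D> (\<lambda>(f, g). pure \<D>\<D> (x1 \<cdot> f, x2 \<cdot> g)) F) =
        tensor_lift (add_monoid B) (\<lambda>(f, g). ev a b (pure \<D>\<D> (x1 \<cdot> f, x2 \<cdot> g))) F"
      by (rule DT.tensor_lift_comp_hom2[OF DD.comm_group_axioms B.a_comm_group F_closed ev_hom[OF h] p[OF x12]])
    also have "\<dots> = tensor_lift (add_monoid B) (\<lambda>(f, g). x1 (f a) \<otimes> x2 (g b)) F"
      by (rule DT.tensor_lift_cong2[OF B.a_comm_group F_closed])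
        (use h x12 in \<open>simp_all add: ev diffop_closed diffop_apply diffop\<close>)
    finally show "ev a b (tensor_lift \<D>\<D> (\<lambda>(f, g). pure \<D>\<D> (x1 \<cdot> f, x2 \<cdot> g)) F) =
      tensor_lift (add_monoid B) (\<lambda>(f, g). x1 (f a) \<otimes> x2 (g b)) F" .
    show "tensor_lift (add_monoid B) (\<lambda>(f, g). x1 (f a) \<otimes> x2 (g b)) F \<in> carrier (add_monoid B)"
      by (rule DT.tensor_lift_closed2[OF B.a_comm_group F_closed]) (use h x12 in \<open>simp add: diffop\<close>)
  qed
  also have "\<dots> = tensor_lift (add_monoid B) (\<lambda>(f, g). tensor_lift (add_monoid B)
      (\<lambda>(x1, x2). x1 (f a) \<otimes> x2 (g b)) (cop \<D> x)) F"
    by (rule tensor_lift_swap2[OF DT.tensor_data_axioms DT.tensor_data_axioms B.a_comm_group,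
          unfolded diffops_tensor_eq, OF cx F_closed]) (use h in \<open>simp add: diffop\<close>)
  also have "\<dots> = tensor_lift (add_monoid B) (\<lambda>(f, g). x (f a \<otimes> g b)) F"
    unfolding ev_def[symmetric]
    by (rule DT.tensor_lift_cong2[OF B.a_comm_group F_closed]) (use h in \<open>simp_all add: cop_diffop x diffop\<close>)
  also have "\<dots> = x (a \<star> b)"
    unfolding star_def by (rule ev_mult_right[OF F_closed h]) (use x in \<open>auto intro!: homI simp: diffop\<close>)
  finally show "ev a b (cop_times_cocycle x) = x (a \<star> b)" .
qed

text \<open>Since \<open>F\<^sup>#\<close> turns \<open>ev\<close> into \<open>evF\<close>, the bidifferential operator of \<open>\<Delta>(x)F\<close>, which is \<open>x(a \<star> b)\<close>,
  characterises the twisted coproduct.\<close>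

lemma cop_twist:
  assumes x: "x \<in> carrier \<D>"
  shows "cop TW x \<in> carrier \<D>\<D>F"
    and "\<lbrakk>a \<in> carrier B; b \<in> carrier B\<rbrakk> \<Longrightarrow> evF a b (cop TW x) = x (a \<star> b)"
proof -
  have eq: "cop TW x = inv_into (carrier \<D>\<D>F) \<Psi> (cop_times_cocycle x)"
    by (simp add: twist_def cop_times_cocycle_def)
  have c: "cop_times_cocycle x \<in> \<Psi> ` carrier \<D>\<D>F"
    using bij_betw_imp_surj_on[OF regular_bij] cop_times_cocycle(1)[OF x] by simp
  show cl: "cop TW x \<in> carrier \<D>\<D>F"
    unfolding eq by (rule inv_into_into[OF c])
  assume h: "a \<in> carrier B" "b \<in> carrier B"
  show "evF a b (cop TW x) = x (a \<star> b)"
    using ev_regular_map[OF cl h] cop_times_cocycle(2)[OF x h] f_inv_into_f[OF c]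
    by (simp only: eq)
qed

lemma evF_mult_right:
  assumes "T \<in> carrier \<D>\<D>F" "a \<in> carrier B" "b \<in> carrier B" "h \<in> hom (add_monoid B) (add_monoid B)"
  shows "tensor_lift (add_monoid B) (\<lambda>(x, y). h (x a \<star> y b)) T = h (evF a b T)"
  unfolding evF_def
  by (rule DTF.tensor_lift_comp_hom2[OF B.a_comm_group B.a_comm_group assms(1,4), symmetric])
    (simp add: diffop assms)

abbreviation p\<Gamma> where "p\<Gamma> \<equiv> twisted_pairing K B \<D> \<J> pairing F"

lemma twisted_pairing:
  assumes D: "D \<in> carrier \<D>"
  shows "X \<in> carrier \<J> \<Longrightarrow> p\<Gamma> D X \<in> carrier B"
    and "\<lbrakk>X \<in> carrier \<J>; Y \<in> carrier \<J>\<rbrakk> \<Longrightarrow> p\<Gamma> D (X \<oplus>\<^bsub>\<J>\<^esub> Y) = p\<Gamma> D X \<oplus> p\<Gamma> D Y"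
    and "\<lbrakk>a \<in> carrier B; b \<in> carrier B\<rbrakk> \<Longrightarrow> p\<Gamma> D (jt a b) = D a \<star> b"
proof -
  have bal: "JH.T.bal (add_monoid B) (\<lambda>xp xm. pairing (x \<cdot> D) (xp \<bullet> tgt \<J> (pairing y xm)))"
    if xy: "x \<in> carrier \<D>" "y \<in> carrier \<D>" for x y
  proof -
    have xD: "x \<cdot> D \<in> carrier \<D>" using xy D by (simp add: diffop_closed)
    show ?thesis
    proof (rule JH.bar_balancedI)
      fix b xp xm assume h: "b \<in> carrier B" "xp \<in> carrier \<J>" "xm \<in> carrier \<J>"
      have "xp \<bullet> tgt \<J> b \<bullet> tgt \<J> (pairing y xm) = xp \<bullet> tgt \<J> (b \<otimes> pairing y xm)"
        using h by (simp add: JH.tgt_hom_simps JH.tgt_closed pairing[OF xy(2)] J.m_ac)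
      then show "pairing (x \<cdot> D) (xp \<bullet> tgt \<J> b \<bullet> tgt \<J> (pairing y xm)) =
          pairing (x \<cdot> D) (xp \<bullet> tgt \<J> (pairing y (tgt \<J> b \<bullet> xm)))"
        using h by (simp only: pairing_act(1)[OF xy(2)])
    qed (simp_all add: JH.tgt_closed JH.tgt_hom_simps pairing[OF xy(2)] pairing[OF xD] J.l_distr J.r_distr)
  qed
  note l = JH.translation_lift[OF B.a_comm_group bal]
  show "X \<in> carrier \<J> \<Longrightarrow> p\<Gamma> D X \<in> carrier B"
    unfolding twisted_pairing_def
    using DT.tensor_lift_closed2[OF B.a_comm_group F_closed] l(1) by simp
  show "\<lbrakk>X \<in> carrier \<J>; Y \<in> carrier \<J>\<rbrakk> \<Longrightarrow> p\<Gamma> D (X \<oplus>\<^bsub>\<J>\<^esub> Y) = p\<Gamma> D X \<oplus> p\<Gamma> D Y"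
    unfolding twisted_pairing_def
    by (rule DT.tensor_lift_add_cong[OF B.a_comm_group F_closed, simplified monoid.select_convs])
      (use l(1,2) in simp_all)
  assume h: "a \<in> carrier B" "b \<in> carrier B"
  show "p\<Gamma> D (jt a b) = D a \<star> b"
    unfolding twisted_pairing_def star_def ev_def
  proof (rule DT.tensor_lift_cong2[OF B.a_comm_group F_closed])
    fix x y assume xy: "x \<in> carrier \<D>" "y \<in> carrier \<D>"
    have "tensor_lift (add_monoid B) (\<lambda>(xp, xm). pairing (x \<cdot> D) (xp \<bullet> tgt \<J> (pairing y xm)))
        (translation K B \<J> (jt a b)) = pairing (x \<cdot> D) (jt a \<one> \<bullet> tgt \<J> (pairing y (jt b \<one>)))"
      by (rule l(3)[OF xy h])
    also have "\<dots> = x (D a) \<otimes> y b"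
      using xy h D by (simp add: pairing diffop_closed diffop diffop_apply)
    finally show "tensor_lift (add_monoid B) (\<lambda>(xp, xm). pairing (x \<cdot> D) (xp \<bullet> tgt \<J> (pairing y xm)))
        (translation K B \<J> (jt a b)) = x (D a) \<otimes> y b" .
    show "x (D a) \<otimes> y b \<in> carrier (add_monoid B)" using xy h D by (simp add: diffop)
  qed
qed

lemma twisted_pairing_left:
  assumes D: "D \<in> carrier \<D>" and D': "D' \<in> carrier \<D>" and X: "X \<in> carrier \<J>" and k: "k \<in> carrier K"
  shows "p\<Gamma> (D \<oplus>\<^bsub>\<D>\<^esub> D') X = p\<Gamma> D X \<oplus> p\<Gamma> D' X"
    and "p\<Gamma> (k \<odot>\<^bsub>\<D>\<^esub> D) X = k \<odot> p\<Gamma> D X"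
    and "p\<Gamma> D (k \<odot>\<^bsub>\<J>\<^esub> X) = k \<odot> p\<Gamma> D X"
proof -
  interpret Jm: module K \<J> by (rule jets_module)
  note tp = twisted_pairing[OF D] twisted_pairing[OF D'] twisted_pairing[OF diffop_closed(2)[OF D D']]
    twisted_pairing[OF diffop_closed(3)[OF k D]]
  show "p\<Gamma> (D \<oplus>\<^bsub>\<D>\<^esub> D') X = p\<Gamma> D X \<oplus> p\<Gamma> D' X"
    using X by (rule jet_generates)
      (simp_all add: tp star_add diffop_apply diffop[OF D] diffop[OF D'] B.a_ac)
  show "p\<Gamma> (k \<odot>\<^bsub>\<D>\<^esub> D) X = k \<odot> p\<Gamma> D X"
    using X by (rule jet_generates)
      (simp_all add: tp k star_smult diffop_apply diffop[OF D] B.smult_r_distr)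
  show "p\<Gamma> D (k \<odot>\<^bsub>\<J>\<^esub> X) = k \<odot> p\<Gamma> D X"
    using X by (rule jet_generates)
      (simp_all add: tp k star_smult jt_smult(1) diffop[OF D] Jm.smult_r_distr B.smult_r_distr)
qed

lemma twisted_pairing_bimodule:
  assumes abcd: "a \<in> carrier B" "b \<in> carrier B" "c \<in> carrier B" "d \<in> carrier B" "f \<in> carrier B"
    and x: "x \<in> carrier \<D>" and g: "g \<in> carrier \<J>"
  shows "p\<Gamma> (\<sigma> a \<cdot> \<tau> b \<cdot> x \<cdot> \<sigma> c \<cdot> \<tau> d) g \<star> f =
    a \<star> p\<Gamma> x (src \<J> c \<otimes>\<^bsub>JG\<^esub> tgt \<J> f \<otimes>\<^bsub>JG\<^esub> g \<otimes>\<^bsub>JG\<^esub> src \<J> d \<otimes>\<^bsub>JG\<^esub> tgt \<J> b)"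
proof -
  let ?y = "\<sigma> a \<cdot> \<tau> b \<cdot> x \<cdot> \<sigma> c \<cdot> \<tau> d"
  have y: "?y \<in> carrier \<D>" using abcd x by (simp add: diffop_closed twist_src twist_tgt)
  have st: "src \<J> e \<in> carrier \<J>" "tgt \<J> e \<in> carrier \<J>" if "e \<in> carrier B" for e
    using that by (simp_all add: JH.src_closed JH.tgt_closed)
  show ?thesis
    using g
  proof (rule jet_generates)
    fix g1 g2 assume h: "g1 \<in> carrier B" "g2 \<in> carrier B"
    show "p\<Gamma> ?y (jt g1 g2) \<star> f = a \<star> p\<Gamma> x (src \<J> c \<otimes>\<^bsub>JG\<^esub> tgt \<J> f \<otimes>\<^bsub>JG\<^esub> jt g1 g2 \<otimes>\<^bsub>JG\<^esub> src \<J> d \<otimes>\<^bsub>JG\<^esub> tgt \<J> b)"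
      using abcd h x
      by (simp add: twisted_pairing[OF y] twisted_pairing[OF x] diffop_apply twist_src twist_tgt diffop[OF x]
          jets_fields(7,8) JG_mult star_unit star_assoc)
  next
    fix X Y assume XY: "X \<in> carrier \<J>" "Y \<in> carrier \<J>"
      and "p\<Gamma> ?y X \<star> f = a \<star> p\<Gamma> x (src \<J> c \<otimes>\<^bsub>JG\<^esub> tgt \<J> f \<otimes>\<^bsub>JG\<^esub> X \<otimes>\<^bsub>JG\<^esub> src \<J> d \<otimes>\<^bsub>JG\<^esub> tgt \<J> b)"
      and "p\<Gamma> ?y Y \<star> f = a \<star> p\<Gamma> x (src \<J> c \<otimes>\<^bsub>JG\<^esub> tgt \<J> f \<otimes>\<^bsub>JG\<^esub> Y \<otimes>\<^bsub>JG\<^esub> src \<J> d \<otimes>\<^bsub>JG\<^esub> tgt \<J> b)"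
    then show "p\<Gamma> ?y (X \<oplus>\<^bsub>\<J>\<^esub> Y) \<star> f =
        a \<star> p\<Gamma> x (src \<J> c \<otimes>\<^bsub>JG\<^esub> tgt \<J> f \<otimes>\<^bsub>JG\<^esub> (X \<oplus>\<^bsub>\<J>\<^esub> Y) \<otimes>\<^bsub>JG\<^esub> src \<J> d \<otimes>\<^bsub>JG\<^esub> tgt \<J> b)"
      using abcd st
      by (simp add: twisted_pairing(1,2)[OF y] twisted_pairing(1,2)[OF x] JG_mult(1-3) star_add)
  qed
qed

text \<open>For symbols \<open>[a \<otimes> b]\<close> and \<open>[c \<otimes> d]\<close> both right-hand sides are
  \<open>\<Sum> x\<^sub>(\<^sub>1\<^sub>)(a) \<star> x\<^sub>(\<^sub>2\<^sub>)(c) \<star> d \<star> b\<close>.\<close>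

lemma twisted_pairing_cop:
  assumes x: "x \<in> carrier \<D>" and gh: "g \<in> carrier \<J>" "h \<in> carrier \<J>"
  shows "p\<Gamma> x (g \<otimes>\<^bsub>JG\<^esub> h) = tensor_lift (add_monoid B) (\<lambda>(x1, x2). p\<Gamma> x1 (g \<otimes>\<^bsub>JG\<^esub> tgt \<J> (p\<Gamma> x2 h))) (cop TW x)"
    and "p\<Gamma> x (g \<otimes>\<^bsub>JG\<^esub> h) = tensor_lift (add_monoid B) (\<lambda>(x1, x2). p\<Gamma> (\<tau> (p\<Gamma> x2 h) \<cdot> x1) g) (cop TW x)"
proof -
  note cx = cop_twist(1)[OF x]
  have jet: "tensor_lift (add_monoid B) (\<lambda>(x1, x2). x1 g1 \<star> (x2 h1 \<star> h2 \<star> g2)) (cop TW x) = p\<Gamma> x (jt g1 g2 \<otimes>\<^bsub>JG\<^esub> jt h1 h2)"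
    if c: "g1 \<in> carrier B" "g2 \<in> carrier B" "h1 \<in> carrier B" "h2 \<in> carrier B" for g1 g2 h1 h2
  proof -
    have hom: "(\<lambda>t. t \<star> (h2 \<star> g2)) \<in> hom (add_monoid B) (add_monoid B)"
      using c by (intro homI) (auto simp: star_add)
    have "tensor_lift (add_monoid B) (\<lambda>(x1, x2). x1 g1 \<star> (x2 h1 \<star> h2 \<star> g2)) (cop TW x) =
        tensor_lift (add_monoid B) (\<lambda>(x1, x2). x1 g1 \<star> x2 h1 \<star> (h2 \<star> g2)) (cop TW x)"
      by (rule DTF.tensor_lift_cong2[OF B.a_comm_group cx]) (use c in \<open>simp_all add: star_assoc diffop\<close>)
    also have "\<dots> = evF g1 h1 (cop TW x) \<star> (h2 \<star> g2)"
      by (rule evF_mult_right[OF cx c(1,3) hom])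
    finally show ?thesis
      using c by (simp add: cop_twist(2)[OF x] JG_mult twisted_pairing[OF x])
  qed
  have tc: "tgt \<J> (p\<Gamma> x2 Y) \<in> carrier \<J>" "\<tau> (p\<Gamma> x2 Y) \<in> carrier \<D>" if "x2 \<in> carrier \<D>" "Y \<in> carrier \<J>" for x2 Y
    using that by (simp_all add: JH.tgt_closed twisted_pairing twist_tgt)
  have \<tau>_add: "\<tau> (a \<oplus> b) \<cdot> x1 = \<tau> a \<cdot> x1 \<oplus>\<^bsub>\<D>\<^esub> \<tau> b \<cdot> x1"
    if "a \<in> carrier B" "b \<in> carrier B" "x1 \<in> carrier \<D>" for a b x1
    using that by (intro diffop_eqI) (simp_all add: diffop_closed twist_tgt diffop_apply diffop star_add)
  have left: "p\<Gamma> (u \<oplus>\<^bsub>\<D>\<^esub> v) X = p\<Gamma> u X \<oplus> p\<Gamma> v X" if "u \<in> carrier \<D>" "v \<in> carrier \<D>" "X \<in> carrier \<J>" for u v X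
    by (rule twisted_pairing_left(1)[OF that B.R.zero_closed])
  show "p\<Gamma> x (g \<otimes>\<^bsub>JG\<^esub> h) = tensor_lift (add_monoid B) (\<lambda>(x1, x2). p\<Gamma> x1 (g \<otimes>\<^bsub>JG\<^esub> tgt \<J> (p\<Gamma> x2 h))) (cop TW x)"
  proof (rule JH.biadditive_eqI[where f = "\<lambda>g h. p\<Gamma> x (g \<otimes>\<^bsub>JG\<^esub> h)" and H = "add_monoid B"
        and g = "\<lambda>g h. tensor_lift (add_monoid B) (\<lambda>(x1, x2). p\<Gamma> x1 (g \<otimes>\<^bsub>JG\<^esub> tgt \<J> (p\<Gamma> x2 h))) (cop TW x)"])
    fix g g' h assume "g \<in> carrier \<J>" "g' \<in> carrier \<J>" "h \<in> carrier \<J>"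
    then show "tensor_lift (add_monoid B) (\<lambda>(x1, x2). p\<Gamma> x1 ((g \<oplus>\<^bsub>\<J>\<^esub> g') \<otimes>\<^bsub>JG\<^esub> tgt \<J> (p\<Gamma> x2 h))) (cop TW x) =
        tensor_lift (add_monoid B) (\<lambda>(x1, x2). p\<Gamma> x1 (g \<otimes>\<^bsub>JG\<^esub> tgt \<J> (p\<Gamma> x2 h))) (cop TW x) \<otimes>\<^bsub>add_monoid B\<^esub>
        tensor_lift (add_monoid B) (\<lambda>(x1, x2). p\<Gamma> x1 (g' \<otimes>\<^bsub>JG\<^esub> tgt \<J> (p\<Gamma> x2 h))) (cop TW x)"
      by (intro DTF.tensor_lift_add_cong[OF B.a_comm_group cx])
        (simp_all add: tc JG_mult(1-3) twisted_pairing(1,2))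
  next
    fix g h h' assume "g \<in> carrier \<J>" "h \<in> carrier \<J>" "h' \<in> carrier \<J>"
    then show "tensor_lift (add_monoid B) (\<lambda>(x1, x2). p\<Gamma> x1 (g \<otimes>\<^bsub>JG\<^esub> tgt \<J> (p\<Gamma> x2 (h \<oplus>\<^bsub>\<J>\<^esub> h')))) (cop TW x) =
        tensor_lift (add_monoid B) (\<lambda>(x1, x2). p\<Gamma> x1 (g \<otimes>\<^bsub>JG\<^esub> tgt \<J> (p\<Gamma> x2 h))) (cop TW x) \<otimes>\<^bsub>add_monoid B\<^esub>
        tensor_lift (add_monoid B) (\<lambda>(x1, x2). p\<Gamma> x1 (g \<otimes>\<^bsub>JG\<^esub> tgt \<J> (p\<Gamma> x2 h'))) (cop TW x)"
      by (intro DTF.tensor_lift_add_cong[OF B.a_comm_group cx])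
        (simp_all add: tc JG_mult(1-3) twisted_pairing(1,2) JH.tgt_hom_simps)
  next
    fix g1 g2 h1 h2 assume c: "g1 \<in> carrier B" "g2 \<in> carrier B" "h1 \<in> carrier B" "h2 \<in> carrier B"
    show "p\<Gamma> x (jt g1 g2 \<otimes>\<^bsub>JG\<^esub> jt h1 h2) =
        tensor_lift (add_monoid B) (\<lambda>(x1, x2). p\<Gamma> x1 (jt g1 g2 \<otimes>\<^bsub>JG\<^esub> tgt \<J> (p\<Gamma> x2 (jt h1 h2)))) (cop TW x)"
      unfolding jet[OF c, symmetric]
      by (rule DTF.tensor_lift_cong2[OF B.a_comm_group cx, symmetric])
        (use c in \<open>simp_all add: twisted_pairing diffop jets_fields(8) JG_mult star_unit tc JG_mult(1)[OF _ tc(1)]\<close>)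
  qed (simp_all add: gh JG_mult(1-3) twisted_pairing(1,2)[OF x])
  show "p\<Gamma> x (g \<otimes>\<^bsub>JG\<^esub> h) = tensor_lift (add_monoid B) (\<lambda>(x1, x2). p\<Gamma> (\<tau> (p\<Gamma> x2 h) \<cdot> x1) g) (cop TW x)"
  proof (rule JH.biadditive_eqI[where f = "\<lambda>g h. p\<Gamma> x (g \<otimes>\<^bsub>JG\<^esub> h)" and H = "add_monoid B"
        and g = "\<lambda>g h. tensor_lift (add_monoid B) (\<lambda>(x1, x2). p\<Gamma> (\<tau> (p\<Gamma> x2 h) \<cdot> x1) g) (cop TW x)"])
    fix g g' h assume "g \<in> carrier \<J>" "g' \<in> carrier \<J>" "h \<in> carrier \<J>"
    then show "tensor_lift (add_monoid B) (\<lambda>(x1, x2). p\<Gamma> (\<tau> (p\<Gamma> x2 h) \<cdot> x1) (g \<oplus>\<^bsub>\<J>\<^esub> g')) (cop TW x) =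
        tensor_lift (add_monoid B) (\<lambda>(x1, x2). p\<Gamma> (\<tau> (p\<Gamma> x2 h) \<cdot> x1) g) (cop TW x) \<otimes>\<^bsub>add_monoid B\<^esub>
        tensor_lift (add_monoid B) (\<lambda>(x1, x2). p\<Gamma> (\<tau> (p\<Gamma> x2 h) \<cdot> x1) g') (cop TW x)"
      by (intro DTF.tensor_lift_add_cong[OF B.a_comm_group cx])
        (simp_all add: tc twisted_pairing(1,2) diffop_closed)
  next
    fix g h h' assume "g \<in> carrier \<J>" "h \<in> carrier \<J>" "h' \<in> carrier \<J>"
    then show "tensor_lift (add_monoid B) (\<lambda>(x1, x2). p\<Gamma> (\<tau> (p\<Gamma> x2 (h \<oplus>\<^bsub>\<J>\<^esub> h')) \<cdot> x1) g) (cop TW x) =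
        tensor_lift (add_monoid B) (\<lambda>(x1, x2). p\<Gamma> (\<tau> (p\<Gamma> x2 h) \<cdot> x1) g) (cop TW x) \<otimes>\<^bsub>add_monoid B\<^esub>
        tensor_lift (add_monoid B) (\<lambda>(x1, x2). p\<Gamma> (\<tau> (p\<Gamma> x2 h') \<cdot> x1) g) (cop TW x)"
      by (intro DTF.tensor_lift_add_cong[OF B.a_comm_group cx])
        (simp_all add: tc twisted_pairing(1,2) diffop_closed \<tau>_add left)
  next
    fix g1 g2 h1 h2 assume c: "g1 \<in> carrier B" "g2 \<in> carrier B" "h1 \<in> carrier B" "h2 \<in> carrier B"
    show "p\<Gamma> x (jt g1 g2 \<otimes>\<^bsub>JG\<^esub> jt h1 h2) =
        tensor_lift (add_monoid B) (\<lambda>(x1, x2). p\<Gamma> (\<tau> (p\<Gamma> x2 (jt h1 h2)) \<cdot> x1) (jt g1 g2)) (cop TW x)"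
      unfolding jet[OF c, symmetric]
      by (rule DTF.tensor_lift_cong2[OF B.a_comm_group cx, symmetric])
        (use c in \<open>simp_all add: twisted_pairing diffop diffop_closed diffop_apply twist_tgt star_assoc tc\<close>)
  qed (simp_all add: gh JG_mult(1-3) twisted_pairing(1,2)[OF x])
qed

lemma twisted_pairing_mult:
  assumes x: "x \<in> carrier \<D>" and y: "y \<in> carrier \<D>" and g: "g \<in> carrier \<J>"
  shows "p\<Gamma> (x \<cdot> y) g = tensor_lift (add_monoid B) (\<lambda>(g1, g2). p\<Gamma> (x \<cdot> \<sigma> (p\<Gamma> y g1)) g2) (cop JG g)"
    and "p\<Gamma> (x \<cdot> y) g = tensor_lift (add_monoid B) (\<lambda>(g1, g2). p\<Gamma> x (src \<J> (p\<Gamma> y g1) \<otimes>\<^bsub>JG\<^esub> g2)) (cop JG g)"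
proof -
  have xy: "x \<cdot> y \<in> carrier \<D>" using x y by (simp add: diffop_closed)
  have xs: "x \<cdot> \<sigma> b \<in> carrier \<D>" if "b \<in> carrier B" for b using that x by (simp add: diffop_closed twist_src)
  have xs_add: "x \<cdot> \<sigma> (a \<oplus> b) = x \<cdot> \<sigma> a \<oplus>\<^bsub>\<D>\<^esub> x \<cdot> \<sigma> b" if "a \<in> carrier B" "b \<in> carrier B" for a b
    using that x by (intro diffop_eqI) (simp_all add: diffop_closed twist_src diffop_apply diffop star_add)
  have left: "p\<Gamma> (u \<oplus>\<^bsub>\<D>\<^esub> v) X = p\<Gamma> u X \<oplus> p\<Gamma> v X" if "u \<in> carrier \<D>" "v \<in> carrier \<D>" "X \<in> carrier \<J>" for u v X
    by (rule twisted_pairing_left(1)[OF that B.R.zero_closed])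
  note tp = twisted_pairing[OF x] twisted_pairing[OF y] twisted_pairing[OF xy] twisted_pairing[OF xs]
  have bal1: "JHG.D.bal (add_monoid B) (\<lambda>g1 g2. p\<Gamma> (x \<cdot> \<sigma> (p\<Gamma> y g1)) g2)"
    unfolding BG_fields JG_fields
    by (rule G_balanced_jetI)
      (simp_all add: tp xs xs_add left diffop_apply twist_src diffop[OF x] diffop[OF y] star_assoc)
  have bal2: "JHG.D.bal (add_monoid B) (\<lambda>g1 g2. p\<Gamma> x (src \<J> (p\<Gamma> y g1) \<otimes>\<^bsub>JG\<^esub> g2))"
    unfolding BG_fields JG_fields
    by (rule G_balanced_jetI)
      (simp_all add: tp JG_mult(1-3) JH.src_closed JH.src_hom_simps tgt_JG_mult diffop[OF x] diffop[OF y] star_assoc)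
  note l1 = JHG.cop_lift[OF B.a_comm_group bal1, unfolded BG_fields JG_fields]
  note l2 = JHG.cop_lift[OF B.a_comm_group bal2, unfolded BG_fields JG_fields]
  show "p\<Gamma> (x \<cdot> y) g = tensor_lift (add_monoid B) (\<lambda>(g1, g2). p\<Gamma> (x \<cdot> \<sigma> (p\<Gamma> y g1)) g2) (cop JG g)"
    using g
    by (rule jet_generates)
      (simp_all only: l1(2,3), simp_all add: tp diffop_apply diffop[OF y] diffop[OF x] star_unit twist_src xs)
  show "p\<Gamma> (x \<cdot> y) g = tensor_lift (add_monoid B) (\<lambda>(g1, g2). p\<Gamma> x (src \<J> (p\<Gamma> y g1) \<otimes>\<^bsub>JG\<^esub> g2)) (cop JG g)"
    using g
    by (rule jet_generates)
      (simp_all only: l2(2,3), simp_all add: tp diffop_apply diffop[OF y] diffop[OF x] star_unit tgt_JG_mult)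
qed

theorem twisted_dual_pairing: "dual_pairing K BG TW JG p\<Gamma>"
proof -
  have z: "\<zero>\<^bsub>K\<^esub> \<in> carrier K" by simp
  have bil: "bilinear_map K TW JG BG p\<Gamma>"
    by (simp add: bilinear_map_def linear_map_def Pi_iff twisted_pairing(1,2) twisted_pairing_left(2,3)
        twisted_pairing_left(1)[OF _ _ _ z])
  have bim: "p\<Gamma> (src TW a \<otimes>\<^bsub>TW\<^esub> tgt TW b \<otimes>\<^bsub>TW\<^esub> x \<otimes>\<^bsub>TW\<^esub> src TW c \<otimes>\<^bsub>TW\<^esub> tgt TW d) g \<otimes>\<^bsub>BG\<^esub> f =
      a \<otimes>\<^bsub>BG\<^esub> p\<Gamma> x (src JG c \<otimes>\<^bsub>JG\<^esub> tgt JG f \<otimes>\<^bsub>JG\<^esub> g \<otimes>\<^bsub>JG\<^esub> src JG d \<otimes>\<^bsub>JG\<^esub> tgt JG b)"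
    if "a \<in> carrier B" "b \<in> carrier B" "c \<in> carrier B" "d \<in> carrier B" "f \<in> carrier B"
      "x \<in> carrier \<D>" "g \<in> carrier \<J>" for a b c d f x g
    using twisted_pairing_bimodule[OF that] that
    by (simp add: twisted_pairing(1) diffop_closed twist_src twist_tgt JG_mult(1) JH.src_closed JH.tgt_closed)
  have one: "p\<Gamma> x \<one>\<^bsub>JG\<^esub> = cou TW x" if "x \<in> carrier \<D>" for x
    using that by (simp add: jt_one twisted_pairing diffop star_unit diffops_fields(9))
  have cou: "p\<Gamma> \<one>\<^bsub>TW\<^esub> g = cou JG g" if "g \<in> carrier \<J>" for g
    using that
    by (rule jet_generates) (simp_all add: twisted_pairing[OF diffop_closed(4)] JG_cou diffop_apply)
  have abg: "add_monoid BG = add_monoid B" by simp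
  show ?thesis
    unfolding dual_pairing_def abg
    by (intro conjI bil ballI; (rule bim one cou | simp only: TW_fields JG_fields, rule twisted_pairing_cop twisted_pairing_mult); simp)
qed

end

text \<open>The hypothesis on \<open>F\<close> speaks of modules of the plain record type; the algebra of operators has to be
  stripped of its additional fields to become its own regular module.\<close>

lemma module_truncate:
  assumes "module K M"
  shows "module K (module.truncate M)"
proof -
  interpret M: module K M by fact
  have "abelian_group (module.truncate M)"
    by (rule abelian_groupI)
      (auto simp: module.truncate_def M.a_ac intro!: bexI[of _ "\<ominus>\<^bsub>M\<^esub> _"] M.l_neg)
  then show ?thesis
    by (intro moduleI M.R.cring_axioms)
      (simp_all add: module.truncate_def M.smult_l_distr M.smult_r_distr M.smult_assoc1)
qed

lemma truncate_fields:
  "carrier (module.truncate M) = carrier M" "add (module.truncate M) = add M" "smult (module.truncate M) = smult M"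
  by (simp_all add: module.truncate_def)

section \<open>The cotwist of the jets by a twisted product\<close>

theorem proposition4p14:
  fixes K :: "'k ring" and B :: "('k, 'b) module"
    and F :: "(('b \<Rightarrow> 'b) \<times> ('b \<Rightarrow> 'b)) tens"
  defines "\<D> \<equiv> diffops K B" and "\<J> \<equiv> jets K B"
  defines "BF \<equiv> twist_base B \<D> F"
  assumes "field K" and "algebra K B"
    and "jets_stabilise K B"
    and "fg_projective B (src_module \<J>)"
    and "left_2cocycle_in K B \<D> F"
    and "invertible_in TYPE('b \<Rightarrow> 'b) TYPE('b \<Rightarrow> 'b) K B \<D> F"
  shows "\<exists>\<Gamma>.
    left_2cocycle_on K B \<J> \<Gamma> \<and>
    invertible_on TYPE('m) TYPE('n) K B \<J> \<Gamma> \<and>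
    (\<forall>a\<in>carrier B. \<forall>b\<in>carrier B. \<forall>c\<in>carrier B. \<forall>d\<in>carrier B.
       \<Gamma> (jet K B a b) (jet K B c d) = (a \<otimes>\<^bsub>BF\<^esub> c) \<otimes>\<^bsub>B\<^esub> d \<otimes>\<^bsub>B\<^esub> b) \<and>
    (let B\<Gamma> = cotwist_base B \<J> \<Gamma>; J\<Gamma> = cotwist K B \<J> \<Gamma>;
         \<Gamma>inv = cocycle_inverse K B \<J> \<Gamma>;
         p\<Gamma> = twisted_pairing K B \<D> \<J> (jet_pairing B) F
     in
      left_2cocycle_on K B\<Gamma> J\<Gamma> \<Gamma>inv \<and>
      (\<forall>a\<in>carrier B. \<forall>b\<in>carrier B. \<forall>c\<in>carrier B. \<forall>d\<in>carrier B.
         \<Gamma>inv (jet K B a b) (jet K B c d) = (a \<otimes>\<^bsub>B\<^esub> c) \<otimes>\<^bsub>BF\<^esub> (d \<otimes>\<^bsub>BF\<^esub> b)) \<and>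
      (\<forall>a\<in>carrier B. \<forall>b\<in>carrier B. a \<otimes>\<^bsub>B\<Gamma>\<^esub> b = a \<otimes>\<^bsub>BF\<^esub> b) \<and>
      left_hopf_algebroid K B\<Gamma> J\<Gamma> \<and>
      (\<forall>b\<in>carrier B. src J\<Gamma> b = jet K B b \<one>\<^bsub>B\<^esub> \<and> tgt J\<Gamma> b = jet K B \<one>\<^bsub>B\<^esub> b) \<and>
      (\<forall>a\<in>carrier B. \<forall>b\<in>carrier B. \<forall>c\<in>carrier B. \<forall>d\<in>carrier B.
         jet K B a b \<otimes>\<^bsub>J\<Gamma>\<^esub> jet K B c d = jet K B (a \<otimes>\<^bsub>BF\<^esub> c) (d \<otimes>\<^bsub>BF\<^esub> b)) \<and>
      (\<forall>a\<in>carrier B. \<forall>b\<in>carrier B.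
         cop J\<Gamma> (jet K B a b) =
           pure (diamond K B\<Gamma> J\<Gamma>) (jet K B a \<one>\<^bsub>B\<^esub>, jet K B \<one>\<^bsub>B\<^esub> b) \<and>
         cou J\<Gamma> (jet K B a b) = a \<otimes>\<^bsub>BF\<^esub> b \<and>
         translation K B\<Gamma> J\<Gamma> (jet K B a b) =
           pure (bar_tensor K B\<Gamma> J\<Gamma>) (jet K B a \<one>\<^bsub>B\<^esub>, jet K B b \<one>\<^bsub>B\<^esub>)) \<and>
      dual_pairing K B\<Gamma> (twist K B \<D> F) J\<Gamma> p\<Gamma> \<and>
      (\<forall>D\<in>carrier \<D>. \<forall>a\<in>carrier B. \<forall>b\<in>carrier B.
         p\<Gamma> D (jet K B a b) = D a \<otimes>\<^bsub>BF\<^esub> b))"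
proof -
  interpret S: stable_jets K B
    by (intro stable_jets.intro commutative_algebra.intro stable_jets_axioms.intro assms)
  obtain N and u :: "nat \<Rightarrow> 'b" and E where
    "\<And>i. i < N \<Longrightarrow> u i \<in> carrier B" "\<And>i. i < N \<Longrightarrow> E i \<in> carrier (diffops K B)"
    "\<And>a. a \<in> carrier B \<Longrightarrow> jet K B a \<one>\<^bsub>B\<^esub> = (\<Oplus>\<^bsub>jets K B\<^esub>i\<in>{..<N}. jet K B (u i) (E i a))"
    by (rule S.coevaluableE[OF S.coevaluation[OF assms(7)[unfolded \<J>_def]]]) iprover
  then interpret C: jet_cocycle K B N u E F
    by unfold_locales (use assms(8) in \<open>simp_all add: \<D>_def\<close>)
  have "left_module K (diffops K B) (module.truncate (diffops K B)) (mult (diffops K B))"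
    using C.left_module_regular module_truncate[OF C.diffops_module]
    unfolding left_module_def bilinear_map_def linear_map_def by (simp add: truncate_fields)
  then have "bij_betw (twist_map K B (diffops K B) F (module.truncate (diffops K B)) (mult (diffops K B))
        (module.truncate (diffops K B)) (mult (diffops K B)))
      (carrier (diamond_mod K C.BF C.\<D>F (module.truncate (diffops K B)) (mult (diffops K B))
        (module.truncate (diffops K B)) (mult (diffops K B))))
      (carrier (diamond_mod K B (diffops K B) (module.truncate (diffops K B)) (mult (diffops K B))
        (module.truncate (diffops K B)) (mult (diffops K B))))"
    using assms(9) unfolding \<D>_def invertible_in_def by blast
  moreover have "diamond_mod K B' L (module.truncate (diffops K B)) \<alpha> (module.truncate (diffops K B)) \<beta> =
      diamond_mod K B' L (diffops K B) \<alpha> (diffops K B) \<beta>"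
    for B' :: "('k, 'b) module" and L :: "('k, 'b, 'b \<Rightarrow> 'b) bialgebroid" and \<alpha> \<beta>
    by (simp only: diamond_mod_def tensor_def truncate_fields)
  moreover have "C.\<D>\<D>F = diamond_mod K C.BF C.\<D>F (diffops K B) (mult (diffops K B)) (diffops K B) (mult (diffops K B))"
    by (simp add: diamond_def diamond_mod_def tensor_def twist_st_def)
  ultimately have "bij_betw (twist_map K B (diffops K B) F (diffops K B) (mult (diffops K B)) (diffops K B) (mult (diffops K B)))
      (carrier C.\<D>\<D>F) (carrier (diamond K B (diffops K B)))"
    by (simp add: twist_map_def diamond_def)
  then interpret I: invertible_jet_cocycle K B N u E F by unfold_locales
  show ?thesis
    unfolding \<D>_def \<J>_def BF_def
  proof (rule exI[of _ C.\<Gamma>], unfold Let_def, intro conjI ballI)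
    show "left_2cocycle_on K B (jets K B) C.\<Gamma>" by (rule C.\<Gamma>_cocycle)
    show "invertible_on TYPE('m) TYPE('n) K B (jets K B) C.\<Gamma>" by (rule I.\<Gamma>_invertible)
    show "left_2cocycle_on K C.BG C.JG C.\<Gamma>inv" by (rule C.\<Gamma>inv_cocycle)
    show "left_hopf_algebroid K C.BG C.JG" by (rule C.JHG.left_hopf_algebroid)
    show "dual_pairing K C.BG (twist K B (diffops K B) F) C.JG I.p\<Gamma>" by (rule I.twisted_dual_pairing)
    fix D a b assume "D \<in> carrier (diffops K B)" "a \<in> carrier B" "b \<in> carrier B"
    then show "I.p\<Gamma> D (jet K B a b) = D a \<otimes>\<^bsub>C.BF\<^esub> b"
      by (simp add: I.twisted_pairing C.twist_base_mult S.diffop)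
  next
    fix a b assume "a \<in> carrier B" "b \<in> carrier B"
    then show "translation K C.BG C.JG (jet K B a b) = pure (bar_tensor K C.BG C.JG) (jet K B a \<one>\<^bsub>B\<^esub>, jet K B b \<one>\<^bsub>B\<^esub>)"
      using C.JHG.translation_jet[of a b] by simp
  next
    fix a b assume "a \<in> carrier B" "b \<in> carrier B"
    then show "cop C.JG (jet K B a b) = pure (diamond K C.BG C.JG) (jet K B a \<one>\<^bsub>B\<^esub>, jet K B \<one>\<^bsub>B\<^esub> b)"
      using C.JHG.cop_jet[of a b] by simp
  qed (simp_all add: C.\<Gamma>_jet C.\<Gamma>inv C.twist_base_mult C.JG_mult C.JG_cou S.jets_fields(7,8))
qed

end
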